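(* Let $n\ge 1$, $0<\sigma<1$, and let $P$ be the operator defined in the context. Let $K$ be a compact subset of $\mathbb{R}^{2n+1}$ and $s\in\mathbb{R}$. Then there exists a constant $C_{K,s}>0$ such that for all $u\in C_0^\infty(\mathbb{R}^{2n+1})$ with $\operatorname{supp}u\subset K$, $$\big\|(1+|D_t|^{\frac{2\sigma}{2\sigma+1}}+|D_x|^{\frac{2\sigma}{2\sigma+1}}+|D_v|^{2\sigma})u\big\|_{s}\le C_{K,s}\big(\|Pu\|_s+\|u\|_s\big),$$ where $\|\cdot\|_s$ is the $H^s(\mathbb{R}^{2n+1})$ Sobolev norm.
   Context: Variables $(t,x,v)\in\mathbb{R}\times\mathbb{R}^n\times\mathbb{R}^n$. Let $a\in C_b^\infty(\mathbb{R}^{2n+1})$ (smooth, all derivatives of all orders bounded) satisfy $a(t,x,v)\ge a_0>0$ for some constant $a_0$ and all $(t,x,v)$. Let $w\in C^\infty(\mathbb{R}^n)$ with $0\le w\le 1$, $w(\eta)=1$ for $|\eta|\ge 2$, $w(\eta)=0$ for $|\eta|\le1$, and set $F(\eta)=|\eta|^{2\sigma}w(\eta)+|\eta|^2(1-w(\eta))$ ($|\cdot|$ Euclidean norm). $(-\tilde\Delta_v)^\sigma$ is the Fourier multiplier in the $v$ variable with symbol $F$, i.e. $\mathcal F_v\big((-\tilde\Delta_v)^\sigma u\big)(\eta)=F(\eta)\mathcal F_vu(\eta)$ with $\mathcal F_vu(\eta)=\int e^{-iv\cdot\eta}u\,dv$. Then $P=\partial_t+v\cdot\nabla_x+a(t,x,v)(-\tilde\Delta_v)^\sigma$.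 We write $D_t=(2\pi i)^{-1}\partial_t$, $D_x=(2\pi i)^{-1}\partial_x$, $D_v=(2\pi i)^{-1}\partial_v$; $|D_t|^\alpha,|D_x|^\alpha,|D_v|^\alpha$ are the Fourier multipliers with symbols $|\tau|^\alpha,|\xi|^\alpha,|\eta|^\alpha$, where $(\tau,\xi,\eta)$ are dual to $(t,x,v)$ for the Fourier transform $\hat u(\tau,\xi,\eta)=\int e^{-2i\pi(t\tau+x\cdot\xi+v\cdot\eta)}u\,dt\,dx\,dv$. $\|u\|_s=\|(1+|D_t|^2+|D_x|^2+|D_v|^2)^{s/2}u\|_{L^2}$. *)

theory Defs
  imports "HOL-Analysis.Analysis"
begin

text \<open>Points of R^(2n+1) are triples (t, x, v) :: real \<times> real^'n \<times> real^'n.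
  Dual variables (tau, xi, eta) live in the same type; the inner product and
  Euclidean norm on the product type are the standard ones.\<close>

type_synonym 'n pt = "real \<times> (real ^ 'n) \<times> (real ^ 'n)"

definition dd :: "'a::real_normed_vector \<Rightarrow> ('a \<Rightarrow> 'b::real_normed_vector) \<Rightarrow> 'a \<Rightarrow> 'b" where
  "dd d f x = frechet_derivative f (at x) d"

fun iter_dd :: "'a::real_normed_vector list \<Rightarrow> ('a \<Rightarrow> 'b::real_normed_vector) \<Rightarrow> 'a \<Rightarrow> 'b" where
  "iter_dd [] f = f"
| "iter_dd (d # ds) f = dd d (iter_dd ds f)"

definition smooth :: "('a::euclidean_space \<Rightarrow> 'b::real_normed_vector) \<Rightarrow> bool" where
  "smooth f \<longleftrightarrow> (\<forall>ds. set ds \<subseteq> Basis \<longrightarrow> (\<forall>x. iter_dd ds f differentiable (at x)))"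

definition smooth_bdd :: "('a::euclidean_space \<Rightarrow> 'b::real_normed_vector) \<Rightarrow> bool" where
  "smooth_bdd f \<longleftrightarrow> smooth f \<and> (\<forall>ds. set ds \<subseteq> Basis \<longrightarrow> bounded (range (iter_dd ds f)))"

definition tsupp :: "('a::topological_space \<Rightarrow> 'b::zero) \<Rightarrow> 'a set" where
  "tsupp f = closure {x. f x \<noteq> 0}"

definition fourier :: "('n::finite pt \<Rightarrow> complex) \<Rightarrow> 'n pt \<Rightarrow> complex" where
  "fourier u \<zeta> = (\<integral>z. cis (- 2 * pi * (z \<bullet> \<zeta>)) * u z \<partial>lborel)"

definition fourier_v :: "('n::finite pt \<Rightarrow> complex) \<Rightarrow> 'n pt \<Rightarrow> complex" where
  "fourier_v u z = (case z of (t, x, \<eta>) \<Rightarrow>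
     (\<integral>v. cis (- (v \<bullet> \<eta>)) * u (t, x, v) \<partial>(lborel :: (real ^ 'n) measure)))"

definition symF :: "real \<Rightarrow> (real ^ 'n \<Rightarrow> real) \<Rightarrow> real ^ 'n \<Rightarrow> real" where
  "symF \<sigma> w \<eta> = norm \<eta> powr (2 * \<sigma>) * w \<eta> + (norm \<eta>)\<^sup>2 * (1 - w \<eta>)"

text \<open>(- tilde Delta_v)^sigma u: Fourier multiplier in v with symbol F, realised by
  the inverse of F_v: (2 pi)^(-n) integral exp(i v.eta) F(eta) F_v u(t,x,eta) d eta.\<close>
definition frac_lap_v :: "real \<Rightarrow> (real ^ 'n::finite \<Rightarrow> real) \<Rightarrow> ('n pt \<Rightarrow> complex) \<Rightarrow> 'n pt \<Rightarrow> complex" where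
  "frac_lap_v \<sigma> w u z = (case z of (t, x, v) \<Rightarrow>
     complex_of_real ((2 * pi) powr (- real CARD('n))) *
     (\<integral>\<eta>. cis (v \<bullet> \<eta>) * complex_of_real (symF \<sigma> w \<eta>) * fourier_v u (t, x, \<eta>)
        \<partial>(lborel :: (real ^ 'n) measure)))"

text \<open>The operator P = d_t + v.grad_x + a(t,x,v) (- tilde Delta_v)^sigma.
  d_t u = directional derivative along (1,0,0); v.grad_x u = directional derivative along (0,v,0).\<close>
definition opP :: "real \<Rightarrow> (real ^ 'n::finite \<Rightarrow> real) \<Rightarrow> ('n pt \<Rightarrow> real) \<Rightarrow> ('n pt \<Rightarrow> complex) \<Rightarrow> 'n pt \<Rightarrow> complex" where
  "opP \<sigma> w a u z = (case z of (t, x, v) \<Rightarrow>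
     frechet_derivative u (at z) (1, 0, 0)
     + frechet_derivative u (at z) (0, v, 0)
     + complex_of_real (a z) * frac_lap_v \<sigma> w u z)"

definition esqrt :: "ennreal \<Rightarrow> ennreal" where
  "esqrt y = (if y = top then top else ennreal (sqrt (enn2real y)))"

text \<open>H^s norm expressed on the Fourier side (Plancherel; the 2 pi convention makes the
  Fourier transform unitary): for g = hat f,
  norm = ( integral (1+|zeta|^2)^s |g(zeta)|^2 d zeta )^(1/2), valued in [0,infinity].\<close>
definition hs_norm_hat :: "real \<Rightarrow> ('n::finite pt \<Rightarrow> complex) \<Rightarrow> ennreal" where
  "hs_norm_hat s g = esqrt (\<integral>\<^sup>+\<zeta>. ennreal ((1 + (norm \<zeta>)\<^sup>2) powr s * (cmod (g \<zeta>))\<^sup>2) \<partial>lborel)"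

definition hs_norm :: "real \<Rightarrow> ('n::finite pt \<Rightarrow> complex) \<Rightarrow> ennreal" where
  "hs_norm s u = hs_norm_hat s (fourier u)"

text \<open>||m(D) u||_s for a Fourier multiplier m(D) (symbol m): its Fourier transform is m * hat u.\<close>
definition hs_norm_mult :: "real \<Rightarrow> ('n::finite pt \<Rightarrow> real) \<Rightarrow> ('n pt \<Rightarrow> complex) \<Rightarrow> ennreal" where
  "hs_norm_mult s m u = hs_norm_hat s (\<lambda>\<zeta>. complex_of_real (m \<zeta>) * fourier u \<zeta>)"

definition lhs_symbol :: "real \<Rightarrow> 'n::finite pt \<Rightarrow> real" where
  "lhs_symbol \<sigma> \<zeta> = (case \<zeta> of (\<tau>, \<xi>, \<eta>) \<Rightarrow>
     1 + \<bar>\<tau>\<bar> powr (2 * \<sigma> / (2 * \<sigma> + 1)) + norm \<xi> powr (2 * \<sigma> / (2 * \<sigma> + 1))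
       + norm \<eta> powr (2 * \<sigma>))"

end

(* On the Fourier side, with zeta = (tau, xi, eta), the transport field v.grad_x becomes -xi.grad_eta, so for a
   constant coefficient the equation is an ordinary differential equation along eta + rho xi, damped by the
   symbol F. Solving it from rho = infinity bounds u^ by an integral of f^ against
   exp(- c int_0^rho (1 + |eta + q xi|^(2 sigma)) dq), and this exponent dominates
   rho (1 + |xi|^(2 sigma/(2 sigma + 1)) + |eta|^(2 sigma)); Schur's test yields the full gain in xi and eta.
   A variable coefficient is frozen at finitely many points. After localisation to a small ball its oscillation
   is a multiplier whose Fourier transform has small L^1 norm, so the error is absorbed, and commutators of F with
   cutoffs are of lower order. Multiplication acts as a convolution on the Fourier side, so the weights
   (1 + |zeta|^2)^(s/2) only cost Peetre's inequality and neither Plancherel's theorem nor a symbolic calculus is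
   needed. The bound in tau is then read off from d_t u = (d_t + v.grad_x) u - v.grad_x u, v being bounded on K. *)

theory Submission
  imports Defs "HOL-Probability.Probability"
begin

subsection \<open>Functions closed under differentiation\<close>

text \<open>The order in which the small constants are chosen makes the absorption possible. The
  bound \<epsilon> on the oscillation depends only on \<open>\<sigma>\<close>, \<open>s\<close>,
  \<open>a0\<close> and the sup bound \<open>A\<close>. It then fixes the radius of the balls, hence
  their number n, and only afterwards the factor \<delta> in front of the commutators, which must
  beat n and the 2^n lost in summation. A sharpened form with the absolute factor 2 in its leading
  term settles this. A term can be absorbed only if it is known to be finite, which is why
  everything is done for Schwartz functions. The cutoff in F hides the singularity of |\<eta>|^(2
  \<sigma>) at the origin, so the multiplier preserves the Schwartz class; of P u itself only
  integrability is used. Shifts of F are compared up to a small multiple of 1 + |\<eta>|^(2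
  \<sigma>), which treats all \<sigma> in (0,1) alike.\<close>

fun diff_cls :: "(('a::euclidean_space \<Rightarrow> complex) \<Rightarrow> bool) \<Rightarrow> nat \<Rightarrow> ('a \<Rightarrow> complex) \<Rightarrow> bool" where
  "diff_cls B 0 f = B f"
| "diff_cls B (Suc n) f = (B f \<and> (\<forall>x. f differentiable at x) \<and> (\<forall>d\<in>Basis. diff_cls B n (dd d f)))"

lemma diff_cls_B: "diff_cls B n f \<Longrightarrow> B f"
  by (cases n) auto

lemma diff_cls_SucD: "diff_cls B (Suc n) f \<Longrightarrow> diff_cls B n f"
  by (induction n arbitrary: f) auto

lemma dd_eq: "(f has_derivative f') (at x) \<Longrightarrow> dd d f x = f' d"
  unfolding dd_def by (metis frechet_derivative_at)

lemma differentiableD: "f differentiable at x \<Longrightarrow> (f has_derivative frechet_derivative f (at x)) (at x)"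
  by (simp add: frechet_derivative_works)

lemma dd_add:
  assumes "\<And>x. f differentiable at x" "\<And>x. g differentiable at x"
  shows "dd d (\<lambda>x. f x + g x) = (\<lambda>x. dd d f x + dd d g x)"
proof
  fix x
  have "((\<lambda>x. f x + g x) has_derivative (\<lambda>h. frechet_derivative f (at x) h + frechet_derivative g (at x) h)) (at x)"
    by (intro has_derivative_add differentiableD assms)
  from dd_eq[OF this] show "dd d (\<lambda>x. f x + g x) x = dd d f x + dd d g x"
    by (simp add: dd_def)
qed

lemma dd_mult:
  fixes f g :: "'a::real_normed_vector \<Rightarrow> complex"
  assumes "\<And>x. f differentiable at x" "\<And>x. g differentiable at x"
  shows "dd d (\<lambda>x. f x * g x) = (\<lambda>x. f x * dd d g x + dd d f x * g x)"
proof
  fix x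
  have "((\<lambda>x. f x * g x) has_derivative (\<lambda>h. f x * frechet_derivative g (at x) h + frechet_derivative f (at x) h * g x)) (at x)"
    by (intro has_derivative_mult differentiableD assms)
  from dd_eq[OF this] show "dd d (\<lambda>x. f x * g x) x = f x * dd d g x + dd d f x * g x"
    by (simp add: dd_def)
qed

lemma dd_const [simp]: "dd d (\<lambda>x. c) = (\<lambda>x. 0)"
  by (auto simp: dd_def)

lemma dd_bounded_linear:
  assumes "bounded_linear L" "\<And>x. f differentiable at x"
  shows "dd d (\<lambda>x. L (f x)) = (\<lambda>x. L (dd d f x))"
proof
  fix x
  have "((\<lambda>x. L (f x)) has_derivative (\<lambda>h. L (frechet_derivative f (at x) h))) (at x)"
    by (intro bounded_linear.has_derivative[OF assms(1)] differentiableD assms)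
  from dd_eq[OF this] show "dd d (\<lambda>x. L (f x)) x = L (dd d f x)"
    by (simp add: dd_def)
qed

lemma diff_cls_add:
  assumes B: "\<And>f g. B f \<Longrightarrow> B g \<Longrightarrow> B (\<lambda>x. f x + g x)"
  shows "diff_cls B n f \<Longrightarrow> diff_cls B n g \<Longrightarrow> diff_cls B n (\<lambda>x. f x + g x)"
proof (induction n arbitrary: f g)
  case 0
  then show ?case by (simp add: B)
next
  case (Suc n)
  then show ?case by (auto simp: dd_add intro!: B)
qed

text \<open>Leibniz: the derivative of a product is a sum of two products, each with one derivative
  fewer left to control. Three separate predicates let the factors come from different classes, as
  in Schwartz times polynomially growing.\<close>

lemma diff_cls_mult:
  assumes B: "\<And>f g. B1 f \<Longrightarrow> B2 g \<Longrightarrow> B3 (\<lambda>x. f x * g x)"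
    and add: "\<And>f g. B3 f \<Longrightarrow> B3 g \<Longrightarrow> B3 (\<lambda>x. f x + g x)"
  shows "diff_cls B1 n f \<Longrightarrow> diff_cls B2 n g \<Longrightarrow> diff_cls B3 n (\<lambda>x. f x * g x)"
proof (induction n arbitrary: f g)
  case 0
  then show ?case by (simp add: B)
next
  case (Suc n)
  then have f: "\<And>x. f differentiable at x" and g: "\<And>x. g differentiable at x" by auto
  have "diff_cls B3 n (dd d (\<lambda>x. f x * g x))" if d: "d \<in> Basis" for d
    unfolding dd_mult[OF f g]
    by (intro diff_cls_add add Suc.IH)
       (use Suc.prems d diff_cls_SucD[of _ n] in \<open>auto simp del: diff_cls.simps simp: diff_cls.simps(2)\<close>)
  then show ?case using Suc.prems f g by (auto intro!: B)
qed

lemma iter_dd_append: "iter_dd (ds @ [d]) f = iter_dd ds (dd d f)"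
  by (induction ds) auto

lemma smooth_differentiable: "smooth f \<Longrightarrow> f differentiable at x"
  unfolding smooth_def by (metis empty_set empty_subsetI iter_dd.simps(1))

lemma smooth_dd:
  fixes f :: "'a::euclidean_space \<Rightarrow> 'b::real_normed_vector"
  shows "smooth f \<Longrightarrow> d \<in> Basis \<Longrightarrow> smooth (dd d f)"
  unfolding smooth_def
proof (intro allI impI)
  fix ds :: "'a list" and x :: 'a
  assume *: "\<forall>ds. set ds \<subseteq> Basis \<longrightarrow> (\<forall>x. iter_dd ds f differentiable at x)" "d \<in> Basis" "set ds \<subseteq> Basis"
  then show "iter_dd ds (dd d f) differentiable at x"
    using *(1)[rule_format, of "ds @ [d]" x] by (simp add: iter_dd_append)
qed

lemma smooth_of_real:
  fixes f :: "'a::euclidean_space \<Rightarrow> real"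
  shows "smooth f \<Longrightarrow> smooth (\<lambda>x. complex_of_real (f x))"
proof -
  assume f: "smooth f"
  have *: "set ds \<subseteq> Basis \<Longrightarrow> iter_dd ds (\<lambda>x. complex_of_real (f x)) = (\<lambda>x. complex_of_real (iter_dd ds f x))" for ds
  proof (induction ds)
    case (Cons d ds)
    then show ?case using f
      by (simp add: smooth_def dd_bounded_linear[OF bounded_linear_of_real])
  qed simp
  show ?thesis
    unfolding smooth_def
  proof (intro allI impI)
    fix ds :: "'a list" and x :: 'a
    assume ds: "set ds \<subseteq> Basis"
    then have "(iter_dd ds f has_derivative frechet_derivative (iter_dd ds f) (at x)) (at x)"
      using f by (simp add: smooth_def frechet_derivative_works)
    from bounded_linear.has_derivative[OF bounded_linear_of_real this]
    show "iter_dd ds (\<lambda>x. complex_of_real (f x)) differentiable at x"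
      unfolding *[OF ds] by (auto simp: differentiable_def)
  qed
qed

subsection \<open>Schwartz functions and tempered multipliers\<close>

definition rapid :: "('a::euclidean_space \<Rightarrow> complex) \<Rightarrow> bool" where
  "rapid f \<longleftrightarrow> (\<forall>N. \<exists>C. \<forall>z. cmod (f z) * (1 + norm z) ^ N \<le> C)"

definition tempered :: "('a::euclidean_space \<Rightarrow> complex) \<Rightarrow> bool" where
  "tempered f \<longleftrightarrow> (\<exists>N C. \<forall>z. cmod (f z) \<le> C * (1 + norm z) ^ N)"

text \<open>The Schwartz space. Decay is required up to every finite order n, so closure properties
  become inductions over n with the function left arbitrary.\<close>

definition schw :: "('a::euclidean_space \<Rightarrow> complex) \<Rightarrow> bool" where
  "schw f \<longleftrightarrow> (\<forall>n. diff_cls rapid n f)"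

text \<open>The multipliers of the Schwartz space, often written O_M: the degree of the polynomial
  bound may depend on the derivative.\<close>

definition smtemp :: "('a::euclidean_space \<Rightarrow> complex) \<Rightarrow> bool" where
  "smtemp f \<longleftrightarrow> (\<forall>n. diff_cls tempered n f)"

lemma rapidE:
  assumes "rapid f"
  obtains C where "C > 0" "\<And>z. cmod (f z) * (1 + norm z) ^ N \<le> C"
proof -
  obtain C where C: "\<And>z. cmod (f z) * (1 + norm z) ^ N \<le> C" using assms unfolding rapid_def by blast
  have "0 \<le> cmod (f 0) * (1 + norm (0::'a)) ^ N" by simp
  then have "C \<ge> 0" using C order.trans by blast
  then show ?thesis using that[of "C+1"] C by (simp add: add_increasing2)
qed

lemma rapid_add: "rapid f \<Longrightarrow> rapid g \<Longrightarrow> rapid (\<lambda>x. f x + g x)"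
  unfolding rapid_def
proof
  fix N assume *: "\<forall>N. \<exists>C. \<forall>z. cmod (f z) * (1 + norm z) ^ N \<le> C" "\<forall>N. \<exists>C. \<forall>z. cmod (g z) * (1 + norm z) ^ N \<le> C"
  obtain C D where "\<forall>z. cmod (f z) * (1 + norm z) ^ N \<le> C" "\<forall>z. cmod (g z) * (1 + norm z) ^ N \<le> D"
    using * by metis
  moreover have "cmod (f z + g z) * (1 + norm z) ^ N \<le> cmod (f z) * (1 + norm z) ^ N + cmod (g z) * (1 + norm z) ^ N" for z
    by (metis distrib_right mult_right_mono norm_triangle_ineq zero_le_power add_nonneg_nonneg norm_ge_zero zero_le_one)
  ultimately show "\<exists>C. \<forall>z. cmod (f z + g z) * (1 + norm z) ^ N \<le> C"
    by (intro exI[of _ "C+D"]) (smt (verit))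
qed

lemma temperedE:
  assumes "tempered f"
  obtains N C where "C > 0" "\<And>z. cmod (f z) \<le> C * (1 + norm z) ^ N"
proof -
  obtain N C where C: "\<And>z. cmod (f z) \<le> C * (1 + norm z) ^ N" using assms unfolding tempered_def by blast
  have "C * (1 + norm z) ^ N \<le> (\<bar>C\<bar>+1) * (1 + norm z) ^ N" for z::'a
    by (intro mult_right_mono) auto
  then have "cmod (f z) \<le> (\<bar>C\<bar>+1) * (1 + norm z) ^ N" for z
    using C[of z] order_trans by blast
  then show ?thesis using that[of "\<bar>C\<bar>+1" N] by simp
qed

lemma tempered_add: "tempered f \<Longrightarrow> tempered g \<Longrightarrow> tempered (\<lambda>x. f x + g x)"
proof -
  assume "tempered f" "tempered g"
  then obtain N C M D where *: "C > 0" "\<And>z. cmod (f z) \<le> C * (1 + norm z) ^ N"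
    "D > 0" "\<And>z. cmod (g z) \<le> D * (1 + norm z) ^ M" by (metis temperedE)
  have "cmod (f z + g z) \<le> (C + D) * (1 + norm z) ^ (N + M)" for z
  proof -
    have "C * (1 + norm z) ^ N \<le> C * (1 + norm z) ^ (N+M)" "D * (1 + norm z) ^ M \<le> D * (1 + norm z) ^ (N+M)"
      using * by (auto intro!: mult_left_mono power_increasing)
    then show ?thesis using *(2,4)[of z] norm_triangle_ineq[of "f z" "g z"] by (auto simp: distrib_right)
  qed
  then show ?thesis unfolding tempered_def by blast
qed

lemma tempered_mult: "tempered f \<Longrightarrow> tempered g \<Longrightarrow> tempered (\<lambda>x. f x * g x)"
proof -
  assume "tempered f" "tempered g"
  then obtain N C M D where *: "C > 0" "\<And>z. cmod (f z) \<le> C * (1 + norm z) ^ N"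
    "D > 0" "\<And>z. cmod (g z) \<le> D * (1 + norm z) ^ M" by (metis temperedE)
  have "cmod (f z * g z) \<le> (C * D) * (1 + norm z) ^ (N + M)" for z
  proof -
    have "cmod (f z) * cmod (g z) \<le> (C * (1 + norm z) ^ N) * (D * (1 + norm z) ^ M)"
      using * by (intro mult_mono) auto
    then show ?thesis by (simp add: norm_mult power_add mult_ac)
  qed
  then show ?thesis unfolding tempered_def by blast
qed

lemma rapid_mult_tempered: "rapid f \<Longrightarrow> tempered g \<Longrightarrow> rapid (\<lambda>x. f x * g x)"
  unfolding rapid_def
proof
  fix M assume f: "\<forall>N. \<exists>C. \<forall>z. cmod (f z) * (1 + norm z) ^ N \<le> C" and "tempered g"
  then obtain N D where *: "D > 0" "\<And>z. cmod (g z) \<le> D * (1 + norm z) ^ N" by (metis temperedE)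
  obtain C where C: "\<And>z. cmod (f z) * (1 + norm z) ^ (N + M) \<le> C" using f by blast
  have "cmod (f z * g z) * (1 + norm z) ^ M \<le> C * D" for z
  proof -
    have "cmod (f z * g z) * (1 + norm z) ^ M \<le> cmod (f z) * (D * (1 + norm z) ^ N) * (1 + norm z) ^ M"
      using * by (simp add: norm_mult mult_left_mono mult_right_mono)
    also have "\<dots> = (cmod (f z) * (1 + norm z) ^ (N + M)) * D" by (simp add: power_add mult_ac)
    also have "\<dots> \<le> C * D" using C * by (intro mult_right_mono) auto
    finally show ?thesis .
  qed
  then show "\<exists>C. \<forall>z. cmod (f z * g z) * (1 + norm z) ^ M \<le> C" by blast
qed

lemma rapid_tempered: "rapid f \<Longrightarrow> tempered f"
  unfolding rapid_def tempered_def by (metis mult.right_neutral power_0)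

lemma diff_cls_mono: "(\<And>f. B f \<Longrightarrow> B' f) \<Longrightarrow> diff_cls B n f \<Longrightarrow> diff_cls B' n f"
  by (induction n arbitrary: f) auto

lemma schw_smtemp: "schw f \<Longrightarrow> smtemp f"
  unfolding schw_def smtemp_def using diff_cls_mono[of rapid tempered] rapid_tempered by blast

lemma schw_add: "schw f \<Longrightarrow> schw g \<Longrightarrow> schw (\<lambda>x. f x + g x)"
  unfolding schw_def by (auto intro!: diff_cls_add rapid_add)

lemma smtemp_add: "smtemp f \<Longrightarrow> smtemp g \<Longrightarrow> smtemp (\<lambda>x. f x + g x)"
  unfolding smtemp_def by (auto intro!: diff_cls_add tempered_add)

lemma schw_mult_smtemp: "schw f \<Longrightarrow> smtemp g \<Longrightarrow> schw (\<lambda>x. f x * g x)"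
  unfolding schw_def smtemp_def
  by (auto intro!: diff_cls_mult[where ?B1.0=rapid and ?B2.0=tempered] rapid_add rapid_mult_tempered)

lemma smtemp_mult: "smtemp f \<Longrightarrow> smtemp g \<Longrightarrow> smtemp (\<lambda>x. f x * g x)"
  unfolding smtemp_def
  by (auto intro!: diff_cls_mult[where ?B1.0=tempered and ?B2.0=tempered] tempered_add tempered_mult)

lemma smtemp_mult_schw: "smtemp f \<Longrightarrow> schw g \<Longrightarrow> schw (\<lambda>x. f x * g x)"
  using schw_mult_smtemp[of g f] by (simp add: mult.commute)

lemma smtemp_const: "smtemp (\<lambda>x. c)"
proof -
  have t: "tempered (\<lambda>x::'a. c)" for c unfolding tempered_def by (intro exI[of _ 0] exI[of _ "cmod c"]) auto
  have "diff_cls tempered n (\<lambda>x::'a. c)" for n c by (induction n arbitrary: c) (auto simp: t)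
  then show ?thesis unfolding smtemp_def by blast
qed

lemma smtemp_linear:
  fixes L :: "'a::euclidean_space \<Rightarrow> real"
  assumes "bounded_linear L" shows "smtemp (\<lambda>x. complex_of_real (L x))"
proof -
  have d: "dd d (\<lambda>x. complex_of_real (L x)) = (\<lambda>x. complex_of_real (L d))" for d
  proof
    fix x show "dd d (\<lambda>x. complex_of_real (L x)) x = complex_of_real (L d)"
      by (rule dd_eq) (intro bounded_linear_imp_has_derivative bounded_linear_compose[OF bounded_linear_of_real assms])
  qed
  have df: "(\<lambda>x. complex_of_real (L x)) differentiable at x" for x
    by (intro bounded_linear_imp_differentiable bounded_linear_compose[OF bounded_linear_of_real assms])
  obtain B where B: "\<And>x. norm (L x) \<le> norm x * B" "B > 0"
    using bounded_linear.pos_bounded[OF assms] by blast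
  have t: "tempered (\<lambda>x. complex_of_real (L x))"
    unfolding tempered_def
  proof (rule exI[of _ 1], rule exI[of _ B], rule allI)
    fix z :: 'a show "cmod (complex_of_real (L z)) \<le> B * (1 + norm z) ^ 1"
      using B(1)[of z] B(2) by (simp add: algebra_simps)
  qed
  have "diff_cls tempered n (\<lambda>x. complex_of_real (L x))" for n
    using smtemp_const unfolding smtemp_def by (cases n) (auto simp: t d df)
  then show ?thesis unfolding smtemp_def by blast
qed

lemma schw_cmult: "schw f \<Longrightarrow> schw (\<lambda>x. c * f x)"
  using smtemp_mult_schw[OF smtemp_const] .

lemma schw_differentiable: "schw f \<Longrightarrow> f differentiable at x"
  unfolding schw_def by (metis diff_cls.simps(2))

lemma schw_dd: "schw f \<Longrightarrow> d \<in> Basis \<Longrightarrow> schw (dd d f)"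
  unfolding schw_def by (metis diff_cls.simps(2))

lemma smtemp_differentiable: "smtemp f \<Longrightarrow> f differentiable at x"
  unfolding smtemp_def by (metis diff_cls.simps(2))

lemma smtemp_dd: "smtemp f \<Longrightarrow> d \<in> Basis \<Longrightarrow> smtemp (dd d f)"
  unfolding smtemp_def by (metis diff_cls.simps(2))

lemma schw_rapid: "schw f \<Longrightarrow> rapid f"
  unfolding schw_def using diff_cls_B by blast

lemma schwE:
  assumes "schw f"
  obtains C where "C > 0" "\<And>z. cmod (f z) * (1 + norm z) ^ N \<le> C"
  using rapidE schw_rapid assms by blast

lemma schw_continuous: "schw f \<Longrightarrow> continuous_on A f"
  by (meson continuous_at_imp_continuous_on differentiable_imp_continuous_within schw_differentiable)

lemma schw_0: "schw (\<lambda>x. 0)"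
proof -
  have "diff_cls rapid n (\<lambda>x::'a. 0)" for n by (induction n) (auto simp: rapid_def)
  then show ?thesis unfolding schw_def by blast
qed

lemma schw_sum: "finite I \<Longrightarrow> (\<And>i. i \<in> I \<Longrightarrow> schw (f i)) \<Longrightarrow> schw (\<lambda>x. \<Sum>i\<in>I. f i x)"
  by (induction rule: finite_induct) (auto simp: schw_0 intro!: schw_add)

lemma schw_mult: "schw f \<Longrightarrow> schw g \<Longrightarrow> schw (\<lambda>x. f x * g x)"
  by (simp add: schw_mult_smtemp schw_smtemp)

lemma dd_supp:
  assumes "\<And>z. f z \<noteq> 0 \<Longrightarrow> norm z \<le> R" "norm z > R"
  shows "dd d f z = 0"
proof -
  have "(f has_derivative (\<lambda>h. 0)) (at z)"
  proof (rule has_derivative_transform_within_open[of "\<lambda>_. 0" _ _ _ "{z. norm z > R}"])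
    show "open {z::'a. norm z > R}" by (intro open_Collect_less continuous_intros)
  qed (use assms in \<open>auto simp: not_le[symmetric]\<close>)
  from dd_eq[OF this] show ?thesis by simp
qed

text \<open>Away from the origin powers of the norm are differentiated as often as one likes; the
  singularity is hidden by a factor vanishing near the origin.\<close>

lemma smtemp_norm_powr:
  fixes g :: "'a::euclidean_space \<Rightarrow> complex"
  assumes "smtemp g" "\<And>z. norm z \<le> 1 \<Longrightarrow> g z = 0"
  shows "smtemp (\<lambda>z. complex_of_real (norm z powr p) * g z)"
proof -
  define k where "k q g z = complex_of_real (norm z powr q) * g z" for q g and z :: 'a
  \<comment> \<open>The family \<open>k q g\<close> is closed under differentiation: the derivative
    of |z|^q in direction h is q |z|^(q-2) (z . h), which is again a power of the norm times a
    function of the same kind. Hence the induction over all q and g at once.\<close>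
  have hd: "(k q g has_derivative (\<lambda>h. k q (\<lambda>z. frechet_derivative g (at z) h) z + k (q - 2) (\<lambda>z. complex_of_real (q * (z \<bullet> h)) * g z) z)) (at z)"
    if g: "smtemp g" "\<And>z. norm z < 1 \<Longrightarrow> g z = 0" for q g z
  proof (cases "norm z < 1")
    case True
    have "(g has_derivative (\<lambda>h. 0)) (at z)"
      by (rule has_derivative_transform_within_open[of "\<lambda>_. 0" _ _ _ "ball 0 1"]) (use g True in auto)
    then have fd: "frechet_derivative g (at z) = (\<lambda>h. 0)" by (metis frechet_derivative_at)
    have "(k q g has_derivative (\<lambda>h. 0)) (at z)"
      by (rule has_derivative_transform_within_open[of "\<lambda>_. 0" _ _ _ "ball 0 1"]) (use g True in \<open>auto simp: k_def\<close>)
    then show ?thesis using g True by (simp add: k_def fd)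
  next
    case False
    then have z: "z \<noteq> 0" by auto
    have e: "norm z powr (q - 2) * (z \<bullet> h) = norm z powr q * ((z \<bullet> h) / norm z / norm z)" for h
      using z by (simp add: powr_diff power2_eq_square)
    have "((\<lambda>z. norm z powr q) has_derivative (\<lambda>h. norm z powr q * (q * (sgn z \<bullet> h) / norm z))) (at z)"
      using has_derivative_powr[OF has_derivative_norm[OF z] has_derivative_const, of q] z
      by (simp add: inner_commute mult_ac)
    then have "((\<lambda>z. complex_of_real (norm z powr q)) has_derivative
        (\<lambda>h. complex_of_real (norm z powr q * (q * (sgn z \<bullet> h) / norm z)))) (at z)"
      by (rule bounded_linear.has_derivative[OF bounded_linear_of_real])
    from has_derivative_mult[OF this differentiableD[OF smtemp_differentiable[OF g(1)]]]
    show ?thesis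
      unfolding k_def
      by (rule has_derivative_eq_rhs) (use z in \<open>auto simp: fun_eq_iff e sgn_div_norm field_simps power2_eq_square powr_diff\<close>)
  qed
  \<comment> \<open>Where g survives the norm is at least 1, so negative powers are harmless and
    \<open>\<bar>q\<bar>\<close> may be rounded up to a natural number.\<close>
  have t: "tempered (k q g)" if g: "smtemp g" "\<And>z. norm z < 1 \<Longrightarrow> g z = 0" for q g
  proof -
    have "tempered g" using g(1) unfolding smtemp_def using diff_cls_B by blast
    then obtain N C where C: "C > 0" "\<And>z. cmod (g z) \<le> C * (1 + norm z) ^ N" by (metis temperedE)
    have "cmod (k q g z) \<le> C * (1 + norm z) ^ (N + nat \<lceil>\<bar>q\<bar>\<rceil>)" for z
    proof (cases "norm z < 1")
      case False
      have "norm z powr q \<le> norm z powr real (nat \<lceil>\<bar>q\<bar>\<rceil>)"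
        using False by (intro powr_mono) linarith+
      also have "\<dots> = norm z ^ (nat \<lceil>\<bar>q\<bar>\<rceil>)" using False by (intro powr_realpow) linarith
      also have "\<dots> \<le> (1 + norm z) ^ (nat \<lceil>\<bar>q\<bar>\<rceil>)" by (intro power_mono) auto
      finally have "norm z powr q * cmod (g z) \<le> (1 + norm z) ^ (nat \<lceil>\<bar>q\<bar>\<rceil>) * (C * (1 + norm z) ^ N)"
        using C by (intro mult_mono) auto
      then show ?thesis by (simp add: k_def norm_mult power_add mult_ac)
    qed (use C(1) g in \<open>auto simp: k_def\<close>)
    then show ?thesis unfolding tempered_def by blast
  qed
  \<comment> \<open>The vanishing hypothesis is carried on the open ball, because there it passes to
    derivatives.\<close>
  have van: "dd d g z = 0" if g: "\<And>z. norm z < 1 \<Longrightarrow> g z = 0" and z: "norm z < 1" for g :: "'a \<Rightarrow> complex" and d z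
  proof -
    have "(g has_derivative (\<lambda>h. 0)) (at z)"
      by (rule has_derivative_transform_within_open[of "\<lambda>_. 0" _ _ _ "ball 0 1"]) (use g z in auto)
    from dd_eq[OF this] show ?thesis by simp
  qed
  have "diff_cls tempered n (k q g)" if "smtemp g" "\<And>z. norm z < 1 \<Longrightarrow> g z = 0" for n q g
    using that
  proof (induction n arbitrary: q g)
    case (Suc n)
    have "dd d (k q g) = (\<lambda>z. k q (dd d g) z + k (q - 2) (\<lambda>z. complex_of_real (q * (z \<bullet> d)) * g z) z)" for d
      using dd_eq[OF hd[OF Suc.prems]] by (auto simp: dd_def k_def)
    moreover have "diff_cls tempered n (k q (dd d g))" if "d \<in> Basis" for d
      using Suc.prems that van by (intro Suc.IH smtemp_dd) auto
    moreover have "diff_cls tempered n (k (q - 2) (\<lambda>z. complex_of_real (q * (z \<bullet> d)) * g z))" for d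
      using Suc.prems
      by (intro Suc.IH smtemp_mult smtemp_linear) (auto intro!: bounded_linear_intros)
    moreover have "k q g differentiable at x" for x
      using hd[OF Suc.prems] unfolding differentiable_def by blast
    ultimately show ?case
      using t[OF Suc.prems] by (auto intro!: diff_cls_add tempered_add)
  qed (simp add: t)
  then show ?thesis using assms unfolding smtemp_def k_def by (simp add: less_imp_le)
qed

subsection \<open>Integrals over Euclidean spaces\<close>

lemma lborel_integral_affine:
  fixes f :: "'a::euclidean_space \<Rightarrow> 'b::{banach, second_countable_topology}"
  assumes [measurable]: "f \<in> borel_measurable borel" and c: "c \<noteq> 0"
  shows "(\<integral>x. f x \<partial>lborel) = \<bar>c\<bar> ^ DIM('a) *\<^sub>R (\<integral>x. f (t + c *\<^sub>R x) \<partial>lborel)"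
  by (subst lborel_affine[OF c, of t]) (simp add: integral_density integral_distr)

lemma lborel_integrable_affine:
  fixes f :: "'a::euclidean_space \<Rightarrow> 'b::{banach, second_countable_topology}"
  assumes f: "integrable lborel f" and c: "c \<noteq> 0"
  shows "integrable lborel (\<lambda>x. f (t + c *\<^sub>R x))"
proof -
  have [measurable]: "f \<in> borel_measurable borel" using f by auto
  have "integrable (density (distr lborel borel (\<lambda>x. t + c *\<^sub>R x)) (\<lambda>_. ennreal (\<bar>c\<bar>^DIM('a)))) f"
    using f lborel_affine[OF c, of t] by (simp add: ennreal_power)
  then have "integrable lborel (\<lambda>x. \<bar>c\<bar>^DIM('a) *\<^sub>R f (t + c *\<^sub>R x))"
    by (subst (asm) integrable_density) (auto simp: integrable_distr_eq)
  from integrable_scaleR_right[OF this, of "inverse (\<bar>c\<bar>^DIM('a))"] show ?thesis using c by simp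
qed

lemma lborel_integral_shift:
  fixes f :: "'a::euclidean_space \<Rightarrow> 'b::{banach, second_countable_topology}"
  assumes "f \<in> borel_measurable borel"
  shows "(\<integral>x. f (x + t) \<partial>lborel) = (\<integral>x. f x \<partial>lborel)"
  using lborel_integral_affine[OF assms, of 1 t] by (simp add: add.commute)

lemma lborel_integral_uminus:
  fixes f :: "'a::euclidean_space \<Rightarrow> 'b::{banach, second_countable_topology}"
  assumes "f \<in> borel_measurable borel"
  shows "(\<integral>x. f (- x) \<partial>lborel) = (\<integral>x. f x \<partial>lborel)"
  using lborel_integral_affine[OF assms, of "-1" 0] by simp

lemma lborel_nn_integral_affine:
  fixes f :: "'a::euclidean_space \<Rightarrow> ennreal"
  assumes [measurable]: "f \<in> borel_measurable borel" and c: "c \<noteq> 0"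
  shows "(\<integral>\<^sup>+x. f x \<partial>lborel) = ennreal (\<bar>c\<bar> ^ DIM('a)) * (\<integral>\<^sup>+x. f (t + c *\<^sub>R x) \<partial>lborel)"
  by (subst lborel_affine[OF c, of t])
     (simp add: nn_integral_density nn_integral_distr nn_integral_cmult ennreal_power)

lemma lborel_nn_integral_shift:
  fixes f :: "'a::euclidean_space \<Rightarrow> ennreal"
  assumes "f \<in> borel_measurable borel"
  shows "(\<integral>\<^sup>+x. f (x + t) \<partial>lborel) = (\<integral>\<^sup>+x. f x \<partial>lborel)"
  using lborel_nn_integral_affine[OF assms, of 1 t] by (simp add: add.commute)

text \<open>In coordinates \<open>lborel\<close> is the image of a finite product of one-dimensional
  Lebesgue measures, so Fubini for finite products applies.\<close>

lemma lborel_integral_prod_Basis: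
  fixes f :: "'a::euclidean_space \<Rightarrow> real \<Rightarrow> complex"
  assumes i: "\<And>b. b \<in> Basis \<Longrightarrow> integrable lborel (f b)"
  shows "(\<integral>x. (\<Prod>b\<in>Basis. f b (x \<bullet> b)) \<partial>lborel) = (\<Prod>b\<in>Basis. (\<integral>x. f b x \<partial>lborel))"
    and "integrable (lborel :: 'a measure) (\<lambda>x. \<Prod>b\<in>Basis. f b (x \<bullet> b))"
proof -
  interpret product_sigma_finite "\<lambda>_::'a. lborel :: real measure" ..
  have [measurable]: "\<And>b. b \<in> Basis \<Longrightarrow> f b \<in> borel_measurable borel" using i by auto
  have s: "(\<Prod>b\<in>Basis. f b ((\<Sum>c\<in>Basis. x c *\<^sub>R c) \<bullet> b)) = (\<Prod>b\<in>Basis. f b (x b))" for x :: "'a \<Rightarrow> real"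
    by (intro prod.cong refl) simp
  show "(\<integral>x. (\<Prod>b\<in>Basis. f b (x \<bullet> b)) \<partial>lborel) = (\<Prod>b\<in>Basis. (\<integral>x. f b x \<partial>lborel))"
    by (simp add: lborel_eq[where ?'a='a] integral_distr s product_integral_prod i)
  show "integrable (lborel :: 'a measure) (\<lambda>x. \<Prod>b\<in>Basis. f b (x \<bullet> b))"
    by (simp add: lborel_eq[where ?'a='a] integrable_distr_eq s product_integrable_prod i)
qed

text \<open>Comparison with the product of 1/(1 + x^2) over the coordinates. Each factor 1 + x^2 is
  at most (1 + |z|)^2, which costs two powers per dimension and explains the exponent
  \<open>2 * DIM('a)\<close>.\<close>

lemma weight_integrable:
  assumes "N \<ge> 2 * DIM('a)"
  shows "integrable lborel (\<lambda>z::'a::euclidean_space. 1 / (1 + norm z) ^ N)"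
proof -
  have "set_integrable lborel UNIV (\<lambda>x::real. inverse (1 + x^2))"
    using integrable_inverse_1_plus_square by simp
  then have "integrable lborel (\<lambda>x::real. inverse (1 + x^2))"
    by (simp add: set_integrable_def)
  from integrable_of_real[OF this, where ?'a=complex]
  have "integrable lborel (\<lambda>z::'a. \<Prod>b\<in>Basis. complex_of_real (inverse (1 + (z \<bullet> b)^2)))"
    by (intro lborel_integral_prod_Basis(2))
  then show ?thesis
  proof (rule Bochner_Integration.integrable_bound)
    show "AE z::'a in lborel. norm (1 / (1 + norm z) ^ N) \<le> norm (\<Prod>b\<in>Basis. complex_of_real (inverse (1 + (z \<bullet> b)^2)))"
    proof (intro AE_I2)
      fix z :: 'a
      have "(\<Prod>b\<in>Basis. 1 + (z \<bullet> b)^2) \<le> (\<Prod>b\<in>(Basis::'a set). (1 + norm z)^2)"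
      proof (intro prod_mono conjI)
        fix b :: 'a assume "b \<in> Basis"
        then have "\<bar>z \<bullet> b\<bar> \<le> norm z" by (rule Basis_le_norm)
        then have "(z \<bullet> b)^2 \<le> (norm z)^2" by (metis abs_ge_zero power2_abs power_mono)
        then show "1 + (z \<bullet> b)^2 \<le> (1 + norm z)^2" by (simp add: power2_sum add_increasing2)
      qed auto
      also have "\<dots> = (1 + norm z) ^ (2 * DIM('a))" by (simp add: power_mult)
      also have "\<dots> \<le> (1 + norm z) ^ N" using assms by (intro power_increasing) auto
      finally have "inverse ((1 + norm z) ^ N) \<le> inverse (\<Prod>b\<in>Basis. 1 + (z \<bullet> b)^2)"
        by (intro le_imp_inverse_le prod_pos) (auto intro: add_pos_nonneg)
      also have "inverse (\<Prod>b\<in>Basis. 1 + (z \<bullet> b)^2) = (\<Prod>b\<in>Basis. inverse (1 + (z \<bullet> b)^2))"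
        using prod_inversef[of "\<lambda>b. 1 + (z \<bullet> b)^2" Basis] by (simp add: o_def)
      also have "\<dots> = norm (\<Prod>b\<in>Basis. complex_of_real (inverse (1 + (z \<bullet> b)^2)))"
        unfolding prod_norm[symmetric] norm_of_real by (intro prod.cong refl) simp
      finally show "norm (1 / (1 + norm z) ^ N) \<le> norm (\<Prod>b\<in>Basis. complex_of_real (inverse (1 + (z \<bullet> b)^2)))"
        by (simp add: inverse_eq_divide)
    qed
  qed measurable
qed

lemma rapid_integrable:
  fixes f :: "'a::euclidean_space \<Rightarrow> complex"
  assumes "rapid f" and [measurable]: "f \<in> borel_measurable borel"
  shows "integrable lborel (\<lambda>z. cmod (f z) * (1 + norm z) ^ N)" "integrable lborel f"
proof -
  show *: "integrable lborel (\<lambda>z. cmod (f z) * (1 + norm z) ^ N)" for N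
  proof -
    let ?M = "2 * DIM('a)"
    obtain C where C: "C > 0" "\<And>z. cmod (f z) * (1 + norm z) ^ (N + ?M) \<le> C" using assms rapidE by blast
    have "integrable lborel (\<lambda>z::'a. C * (1 / (1 + norm z) ^ ?M))"
      by (intro integrable_mult_right weight_integrable) simp
    then show ?thesis
    proof (rule Bochner_Integration.integrable_bound)
      show "AE z in lborel. norm (cmod (f z) * (1 + norm z) ^ N) \<le> norm (C * (1 / (1 + norm z) ^ ?M))"
      proof (intro AE_I2)
        fix z :: 'a
        have p: "0 < 1 + norm z" by (simp add: add_pos_nonneg)
        then show "norm (cmod (f z) * (1 + norm z) ^ N) \<le> norm (C * (1 / (1 + norm z) ^ ?M))"
          using C(2)[of z] C(1) by (simp add: field_simps power_add abs_of_pos)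
      qed
    qed measurable
  qed
  have "integrable lborel (\<lambda>z. cmod (f z))" using *[of 0] by simp
  then show "integrable lborel f" by (simp add: integrable_norm_iff)
qed

lemma schw_measurable [measurable]: "schw f \<Longrightarrow> f \<in> borel_measurable borel"
  by (intro borel_measurable_continuous_onI schw_continuous)

lemma schw_integrable: "schw f \<Longrightarrow> integrable lborel f"
  by (intro rapid_integrable schw_rapid schw_measurable)

lemma schw_integrable_weight: "schw f \<Longrightarrow> integrable lborel (\<lambda>z. cmod (f z) * (1 + norm z) ^ N)"
  by (intro rapid_integrable schw_rapid schw_measurable)

text \<open>Mean value inequality on the segment from z to z + h; the bound on the derivative in
  direction h already contains the factor |h|.\<close>

lemma differentiable_increment:
  fixes f :: "'a::euclidean_space \<Rightarrow> complex"
  assumes f: "\<And>x. f differentiable at x" and B: "\<And>s. 0 \<le> s \<Longrightarrow> s \<le> 1 \<Longrightarrow> cmod (frechet_derivative f (at (z + s *\<^sub>R h)) h) \<le> B"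
  shows "cmod (f (z + h) - f z) \<le> B"
proof -
  have hd: "((\<lambda>s. f (z + s *\<^sub>R h)) has_vector_derivative frechet_derivative f (at (z + s *\<^sub>R h)) h) (at s within {0..1})" for s
  proof -
    have "((\<lambda>s. z + s *\<^sub>R h) has_derivative (\<lambda>r. r *\<^sub>R h)) (at s within {0..1})"
      by (auto intro!: derivative_eq_intros)
    from has_derivative_compose[OF this has_derivative_at_withinI[OF differentiableD[OF f]]]
    have "((\<lambda>s. f (z + s *\<^sub>R h)) has_derivative (\<lambda>r. frechet_derivative f (at (z + s *\<^sub>R h)) (r *\<^sub>R h))) (at s within {0..1})"
      using has_derivative_compose[OF \<open>((\<lambda>s. z + s *\<^sub>R h) has_derivative (\<lambda>r. r *\<^sub>R h)) (at s within {0..1})\<close> differentiableD[OF f]] by simp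
    moreover have "linear (frechet_derivative f (at (z + s *\<^sub>R h)))"
      by (rule linear_frechet_derivative[OF f])
    ultimately show ?thesis by (simp add: has_vector_derivative_def linear_cmul)
  qed
  have "norm (f (z + 1 *\<^sub>R h) - f (z + 0 *\<^sub>R h)) \<le> B * norm (1 - 0 :: real)"
  proof (rule differentiable_bound[of "{0..1}"])
    show "\<And>s. s \<in> {0..1} \<Longrightarrow> ((\<lambda>s. f (z + s *\<^sub>R h)) has_derivative (\<lambda>r. r *\<^sub>R frechet_derivative f (at (z + s *\<^sub>R h)) h)) (at s within {0..1})"
      using hd by (simp add: has_vector_derivative_def)
    show "\<And>s. s \<in> {0..1} \<Longrightarrow> onorm (\<lambda>r. r *\<^sub>R frechet_derivative f (at (z + s *\<^sub>R h)) h) \<le> B"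
    proof (rule onorm_bound)
      fix s r :: real assume s: "s \<in> {0..1}"
      show "norm (r *\<^sub>R frechet_derivative f (at (z + s *\<^sub>R h)) h) \<le> B * norm r"
        using mult_left_mono[OF B[of s], of "\<bar>r\<bar>"] s by (simp add: mult.commute)
      show "0 \<le> B" using order_trans[OF norm_ge_zero B[of 0]] by simp
    qed
  qed auto
  then show ?thesis by simp
qed

lemma weight_shift:
  fixes z h :: "'a::real_normed_vector"
  assumes "norm h \<le> 1" shows "1 / (1 + norm (z + h)) ^ N \<le> 2 ^ N / (1 + norm z) ^ N"
proof -
  have "norm z \<le> norm (z + h) + norm h" using norm_triangle_ineq4[of "z+h" h] by simp
  then have "1 + norm z \<le> 2 * (1 + norm (z + h))" using assms by (smt (verit) norm_ge_zero)
  then have "(1 + norm z) ^ N \<le> 2 ^ N * (1 + norm (z + h)) ^ N"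
    by (metis power_mult_distrib power_mono add_nonneg_nonneg norm_ge_zero zero_le_one)
  then show ?thesis
    by (simp add: field_simps add_pos_nonneg)
qed

text \<open>Difference quotients integrate to zero by translation invariance, and they converge to
  the derivative under an integrable majorant.\<close>

lemma integral_dd_zero:
  fixes f :: "'a::euclidean_space \<Rightarrow> complex"
  assumes f: "schw f" and d: "d \<in> Basis"
  shows "(\<integral>z. dd d f z \<partial>lborel) = 0"
proof -
  let ?M = "2 * DIM('a)"
  note [measurable] = schw_measurable[OF f] schw_measurable[OF schw_dd[OF f d]]
  \<comment> \<open>Steps of length at most 1, so that \<open>weight_shift\<close> controls the
    decay along the whole segment by the weight at its starting point.\<close>
  define h where "h k = inverse (real (Suc k))" for k
  have h: "0 < h k" "h k \<le> 1" for k by (auto simp: h_def divide_simps)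
  obtain C where C: "C > 0" "\<And>z. cmod (dd d f z) * (1 + norm z) ^ ?M \<le> C" using schwE[OF schw_dd[OF f d]] by metis
  have C': "cmod (dd d f z) \<le> C / (1 + norm z) ^ ?M" for z
    using C(2)[of z] by (simp add: field_simps add_pos_nonneg)
  define q where "q k z = (f (z + h k *\<^sub>R d) - f z) / of_real (h k)" for k z
  have lim: "(\<lambda>k. \<integral>z. q k z \<partial>lborel) \<longlonglongrightarrow> (\<integral>z. dd d f z \<partial>lborel)"
  proof (rule integral_dominated_convergence)
    show "integrable lborel (\<lambda>z::'a. C * 2 ^ ?M * (1 / (1 + norm z) ^ ?M))"
      by (intro integrable_mult_right weight_integrable) simp
    show "AE z in lborel. (\<lambda>k. q k z) \<longlonglongrightarrow> dd d f z"
    proof (intro AE_I2)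
      fix z
      have "((\<lambda>s. f (z + s *\<^sub>R d)) has_vector_derivative dd d f z) (at 0)"
      proof -
        have "((\<lambda>s. z + s *\<^sub>R d) has_derivative (\<lambda>r. r *\<^sub>R d)) (at 0)"
          by (auto intro!: derivative_eq_intros)
        from has_derivative_compose[OF this, of f] differentiableD[OF schw_differentiable[OF f]]
        have "((\<lambda>s. f (z + s *\<^sub>R d)) has_derivative (\<lambda>r. frechet_derivative f (at z) (r *\<^sub>R d))) (at 0)" by simp
        then show ?thesis
          using linear_frechet_derivative[OF schw_differentiable[OF f]]
          by (simp add: has_vector_derivative_def linear_cmul dd_def)
      qed
      then have "((\<lambda>s. (f (z + s *\<^sub>R d) - f z) /\<^sub>R s) \<longlongrightarrow> dd d f z) (at 0)"
        unfolding has_vector_derivative_def has_derivative_at tendsto_dist_iff[of _ "dd d f z"]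
      proof (elim conjE Lim_transform_eventually)
        have "norm (f (z + (0 + s) *\<^sub>R d) - f (z + 0 *\<^sub>R d) - s *\<^sub>R dd d f z) / norm s =
           dist ((f (z + s *\<^sub>R d) - f z) /\<^sub>R s) (dd d f z)" if "s \<noteq> 0" for s
        proof -
          have "(f (z + s *\<^sub>R d) - f z) /\<^sub>R s - dd d f z = inverse s *\<^sub>R (f (z + s *\<^sub>R d) - f z - s *\<^sub>R dd d f z)"
            using that by (simp add: scaleR_diff_right)
          then show ?thesis using that by (simp add: dist_norm divide_inverse mult.commute)
        qed
        then show "\<forall>\<^sub>F s in at 0. norm (f (z + (0 + s) *\<^sub>R d) - f (z + 0 *\<^sub>R d) - s *\<^sub>R dd d f z) / norm s =
           dist ((f (z + s *\<^sub>R d) - f z) /\<^sub>R s) (dd d f z)"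
          by (auto simp: eventually_at intro!: exI[of _ 1])
      qed
      moreover have "filterlim h (at 0) sequentially"
        using h LIMSEQ_inverse_real_of_nat by (auto simp: filterlim_at h_def[abs_def])
      ultimately have "(\<lambda>k. (f (z + h k *\<^sub>R d) - f z) /\<^sub>R h k) \<longlonglongrightarrow> dd d f z"
        by (rule filterlim_compose)
      then show "(\<lambda>k. q k z) \<longlonglongrightarrow> dd d f z"
        by (simp add: q_def scaleR_conv_of_real divide_inverse mult.commute)
    qed
    show "AE z in lborel. norm (q k z) \<le> C * 2 ^ ?M * (1 / (1 + norm z) ^ ?M)" for k
    proof (intro AE_I2)
      fix z
      have "cmod (f (z + h k *\<^sub>R d) - f z) \<le> h k * (C * 2 ^ ?M * (1 / (1 + norm z) ^ ?M))"
      proof (rule differentiable_increment[OF schw_differentiable[OF f]])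
        fix s :: real assume s: "0 \<le> s" "s \<le> 1"
        let ?y = "z + s *\<^sub>R h k *\<^sub>R d"
        have "norm (s *\<^sub>R h k *\<^sub>R d) \<le> 1" using s h[of k] d by (simp add: mult_le_one)
        from weight_shift[OF this, of z ?M]
        have "C * (1 / (1 + norm ?y) ^ ?M) \<le> C * (2 ^ ?M / (1 + norm z) ^ ?M)"
          using C(1) by (intro mult_left_mono) auto
        then have "cmod (dd d f ?y) \<le> C * (2 ^ ?M / (1 + norm z) ^ ?M)"
          using C'[of ?y] by simp
        moreover have "frechet_derivative f (at ?y) (h k *\<^sub>R d) = h k *\<^sub>R dd d f ?y"
          using linear_frechet_derivative[OF schw_differentiable[OF f]] by (simp add: linear_cmul dd_def)
        ultimately show "cmod (frechet_derivative f (at ?y) (h k *\<^sub>R d)) \<le> h k * (C * 2 ^ ?M * (1 / (1 + norm z) ^ ?M))"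
          using h[of k] mult_left_mono[of "cmod (dd d f ?y)" "C * (2 ^ ?M / (1 + norm z) ^ ?M)" "h k"] by simp
      qed
      then show "norm (q k z) \<le> C * 2 ^ ?M * (1 / (1 + norm z) ^ ?M)"
        using h[of k] by (simp add: q_def norm_divide pos_divide_le_eq mult.commute)
    qed
  qed (auto simp: q_def)
  have "(\<integral>z. q k z \<partial>lborel) = 0" for k
  proof -
    have i: "integrable lborel (\<lambda>z. f (z + h k *\<^sub>R d))"
      using lborel_integrable_affine[OF schw_integrable[OF f], of 1 "h k *\<^sub>R d"] by (simp add: add.commute)
    have "(\<integral>z. q k z \<partial>lborel) = ((\<integral>z. f (z + h k *\<^sub>R d) \<partial>lborel) - (\<integral>z. f z \<partial>lborel)) / of_real (h k)"
      unfolding q_def by (simp add: Bochner_Integration.integral_diff[OF i schw_integrable[OF f]])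
    then show ?thesis by (simp add: lborel_integral_shift)
  qed
  then show ?thesis using lim by (simp add: LIMSEQ_const_iff)
qed

subsection \<open>The Fourier transform on Schwartz functions\<close>

definition ft :: "('a::euclidean_space \<Rightarrow> complex) \<Rightarrow> 'a \<Rightarrow> complex" where
  "ft f \<zeta> = (\<integral>z. cis (- 2 * pi * (z \<bullet> \<zeta>)) * f z \<partial>lborel)"

lemma fourier_eq_ft: "fourier = ft"
  by (intro ext) (simp add: fourier_def ft_def)

lemma cis_has_derivative:
  "((\<lambda>z::'a::euclidean_space. cis (c * (z \<bullet> \<zeta>))) has_derivative (\<lambda>h. \<i> * of_real (c * (h \<bullet> \<zeta>)) * cis (c * (z \<bullet> \<zeta>)))) (at z)"
proof -
  have "((\<lambda>z. \<i> * of_real (c * (z \<bullet> \<zeta>))) has_derivative (\<lambda>h. \<i> * of_real (c * (h \<bullet> \<zeta>)))) (at z)"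
    by (intro derivative_eq_intros) auto
  from has_derivative_compose[OF this, of exp "\<lambda>h. exp (\<i> * of_real (c * (z \<bullet> \<zeta>))) * h"]
  have "((\<lambda>z. exp (\<i> * of_real (c * (z \<bullet> \<zeta>)))) has_derivative (\<lambda>h. exp (\<i> * of_real (c * (z \<bullet> \<zeta>))) * (\<i> * of_real (c * (h \<bullet> \<zeta>))))) (at z)"
    using DERIV_exp[of "\<i> * of_real (c * (z \<bullet> \<zeta>))"] by (simp add: has_field_derivative_def)
  then show ?thesis by (simp add: cis_conv_exp mult.commute)
qed

lemma smtemp_cis: "smtemp (\<lambda>z::'a::euclidean_space. cis (c * (z \<bullet> \<zeta>)))"
proof -
  define e where "e k z = k * cis (c * (z \<bullet> \<zeta>))" for k and z :: 'a
  have hd: "(e k has_derivative (\<lambda>h. e (k * \<i> * of_real (c * (h \<bullet> \<zeta>))) z)) (at z)" for k z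
    unfolding e_def using has_derivative_mult_right[OF cis_has_derivative[of c \<zeta> z], of k] by (simp add: mult_ac)
  then have d: "dd d (e k) = e (k * \<i> * of_real (c * (d \<bullet> \<zeta>)))" for d k
    using dd_eq by blast
  have t: "tempered (e k)" for k
    unfolding tempered_def e_def by (intro exI[of _ 0] exI[of _ "cmod k"]) (auto simp: norm_mult)
  have "diff_cls tempered n (e k)" for n k
    by (induction n arbitrary: k) (use hd in \<open>auto simp: d t differentiable_def\<close>)
  then have "smtemp (e 1)" unfolding smtemp_def by blast
  then show ?thesis by (simp add: e_def[abs_def])
qed

lemma cis_measurable [measurable]: "f \<in> borel_measurable M \<Longrightarrow> (\<lambda>x. cis (f x)) \<in> borel_measurable M"
  unfolding cis_conv_exp by measurable

lemma ft_integrand_integrable: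
  "integrable lborel f \<Longrightarrow> integrable lborel (\<lambda>z::'a::euclidean_space. cis (c * (z \<bullet> \<zeta>)) * f z)"
  by (rule Bochner_Integration.integrable_bound[where f=f]) (auto simp: norm_mult)

lemma ft_bound: "cmod (ft f \<zeta>) \<le> (\<integral>z. cmod (f z) \<partial>lborel)"
proof -
  have "cmod (ft f \<zeta>) \<le> (\<integral>z. cmod (cis (- 2 * pi * (z \<bullet> \<zeta>)) * f z) \<partial>lborel)"
    unfolding ft_def by (rule integral_norm_bound)
  then show ?thesis by (simp add: norm_mult)
qed

lemma ft_add: "integrable lborel f \<Longrightarrow> integrable lborel g \<Longrightarrow> ft (\<lambda>z. f z + g z) \<zeta> = ft f \<zeta> + ft g \<zeta>"
  unfolding ft_def using ft_integrand_integrable[of f "-2*pi" \<zeta>] ft_integrand_integrable[of g "-2*pi" \<zeta>]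
  by (simp add: distrib_left)

lemma ft_cmult: "ft (\<lambda>z. c * f z) \<zeta> = c * ft f \<zeta>"
  unfolding ft_def by (simp add: mult.left_commute)

lemma ft_diff: "integrable lborel f \<Longrightarrow> integrable lborel g \<Longrightarrow> ft (\<lambda>z. f z - g z) \<zeta> = ft f \<zeta> - ft g \<zeta>"
  using ft_add[of f "\<lambda>z. -1 * g z"] ft_cmult[of "-1" g \<zeta>] by simp

lemma ft_sum: "finite I \<Longrightarrow> (\<And>i. i \<in> I \<Longrightarrow> integrable lborel (f i)) \<Longrightarrow> ft (\<lambda>z. \<Sum>i\<in>I. f i z) \<zeta> = (\<Sum>i\<in>I. ft (f i) \<zeta>)"
proof (induction rule: finite_induct)
  case empty
  then show ?case by (simp add: ft_def)
next
  case (insert x F)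
  then show ?case by (simp add: ft_add)
qed

text \<open>Integration by parts: the character times f is still Schwartz, so its derivative
  integrates to zero.\<close>

lemma ft_dd:
  assumes f: "schw f" and d: "d \<in> Basis"
  shows "ft (dd d f) \<zeta> = 2 * pi * \<i> * of_real (\<zeta> \<bullet> d) * ft f \<zeta>"
proof -
  define e where "e z = cis (- 2 * pi * (z \<bullet> \<zeta>))" for z
  have e: "smtemp e" unfolding e_def using smtemp_cis[of "-2*pi" \<zeta>] by simp
  have de: "dd d e = (\<lambda>z. - 2 * pi * \<i> * of_real (\<zeta> \<bullet> d) * e z)"
    unfolding e_def using dd_eq[OF cis_has_derivative[of "-2*pi" \<zeta>]] by (auto simp: inner_commute)
  have "dd d (\<lambda>z. e z * f z) = (\<lambda>z. e z * dd d f z + dd d e z * f z)"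
    by (rule dd_mult) (use e f smtemp_differentiable schw_differentiable in auto)
  moreover have "(\<integral>z. dd d (\<lambda>z. e z * f z) z \<partial>lborel) = 0"
    by (intro integral_dd_zero smtemp_mult_schw e f d)
  moreover have "integrable lborel (\<lambda>z. e z * dd d f z)" "integrable lborel (\<lambda>z. e z * f z)"
    by (intro schw_integrable smtemp_mult_schw e f d schw_dd)+
  ultimately have "(\<integral>z. e z * dd d f z \<partial>lborel) = 2 * pi * \<i> * of_real (\<zeta> \<bullet> d) * (\<integral>z. e z * f z \<partial>lborel)"
    by (simp add: de mult.assoc eq_neg_iff_add_eq_0)
  then show ?thesis by (simp add: ft_def e_def)
qed

lemma cis_taylor1: "cmod (cis x - 1 - \<i> * of_real x) \<le> x\<^sup>2"
  using iexp_approx1[of x 1] by (simp add: cis_conv_exp diff_diff_eq power2_eq_square) (smt (verit) zero_le_square)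

text \<open>The second-order Taylor remainder of the character, integrated against f, is at most
  \<open>K\<close> |h|^2, where \<open>K\<close> is a second moment of f and does not depend on the
  point.\<close>

lemma ft_has_derivative:
  fixes f :: "'a::euclidean_space \<Rightarrow> complex"
  assumes f: "schw f"
  shows "(ft f has_derivative (\<lambda>h. ft (\<lambda>z. - 2 * pi * \<i> * of_real (z \<bullet> h) * f z) \<zeta>)) (at \<zeta>)"
proof -
  note [measurable] = schw_measurable[OF f]
  have s: "schw (\<lambda>z. - 2 * pi * \<i> * of_real (z \<bullet> h) * f z)" for h
    using smtemp_mult_schw[OF smtemp_mult[OF smtemp_const smtemp_linear] f, of "\<lambda>z. z \<bullet> h" "- 2 * pi * \<i>"]
    by (simp add: bounded_linear_inner_left)
  define K where "K = 4 * pi\<^sup>2 * (\<integral>z. cmod (f z) * (1 + norm z) ^ 2 \<partial>lborel)"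
  have K: "K \<ge> 0" unfolding K_def by (intro mult_nonneg_nonneg Bochner_Integration.integral_nonneg) auto
  have "linear (\<lambda>h. ft (\<lambda>z. - 2 * pi * \<i> * of_real (z \<bullet> h) * f z) \<zeta>)"
  proof (rule linearI)
    fix g h
    have "(\<lambda>z. - 2 * pi * \<i> * of_real (z \<bullet> (g + h)) * f z) = (\<lambda>z. - 2 * pi * \<i> * of_real (z \<bullet> g) * f z + - 2 * pi * \<i> * of_real (z \<bullet> h) * f z)"
      by (simp add: inner_add_right algebra_simps)
    then show "ft (\<lambda>z. - 2 * pi * \<i> * of_real (z \<bullet> (g + h)) * f z) \<zeta> =
      ft (\<lambda>z. - 2 * pi * \<i> * of_real (z \<bullet> g) * f z) \<zeta> + ft (\<lambda>z. - 2 * pi * \<i> * of_real (z \<bullet> h) * f z) \<zeta>"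
      using ft_add[OF schw_integrable[OF s[of g]] schw_integrable[OF s[of h]]] by simp
  next
    fix r h
    show "ft (\<lambda>z. - 2 * pi * \<i> * of_real (z \<bullet> (r *\<^sub>R h)) * f z) \<zeta> = r *\<^sub>R ft (\<lambda>z. - 2 * pi * \<i> * of_real (z \<bullet> h) * f z) \<zeta>"
      using ft_cmult[of "of_real r" "\<lambda>z. - 2 * pi * \<i> * of_real (z \<bullet> h) * f z"] by (simp add: scaleR_conv_of_real mult_ac)
  qed
  then have bl: "bounded_linear (\<lambda>h. ft (\<lambda>z. - 2 * pi * \<i> * of_real (z \<bullet> h) * f z) \<zeta>)"
    by (rule linear_conv_bounded_linear[THEN iffD1])
  have est: "cmod (ft f (\<zeta> + h) - ft f \<zeta> - ft (\<lambda>z. - 2 * pi * \<i> * of_real (z \<bullet> h) * f z) \<zeta>) \<le> K * (norm h)\<^sup>2" for h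
  proof -
    let ?g = "\<lambda>z. cis (- 2 * pi * (z \<bullet> (\<zeta> + h))) * f z - cis (- 2 * pi * (z \<bullet> \<zeta>)) * f z
        - cis (- 2 * pi * (z \<bullet> \<zeta>)) * (- 2 * pi * \<i> * of_real (z \<bullet> h) * f z)"
    have i: "integrable lborel (\<lambda>z. cis (- 2 * pi * (z \<bullet> \<eta>)) * g z)" if "schw g" for \<eta> g
      using ft_integrand_integrable[OF schw_integrable[OF that], of "-2*pi"] by simp
    have eq: "ft f (\<zeta> + h) - ft f \<zeta> - ft (\<lambda>z. - 2 * pi * \<i> * of_real (z \<bullet> h) * f z) \<zeta> = (\<integral>z. ?g z \<partial>lborel)"
      unfolding ft_def using i[OF f] i[OF s] by (simp only: Bochner_Integration.integral_diff Bochner_Integration.integrable_diff)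
    have "cmod (?g z) \<le> 4 * pi\<^sup>2 * (norm h)\<^sup>2 * (cmod (f z) * (1 + norm z) ^ 2)" for z
    proof -
      let ?x = "- 2 * pi * (z \<bullet> h)"
      have "cis (- 2 * pi * (z \<bullet> (\<zeta> + h))) = cis (- 2 * pi * (z \<bullet> \<zeta>)) * cis ?x"
        by (simp add: cis_mult inner_add_right algebra_simps)
      then have "?g z = cis (- 2 * pi * (z \<bullet> \<zeta>)) * (cis ?x - 1 - \<i> * of_real ?x) * f z"
        by (simp add: algebra_simps)
      then have "cmod (?g z) \<le> ?x\<^sup>2 * cmod (f z)"
        using cis_taylor1[of ?x] by (simp add: norm_mult mult_right_mono)
      also have "?x\<^sup>2 = 4 * pi\<^sup>2 * \<bar>z \<bullet> h\<bar>\<^sup>2" by (simp add: power_mult_distrib)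
      also have "\<bar>z \<bullet> h\<bar>\<^sup>2 \<le> (norm z * norm h)\<^sup>2" by (intro power_mono Cauchy_Schwarz_ineq2) auto
      also have "(norm z * norm h)\<^sup>2 \<le> (1 + norm z)\<^sup>2 * (norm h)\<^sup>2"
        by (simp add: power_mult_distrib mult_right_mono power_mono)
      finally show ?thesis by (simp add: mult_left_mono mult_right_mono mult_ac)
    qed
    then have "cmod (\<integral>z. ?g z \<partial>lborel) \<le> (\<integral>z. 4 * pi\<^sup>2 * (norm h)\<^sup>2 * (cmod (f z) * (1 + norm z) ^ 2) \<partial>lborel)"
      using Bochner_Integration.integrable_diff[OF Bochner_Integration.integrable_diff[OF i[OF f, of "\<zeta> + h"] i[OF f, of \<zeta>]] i[OF s, of \<zeta> h]]
        integrable_mult_right[OF schw_integrable_weight[OF f, of 2], of "4 * pi\<^sup>2 * (norm h)\<^sup>2"]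
      by (intro Bochner_Integration.integral_norm_bound_integral; simp)
    then have "cmod (\<integral>z. ?g z \<partial>lborel) \<le> 4 * pi\<^sup>2 * (norm h)\<^sup>2 * (\<integral>z. cmod (f z) * (1 + norm z) ^ 2 \<partial>lborel)"
      by (simp only: integral_mult_right_zero)
    also have "\<dots> = K * (norm h)\<^sup>2" by (simp add: K_def)
    finally show ?thesis unfolding eq .
  qed
  show ?thesis
    unfolding has_derivative_at_alt
  proof (intro conjI bl allI impI)
    fix e :: real assume e: "e > 0"
    show "\<exists>d>0. \<forall>y. norm (y - \<zeta>) < d \<longrightarrow> norm (ft f y - ft f \<zeta> - ft (\<lambda>z. - 2 * pi * \<i> * of_real (z \<bullet> (y - \<zeta>)) * f z) \<zeta>) \<le> e * norm (y - \<zeta>)"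
    proof (intro exI[of _ "e / (K + 1)"] conjI allI impI)
      show "0 < e / (K + 1)" using e K by simp
      fix y assume y: "norm (y - \<zeta>) < e / (K + 1)"
      have "norm (ft f y - ft f \<zeta> - ft (\<lambda>z. - 2 * pi * \<i> * of_real (z \<bullet> (y - \<zeta>)) * f z) \<zeta>) \<le> K * norm (y - \<zeta>) * norm (y - \<zeta>)"
        using est[of "y - \<zeta>"] by (simp add: power2_eq_square)
      also have "\<dots> \<le> e * norm (y - \<zeta>)"
      proof (intro mult_right_mono)
        have "(K + 1) * norm (y - \<zeta>) < e" using y K by (simp add: field_simps)
        then show "K * norm (y - \<zeta>) \<le> e" by (simp add: distrib_right) (smt (verit) norm_ge_zero)
      qed auto
      finally show "norm (ft f y - ft f \<zeta> - ft (\<lambda>z. - 2 * pi * \<i> * of_real (z \<bullet> (y - \<zeta>)) * f z) \<zeta>) \<le> e * norm (y - \<zeta>)" .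
    qed
  qed
qed

lemma schw_mult_inner: "schw f \<Longrightarrow> schw (\<lambda>z. c * of_real (z \<bullet> h) * f z)"
  using smtemp_mult_schw[OF smtemp_mult[OF smtemp_const smtemp_linear], of "\<lambda>z. z \<bullet> h" f c]
  by (simp add: bounded_linear_inner_left)

lemma dd_ft: "schw f \<Longrightarrow> dd d (ft f) = ft (\<lambda>z. - 2 * pi * \<i> * of_real (z \<bullet> d) * f z)"
  using dd_eq[OF ft_has_derivative] by blast

lemma rapid_ft:
  fixes f :: "'a::euclidean_space \<Rightarrow> complex"
  assumes "schw f" shows "rapid (ft f)"
  unfolding rapid_def
proof
  fix N
  show "\<exists>C. \<forall>\<zeta>. cmod (ft f \<zeta>) * (1 + norm \<zeta>) ^ N \<le> C"
    using assms
  proof (induction N arbitrary: f)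
    case 0
    then show ?case using ft_bound[of f] by auto
  next
    case (Suc N)
    obtain C where C: "\<And>\<zeta>. cmod (ft f \<zeta>) * (1 + norm \<zeta>) ^ N \<le> C" using Suc by blast
    have "\<forall>b\<in>Basis. \<exists>D. \<forall>\<zeta>. cmod (ft (dd b f) \<zeta>) * (1 + norm \<zeta>) ^ N \<le> D" using Suc schw_dd by blast
    then obtain D where D: "\<And>b \<zeta>. b \<in> Basis \<Longrightarrow> cmod (ft (dd b f) \<zeta>) * (1 + norm \<zeta>) ^ N \<le> D b" by metis
    have "cmod (ft f \<zeta>) * (1 + norm \<zeta>) ^ Suc N \<le> C + (\<Sum>b\<in>Basis. D b)" for \<zeta>
    proof -
      have b: "cmod (ft f \<zeta>) * \<bar>\<zeta> \<bullet> b\<bar> \<le> cmod (ft (dd b f) \<zeta>)" if "b \<in> Basis" for b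
      proof -
        have "1 * (\<bar>\<zeta> \<bullet> b\<bar> * cmod (ft f \<zeta>)) \<le> 2 * pi * (\<bar>\<zeta> \<bullet> b\<bar> * cmod (ft f \<zeta>))"
          using pi_gt3 by (intro mult_right_mono) auto
        then show ?thesis using that Suc.prems by (simp add: ft_dd norm_mult mult_ac)
      qed
      have "cmod (ft f \<zeta>) * (1 + norm \<zeta>) \<le> cmod (ft f \<zeta>) * (1 + (\<Sum>b\<in>Basis. \<bar>\<zeta> \<bullet> b\<bar>))"
        using norm_le_l1[of \<zeta>] by (intro mult_left_mono) auto
      also have "\<dots> \<le> cmod (ft f \<zeta>) + (\<Sum>b\<in>Basis. cmod (ft (dd b f) \<zeta>))"
        unfolding distrib_left sum_distrib_left using b by (auto intro!: sum_mono)
      finally have "cmod (ft f \<zeta>) * (1 + norm \<zeta>) * (1 + norm \<zeta>) ^ N \<le> (cmod (ft f \<zeta>) + (\<Sum>b\<in>Basis. cmod (ft (dd b f) \<zeta>))) * (1 + norm \<zeta>) ^ N"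
        by (intro mult_right_mono) auto
      also have "\<dots> \<le> C + (\<Sum>b\<in>Basis. D b)"
        unfolding distrib_right sum_distrib_right by (intro add_mono C sum_mono D)
      finally show ?thesis by (simp add: mult_ac)
    qed
    then show ?case by blast
  qed
qed

lemma schw_ft: "schw f \<Longrightarrow> schw (ft f)"
proof -
  have "diff_cls rapid n (ft f)" if "schw f" for n and f :: "'a \<Rightarrow> complex"
    using that
  proof (induction n arbitrary: f)
    case (Suc n)
    then show ?case
      using ft_has_derivative[OF Suc.prems] schw_mult_inner[OF Suc.prems, of "- 2 * pi * \<i>"]
      by (auto simp: rapid_ft dd_ft differentiable_def intro!: Suc.IH)
  qed (simp add: rapid_ft)
  then show "schw f \<Longrightarrow> schw (ft f)" unfolding schw_def[of "ft f"] by blast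
qed

subsection \<open>Fourier inversion\<close>

text \<open>A rescaling of the characteristic function of the standard normal distribution: the
  dilation by r = sqrt(2 pi) turns exp(-x^2/2) into exp(-pi x^2).\<close>

lemma gauss_integral_real:
  shows "(\<integral>x. cis (- 2 * pi * (x * s)) * complex_of_real (exp (- pi * x\<^sup>2)) \<partial>lborel) = complex_of_real (exp (- pi * s\<^sup>2))"
    and "integrable lborel (\<lambda>x. cis (- 2 * pi * (x * s)) * complex_of_real (exp (- pi * x\<^sup>2)))"
proof -
  define r where "r = sqrt (2 * pi)"
  have r: "r > 0" "r * r = 2 * pi" by (auto simp: r_def)
  define f where "f x = std_normal_density x *\<^sub>R iexp (- r * s * x)" for x
  have [measurable]: "f \<in> borel_measurable borel" unfolding f_def by measurable
  have i: "integrable lborel f"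
    by (rule Bochner_Integration.integrable_bound[where f=std_normal_density])
       (auto simp: f_def normal_density_nonneg)
  have "complex_of_real (exp (- ((- r * s)\<^sup>2 / 2))) = char std_normal_distribution (- r * s)"
    by (simp add: char_std_normal_distribution)
  also have "\<dots> = (\<integral>x. f x \<partial>lborel)"
    unfolding char_def f_def by (subst integral_density) (auto simp: normal_density_nonneg)
  also have "\<dots> = r *\<^sub>R (\<integral>x. f (r * x) \<partial>lborel)"
    using lborel_integral_affine[of f r 0] r by simp
  also have "(\<lambda>x. f (r * x)) = (\<lambda>x. (1 / r) *\<^sub>R (cis (- 2 * pi * (x * s)) * complex_of_real (exp (- pi * x\<^sup>2))))"
  proof
    fix x
    have "- r * s * (r * x) = - 2 * pi * (x * s)" "(r * x)\<^sup>2 / 2 = pi * x\<^sup>2"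
      using r by (auto simp: power2_eq_square algebra_simps)
    then show "f (r * x) = (1 / r) *\<^sub>R (cis (- 2 * pi * (x * s)) * complex_of_real (exp (- pi * x\<^sup>2)))"
      unfolding f_def std_normal_density_def cis_conv_exp by (simp add: r_def scaleR_conv_of_real mult_ac)
  qed
  finally have "complex_of_real (exp (- ((- r * s)\<^sup>2 / 2))) = (\<integral>x. cis (- 2 * pi * (x * s)) * complex_of_real (exp (- pi * x\<^sup>2)) \<partial>lborel)"
    using r by (simp only: integral_scaleR_right) simp
  moreover have "(- r * s)\<^sup>2 / 2 = pi * s\<^sup>2"
    using r by (simp add: power_mult_distrib power2_eq_square)
  ultimately show "(\<integral>x. cis (- 2 * pi * (x * s)) * complex_of_real (exp (- pi * x\<^sup>2)) \<partial>lborel) = complex_of_real (exp (- pi * s\<^sup>2))"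
    by simp
  have "integrable lborel (\<lambda>x. r *\<^sub>R f (r * x))"
    using lborel_integrable_affine[OF i, of r 0] r by simp
  then show "integrable lborel (\<lambda>x. cis (- 2 * pi * (x * s)) * complex_of_real (exp (- pi * x\<^sup>2)))"
    using r by (simp add: \<open>(\<lambda>x. f (r * x)) = _\<close>[THEN fun_cong])
qed

definition gauss :: "'a::euclidean_space \<Rightarrow> complex" where
  "gauss z = complex_of_real (exp (- pi * (norm z)\<^sup>2))"

lemma gauss_prod: "gauss z = (\<Prod>b\<in>Basis. complex_of_real (exp (- pi * (z \<bullet> b)\<^sup>2)))"
proof -
  have "(norm z)\<^sup>2 = (\<Sum>b\<in>Basis. (z \<bullet> b)\<^sup>2)"
    unfolding power2_norm_eq_inner by (subst euclidean_inner) (simp add: power2_eq_square)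
  then have "- pi * (norm z)\<^sup>2 = (\<Sum>b\<in>Basis. - pi * (z \<bullet> b)\<^sup>2)" by (simp add: sum_distrib_left sum_negf)
  then show ?thesis unfolding gauss_def by (simp only: exp_sum finite_Basis of_real_prod)
qed

lemma gauss_measurable [measurable]: "gauss \<in> borel_measurable borel"
  unfolding gauss_def by measurable

lemma gauss_integrable: "integrable lborel gauss"
  unfolding gauss_prod using gauss_integral_real(2)[of 0]
  by (intro lborel_integral_prod_Basis(2)) simp

lemma ft_gauss: "ft gauss = gauss"
proof
  fix \<zeta> :: 'a
  have "cis (- 2 * pi * (z \<bullet> \<zeta>)) * gauss z = (\<Prod>b\<in>Basis. cis (- 2 * pi * ((z \<bullet> b) * (\<zeta> \<bullet> b))) * complex_of_real (exp (- pi * (z \<bullet> b)\<^sup>2)))" for z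
  proof -
    have "cis (- 2 * pi * (z \<bullet> \<zeta>)) = (\<Prod>b\<in>Basis. cis (- 2 * pi * ((z \<bullet> b) * (\<zeta> \<bullet> b))))"
      unfolding cis_conv_exp exp_sum[OF finite_Basis, symmetric]
      by (subst euclidean_inner) (simp add: sum_distrib_left of_real_sum)
    then show ?thesis by (simp only: gauss_prod prod.distrib)
  qed
  then show "ft gauss \<zeta> = gauss \<zeta>"
    unfolding ft_def by (simp only: lborel_integral_prod_Basis(1)[OF gauss_integral_real(2)] gauss_integral_real(1) gauss_prod)
qed

section \<open>Multiplication formula, inversion and the convolution theorem\<close>

lemma integrable_pair_prod:
  fixes f :: "'a::euclidean_space \<Rightarrow> complex" and g :: "'b::euclidean_space \<Rightarrow> complex"
  assumes f: "integrable lborel f" and g: "integrable lborel g"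
    and [measurable]: "case_prod h \<in> borel_measurable borel" and h: "\<And>x y. cmod (h x y) \<le> 1"
  shows "integrable (lborel \<Otimes>\<^sub>M lborel) (\<lambda>(x,y). h x y * f x * g y)"
proof -
  have [measurable]: "f \<in> borel_measurable borel" "g \<in> borel_measurable borel" using f g by auto
  have "case_prod h \<in> borel_measurable (borel \<Otimes>\<^sub>M borel)"
    by (simp add: borel_prod)
  then have [measurable]: "(\<lambda>p. h (fst p) (snd p)) \<in> borel_measurable (borel \<Otimes>\<^sub>M borel)"
    by (simp add: case_prod_beta')
  have i: "integrable (lborel \<Otimes>\<^sub>M lborel) (\<lambda>(x,y). f x * g y)"
  proof (rule lborel_pair.Fubini_integrable)
    show "AE x in lborel. integrable lborel (\<lambda>y. case (x, y) of (x, y) \<Rightarrow> f x * g y)"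
      using g by simp
    have "integrable lborel (\<lambda>x. cmod (f x) * (\<integral>y. cmod (g y) \<partial>lborel))" using f by simp
    then show "integrable lborel (\<lambda>x. \<integral>y. norm (case (x, y) of (x, y) \<Rightarrow> f x * g y) \<partial>lborel)"
      by (simp add: norm_mult)
  qed (simp add: case_prod_beta')
  show ?thesis
    by (rule Bochner_Integration.integrable_bound[OF i])
       (use h in \<open>auto simp: norm_mult case_prod_beta' mult.assoc intro!: mult_left_le_one_le\<close>)
qed

lemma cis_inner_measurable: "case_prod (\<lambda>x y. cis (c * (x \<bullet> y))) \<in> borel_measurable borel"
  unfolding case_prod_beta' by (intro borel_measurable_continuous_onI continuous_intros)

lemma ft_multiplication:
  fixes f g :: "'a::euclidean_space \<Rightarrow> complex"
  assumes f: "integrable lborel f" and g: "integrable lborel g"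
  shows "(\<integral>x. ft f x * g x \<partial>lborel) = (\<integral>x. f x * ft g x \<partial>lborel)"
proof -
  have "integrable (lborel \<Otimes>\<^sub>M lborel) (\<lambda>(x,y). cis (-2 * pi * (x \<bullet> y)) * f x * g y)"
    by (rule integrable_pair_prod[OF f g cis_inner_measurable]) simp
  from lborel_pair.Fubini_integral[OF this]
  show ?thesis by (simp add: ft_def inner_commute mult_ac flip: integral_mult_left_zero integral_mult_right_zero)
qed

text \<open>Gaussian regularisation. The multiplication formula rewrites the integral of
  \<open>ft f\<close> against a flattened Gaussian as a Gaussian average of f around z at scale
  \<open>e k\<close>; both sides then converge dominatedly. The hypotheses stay below the Schwartz
  class because \<open>partial_inversion\<close> uses the theorem for a partial transform.\<close>

theorem ft_inversion:
  fixes f :: "'a::euclidean_space \<Rightarrow> complex"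
  assumes f: "integrable lborel f" and c: "continuous_on UNIV f" and M: "\<And>z. cmod (f z) \<le> M"
    and ff: "integrable lborel (ft f)"
  shows "ft (ft f) (- z) = f z"
proof -
  have [measurable]: "f \<in> borel_measurable borel" "ft f \<in> borel_measurable borel" using f ff by auto
  define e where "e k = inverse (real (Suc k))" for k
  have e: "e k > 0" for k by (simp add: e_def)
  have elim: "e \<longlonglongrightarrow> 0" using LIMSEQ_inverse_real_of_nat by (simp add: e_def[abs_def])
  \<comment> \<open>The modulation moves the approximate identity \<open>ft (g k)\<close> to the
    point z.\<close>
  define g where "g k \<zeta> = cis (2 * pi * (z \<bullet> \<zeta>)) * gauss (e k *\<^sub>R \<zeta>)" for k \<zeta>
  have gi: "integrable lborel (\<lambda>\<zeta>::'a. gauss (e k *\<^sub>R \<zeta>))" for k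
    using lborel_integrable_affine[OF gauss_integrable, of "e k" 0] e[of k] by simp
  have g: "integrable lborel (g k)" for k
    unfolding g_def using ft_integrand_integrable[OF gi, of "2*pi" z] by (simp add: inner_commute)
  have ftg: "ft (g k) y = (1 / e k) ^ DIM('a) *\<^sub>R gauss ((1 / e k) *\<^sub>R (y - z))" for k y
  proof -
    let ?h = "\<lambda>\<zeta>. cis (- 2 * pi * (\<zeta> \<bullet> (y - z))) * gauss (e k *\<^sub>R \<zeta>)"
    have "ft (g k) y = (\<integral>\<zeta>. ?h \<zeta> \<partial>lborel)"
      unfolding ft_def g_def mult.assoc[symmetric] cis_mult
      by (intro Bochner_Integration.integral_cong refl) (simp add: inner_diff_right inner_commute algebra_simps)
    also have "\<dots> = (1 / e k) ^ DIM('a) *\<^sub>R (\<integral>\<zeta>. ?h (0 + (1 / e k) *\<^sub>R \<zeta>) \<partial>lborel)"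
      using e[of k] by (subst lborel_integral_affine[of _ "1 / e k" 0]) auto
    also have "(\<integral>\<zeta>. ?h (0 + (1 / e k) *\<^sub>R \<zeta>) \<partial>lborel) = ft gauss ((1 / e k) *\<^sub>R (y - z))"
      unfolding ft_def using e[of k] by (simp add: less_imp_neq[symmetric])
    finally show ?thesis by (simp add: ft_gauss)
  qed
  have A: "(\<integral>x. ft f x * g k x \<partial>lborel) = (\<integral>x. f (z + e k *\<^sub>R x) * gauss x \<partial>lborel)" for k
  proof -
    have "(\<integral>x. ft f x * g k x \<partial>lborel) = (\<integral>x. f x * ft (g k) x \<partial>lborel)" by (rule ft_multiplication[OF f g])
    also have "\<dots> = e k ^ DIM('a) *\<^sub>R (\<integral>x. f (z + e k *\<^sub>R x) * ft (g k) (z + e k *\<^sub>R x) \<partial>lborel)"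
      using e[of k] by (subst lborel_integral_affine[of _ "e k" z]) (auto simp: ftg)
    also have "\<dots> = (\<integral>x. f (z + e k *\<^sub>R x) * gauss x \<partial>lborel)"
      using e[of k] by (simp add: ftg power_one_over less_imp_neq[symmetric] scaleR_conv_of_real)
    finally show ?thesis .
  qed
  \<comment> \<open>Total mass 1 is the self-duality of the Gaussian read at the origin.\<close>
  have g1: "(\<integral>x. gauss x \<partial>(lborel :: 'a measure)) = 1"
    using fun_cong[OF ft_gauss, of "0::'a"] by (simp add: ft_def gauss_def)
  have gb: "cmod (gauss x) \<le> 1" for x :: 'a by (simp add: gauss_def)
  have "(\<lambda>k. \<integral>x. f (z + e k *\<^sub>R x) * gauss x \<partial>lborel) \<longlonglongrightarrow> (\<integral>x. f z * gauss x \<partial>(lborel :: 'a measure))"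
  proof (rule integral_dominated_convergence)
    show "integrable lborel (\<lambda>x::'a. M * cmod (gauss x))"
      by (intro integrable_mult_right integrable_norm gauss_integrable)
    show "AE x in lborel. (\<lambda>k. f (z + e k *\<^sub>R x) * gauss x) \<longlonglongrightarrow> f z * gauss x"
    proof (intro AE_I2 tendsto_mult tendsto_const)
      fix x :: 'a
      have "(\<lambda>k. z + e k *\<^sub>R x) \<longlonglongrightarrow> z + 0 *\<^sub>R x" by (intro tendsto_intros elim)
      moreover have "isCont f z" using c by (simp add: continuous_on_eq_continuous_at)
      ultimately show "(\<lambda>k. f (z + e k *\<^sub>R x)) \<longlonglongrightarrow> f z" using isCont_tendsto_compose[of z f] by auto
    qed
    show "AE x in lborel. norm (f (z + e k *\<^sub>R x) * gauss x) \<le> M * cmod (gauss x)" for k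
      using M by (intro AE_I2) (simp add: norm_mult mult_right_mono)
  qed auto
  then have L1: "(\<lambda>k. \<integral>x. ft f x * g k x \<partial>lborel) \<longlonglongrightarrow> f z" by (simp add: A g1)
  have "(\<lambda>k. \<integral>x. ft f x * g k x \<partial>lborel) \<longlonglongrightarrow> (\<integral>x. ft f x * cis (2 * pi * (z \<bullet> x)) \<partial>lborel)"
  proof (rule integral_dominated_convergence)
    show "integrable lborel (\<lambda>x. cmod (ft f x))" using ff by simp
    show "AE x in lborel. (\<lambda>k. ft f x * g k x) \<longlonglongrightarrow> ft f x * cis (2 * pi * (z \<bullet> x))"
    proof (intro AE_I2 tendsto_mult tendsto_const)
      fix x :: 'a
      have "(\<lambda>k. gauss (e k *\<^sub>R x)) \<longlonglongrightarrow> complex_of_real (exp (- pi * (norm (0 *\<^sub>R x))\<^sup>2))"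
        unfolding gauss_def by (intro tendsto_intros elim)
      from tendsto_mult[OF tendsto_const this, of "cis (2 * pi * (z \<bullet> x))"]
      show "(\<lambda>k. g k x) \<longlonglongrightarrow> cis (2 * pi * (z \<bullet> x))" by (simp add: g_def)
    qed
    show "AE x in lborel. norm (ft f x * g k x) \<le> cmod (ft f x)" for k
      using gb by (intro AE_I2) (simp add: norm_mult g_def mult_left_le)
  qed (auto simp: g_def)
  from LIMSEQ_unique[OF L1 this] show ?thesis
    by (simp add: ft_def inner_commute mult.commute)
qed

lemma schw_inversion: "schw f \<Longrightarrow> ft (ft f) (- z) = f z"
proof -
  assume f: "schw f"
  obtain C where "\<And>z. cmod (f z) * (1 + norm z) ^ 0 \<le> C" using schwE[OF f] by metis
  then show ?thesis
    by (intro ft_inversion[where M=C] schw_integrable schw_ft f schw_continuous) auto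
qed

text \<open>The inversion formula of the Schwartz factor is inserted and the integrals are
  exchanged. The other factor is merely integrable, since it will be \<open>opP\<close> or
  \<open>frac_lap_v\<close> applied to a function.\<close>

lemma ft_mult:
  fixes \<phi> g :: "'a::euclidean_space \<Rightarrow> complex"
  assumes \<phi>: "schw \<phi>" and g: "integrable lborel g"
  shows "ft (\<lambda>z. \<phi> z * g z) \<zeta> = (\<integral>\<theta>. ft \<phi> \<theta> * ft g (\<zeta> - \<theta>) \<partial>lborel)"
proof -
  define k where "k z = cis (- 2 * pi * (z \<bullet> \<zeta>)) * g z" for z
  have k: "integrable lborel k" unfolding k_def using ft_integrand_integrable[OF g, of "-2*pi"] by simp
  have i: "integrable (lborel \<Otimes>\<^sub>M lborel) (\<lambda>(x,y). cis (2 * pi * (x \<bullet> y)) * ft \<phi> x * k y)"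
    by (rule integrable_pair_prod[OF schw_integrable[OF schw_ft[OF \<phi>]] k cis_inner_measurable]) simp
  have "\<phi> y = (\<integral>x. cis (2 * pi * (x \<bullet> y)) * ft \<phi> x \<partial>lborel)" for y
    using schw_inversion[OF \<phi>, of y] by (simp add: ft_def)
  then have "(\<integral>x. cis (2 * pi * (x \<bullet> y)) * ft \<phi> x * k y \<partial>lborel) = \<phi> y * k y" for y
    by (simp only: integral_mult_left_zero)
  moreover have "ft (\<lambda>z. \<phi> z * g z) \<zeta> = (\<integral>y. \<phi> y * k y \<partial>lborel)"
    unfolding ft_def[of "\<lambda>z. \<phi> z * g z"] k_def by (simp only: mult.left_commute)
  ultimately have "ft (\<lambda>z. \<phi> z * g z) \<zeta> = (\<integral>y. (\<integral>x. cis (2 * pi * (x \<bullet> y)) * ft \<phi> x * k y \<partial>lborel) \<partial>lborel)"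
    by (simp only:)
  also have "\<dots> = (\<integral>x. (\<integral>y. cis (2 * pi * (x \<bullet> y)) * ft \<phi> x * k y \<partial>lborel) \<partial>lborel)"
    by (rule lborel_pair.Fubini_integral[OF i])
  also have "\<dots> = (\<integral>\<theta>. ft \<phi> \<theta> * ft g (\<zeta> - \<theta>) \<partial>lborel)"
  proof (intro Bochner_Integration.integral_cong refl)
    fix x
    have "cis (2 * pi * (x \<bullet> y)) * ft \<phi> x * k y = ft \<phi> x * (cis (- 2 * pi * (y \<bullet> (\<zeta> - x))) * g y)" for y
    proof -
      have "cis (2 * pi * (x \<bullet> y)) * cis (- 2 * pi * (y \<bullet> \<zeta>)) = cis (- 2 * pi * (y \<bullet> (\<zeta> - x)))"
        unfolding cis_mult by (simp add: inner_diff_right inner_commute algebra_simps)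
      then show ?thesis by (simp add: k_def mult_ac)
    qed
    then show "(\<integral>y. cis (2 * pi * (x \<bullet> y)) * ft \<phi> x * k y \<partial>lborel) = ft \<phi> x * ft g (\<zeta> - x)"
      by (simp only: integral_mult_right_zero ft_def[of g])
  qed
  finally show ?thesis .
qed

subsection \<open>Smooth functions and linear changes of variables\<close>

text \<open>The trivial predicate turns the recursive class into plain smoothness, so the closure
  lemmas above apply to it as well.\<close>

definition smth :: "('a::euclidean_space \<Rightarrow> complex) \<Rightarrow> bool" where
  "smth f \<longleftrightarrow> (\<forall>n. diff_cls (\<lambda>_. True) n f)"

lemma smth_differentiable: "smth f \<Longrightarrow> f differentiable at x"
  unfolding smth_def by (metis diff_cls.simps(2))

lemma smth_dd: "smth f \<Longrightarrow> d \<in> Basis \<Longrightarrow> smth (dd d f)"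
  unfolding smth_def by (metis diff_cls.simps(2))

lemma smth_add: "smth f \<Longrightarrow> smth g \<Longrightarrow> smth (\<lambda>x. f x + g x)"
  unfolding smth_def by (auto intro!: diff_cls_add)

lemma smth_mult: "smth f \<Longrightarrow> smth g \<Longrightarrow> smth (\<lambda>x. f x * g x)"
  unfolding smth_def by (auto intro!: diff_cls_mult[where ?B1.0="\<lambda>_. True" and ?B2.0="\<lambda>_. True"])

lemma smtemp_smth: "smtemp f \<Longrightarrow> smth f"
  unfolding smtemp_def smth_def using diff_cls_mono[of tempered "\<lambda>_. True"] by blast

lemma schw_smth: "schw f \<Longrightarrow> smth f"
  by (intro smtemp_smth schw_smtemp)

lemma smooth_smth:
  fixes f :: "'a::euclidean_space \<Rightarrow> complex"
  assumes "smooth f" shows "smth f"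
proof -
  have "diff_cls (\<lambda>_. True) n f" for n using assms
    by (induction n arbitrary: f) (auto simp: smooth_differentiable smooth_dd)
  then show ?thesis unfolding smth_def by blast
qed

text \<open>On a closed ball continuity supplies every decay bound, and differentiation does not
  enlarge the ball that contains the support.\<close>

lemma smth_schw:
  assumes "smth f" "\<And>z. f z \<noteq> 0 \<Longrightarrow> norm z \<le> R"
  shows "schw f"
proof -
  have r: "rapid f" if f: "smth f" "\<And>z. f z \<noteq> 0 \<Longrightarrow> norm z \<le> R" for f :: "'a \<Rightarrow> complex"
    unfolding rapid_def
  proof
    fix N
    have c: "continuous_on (cball 0 R) f"
      by (meson continuous_at_imp_continuous_on differentiable_imp_continuous_within smth_differentiable f)
    have "compact ((\<lambda>z. cmod (f z) * (1 + norm z) ^ N) ` cball 0 R)"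
      by (intro compact_continuous_image continuous_intros c compact_cball)
    from compact_imp_bounded[OF this]
    obtain C where C: "\<And>z. z \<in> cball 0 R \<Longrightarrow> \<bar>cmod (f z) * (1 + norm z) ^ N\<bar> \<le> C"
      unfolding bounded_real by blast
    have "cmod (f z) * (1 + norm z) ^ N \<le> \<bar>C\<bar>" for z
    proof (cases "f z = 0")
      case False
      then have "z \<in> cball 0 R" using f(2)[of z] by (simp add: dist_norm)
      then show ?thesis using C[of z] by linarith
    qed auto
    then show "\<exists>C. \<forall>z. cmod (f z) * (1 + norm z) ^ N \<le> C" by blast
  qed
  have "diff_cls rapid n f" for n
    using assms
  proof (induction n arbitrary: f)
    case (Suc n)
    show ?case unfolding diff_cls.simps
    proof (intro conjI allI ballI Suc.IH smth_dd r)
      fix d z assume "d \<in> (Basis :: 'a set)" "dd d f z \<noteq> 0"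
      then show "norm z \<le> R" using dd_supp[of f R z d] Suc.prems by force
    qed (use Suc.prems smth_differentiable in auto)
  qed (simp add: r)
  then show ?thesis unfolding schw_def by blast
qed

lemma dd_affine:
  fixes g :: "'b::euclidean_space \<Rightarrow> complex" and L :: "'a::euclidean_space \<Rightarrow> 'b"
  assumes L: "bounded_linear L" and g: "\<And>x. g differentiable at x"
  shows "(\<lambda>x. g (c + L x)) differentiable at x"
    and "dd d (\<lambda>x. g (c + L x)) = (\<lambda>x. \<Sum>b\<in>Basis. complex_of_real (L d \<bullet> b) * dd b g (c + L x))"
proof -
  have hd: "((\<lambda>x. g (c + L x)) has_derivative (\<lambda>h. frechet_derivative g (at (c + L x)) (L h))) (at x)" for x
  proof -
    have "((\<lambda>x. c + L x) has_derivative L) (at x)"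
      using has_derivative_add[OF has_derivative_const bounded_linear_imp_has_derivative[OF L], of c] by simp
    from has_derivative_compose[OF this differentiableD[OF g]] show ?thesis .
  qed
  then show "(\<lambda>x. g (c + L x)) differentiable at x" unfolding differentiable_def by blast
  show "dd d (\<lambda>x. g (c + L x)) = (\<lambda>x. \<Sum>b\<in>Basis. complex_of_real (L d \<bullet> b) * dd b g (c + L x))"
  proof
    fix x
    interpret l: linear "frechet_derivative g (at (c + L x))" by (rule linear_frechet_derivative[OF g])
    have "frechet_derivative g (at (c + L x)) (L d) = frechet_derivative g (at (c + L x)) (\<Sum>b\<in>Basis. (L d \<bullet> b) *\<^sub>R b)"
      by (simp add: euclidean_representation)
    also have "\<dots> = (\<Sum>b\<in>Basis. (L d \<bullet> b) *\<^sub>R frechet_derivative g (at (c + L x)) b)"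
      by (simp add: l.sum l.scale)
    finally show "dd d (\<lambda>x. g (c + L x)) x = (\<Sum>b\<in>Basis. complex_of_real (L d \<bullet> b) * dd b g (c + L x))"
      using dd_eq[OF hd, of d x] by (simp add: dd_def scaleR_conv_of_real)
  qed
qed

lemma diff_cls_sum:
  assumes B: "\<And>f g. B f \<Longrightarrow> B g \<Longrightarrow> B (\<lambda>x. f x + g x)" and 0: "diff_cls B n (\<lambda>x. 0)"
  shows "finite I \<Longrightarrow> (\<And>i. i \<in> I \<Longrightarrow> diff_cls B n (f i)) \<Longrightarrow> diff_cls B n (\<lambda>x. \<Sum>i\<in>I. f i x)"
  by (induction rule: finite_induct) (auto simp: 0 intro!: diff_cls_add B)

text \<open>By the chain rule a partial derivative of the composite is a combination, with constant
  coefficients, of partial derivatives of g in the same composition.\<close>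

lemma diff_cls_affine:
  fixes L :: "'a::euclidean_space \<Rightarrow> 'b::euclidean_space"
  assumes L: "bounded_linear L"
    and B: "\<And>f g. B f \<Longrightarrow> B g \<Longrightarrow> B (\<lambda>x. f x + g x)" and k: "\<And>k f. B f \<Longrightarrow> B (\<lambda>x. k * f x)"
    and c: "\<And>g. B' g \<Longrightarrow> B (\<lambda>x. g (c + L x))" and z: "\<And>n. diff_cls B n (\<lambda>x. 0)"
  shows "diff_cls B' n g \<Longrightarrow> diff_cls B n (\<lambda>x. g (c + L x))"
proof (induction n arbitrary: g)
  case (Suc n)
  have m: "diff_cls B n f \<Longrightarrow> diff_cls B n (\<lambda>x. k * f x)" for n k f
  proof (induction n arbitrary: f)
    case (Suc n)
    moreover have "dd d (\<lambda>x. k * f x) = (\<lambda>x. k * dd d f x)" for d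
      using dd_bounded_linear[OF bounded_linear_mult_right, of f d k] Suc.prems by auto
    ultimately show ?case by (auto intro!: assms(3))
  qed (simp add: assms(3))
  show ?case
    using Suc dd_affine[OF L, where g=g and c=c] z c by (auto intro!: diff_cls_sum B m)
qed (simp add: c)

lemma smth_affine:
  fixes L :: "'a::euclidean_space \<Rightarrow> 'b::euclidean_space"
  shows "smth g \<Longrightarrow> bounded_linear L \<Longrightarrow> smth (\<lambda>x. g (c + L x))"
  unfolding smth_def
  by (rule allI, rule diff_cls_affine[where B="\<lambda>_. True" and B'="\<lambda>_. True"])
     (use smtemp_smth[OF smtemp_const, unfolded smth_def] in auto)

lemma smtemp_bounded_linear:
  fixes L :: "'a::euclidean_space \<Rightarrow> 'b::euclidean_space"
  assumes "smtemp g" and L: "bounded_linear L" shows "smtemp (\<lambda>x. g (L x))"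
proof -
  have t: "tempered (\<lambda>x. g (0 + L x))" if tg: "tempered g" for g :: "'b \<Rightarrow> complex"
  proof -
    obtain N C where C: "C > 0" "\<And>z. cmod (g z) \<le> C * (1 + norm z) ^ N" using temperedE[OF tg] by blast
    obtain B where B: "\<And>x. norm (L x) \<le> norm x * B" "B > 0"
      using bounded_linear.pos_bounded[OF L] by blast
    have "cmod (g (0 + L z)) \<le> (C * (1 + B) ^ N) * (1 + norm z) ^ N" for z
    proof -
      have "1 + norm (L z) \<le> (1 + B) * (1 + norm z)" using B(1)[of z] B(2) norm_ge_zero[of z] unfolding distrib_left distrib_right mult.commute[of "norm z"] by linarith
      then have "(1 + norm (L z)) ^ N \<le> ((1 + B) * (1 + norm z)) ^ N" by (intro power_mono) auto
      then have "C * (1 + norm (L z)) ^ N \<le> C * ((1 + B) * (1 + norm z)) ^ N" using C(1) by simp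
      then show ?thesis using C(2)[of "L z"] by (simp add: power_mult_distrib mult_ac)
    qed
    then show ?thesis unfolding tempered_def by blast
  qed
  have k: "tempered f \<Longrightarrow> tempered (\<lambda>x. k * f x)" for k and f :: "'a \<Rightarrow> complex"
    using tempered_mult[of "\<lambda>_. k" f] smtemp_const[of k] unfolding smtemp_def by (metis diff_cls.simps(1))
  have "diff_cls tempered n (\<lambda>x. g (0 + L x))" for n
    by (rule diff_cls_affine[where B=tempered and B'=tempered])
       (use L k t tempered_add assms(1) smtemp_const[of 0] in \<open>auto simp: smtemp_def\<close>)
  then show ?thesis unfolding smtemp_def by simp
qed

subsection \<open>The operator in Fourier variables\<close>

text \<open>The factor 2 pi translates between the two Fourier conventions of the definitions.\<close>

definition ksym :: "real \<Rightarrow> (real ^ 'n::finite \<Rightarrow> real) \<Rightarrow> 'n pt \<Rightarrow> real" where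
  "ksym \<sigma> w \<zeta> = symF \<sigma> w ((2 * pi) *\<^sub>R snd (snd \<zeta>))"

locale bump =
  fixes w :: "real ^ 'n::finite \<Rightarrow> real"
  assumes w: "smooth w" "\<And>\<eta>. 0 \<le> w \<eta>" "\<And>\<eta>. w \<eta> \<le> 1"
    "\<And>\<eta>. norm \<eta> \<ge> 2 \<Longrightarrow> w \<eta> = 1" "\<And>\<eta>. norm \<eta> \<le> 1 \<Longrightarrow> w \<eta> = 0"
begin

text \<open>The compactly supported complement of the cutoff serves twice: it makes the quadratic
  part of the symbol Schwartz, and it is the source of all bump functions used for
  localisation.\<close>

definition bp :: "real ^ 'n \<Rightarrow> complex" where "bp \<eta> = 1 - complex_of_real (w \<eta>)"

lemma bp_schw: "schw bp"
proof (rule smth_schw[where R=2])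
  have "smth (\<lambda>\<eta>. complex_of_real (w \<eta>))" by (intro smooth_smth smooth_of_real w)
  from smth_add[OF smtemp_smth[OF smtemp_const] smth_mult[OF smtemp_smth[OF smtemp_const] this], of 1 "-1"]
  show "smth bp" unfolding bp_def by simp
  show "\<And>z. bp z \<noteq> 0 \<Longrightarrow> norm z \<le> 2" using w(4) unfolding bp_def by force
qed

lemma w_smtemp: "smtemp (\<lambda>\<eta>. complex_of_real (w \<eta>))"
proof -
  have "(\<lambda>\<eta>. complex_of_real (w \<eta>)) = (\<lambda>\<eta>. 1 + (-1) * bp \<eta>)" by (auto simp: bp_def)
  then show ?thesis
    using smtemp_add[OF smtemp_const schw_smtemp[OF schw_cmult[OF bp_schw]], of 1 "-1"] by simp
qed

text \<open>The singular power is multiplied by \<open>w\<close>, which vanishes on the unit ball,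
  and the quadratic part is a polynomial times the compactly supported \<open>bp\<close>.\<close>

lemma symF_smtemp: "smtemp (\<lambda>\<eta>. complex_of_real (symF \<sigma> w \<eta>))"
proof -
  have eq: "(\<lambda>\<eta>. complex_of_real (symF \<sigma> w \<eta>)) = (\<lambda>\<eta>. complex_of_real (norm \<eta> powr (2 * \<sigma>)) * complex_of_real (w \<eta>) +
     (\<Sum>b\<in>Basis. of_real (\<eta> \<bullet> b) * (of_real (\<eta> \<bullet> b) * bp \<eta>)))"
  proof
    fix \<eta> :: "real ^ 'n"
    have "(norm \<eta>)\<^sup>2 = (\<Sum>b\<in>Basis. (\<eta> \<bullet> b) * (\<eta> \<bullet> b))"
      unfolding power2_norm_eq_inner by (rule euclidean_inner)
    then show "complex_of_real (symF \<sigma> w \<eta>) = complex_of_real (norm \<eta> powr (2 * \<sigma>)) * complex_of_real (w \<eta>) +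
     (\<Sum>b\<in>Basis. of_real (\<eta> \<bullet> b) * (of_real (\<eta> \<bullet> b) * bp \<eta>))"
      by (simp add: symF_def bp_def sum_distrib_right mult.assoc)
  qed
  have l: "schw (\<lambda>\<eta>. of_real (\<eta> \<bullet> b) * f \<eta>)" if "schw f" for f and b :: "real ^ 'n"
    using schw_mult_inner[OF that, of 1 b] by simp
  show ?thesis unfolding eq
    by (intro smtemp_add smtemp_norm_powr w_smtemp schw_smtemp schw_sum l bp_schw) (auto simp: w)
qed

lemma ksym_smtemp: "smtemp (\<lambda>\<zeta>. complex_of_real (ksym \<sigma> w \<zeta>))"
  unfolding ksym_def
  by (rule smtemp_bounded_linear[OF symF_smtemp])
     (intro bounded_linear_scaleR_right bounded_linear_compose[OF bounded_linear_scaleR_right] bounded_linear_compose[OF bounded_linear_snd bounded_linear_snd])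

end

section \<open>Separating the velocity variable from time and position\<close>

lemma lborel_reassoc:
  "distr lborel borel (\<lambda>p::('a::euclidean_space \<times> 'b::euclidean_space) \<times> 'c::euclidean_space. (fst (fst p), snd (fst p), snd p)) = lborel"
proof (rule measure_eqI)
  let ?A = "\<lambda>p::('a \<times> 'b) \<times> 'c. (fst (fst p), snd (fst p), snd p)"
  have [measurable]: "?A \<in> borel_measurable borel"
    by (intro borel_measurable_continuous_onI continuous_intros)
  have it: "(\<integral>\<^sup>+x. \<integral>\<^sup>+y. f (x, y) \<partial>lborel \<partial>lborel) = integral\<^sup>N lborel f" if "f \<in> borel_measurable borel"
    for f :: "'d::euclidean_space \<times> 'e::euclidean_space \<Rightarrow> ennreal"
    using lborel.nn_integral_fst[of f lborel] that by (simp add: lborel_prod)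
  fix S assume "S \<in> sets (distr lborel borel ?A)"
  then have S: "S \<in> sets borel" by simp
  let ?i = "indicator S :: _ \<Rightarrow> ennreal"
  have [measurable]: "?i \<in> borel_measurable borel" using S by simp
  have "emeasure (distr lborel borel ?A) S = (\<integral>\<^sup>+p. ?i (?A p) \<partial>lborel)"
    using S nn_integral_indicator[of S "distr lborel borel ?A"] nn_integral_distr[of ?A lborel borel ?i] by auto
  also have "\<dots> = (\<integral>\<^sup>+y. \<integral>\<^sup>+v. ?i (fst y, snd y, v) \<partial>lborel \<partial>lborel)"
    by (subst it[symmetric]) auto
  also have "\<dots> = (\<integral>\<^sup>+t. \<integral>\<^sup>+x. \<integral>\<^sup>+v. ?i (t, x, v) \<partial>lborel \<partial>lborel \<partial>lborel)"
  proof (subst it[symmetric])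
    have "(\<lambda>(y, v). ?i (fst y, snd y, v)) \<in> borel_measurable (borel \<Otimes>\<^sub>M lborel)"
    proof -
      have s: "sets (borel \<Otimes>\<^sub>M lborel :: (('a \<times> 'b) \<times> 'c) measure) = sets borel"
        by (subst borel_prod[symmetric], intro sets_pair_measure_cong) auto
      have "(\<lambda>p. ?i (?A p)) \<in> borel_measurable borel" by measurable
      then show ?thesis unfolding measurable_cong_sets[OF s refl] by (simp add: case_prod_beta')
    qed
    from lborel.borel_measurable_nn_integral[OF this]
    show "(\<lambda>y. \<integral>\<^sup>+v. ?i (fst y, snd y, v) \<partial>lborel) \<in> borel_measurable borel" by simp
  qed simp
  also have "\<dots> = (\<integral>\<^sup>+t. \<integral>\<^sup>+q. ?i (t, q) \<partial>lborel \<partial>lborel)"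
    by (intro nn_integral_cong, subst it[symmetric]) auto
  also have "\<dots> = emeasure lborel S"
    using S by (subst it) auto
  finally show "emeasure (distr lborel borel ?A) S = emeasure lborel S" .
qed simp

text \<open>Points are nested as t, (x, v), whereas the multiplier acts in v alone, so Fubini is
  wanted for the pair ((t, x), v).\<close>

lemma lborel_integral_reassoc:
  fixes f :: "'a::euclidean_space \<times> 'b::euclidean_space \<times> 'c::euclidean_space \<Rightarrow> complex"
  assumes f: "integrable lborel f"
  shows "(\<integral>z. f z \<partial>lborel) = (\<integral>y. (\<integral>v. f (fst y, snd y, v) \<partial>lborel) \<partial>lborel)"
    and "(\<integral>z. f z \<partial>lborel) = (\<integral>v. (\<integral>y. f (fst y, snd y, v) \<partial>lborel) \<partial>lborel)"
    and "integrable lborel (\<lambda>y. \<integral>v. f (fst y, snd y, v) \<partial>lborel)"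
proof -
  let ?A = "\<lambda>p::('a \<times> 'b) \<times> 'c. (fst (fst p), snd (fst p), snd p)"
  have A [measurable]: "?A \<in> borel_measurable borel"
    by (intro borel_measurable_continuous_onI continuous_intros)
  have [measurable]: "f \<in> borel_measurable borel" using f by auto
  have i: "integrable (lborel \<Otimes>\<^sub>M lborel) (\<lambda>(y,v). f (fst y, snd y, v))"
  proof -
    have "integrable (distr lborel borel ?A) f" using f by (simp only: lborel_reassoc)
    then have "integrable lborel (\<lambda>p. f (?A p))" by (subst (asm) integrable_distr_eq) auto
    then show ?thesis by (simp add: lborel_prod case_prod_beta')
  qed
  have e: "(\<integral>z. f z \<partial>lborel) = (\<integral>p. f (?A p) \<partial>lborel)"
    by (subst lborel_reassoc[symmetric], subst integral_distr) auto
  show "(\<integral>z. f z \<partial>lborel) = (\<integral>y. (\<integral>v. f (fst y, snd y, v) \<partial>lborel) \<partial>lborel)"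
    using lborel_pair.integral_fst[OF i] by (simp add: e lborel_prod case_prod_beta')
  show "(\<integral>z. f z \<partial>lborel) = (\<integral>v. (\<integral>y. f (fst y, snd y, v) \<partial>lborel) \<partial>lborel)"
    using lborel_pair.integral_snd[OF i] by (simp add: e lborel_prod case_prod_beta')
  show "integrable lborel (\<lambda>y. \<integral>v. f (fst y, snd y, v) \<partial>lborel)"
    using lborel_pair.integrable_fst[OF i] .
qed

lemma ft_measurable [measurable]:
  assumes [measurable]: "f \<in> borel_measurable borel"
  shows "ft f \<in> borel_measurable borel"
proof -
  have "(\<lambda>\<zeta>. \<integral>z. cis (- 2 * pi * (z \<bullet> \<zeta>)) * f z \<partial>lborel) \<in> borel_measurable borel"
    by (rule lborel.borel_measurable_lebesgue_integral) simp
  then show ?thesis by (simp add: ft_def[abs_def])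
qed

text \<open>With \<eta> fixed, let \<open>q\<close> be the transform of u in v as a function of (t,
  x). Its transform in (t, x) is the full transform of u, so inversion in these n + 1 variables
  recovers \<open>q\<close>.\<close>

lemma partial_inversion:
  fixes u :: "'n::finite pt \<Rightarrow> complex"
  assumes u: "schw u"
  shows "(\<integral>v. cis (- 2 * pi * (v \<bullet> \<eta>)) * u (t, x, v) \<partial>lborel) =
    (\<integral>y. cis (2 * pi * ((t, x) \<bullet> y)) * ft u (fst y, snd y, \<eta>) \<partial>lborel)"
proof -
  let ?N = "2 * DIM(real ^ 'n)"
  note [measurable] = schw_measurable[OF u]
  define q where "q y = (\<integral>v. cis (- 2 * pi * (v \<bullet> \<eta>)) * u (fst y, snd y, v) \<partial>lborel)" for y :: "real \<times> (real ^ 'n)"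
  obtain C where C: "C > 0" "\<And>z. cmod (u z) * (1 + norm z) ^ ?N \<le> C" using schwE[OF u] by metis
  have Cv: "cmod (u (t, x, v)) \<le> C * (1 / (1 + norm v) ^ ?N)" for t x v
  proof -
    have "norm v \<le> norm (t, x, v)" by (metis norm_snd_le order_trans)
    then have "cmod (u (t,x,v)) * (1 + norm v) ^ ?N \<le> cmod (u (t,x,v)) * (1 + norm (t,x,v)) ^ ?N"
      by (intro mult_left_mono power_mono) auto
    then have "cmod (u (t,x,v)) * (1 + norm v) ^ ?N \<le> C" using C(2) order_trans by blast
    then show ?thesis by (simp add: field_simps add_pos_nonneg)
  qed
  have wi: "integrable lborel (\<lambda>v::real ^ 'n. C * (1 / (1 + norm v) ^ ?N))"
    by (intro integrable_mult_right weight_integrable) simp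
  have m [measurable]: "(\<lambda>v. u (t, x, v)) \<in> borel_measurable borel" for t x
  proof -
    have "continuous_on UNIV (\<lambda>v. u (t, x, v))"
      by (rule continuous_on_compose2[OF schw_continuous[OF u, of UNIV]]) (auto intro!: continuous_intros)
    then show ?thesis by (rule borel_measurable_continuous_onI)
  qed
  have ui: "integrable lborel (\<lambda>v. u (t, x, v))" for t x
    by (rule Bochner_Integration.integrable_bound[OF wi]) (use Cv C(1) in auto)
  define Q where "Q = (\<integral>v. C * (1 / (1 + norm v) ^ ?N) \<partial>(lborel :: (real ^ 'n) measure))"
  have qb: "cmod (q y) \<le> Q" for y
    unfolding q_def Q_def
  proof (rule Bochner_Integration.integral_norm_bound_integral[OF _ wi])
    show "integrable lborel (\<lambda>v. cis (- 2 * pi * (v \<bullet> \<eta>)) * u (fst y, snd y, v))"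
      using ft_integrand_integrable[OF ui, of "-2*pi" \<eta>] by simp
  qed (use Cv in \<open>auto simp: norm_mult\<close>)
  have qc: "continuous_on UNIV q"
    unfolding continuous_on_sequentially
  proof (intro allI ballI impI, elim conjE)
    fix Y :: "nat \<Rightarrow> real \<times> (real ^ 'n)" and y assume Y: "Y \<longlonglongrightarrow> y"
    show "(q \<circ> Y) \<longlonglongrightarrow> q y"
      unfolding o_def q_def
    proof (rule integral_dominated_convergence[OF _ _ wi])
      show "AE v in lborel. (\<lambda>k. cis (- 2 * pi * (v \<bullet> \<eta>)) * u (fst (Y k), snd (Y k), v)) \<longlonglongrightarrow> cis (- 2 * pi * (v \<bullet> \<eta>)) * u (fst y, snd y, v)"
      proof (intro AE_I2 tendsto_mult tendsto_const)
        fix v :: "real ^ 'n"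
        have "(\<lambda>k. (fst (Y k), snd (Y k), v)) \<longlonglongrightarrow> (fst y, snd y, v)"
          by (intro tendsto_intros Y)
        moreover have "isCont u (fst y, snd y, v)"
          using schw_continuous[OF u, of UNIV] by (simp add: continuous_on_eq_continuous_at)
        ultimately show "(\<lambda>k. u (fst (Y k), snd (Y k), v)) \<longlonglongrightarrow> u (fst y, snd y, v)"
          using isCont_tendsto_compose[of _ u] by blast
      qed
    qed (use Cv in \<open>auto simp: norm_mult\<close>)
  qed
  have ci: "integrable lborel (\<lambda>z. cis (c * (z \<bullet> \<zeta>)) * u z)" for c \<zeta>
    by (rule ft_integrand_integrable[OF schw_integrable[OF u]])
  have qi: "integrable lborel q"
  proof -
    have "cis (- 2 * pi * ((fst y, snd y, v) \<bullet> (0, 0, \<eta>))) = cis (- 2 * pi * (v \<bullet> \<eta>))" for y :: "real \<times> (real ^ 'n)" and v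
      by simp
    then show ?thesis using lborel_integral_reassoc(3)[OF ci[of "-2*pi" "(0, 0, \<eta>)"]] by (simp add: q_def[abs_def])
  qed
  have ftq: "ft q y' = ft u (fst y', snd y', \<eta>)" for y'
  proof -
    have "ft u (fst y', snd y', \<eta>) = (\<integral>y. (\<integral>v. cis (- 2 * pi * ((fst y, snd y, v) \<bullet> (fst y', snd y', \<eta>))) * u (fst y, snd y, v) \<partial>lborel) \<partial>lborel)"
      using lborel_integral_reassoc(1)[OF ci[of "-2*pi" "(fst y', snd y', \<eta>)"]] by (simp add: ft_def)
    also have "\<dots> = (\<integral>y. cis (- 2 * pi * (y \<bullet> y')) * q y \<partial>lborel)"
    proof (intro Bochner_Integration.integral_cong refl)
      fix y :: "real \<times> (real ^ 'n)"
      have "cis (- 2 * pi * ((fst y, snd y, v) \<bullet> (fst y', snd y', \<eta>))) * u (fst y, snd y, v) =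
        cis (- 2 * pi * (y \<bullet> y')) * (cis (- 2 * pi * (v \<bullet> \<eta>)) * u (fst y, snd y, v))" for v
        unfolding mult.assoc[symmetric] cis_mult by (simp add: inner_prod_def algebra_simps)
      then show "(\<integral>v. cis (- 2 * pi * ((fst y, snd y, v) \<bullet> (fst y', snd y', \<eta>))) * u (fst y, snd y, v) \<partial>lborel) = cis (- 2 * pi * (y \<bullet> y')) * q y"
        unfolding q_def by (simp only: integral_mult_right_zero)
    qed
    finally show ?thesis by (simp add: ft_def)
  qed
  have "integrable lborel (\<lambda>y. ft u (fst y, snd y, \<eta>))"
  proof (rule rapid_integrable(2))
    show "rapid (\<lambda>y. ft u (fst y, snd y, \<eta>))"
      unfolding rapid_def
    proof
      fix N
      obtain C where C: "C > 0" "\<And>z. cmod (ft u z) * (1 + norm z) ^ N \<le> C" using schwE[OF schw_ft[OF u]] by metis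
      have "cmod (ft u (fst y, snd y, \<eta>)) * (1 + norm y) ^ N \<le> C" for y
      proof -
        have "norm y \<le> norm (fst y, snd y, \<eta>)"
          by (auto simp: norm_prod_def)
        then have "cmod (ft u (fst y, snd y, \<eta>)) * (1 + norm y) ^ N \<le> cmod (ft u (fst y, snd y, \<eta>)) * (1 + norm (fst y, snd y, \<eta>)) ^ N"
          by (intro mult_left_mono power_mono) auto
        then show ?thesis using C(2) order_trans by blast
      qed
      then show "\<exists>C. \<forall>z. cmod (ft u (fst z, snd z, \<eta>)) * (1 + norm z) ^ N \<le> C" by blast
    qed
    have "continuous_on UNIV (\<lambda>y. ft u (fst y, snd y, \<eta>))"
      by (rule continuous_on_compose2[OF schw_continuous[OF schw_ft[OF u], of UNIV]]) (auto intro!: continuous_intros)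
    then show "(\<lambda>y. ft u (fst y, snd y, \<eta>)) \<in> borel_measurable borel" by (rule borel_measurable_continuous_onI)
  qed
  then have "integrable lborel (ft q)" by (simp add: ftq[abs_def])
  from ft_inversion[OF qi qc qb this, of "(t, x)"] show ?thesis
    unfolding ftq[abs_def] ft_def[of "\<lambda>y. ft u (fst y, snd y, \<eta>)"]
    by (simp add: q_def inner_prod_def inner_commute mult.commute[of _ t] algebra_simps)
qed

context bump
begin

lemma schw_ksym_ft: "schw u \<Longrightarrow> schw (\<lambda>\<zeta>. complex_of_real (ksym \<sigma> w \<zeta>) * ft u \<zeta>)"
  by (intro smtemp_mult_schw ksym_smtemp schw_ft)

text \<open>Partial inversion writes the v-transform at a fixed (t, x) as an integral over the
  remaining dual variables; the iterated integral is then the inverse of the full transform.\<close>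

lemma frac_lap_v_eq:
  assumes u: "schw u"
  shows "frac_lap_v \<sigma> w u z = ft (\<lambda>\<zeta>. complex_of_real (ksym \<sigma> w \<zeta>) * ft u \<zeta>) (- z)"
proof -
  obtain t x v where z: "z = (t, x, v)" by (cases z)
  let ?g = "\<lambda>\<eta>. cis (v \<bullet> \<eta>) * complex_of_real (symF \<sigma> w \<eta>) * fourier_v u (t, x, \<eta>)"
  have m: "(\<lambda>v. u (t, x, v)) \<in> borel_measurable borel"
  proof -
    have "continuous_on UNIV (\<lambda>v. u (t, x, v))"
      by (rule continuous_on_compose2[OF schw_continuous[OF u, of UNIV]]) (auto intro!: continuous_intros)
    then show ?thesis by (rule borel_measurable_continuous_onI)
  qed
  have fv: "fourier_v u (t, x, \<eta>) = ft (\<lambda>v. u (t, x, v)) ((1 / (2 * pi)) *\<^sub>R \<eta>)" for \<eta>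
    by (simp add: fourier_v_def ft_def)
  have sm: "(\<lambda>\<eta>. complex_of_real (symF \<sigma> w \<eta>)) \<in> borel_measurable borel"
    by (intro borel_measurable_continuous_onI continuous_at_imp_continuous_on ballI
        differentiable_imp_continuous_within smtemp_differentiable symF_smtemp)
  have gm: "?g \<in> borel_measurable borel"
    unfolding fv
    by (intro borel_measurable_times measurable_compose[OF _ ft_measurable[OF m]] sm) auto
  \<comment> \<open>The substitution \<eta> to 2 pi \<eta> passes from one Fourier convention to the
    other, and its Jacobian cancels the prefactor (2 pi)^(-n).\<close>
  have "(\<integral>\<eta>. ?g \<eta> \<partial>lborel) = (2 * pi) ^ CARD('n) *\<^sub>R (\<integral>\<eta>. ?g (0 + (2 * pi) *\<^sub>R \<eta>) \<partial>lborel)"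
    by (subst lborel_integral_affine[OF gm, of "2 * pi" 0]) auto
  moreover have "(2 * pi) powr - real CARD('n) * (2 * pi) ^ CARD('n) = 1"
    by (simp add: powr_minus powr_realpow field_simps del: power_mult_distrib)
  ultimately have "frac_lap_v \<sigma> w u z = (\<integral>\<eta>. ?g ((2 * pi) *\<^sub>R \<eta>) \<partial>lborel)"
    by (simp add: frac_lap_v_def z scaleR_conv_of_real mult.assoc[symmetric] flip: of_real_mult of_real_power)
       (simp add: mult.assoc)?
  also have "\<dots> = (\<integral>\<eta>. (\<integral>y. cis (2 * pi * ((fst y, snd y, \<eta>) \<bullet> z)) * (complex_of_real (ksym \<sigma> w (fst y, snd y, \<eta>)) * ft u (fst y, snd y, \<eta>)) \<partial>lborel) \<partial>lborel)"
  proof (intro Bochner_Integration.integral_cong refl)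
    fix \<eta> :: "real ^ 'n"
    have "fourier_v u (t, x, (2 * pi) *\<^sub>R \<eta>) = (\<integral>v. cis (- 2 * pi * (v \<bullet> \<eta>)) * u (t, x, v) \<partial>lborel)"
      by (simp add: fourier_v_def)
    also have "\<dots> = (\<integral>y. cis (2 * pi * ((t, x) \<bullet> y)) * ft u (fst y, snd y, \<eta>) \<partial>lborel)"
      by (rule partial_inversion[OF u])
    finally have "?g ((2 * pi) *\<^sub>R \<eta>) = (\<integral>y. cis (v \<bullet> (2 * pi) *\<^sub>R \<eta>) * complex_of_real (symF \<sigma> w ((2 * pi) *\<^sub>R \<eta>)) * (cis (2 * pi * ((t, x) \<bullet> y)) * ft u (fst y, snd y, \<eta>)) \<partial>lborel)"
      by (simp only: integral_mult_right_zero)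
    also have "\<dots> = (\<integral>y. cis (2 * pi * ((fst y, snd y, \<eta>) \<bullet> z)) * (complex_of_real (ksym \<sigma> w (fst y, snd y, \<eta>)) * ft u (fst y, snd y, \<eta>)) \<partial>lborel)"
    proof (intro Bochner_Integration.integral_cong refl)
      fix y :: "real \<times> (real ^ 'n)"
      have "cis (v \<bullet> (2 * pi) *\<^sub>R \<eta>) * cis (2 * pi * ((t, x) \<bullet> y)) = cis (2 * pi * ((fst y, snd y, \<eta>) \<bullet> z))"
        unfolding cis_mult by (simp add: z inner_prod_def inner_commute algebra_simps)
      then show "cis (v \<bullet> (2 * pi) *\<^sub>R \<eta>) * complex_of_real (symF \<sigma> w ((2 * pi) *\<^sub>R \<eta>)) * (cis (2 * pi * ((t, x) \<bullet> y)) * ft u (fst y, snd y, \<eta>))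
        = cis (2 * pi * ((fst y, snd y, \<eta>) \<bullet> z)) * (complex_of_real (ksym \<sigma> w (fst y, snd y, \<eta>)) * ft u (fst y, snd y, \<eta>))"
        by (simp add: ksym_def)
    qed
    finally show "?g ((2 * pi) *\<^sub>R \<eta>) = (\<integral>y. cis (2 * pi * ((fst y, snd y, \<eta>) \<bullet> z)) * (complex_of_real (ksym \<sigma> w (fst y, snd y, \<eta>)) * ft u (fst y, snd y, \<eta>)) \<partial>lborel)" .
  qed
  also have "\<dots> = (\<integral>\<zeta>. cis (2 * pi * (\<zeta> \<bullet> z)) * (complex_of_real (ksym \<sigma> w \<zeta>) * ft u \<zeta>) \<partial>lborel)"
    by (rule lborel_integral_reassoc(2)[symmetric])
       (rule ft_integrand_integrable[OF schw_integrable[OF schw_ksym_ft[OF u]]])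
  finally show ?thesis by (simp add: ft_def)
qed

lemma frac_lap_v_integrable:
  assumes u: "schw u" shows "integrable lborel (frac_lap_v \<sigma> w u)"
proof -
  have "integrable lborel (\<lambda>z. ft (\<lambda>\<zeta>. complex_of_real (ksym \<sigma> w \<zeta>) * ft u \<zeta>) (0 + (-1) *\<^sub>R z))"
    by (rule lborel_integrable_affine) (auto intro!: schw_integrable schw_ft schw_ksym_ft u)
  then show ?thesis unfolding frac_lap_v_eq[OF u, abs_def] by simp
qed

text \<open>Inversion with a reflection. From here on the operator enters only as multiplication by
  \<open>ksym\<close> on the Fourier side and as an integrable function.\<close>

lemma ft_frac_lap_v:
  assumes u: "schw u" shows "ft (frac_lap_v \<sigma> w u) \<zeta> = complex_of_real (ksym \<sigma> w \<zeta>) * ft u \<zeta>"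
proof -
  let ?H = "\<lambda>\<zeta>. complex_of_real (ksym \<sigma> w \<zeta>) * ft u \<zeta>"
  have H: "schw ?H" by (rule schw_ksym_ft[OF u])
  have m: "(\<lambda>z. cis (- 2 * pi * (z \<bullet> - \<zeta>)) * ft ?H z) \<in> borel_measurable borel"
    using schw_measurable[OF schw_ft[OF H]] by auto
  have "ft (frac_lap_v \<sigma> w u) \<zeta> = (\<integral>z. cis (- 2 * pi * (- z \<bullet> - \<zeta>)) * ft ?H (- z) \<partial>lborel)"
    by (simp add: ft_def[of "frac_lap_v \<sigma> w u"] frac_lap_v_eq[OF u])
  also have "\<dots> = ft (ft ?H) (- \<zeta>)"
    unfolding lborel_integral_uminus[OF m] ft_def[of "ft ?H"] ..
  finally show ?thesis by (simp add: schw_inversion[OF H])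
qed

end

subsection \<open>The transport part\<close>

definition transport :: "('n::finite pt \<Rightarrow> complex) \<Rightarrow> 'n pt \<Rightarrow> complex" where
  "transport u z = frechet_derivative u (at z) (1, 0, 0) + frechet_derivative u (at z) (0, snd (snd z), 0)"

lemma Basis_pt: "(1, 0, 0) \<in> (Basis :: 'n::finite pt set)"
  "b \<in> Basis \<Longrightarrow> (0, b, 0) \<in> (Basis :: 'n pt set)" "b \<in> Basis \<Longrightarrow> (0, 0, b) \<in> (Basis :: 'n pt set)"
  by (auto simp: Basis_prod_def zero_prod_def[symmetric])

lemma frechet_sum_Basis:
  assumes "f differentiable at z" and l: "linear l"
  shows "frechet_derivative f (at z) (l v) = (\<Sum>b\<in>Basis. (v \<bullet> b) *\<^sub>R frechet_derivative f (at z) (l b))"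
proof -
  interpret L: linear "frechet_derivative f (at z)" by (rule linear_frechet_derivative[OF assms(1)])
  have "l v = l (\<Sum>b\<in>Basis. (v \<bullet> b) *\<^sub>R b)" by (simp add: euclidean_representation)
  also have "\<dots> = (\<Sum>b\<in>Basis. (v \<bullet> b) *\<^sub>R l b)" using l by (simp add: linear_sum linear_cmul)
  finally show ?thesis by (simp add: L.sum L.scale)
qed

lemma linear_inj_pt: "linear (\<lambda>v. (0, v, 0))" "linear (\<lambda>v. (0, 0, v))"
  by (auto intro!: linearI)

lemma transport_eq:
  assumes "\<And>z. u differentiable at z"
  shows "transport u z = dd (1, 0, 0) u z + (\<Sum>b\<in>Basis. of_real (z \<bullet> (0, 0, b)) * dd (0, b, 0) u z)"
  unfolding transport_def dd_def
  by (subst frechet_sum_Basis[OF assms linear_inj_pt(1)]) (simp add: inner_prod_def scaleR_conv_of_real)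

lemma schw_mult_inner1: "schw f \<Longrightarrow> schw (\<lambda>z. of_real (z \<bullet> h) * f z)"
  using schw_mult_inner[of f 1 h] by simp

lemma schw_transport: "schw u \<Longrightarrow> schw (transport u)"
proof -
  assume u: "schw u"
  have "transport u = (\<lambda>z. dd (1, 0, 0) u z + (\<Sum>b\<in>Basis. of_real (z \<bullet> (0, 0, b)) * dd (0, b, 0) u z))"
    using transport_eq[OF schw_differentiable[OF u]] by blast
  then show ?thesis
    by (auto intro!: schw_add schw_sum schw_mult_inner1 schw_dd u Basis_pt)
qed

text \<open>Differentiation in x_b gives the factor 2 pi i \<xi>_b, multiplication by v_b gives the
  derivative in \<eta>_b divided by -2 pi i. The constants cancel up to the sign, so the
  characteristics move with velocity exactly \<xi>.\<close>

lemma ft_transport: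
  fixes u :: "'n::finite pt \<Rightarrow> complex"
  assumes u: "schw u"
  shows "ft (transport u) \<zeta> = 2 * pi * \<i> * of_real (fst \<zeta>) * ft u \<zeta> - frechet_derivative (ft u) (at \<zeta>) (0, 0, fst (snd \<zeta>))"
proof -
  have df: "u differentiable at z" for z by (rule schw_differentiable[OF u])
  have b: "ft (\<lambda>z. of_real (z \<bullet> (0, 0, b)) * dd (0, b, 0) u z) \<zeta> = - (of_real (\<zeta> \<bullet> (0, b, 0)) * dd (0, 0, b) (ft u) \<zeta>)"
    if b: "b \<in> Basis" for b :: "real ^ 'n"
  proof -
    let ?B = "(0, 0, b) :: 'n pt" and ?X = "(0, b, 0) :: 'n pt"
    have dl: "dd ?X (\<lambda>z. complex_of_real (z \<bullet> ?B)) = (\<lambda>z. 0)"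
    proof
      fix z
      have "((\<lambda>z. complex_of_real (z \<bullet> ?B)) has_derivative (\<lambda>h. complex_of_real (h \<bullet> ?B))) (at z)"
        by (intro derivative_eq_intros) auto
      from dd_eq[OF this, of ?X] show "dd ?X (\<lambda>z. complex_of_real (z \<bullet> ?B)) z = 0" by simp
    qed
    \<comment> \<open>The coefficient v_b does not depend on x_b, so it may be moved inside the
      derivative before transforming.\<close>
    have "(\<lambda>z. of_real (z \<bullet> ?B) * dd ?X u z) = dd ?X (\<lambda>z. of_real (z \<bullet> ?B) * u z)"
      by (subst dd_mult) (auto simp: dl df intro!: smtemp_differentiable smtemp_linear bounded_linear_inner_left)
    then have "ft (\<lambda>z. of_real (z \<bullet> ?B) * dd ?X u z) \<zeta> = 2 * pi * \<i> * of_real (\<zeta> \<bullet> ?X) * ft (\<lambda>z. of_real (z \<bullet> ?B) * u z) \<zeta>"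
      using ft_dd[OF schw_mult_inner1[OF u] Basis_pt(2)[OF b]] by simp
    moreover have "dd ?B (ft u) \<zeta> = (- 2 * pi * \<i>) * ft (\<lambda>z. of_real (z \<bullet> ?B) * u z) \<zeta>"
      unfolding dd_ft[OF u] mult.assoc[of "- 2 * pi * \<i>"] ft_cmult ..
    ultimately show ?thesis by simp
  qed
  have "ft (transport u) \<zeta> = ft (\<lambda>z. dd (1, 0, 0) u z + (\<Sum>b\<in>Basis. of_real (z \<bullet> (0, 0, b)) * dd (0, b, 0) u z)) \<zeta>"
    using transport_eq[OF df] by presburger
  also have "\<dots> = ft (dd (1, 0, 0) u) \<zeta> + (\<Sum>b\<in>Basis. ft (\<lambda>z. of_real (z \<bullet> (0, 0, b)) * dd (0, b, 0) u z) \<zeta>)"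
    by (subst ft_add, intro schw_integrable schw_dd u Basis_pt, intro schw_integrable schw_sum,
        auto intro!: ft_sum schw_integrable schw_mult_inner1 schw_dd u Basis_pt)
  also have "\<dots> = 2 * pi * \<i> * of_real (\<zeta> \<bullet> (1, 0, 0)) * ft u \<zeta> - (\<Sum>b\<in>Basis. of_real (\<zeta> \<bullet> (0, b, 0)) * dd (0, 0, b) (ft u) \<zeta>)"
    by (simp add: ft_dd[OF u Basis_pt(1)] b sum_negf cong: sum.cong)
  also have "(\<Sum>b\<in>Basis. of_real (\<zeta> \<bullet> (0, b, 0)) * dd (0, 0, b) (ft u) \<zeta>) = frechet_derivative (ft u) (at \<zeta>) (0, 0, fst (snd \<zeta>))"
    by (subst frechet_sum_Basis[OF schw_differentiable[OF schw_ft[OF u]] linear_inj_pt(2)])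
       (simp add: inner_prod_def scaleR_conv_of_real dd_def)
  finally show ?thesis by (simp add: inner_prod_def)
qed

lemma transport_mult:
  assumes "\<And>z. f differentiable at z" "\<And>z. g differentiable at z"
  shows "transport (\<lambda>z. f z * g z) z = f z * transport g z + transport f z * g z"
proof -
  have "dd d (\<lambda>z. f z * g z) z = f z * dd d g z + dd d f z * g z" for d
    using dd_mult[OF assms] by metis
  then show ?thesis unfolding transport_def dd_def by (simp add: algebra_simps)
qed

lemma opP_eq: "opP \<sigma> w a u z = transport u z + complex_of_real (a z) * frac_lap_v \<sigma> w u z"
  unfolding opP_def transport_def by (cases z) simp

subsection \<open>Weighted norms on the Fourier side\<close>

text \<open>The square of a weighted L^2 norm, extended-valued so that Tonelli and monotonicity
  apply directly; the absolute value lets weights be compared without tracking signs.\<close>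

definition Nsq :: "('a::euclidean_space \<Rightarrow> real) \<Rightarrow> ('a \<Rightarrow> complex) \<Rightarrow> ennreal" where
  "Nsq W g = (\<integral>\<^sup>+\<zeta>. (ennreal (\<bar>W \<zeta>\<bar> * cmod (g \<zeta>)))\<^sup>2 \<partial>lborel)"

section \<open>Cauchy-Schwarz and Young inequalities for extended non-negative integrands\<close>

lemma ennreal_square_add: "(a + b :: ennreal)\<^sup>2 \<le> 2 * a\<^sup>2 + 2 * b\<^sup>2"
proof (cases a; cases b)
  fix x y :: real assume *: "0 \<le> x" "a = ennreal x" "0 \<le> y" "b = ennreal y"
  have "(x + y)\<^sup>2 \<le> 2 * x\<^sup>2 + 2 * y\<^sup>2"
    using zero_le_square[of "x - y"] by (simp add: power2_eq_square algebra_simps)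
  then have "ennreal ((x + y)\<^sup>2) \<le> ennreal (2 * x\<^sup>2 + 2 * y\<^sup>2)" by (rule ennreal_leI)
  moreover have "a + b = ennreal (x + y)" using * by simp
  ultimately show ?thesis using * by (simp only: ennreal_power) (simp add: ennreal_mult ennreal_power)
qed (auto simp: power2_eq_square ennreal_mult_top ennreal_top_mult)

lemma ennreal_2ab: "2 * (a * b) \<le> a\<^sup>2 + (b :: ennreal)\<^sup>2"
proof (cases a; cases b)
  fix x y :: real assume *: "0 \<le> x" "a = ennreal x" "0 \<le> y" "b = ennreal y"
  have "2 * (x * y) \<le> x\<^sup>2 + y\<^sup>2"
    using zero_le_square[of "x - y"] by (simp add: power2_eq_square algebra_simps)
  then have "ennreal (2 * (x * y)) \<le> ennreal (x\<^sup>2 + y\<^sup>2)" by (rule ennreal_leI)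
  then show ?thesis using * by (simp add: ennreal_power ennreal_mult)
qed (auto simp: power2_eq_square ennreal_top_mult)

text \<open>Twice the square on the left is a double integral of 2 h(x) h(y) against k(x) k(y), and
  2 h(x) h(y) is at most h(x)^2 + h(y)^2. The argument also survives infinite values.\<close>

lemma nn_integral_Cauchy_Schwarz:
  assumes [measurable]: "k \<in> borel_measurable M" "h \<in> borel_measurable M"
  shows "(\<integral>\<^sup>+x. k x * h x \<partial>M)\<^sup>2 \<le> (\<integral>\<^sup>+x. k x \<partial>M) * (\<integral>\<^sup>+x. k x * (h x)\<^sup>2 \<partial>M)"
proof -
  let ?K = "\<integral>\<^sup>+x. k x \<partial>M" and ?Q = "\<integral>\<^sup>+x. k x * (h x)\<^sup>2 \<partial>M" and ?S = "\<integral>\<^sup>+x. k x * h x \<partial>M"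
  have "2 * ?S\<^sup>2 = (\<integral>\<^sup>+x. \<integral>\<^sup>+y. 2 * ((k x * h x) * (k y * h y)) \<partial>M \<partial>M)"
    by (simp add: nn_integral_cmult nn_integral_multc power2_eq_square)
  also have "\<dots> \<le> (\<integral>\<^sup>+x. \<integral>\<^sup>+y. k x * (h x)\<^sup>2 * k y + k x * (k y * (h y)\<^sup>2) \<partial>M \<partial>M)"
  proof (intro nn_integral_mono)
    fix x y
    have "k x * k y * (2 * (h x * h y)) \<le> k x * k y * ((h x)\<^sup>2 + (h y)\<^sup>2)"
      by (intro mult_left_mono ennreal_2ab) auto
    then show "2 * ((k x * h x) * (k y * h y)) \<le> k x * (h x)\<^sup>2 * k y + k x * (k y * (h y)\<^sup>2)"
      by (simp add: distrib_left mult_ac)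
  qed
  also have "\<dots> = 2 * (?K * ?Q)"
    by (simp add: nn_integral_add nn_integral_cmult nn_integral_multc mult.commute mult_2)
  finally have "2 * ?S\<^sup>2 \<le> 2 * (?K * ?Q)" .
  then show ?thesis by (subst (asm) ennreal_mult_le_mult_iff) auto
qed

definition conv :: "('a::euclidean_space \<Rightarrow> ennreal) \<Rightarrow> ('a \<Rightarrow> ennreal) \<Rightarrow> 'a \<Rightarrow> ennreal" where
  "conv k H \<zeta> = (\<integral>\<^sup>+\<theta>. k \<theta> * H (\<zeta> - \<theta>) \<partial>lborel)"

lemma conv_measurable [measurable]:
  assumes [measurable]: "k \<in> borel_measurable borel" "H \<in> borel_measurable borel"
  shows "conv k H \<in> borel_measurable borel"
proof -
  have "(\<lambda>\<zeta>. \<integral>\<^sup>+\<theta>. k \<theta> * H (\<zeta> - \<theta>) \<partial>lborel) \<in> borel_measurable borel"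
    by (rule lborel.borel_measurable_nn_integral) simp
  then show ?thesis by (simp add: conv_def[abs_def])
qed

text \<open>Cauchy-Schwarz with the kernel as density, then Tonelli and translation
  invariance.\<close>

lemma young_nn:
  assumes [measurable]: "k \<in> borel_measurable borel" "H \<in> borel_measurable borel"
  shows "(\<integral>\<^sup>+\<zeta>. (conv k H \<zeta>)\<^sup>2 \<partial>lborel) \<le> (\<integral>\<^sup>+\<theta>. k \<theta> \<partial>lborel)\<^sup>2 * (\<integral>\<^sup>+\<zeta>. (H \<zeta>)\<^sup>2 \<partial>lborel)"
proof -
  let ?K = "\<integral>\<^sup>+\<theta>. k \<theta> \<partial>lborel"
  have "(\<integral>\<^sup>+\<zeta>. (conv k H \<zeta>)\<^sup>2 \<partial>lborel) \<le> (\<integral>\<^sup>+\<zeta>. ?K * (\<integral>\<^sup>+\<theta>. k \<theta> * (H (\<zeta> - \<theta>))\<^sup>2 \<partial>lborel) \<partial>lborel)"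
    unfolding conv_def by (intro nn_integral_mono nn_integral_Cauchy_Schwarz) auto
  also have "\<dots> = ?K * (\<integral>\<^sup>+\<zeta>. (\<integral>\<^sup>+\<theta>. k \<theta> * (H (\<zeta> - \<theta>))\<^sup>2 \<partial>lborel) \<partial>lborel)"
    by (rule nn_integral_cmult) (simp add: lborel.borel_measurable_nn_integral)
  also have "(\<integral>\<^sup>+\<zeta>. (\<integral>\<^sup>+\<theta>. k \<theta> * (H (\<zeta> - \<theta>))\<^sup>2 \<partial>lborel) \<partial>lborel) = (\<integral>\<^sup>+\<theta>. (\<integral>\<^sup>+\<zeta>. k \<theta> * (H (\<zeta> - \<theta>))\<^sup>2 \<partial>lborel) \<partial>lborel)"
    by (rule lborel_pair.Fubini') simp
  also have "\<dots> = (\<integral>\<^sup>+\<theta>. k \<theta> * (\<integral>\<^sup>+\<zeta>. (H \<zeta>)\<^sup>2 \<partial>lborel) \<partial>lborel)"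
  proof (intro nn_integral_cong)
    fix \<theta>
    have "(\<integral>\<^sup>+\<zeta>. k \<theta> * (H (\<zeta> - \<theta>))\<^sup>2 \<partial>lborel) = k \<theta> * (\<integral>\<^sup>+\<zeta>. (H (\<zeta> + - \<theta>))\<^sup>2 \<partial>lborel)"
      by (simp add: nn_integral_cmult)
    also have "(\<integral>\<^sup>+\<zeta>. (H (\<zeta> + - \<theta>))\<^sup>2 \<partial>lborel) = (\<integral>\<^sup>+\<zeta>. (H \<zeta>)\<^sup>2 \<partial>lborel)"
      by (rule lborel_nn_integral_shift) simp
    finally show "(\<integral>\<^sup>+\<zeta>. k \<theta> * (H (\<zeta> - \<theta>))\<^sup>2 \<partial>lborel) = k \<theta> * (\<integral>\<^sup>+\<zeta>. (H \<zeta>)\<^sup>2 \<partial>lborel)" .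
  qed
  also have "\<dots> = ?K * (\<integral>\<^sup>+\<zeta>. (H \<zeta>)\<^sup>2 \<partial>lborel)" by (simp add: nn_integral_multc)
  finally show ?thesis by (simp add: power2_eq_square mult.assoc)
qed

text \<open>For a non-integrable function the left side is 0, the default value of the Bochner
  integral, so the bound holds for every f.\<close>

lemma norm_integral_le_nn: "ennreal (cmod (\<integral>x. f x \<partial>M)) \<le> (\<integral>\<^sup>+x. ennreal (cmod (f x)) \<partial>M)"
  by (cases "integrable M f") (auto simp: integral_norm_bound_ennreal not_integrable_integral_eq)

text \<open>Two kernels, because in the applications the leading part carries a small constant while the
  remainder may be large.\<close>

lemma conv_bound:
  fixes g h :: "'a::euclidean_space \<Rightarrow> complex"
  assumes g: "\<And>\<zeta>. g \<zeta> = (\<integral>\<theta>. k \<zeta> \<theta> * h (\<zeta> - \<theta>) \<partial>lborel)"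
    and m: "h \<in> borel_measurable borel" "W1 \<in> borel_measurable borel" "W2 \<in> borel_measurable borel"
    and k: "integrable lborel k1" "integrable lborel k2" "\<And>\<theta>. k1 \<theta> \<ge> 0" "\<And>\<theta>. k2 \<theta> \<ge> 0"
    and le: "\<And>\<zeta> \<theta>. \<bar>W \<zeta>\<bar> * cmod (k \<zeta> \<theta>) \<le> k1 \<theta> * \<bar>W1 (\<zeta> - \<theta>)\<bar> + k2 \<theta> * \<bar>W2 (\<zeta> - \<theta>)\<bar>"
  shows "Nsq W g \<le> ennreal (2 * (\<integral>\<theta>. k1 \<theta> \<partial>lborel)\<^sup>2) * Nsq W1 h + ennreal (2 * (\<integral>\<theta>. k2 \<theta> \<partial>lborel)\<^sup>2) * Nsq W2 h"
proof -
  note [measurable] = m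
  have [measurable]: "k1 \<in> borel_measurable borel" "k2 \<in> borel_measurable borel" using k by auto
  let ?H1 = "\<lambda>\<zeta>. ennreal (\<bar>W1 \<zeta>\<bar> * cmod (h \<zeta>))" and ?H2 = "\<lambda>\<zeta>. ennreal (\<bar>W2 \<zeta>\<bar> * cmod (h \<zeta>))"
  have p: "ennreal (\<bar>W \<zeta>\<bar> * cmod (g \<zeta>)) \<le> conv (\<lambda>\<theta>. ennreal (k1 \<theta>)) ?H1 \<zeta> + conv (\<lambda>\<theta>. ennreal (k2 \<theta>)) ?H2 \<zeta>" for \<zeta>
  proof -
    have "ennreal (\<bar>W \<zeta>\<bar> * cmod (g \<zeta>)) = ennreal (cmod (\<integral>\<theta>. of_real \<bar>W \<zeta>\<bar> * (k \<zeta> \<theta> * h (\<zeta> - \<theta>)) \<partial>lborel))"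
      by (simp add: g norm_mult)
    also have "\<dots> \<le> (\<integral>\<^sup>+\<theta>. ennreal (cmod (of_real \<bar>W \<zeta>\<bar> * (k \<zeta> \<theta> * h (\<zeta> - \<theta>)))) \<partial>lborel)"
      by (rule norm_integral_le_nn)
    also have "\<dots> \<le> (\<integral>\<^sup>+\<theta>. ennreal (k1 \<theta>) * ?H1 (\<zeta> - \<theta>) + ennreal (k2 \<theta>) * ?H2 (\<zeta> - \<theta>) \<partial>lborel)"
    proof (intro nn_integral_mono)
      fix \<theta>
      have "\<bar>W \<zeta>\<bar> * cmod (k \<zeta> \<theta>) * cmod (h (\<zeta> - \<theta>)) \<le> (k1 \<theta> * \<bar>W1 (\<zeta> - \<theta>)\<bar> + k2 \<theta> * \<bar>W2 (\<zeta> - \<theta>)\<bar>) * cmod (h (\<zeta> - \<theta>))"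
        by (intro mult_right_mono le) auto
      then have "ennreal (\<bar>W \<zeta>\<bar> * cmod (k \<zeta> \<theta>) * cmod (h (\<zeta> - \<theta>))) \<le> ennreal (k1 \<theta> * (\<bar>W1 (\<zeta> - \<theta>)\<bar> * cmod (h (\<zeta> - \<theta>))) + k2 \<theta> * (\<bar>W2 (\<zeta> - \<theta>)\<bar> * cmod (h (\<zeta> - \<theta>))))"
        by (intro ennreal_leI) (simp add: algebra_simps)
      then show "ennreal (cmod (of_real \<bar>W \<zeta>\<bar> * (k \<zeta> \<theta> * h (\<zeta> - \<theta>)))) \<le> ennreal (k1 \<theta>) * ?H1 (\<zeta> - \<theta>) + ennreal (k2 \<theta>) * ?H2 (\<zeta> - \<theta>)"
        using k by (simp add: norm_mult ennreal_mult' mult.assoc)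
    qed
    also have "\<dots> = conv (\<lambda>\<theta>. ennreal (k1 \<theta>)) ?H1 \<zeta> + conv (\<lambda>\<theta>. ennreal (k2 \<theta>)) ?H2 \<zeta>"
      unfolding conv_def by (rule nn_integral_add) auto
    finally show ?thesis .
  qed
  have "Nsq W g \<le> (\<integral>\<^sup>+\<zeta>. (conv (\<lambda>\<theta>. ennreal (k1 \<theta>)) ?H1 \<zeta> + conv (\<lambda>\<theta>. ennreal (k2 \<theta>)) ?H2 \<zeta>)\<^sup>2 \<partial>lborel)"
    unfolding Nsq_def by (intro nn_integral_mono power_mono p) auto
  also have "\<dots> \<le> (\<integral>\<^sup>+\<zeta>. 2 * (conv (\<lambda>\<theta>. ennreal (k1 \<theta>)) ?H1 \<zeta>)\<^sup>2 + 2 * (conv (\<lambda>\<theta>. ennreal (k2 \<theta>)) ?H2 \<zeta>)\<^sup>2 \<partial>lborel)"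
    by (intro nn_integral_mono ennreal_square_add)
  also have "\<dots> = 2 * (\<integral>\<^sup>+\<zeta>. (conv (\<lambda>\<theta>. ennreal (k1 \<theta>)) ?H1 \<zeta>)\<^sup>2 \<partial>lborel) + 2 * (\<integral>\<^sup>+\<zeta>. (conv (\<lambda>\<theta>. ennreal (k2 \<theta>)) ?H2 \<zeta>)\<^sup>2 \<partial>lborel)"
    by (simp add: nn_integral_add nn_integral_cmult)
  also have "\<dots> \<le> 2 * ((\<integral>\<^sup>+\<theta>. ennreal (k1 \<theta>) \<partial>lborel)\<^sup>2 * Nsq W1 h) + 2 * ((\<integral>\<^sup>+\<theta>. ennreal (k2 \<theta>) \<partial>lborel)\<^sup>2 * Nsq W2 h)"
    unfolding Nsq_def by (intro add_mono mult_left_mono young_nn) auto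
  also have "\<dots> = ennreal (2 * (\<integral>\<theta>. k1 \<theta> \<partial>lborel)\<^sup>2) * Nsq W1 h + ennreal (2 * (\<integral>\<theta>. k2 \<theta> \<partial>lborel)\<^sup>2) * Nsq W2 h"
    using k by (simp add: nn_integral_eq_integral ennreal_mult Bochner_Integration.integral_nonneg mult.assoc flip: ennreal_power)
  finally show ?thesis .
qed

lemma Nsq_le2:
  assumes m: "W1 \<in> borel_measurable borel" "g1 \<in> borel_measurable borel" "W2 \<in> borel_measurable borel" "g2 \<in> borel_measurable borel"
    and AB: "A \<ge> 0" "B \<ge> 0"
    and le: "\<And>\<zeta>. \<bar>W \<zeta>\<bar> * cmod (g \<zeta>) \<le> A * (\<bar>W1 \<zeta>\<bar> * cmod (g1 \<zeta>)) + B * (\<bar>W2 \<zeta>\<bar> * cmod (g2 \<zeta>))"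
  shows "Nsq W g \<le> ennreal (2 * A\<^sup>2) * Nsq W1 g1 + ennreal (2 * B\<^sup>2) * Nsq W2 g2"
proof -
  note [measurable] = m
  let ?H1 = "\<lambda>\<zeta>. ennreal (\<bar>W1 \<zeta>\<bar> * cmod (g1 \<zeta>))" and ?H2 = "\<lambda>\<zeta>. ennreal (\<bar>W2 \<zeta>\<bar> * cmod (g2 \<zeta>))"
  have "Nsq W g \<le> (\<integral>\<^sup>+\<zeta>. 2 * (ennreal A * ?H1 \<zeta>)\<^sup>2 + 2 * (ennreal B * ?H2 \<zeta>)\<^sup>2 \<partial>lborel)"
    unfolding Nsq_def
  proof (intro nn_integral_mono)
    fix \<zeta>
    have "ennreal (\<bar>W \<zeta>\<bar> * cmod (g \<zeta>)) \<le> ennreal (A * (\<bar>W1 \<zeta>\<bar> * cmod (g1 \<zeta>)) + B * (\<bar>W2 \<zeta>\<bar> * cmod (g2 \<zeta>)))"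
      by (intro ennreal_leI le)
    also have "\<dots> = ennreal A * ?H1 \<zeta> + ennreal B * ?H2 \<zeta>" using AB by (simp add: ennreal_mult')
    finally have "(ennreal (\<bar>W \<zeta>\<bar> * cmod (g \<zeta>)))\<^sup>2 \<le> (ennreal A * ?H1 \<zeta> + ennreal B * ?H2 \<zeta>)\<^sup>2" by (rule power_mono) auto
    then show "(ennreal (\<bar>W \<zeta>\<bar> * cmod (g \<zeta>)))\<^sup>2 \<le> 2 * (ennreal A * ?H1 \<zeta>)\<^sup>2 + 2 * (ennreal B * ?H2 \<zeta>)\<^sup>2"
      using ennreal_square_add order_trans by blast
  qed
  also have "\<dots> = ennreal (2 * A\<^sup>2) * Nsq W1 g1 + ennreal (2 * B\<^sup>2) * Nsq W2 g2"
    unfolding Nsq_def using AB by (simp add: nn_integral_add nn_integral_cmult power_mult_distrib ennreal_mult mult.assoc flip: ennreal_power)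
  finally show ?thesis .
qed

text \<open>The factor 2 comes from specialising the two-term bound to a vanishing second
  coefficient.\<close>

lemma Nsq_le:
  assumes m: "W1 \<in> borel_measurable borel" "g1 \<in> borel_measurable borel" and A: "A \<ge> 0"
    and le: "\<And>\<zeta>. \<bar>W \<zeta>\<bar> * cmod (g \<zeta>) \<le> A * (\<bar>W1 \<zeta>\<bar> * cmod (g1 \<zeta>))"
  shows "Nsq W g \<le> ennreal (2 * A\<^sup>2) * Nsq W1 g1"
  using Nsq_le2[OF m m A order_refl, of W g] le by simp

lemma Nsq_add:
  assumes m: "W \<in> borel_measurable borel" "g1 \<in> borel_measurable borel" "g2 \<in> borel_measurable borel"
  shows "Nsq W (\<lambda>\<zeta>. g1 \<zeta> + g2 \<zeta>) \<le> 2 * Nsq W g1 + 2 * Nsq W g2"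
proof -
  have "\<bar>W \<zeta>\<bar> * cmod (g1 \<zeta> + g2 \<zeta>) \<le> 1 * (\<bar>W \<zeta>\<bar> * cmod (g1 \<zeta>)) + 1 * (\<bar>W \<zeta>\<bar> * cmod (g2 \<zeta>))" for \<zeta>
    using mult_left_mono[OF norm_triangle_ineq, of "\<bar>W \<zeta>\<bar>" "g1 \<zeta>" "g2 \<zeta>"] by (simp add: distrib_left)
  from Nsq_le2[OF m(1,2) m(1,3) _ _ this] show ?thesis by simp
qed

lemma Nsq_cmult: "Nsq W (\<lambda>\<zeta>. c * g \<zeta>) = ennreal ((cmod c)\<^sup>2) * Nsq W g" if [measurable]: "W \<in> borel_measurable borel" "g \<in> borel_measurable borel"
  unfolding Nsq_def
  by (subst nn_integral_cmult[symmetric]) (auto simp: norm_mult ennreal_mult power_mult_distrib ennreal_power mult_ac)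

text \<open>A purely qualitative statement, on which the later absorption of terms into the left
  side rests.\<close>

lemma Nsq_finite:
  assumes g: "rapid g" and m: "g \<in> borel_measurable borel" "W \<in> borel_measurable borel" and W: "\<And>\<zeta>. \<bar>W \<zeta>\<bar> \<le> C * (1 + norm \<zeta>) ^ N"
  shows "Nsq W g < \<infinity>"
proof -
  obtain D where D: "D > 0" "\<And>z. cmod (g z) * (1 + norm z) ^ N \<le> D" using rapidE[OF g] by metis
  have C: "C \<ge> 0"
  proof (rule ccontr)
    assume "\<not> C \<ge> 0" then show False using W[of 0] by simp
  qed
  have i: "integrable lborel (\<lambda>z. C * D * C * (cmod (g z) * (1 + norm z) ^ N))"
    by (intro integrable_mult_right rapid_integrable g m)
  have "Nsq W g \<le> (\<integral>\<^sup>+z. ennreal (C * D * C * (cmod (g z) * (1 + norm z) ^ N)) \<partial>lborel)"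
    unfolding Nsq_def
  proof (intro nn_integral_mono)
    fix z
    let ?x = "cmod (g z) * (1 + norm z) ^ N"
    have "\<bar>W z\<bar> * cmod (g z) \<le> C * ?x" using mult_right_mono[OF W[of z], of "cmod (g z)"] by (simp add: mult_ac)
    then have "(\<bar>W z\<bar> * cmod (g z))\<^sup>2 \<le> (C * ?x)\<^sup>2" by (intro power_mono) auto
    also have "\<dots> = C * ?x * (C * ?x)" by (simp add: power2_eq_square)
    \<comment> \<open>One of the two factors is bounded by its supremum, which leaves a first power
      that is integrable.\<close>
    also have "\<dots> \<le> C * D * (C * ?x)" using C D by (intro mult_right_mono mult_left_mono) auto
    finally show "(ennreal (\<bar>W z\<bar> * cmod (g z)))\<^sup>2 \<le> ennreal (C * D * C * ?x)"
      by (simp add: ennreal_power ennreal_leI mult.assoc)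
  qed
  also have "\<dots> < \<infinity>" using i unfolding integrable_iff_bounded
    using C D(1) by (simp add: abs_mult)
  finally show ?thesis .
qed

subsection \<open>Weights\<close>

text \<open>The Japanese bracket (1 + |\<zeta>|^2)^(1/2), written as a norm so that it inherits the
  triangle inequality.\<close>

definition jb :: "'a::real_normed_vector \<Rightarrow> real" where "jb \<zeta> = norm (1::real, \<zeta>)"

lemma jb_ge1: "jb \<zeta> \<ge> 1"
  unfolding jb_def using norm_fst_le[of "1::real" \<zeta>] by simp

lemma jb_pos [simp]: "jb \<zeta> > 0" using jb_ge1[of \<zeta>] by linarith

lemma jb_ge_norm: "jb \<zeta> \<ge> norm \<zeta>"
  unfolding jb_def by (rule norm_snd_le)

lemma jb_triangle: "jb \<zeta> \<le> jb \<zeta>' + norm (\<zeta> - \<zeta>')"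
proof -
  have "(1::real, \<zeta>) = (1, \<zeta>') + (0, \<zeta> - \<zeta>')" by simp
  then have "jb \<zeta> \<le> jb \<zeta>' + norm (0::real, \<zeta> - \<zeta>')" unfolding jb_def by (metis norm_triangle_ineq)
  then show ?thesis by simp
qed

lemma jb_sq: "(jb \<zeta>)\<^sup>2 = 1 + (norm \<zeta>)\<^sup>2"
  by (simp add: jb_def norm_Pair)

lemma jb_measurable [measurable]: "jb \<in> borel_measurable borel"
  unfolding jb_def by (intro borel_measurable_continuous_onI continuous_intros)

text \<open>Two-sided comparability of x and y is assumed so that negative exponents are covered
  together with positive ones.\<close>

lemma powr_ratio:
  assumes "0 < x" "0 < y" "1 \<le> c" "x \<le> c * y" "y \<le> c * (x::real)"
  shows "x powr s \<le> c powr \<bar>s\<bar> * y powr s"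
proof (cases "s \<ge> 0")
  case True
  then have "x powr s \<le> (c * y) powr s" using assms by (intro powr_mono2) auto
  then show ?thesis using True assms by (simp add: powr_mult)
next
  case False
  have "x powr s \<le> (y / c) powr s" using assms False by (intro powr_mono2') (auto simp: field_simps)
  then show ?thesis using False assms by (simp add: powr_divide powr_minus field_simps)
qed

definition jw :: "real \<Rightarrow> 'a::real_normed_vector \<Rightarrow> real" where "jw s \<zeta> = jb \<zeta> powr s"

lemma jw_pos [simp]: "jw s \<zeta> > 0" by (simp add: jw_def less_imp_neq[OF jb_pos, symmetric])

lemma jw_nonneg [simp]: "jw s \<zeta> \<ge> 0" by (simp add: jw_def)

lemma jw_measurable [measurable]: "jw s \<in> borel_measurable borel"
  unfolding jw_def by measurable

lemma hs_norm_hat_eq: "hs_norm_hat s g = esqrt (Nsq (jw s) g)"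
proof -
  have "(1 + (norm \<zeta>)\<^sup>2) powr s * (cmod (g \<zeta>))\<^sup>2 = (\<bar>jw s \<zeta>\<bar> * cmod (g \<zeta>))\<^sup>2" for \<zeta>
  proof -
    have "(jw s \<zeta>)\<^sup>2 = ((jb \<zeta>)\<^sup>2) powr s"
      unfolding jw_def using jb_pos[of \<zeta>] by (simp add: power2_eq_square powr_mult)
    then show ?thesis by (simp add: jb_sq power_mult_distrib)
  qed
  then show ?thesis unfolding hs_norm_hat_def Nsq_def by (simp add: ennreal_power)
qed

lemma powr_le_power: "1 \<le> x \<Longrightarrow> x powr \<bar>s\<bar> \<le> x ^ nat \<lceil>\<bar>s\<bar>\<rceil>" for x s :: real
proof -
  assume x: "1 \<le> x"
  have "x powr \<bar>s\<bar> \<le> x powr real (nat \<lceil>\<bar>s\<bar>\<rceil>)" using x by (intro powr_mono) linarith+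
  also have "\<dots> = x ^ nat \<lceil>\<bar>s\<bar>\<rceil>" using x by (intro powr_realpow) linarith
  finally show ?thesis .
qed

text \<open>Peetre's inequality; the exponent is rounded up to a natural number to match the weights
  for which Schwartz functions are known to be integrable.\<close>

lemma jw_peetre: "jw s \<zeta> \<le> (1 + norm \<theta>) ^ nat \<lceil>\<bar>s\<bar>\<rceil> * jw s (\<zeta> - \<theta>)"
proof -
  have a: "jb \<zeta> \<le> jb (\<zeta> - \<theta>) + norm \<theta>" "jb (\<zeta> - \<theta>) \<le> jb \<zeta> + norm \<theta>"
    using jb_triangle[of \<zeta> "\<zeta> - \<theta>"] jb_triangle[of "\<zeta> - \<theta>" \<zeta>] by auto
  have b: "x + norm \<theta> \<le> (1 + norm \<theta>) * x" if "x \<ge> 1" for x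
    using mult_left_mono[OF that norm_ge_zero[of \<theta>]] by (simp add: algebra_simps)
  have "jw s \<zeta> \<le> (1 + norm \<theta>) powr \<bar>s\<bar> * jw s (\<zeta> - \<theta>)"
    unfolding jw_def
    by (rule powr_ratio) (use a b[OF jb_ge1, of "\<zeta> - \<theta>"] b[OF jb_ge1, of \<zeta>] in auto)
  also have "\<dots> \<le> (1 + norm \<theta>) ^ nat \<lceil>\<bar>s\<bar>\<rceil> * jw s (\<zeta> - \<theta>)"
    by (intro mult_right_mono powr_le_power) auto
  finally show ?thesis .
qed

text \<open>The point is the absolute constant 2: the factor growing with the shift only multiplies a term
  of lower order. The shift is either small or large compared with the weight.\<close>

lemma jw_peetre_sharp:
  "\<exists>C\<ge>0. \<forall>\<zeta> \<theta> :: 'a::real_normed_vector. jw s \<zeta> \<le> 2 * jw s (\<zeta> - \<theta>) + C * (1 + norm \<theta>) ^ Suc (nat \<lceil>\<bar>s\<bar>\<rceil>) * (jw s (\<zeta> - \<theta>) / jb (\<zeta> - \<theta>))"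
proof -
  \<comment> \<open>Brackets with ratio at most c have s-th powers with ratio at most c^|s| \<le> 2.
    Below, d = 1 - 1/c is the relative shift for which both 1 + d \<le> c and c (1 - d) = 1.\<close>
  define c where "c = (2::real) powr (1 / (\<bar>s\<bar> + 1))"
  have c1: "c > 1" unfolding c_def by simp
  have c2: "c powr \<bar>s\<bar> \<le> 2"
  proof -
    have "c powr \<bar>s\<bar> = 2 powr (\<bar>s\<bar> / (\<bar>s\<bar> + 1))" unfolding c_def by (simp add: powr_powr)
    also have "\<dots> \<le> 2 powr 1" by (intro powr_mono) (auto simp: divide_simps)
    finally show ?thesis by simp
  qed
  define d where "d = 1 - 1 / c"
  have d: "0 < d" "d < 1" "c * (1 - d) = 1" using c1 by (auto simp: d_def field_simps)
  have d2: "1 + d \<le> c"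
  proof -
    have "(1 + d) * (1 - d) \<le> 1" by (simp add: algebra_simps)
    then have "c * ((1 + d) * (1 - d)) \<le> c * 1" using c1 by (intro mult_left_mono) auto
    moreover have "c * ((1 + d) * (1 - d)) = 1 + d" using d(3) by (metis mult.assoc mult.commute mult.right_neutral)
    ultimately show ?thesis by simp
  qed
  have "jw s \<zeta> \<le> 2 * jw s (\<zeta> - \<theta>) + 1 / d * (1 + norm \<theta>) ^ Suc (nat \<lceil>\<bar>s\<bar>\<rceil>) * (jw s (\<zeta> - \<theta>) / jb (\<zeta> - \<theta>))" for \<zeta> \<theta> :: 'a
  proof (cases "norm \<theta> \<le> d * jb (\<zeta> - \<theta>)")
    case True
    let ?b = "jb (\<zeta> - \<theta>)"
    have "jb \<zeta> \<le> ?b + norm \<theta>" "?b \<le> jb \<zeta> + norm \<theta>"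
      using jb_triangle[of \<zeta> "\<zeta> - \<theta>"] jb_triangle[of "\<zeta> - \<theta>" \<zeta>] by auto
    then have "jb \<zeta> \<le> (1 + d) * ?b" "(1 - d) * ?b \<le> jb \<zeta>" using True by (auto simp: algebra_simps)
    then have "jb \<zeta> \<le> c * ?b" "?b \<le> c * jb \<zeta>"
    proof -
      show "jb \<zeta> \<le> c * ?b" using \<open>jb \<zeta> \<le> (1 + d) * ?b\<close> mult_right_mono[OF d2, of ?b] less_imp_le[OF jb_pos] by (metis order_trans)
      have "c * ((1 - d) * ?b) \<le> c * jb \<zeta>" using \<open>(1 - d) * ?b \<le> jb \<zeta>\<close> c1 by (intro mult_left_mono) auto
      then show "?b \<le> c * jb \<zeta>" using d(3) by (simp add: mult.assoc[symmetric])
    qed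
    then have "jw s \<zeta> \<le> c powr \<bar>s\<bar> * jw s (\<zeta> - \<theta>)"
      unfolding jw_def using c1 by (intro powr_ratio) auto
    also have "\<dots> \<le> 2 * jw s (\<zeta> - \<theta>)" using c2 by (intro mult_right_mono) auto
    also have "\<dots> \<le> 2 * jw s (\<zeta> - \<theta>) + 1 / d * (1 + norm \<theta>) ^ Suc (nat \<lceil>\<bar>s\<bar>\<rceil>) * (jw s (\<zeta> - \<theta>) / jb (\<zeta> - \<theta>))"
      using d(1) less_imp_le[OF jb_pos] by (simp add: divide_nonneg_pos)
    finally show ?thesis .
  next
    case False
    let ?b = "jb (\<zeta> - \<theta>)" and ?n = "nat \<lceil>\<bar>s\<bar>\<rceil>"
    \<comment> \<open>For a large shift this quotient exceeds 1, so multiplying by it buys the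
      division by the bracket at the price of one more power of 1 + |\<theta>|.\<close>
    have "1 \<le> (1 + norm \<theta>) / (d * ?b)" using False d(1) jb_pos[of "\<zeta> - \<theta>"] by (simp add: pos_le_divide_eq)
    then have "(1 + norm \<theta>) ^ ?n * jw s (\<zeta> - \<theta>) * 1 \<le> (1 + norm \<theta>) ^ ?n * jw s (\<zeta> - \<theta>) * ((1 + norm \<theta>) / (d * ?b))"
      by (intro mult_left_mono) auto
    then have "jw s \<zeta> \<le> 1 / d * (1 + norm \<theta>) ^ Suc ?n * (jw s (\<zeta> - \<theta>) / ?b)"
      using jw_peetre[of s \<zeta> \<theta>] by (simp add: mult_ac)
    also have "\<dots> \<le> 2 * jw s (\<zeta> - \<theta>) + 1 / d * (1 + norm \<theta>) ^ Suc ?n * (jw s (\<zeta> - \<theta>) / ?b)" by simp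
    finally show ?thesis .
  qed
  then show ?thesis using d(1) by (intro exI[of _ "1 / d"]) auto
qed

text \<open>Again by the dichotomy between small and large shifts.\<close>

lemma powr_diff_bound:
  fixes p \<delta> :: real
  assumes p: "0 < p" "p < 2" and \<delta>: "0 < \<delta>"
  shows "\<exists>C\<ge>0. \<forall>x\<ge>0. \<forall>y\<ge>0. \<bar>x powr p - y powr p\<bar> \<le> \<delta> * y powr p + C * (1 + \<bar>x - y\<bar>)\<^sup>2"
proof -
  \<comment> \<open>For d \<le> 1/2 the numbers (1 + d)^p and (1 - d)^p differ from 1 by at most 3
    d, which is at most \<delta>.\<close>
  define d where "d = min (1/2) (\<delta> / 3)"
  have d: "0 < d" "d \<le> 1/2" "3 * d \<le> \<delta>" using \<delta> by (auto simp: d_def)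
  define C where "C = 2 * (1 / d + 2)\<^sup>2"
  have "\<bar>x powr p - y powr p\<bar> \<le> \<delta> * y powr p + C * (1 + \<bar>x - y\<bar>)\<^sup>2" if xy: "x \<ge> 0" "y \<ge> 0" for x y
  proof (cases "\<bar>x - y\<bar> \<le> d * y")
    case True
    have "x powr p \<le> ((1 + d) * y) powr p" using True xy p by (intro powr_mono2) (auto simp: algebra_simps)
    also have "\<dots> = (1 + d) powr p * y powr p" using xy d by (simp add: powr_mult)
    also have "(1 + d) powr p \<le> (1 + d) powr 2" using p d by (intro powr_mono) auto
    also have "(1 + d) powr 2 = (1 + d)\<^sup>2" using d by simp
    also have "(1 + d)\<^sup>2 \<le> 1 + 3 * d" using d mult_left_mono[of d 1 d] by (simp add: power2_eq_square algebra_simps)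
    finally have u: "x powr p \<le> (1 + 3 * d) * y powr p" by (simp add: mult_right_mono)
    have "(1 - 2 * d) \<le> (1 - d)\<^sup>2" by (simp add: power2_eq_square algebra_simps)
    also have "(1 - d)\<^sup>2 = (1 - d) powr 2" using d by simp
    also have "\<dots> \<le> (1 - d) powr p" using p d by (intro powr_mono') auto
    finally have "(1 - 2 * d) * y powr p \<le> (1 - d) powr p * y powr p" by (intro mult_right_mono) auto
    also have "\<dots> = ((1 - d) * y) powr p" using xy d by (simp add: powr_mult)
    also have "\<dots> \<le> x powr p" using True xy p d mult_right_mono[of d 1 y] by (intro powr_mono2) (auto simp: algebra_simps)
    finally have l: "(1 - 2 * d) * y powr p \<le> x powr p" .
    have "d * y powr p \<ge> 0" using d by simp
    then have "\<bar>x powr p - y powr p\<bar> \<le> (3 * d) * y powr p" using u l by (simp add: algebra_simps abs_le_iff)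
    also have "\<dots> \<le> \<delta> * y powr p" using d by (intro mult_right_mono) auto
    also have "\<dots> \<le> \<delta> * y powr p + C * (1 + \<bar>x - y\<bar>)\<^sup>2" by (simp add: C_def)
    finally show ?thesis .
  next
    case False
    let ?e = "\<bar>x - y\<bar>"
    \<comment> \<open>Now y, and with it x, is bounded by a multiple of |x - y|; as p < 2 both
      powers disappear in the quadratic remainder.\<close>
    have y: "y \<le> ?e / d" using False d by (simp add: field_simps)
    have b: "z powr p \<le> ((1 / d + 2) * (1 + ?e))\<^sup>2" if "z \<ge> 0" "z \<le> ?e / d + ?e" for z
    proof -
      have "z \<le> (1 / d + 2) * (1 + ?e)" using that d(1) by (simp add: distrib_left distrib_right) (smt (verit) divide_nonneg_pos abs_ge_zero zero_less_divide_1_iff)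
      then have "z powr p \<le> ((1 / d + 2) * (1 + ?e)) powr p" using that p by (intro powr_mono2) auto
      also have "\<dots> \<le> ((1 / d + 2) * (1 + ?e)) powr 2"
      proof (intro powr_mono)
        have "1 * 1 \<le> (1 / d + 2) * (1 + ?e)" using d(1) by (intro mult_mono) auto
        then show "1 \<le> (1 / d + 2) * (1 + ?e)" by simp
      qed (use p in auto)
      also have "\<dots> = ((1 / d + 2) * (1 + ?e))\<^sup>2" using d(1) by (intro powr_numeral mult_pos_pos) (auto intro: add_pos_nonneg)
      finally show ?thesis .
    qed
    have "x powr p \<le> ((1 / d + 2) * (1 + ?e))\<^sup>2" "y powr p \<le> ((1 / d + 2) * (1 + ?e))\<^sup>2"
      using y xy by (auto intro!: b)
    moreover have "x powr p \<ge> 0" "y powr p \<ge> 0" by auto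
    ultimately have "\<bar>x powr p - y powr p\<bar> \<le> 2 * ((1 / d + 2) * (1 + ?e))\<^sup>2" by linarith
    also have "\<dots> = C * (1 + ?e)\<^sup>2" by (simp add: C_def power_mult_distrib)
    also have "\<dots> \<le> \<delta> * y powr p + C * (1 + ?e)\<^sup>2" using \<delta> by simp
    finally show ?thesis .
  qed
  then show ?thesis by (intro exI[of _ C]) (auto simp: C_def)
qed

subsection \<open>Constant coefficients: integration along characteristics\<close>

lemma powr_add_le:
  fixes x y p :: real
  assumes "0 \<le> x" "0 \<le> y" "0 < p" "p < 2"
  shows "(x + y) powr p \<le> 4 * (x powr p + y powr p)"
proof -
  have "(x + y) powr p \<le> (2 * max x y) powr p" using assms by (intro powr_mono2) auto
  also have "\<dots> = 2 powr p * (max x y) powr p" using assms by (simp add: powr_mult)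
  also have "\<dots> \<le> 4 * (max x y) powr p"
  proof (intro mult_right_mono)
    have "(2::real) powr p \<le> 2 powr 2" using assms by (intro powr_mono) auto
    then show "(2::real) powr p \<le> 4" by simp
  qed auto
  also have "(max x y) powr p \<le> x powr p + y powr p" by (auto simp: max_def)
  finally show ?thesis by simp
qed

lemma power_exp_bound:
  fixes a :: real
  assumes "0 < a"
  shows "\<exists>C\<ge>1. \<forall>x\<ge>0. (1 + x) ^ n \<le> C * exp (a * x)"
proof -
  \<comment> \<open>This choice gives 1 + x \<le> m (1 + a x / (n + 1)) \<le> m exp(a x / (n + 1)),
    which is raised to the power n + 1; using n + 1 in place of n avoids a division by zero for n =
    0.\<close>
  define m where "m = max 1 (real (Suc n) / a)"
  have "(1 + x) ^ n \<le> m ^ Suc n * exp (a * x)" if x: "x \<ge> 0" for x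
  proof -
    have e: "real (Suc n) \<le> m * a" using assms by (simp add: m_def field_simps max_def)
    have "x \<le> m * (a * x / real (Suc n))"
    proof -
      have "x * real (Suc n) \<le> x * (m * a)" using e x by (intro mult_left_mono) auto
      then show ?thesis by (simp add: field_simps)
    qed
    then have "1 + x \<le> m * (1 + a * x / real (Suc n))" unfolding distrib_left by (intro add_mono) (auto simp: m_def)
    also have "\<dots> \<le> m * exp (a * x / real (Suc n))" by (intro mult_left_mono exp_ge_add_one_self) (auto simp: m_def)
    finally have "(1 + x) ^ Suc n \<le> (m * exp (a * x / real (Suc n))) ^ Suc n" using x by (intro power_mono) auto
    also have "\<dots> = m ^ Suc n * exp (a * x)"
      unfolding power_mult_distrib exp_of_nat_mult[symmetric] by simp
    finally have *: "(1 + x) ^ Suc n \<le> m ^ Suc n * exp (a * x)" .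
    have "(1 + x) ^ n \<le> (1 + x) ^ Suc n" using x by (intro power_increasing) auto
    then show ?thesis using * by linarith
  qed
  moreover have "m ^ Suc n \<ge> 1" by (intro one_le_power) (simp add: m_def)
  ultimately show ?thesis by blast
qed

text \<open>A point moving on a line with speed |\<xi>| cannot stay near the origin. If |\<eta>|
  dominates the total displacement, the first quarter of the time interval is good. Otherwise either
  the first quarter is good or the point comes close to 0 during it, and then the last quarter is
  good.\<close>

lemma affine_norm_lower:
  fixes \<eta> \<xi> :: "'a::real_normed_vector"
  assumes "\<rho> \<ge> 0"
  obtains a b where "0 \<le> a" "a \<le> b" "b \<le> \<rho>" "b - a = \<rho> / 4"
    "\<And>q. a \<le> q \<Longrightarrow> q \<le> b \<Longrightarrow> norm (\<eta> + q *\<^sub>R \<xi>) \<ge> max (norm \<eta>) (\<rho> * norm \<xi>) / 16"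
proof (cases "\<rho> * norm \<xi> \<le> norm \<eta> / 2")
  case True
  have "norm (\<eta> + q *\<^sub>R \<xi>) \<ge> max (norm \<eta>) (\<rho> * norm \<xi>) / 16" if "0 \<le> q" "q \<le> \<rho> / 4" for q
  proof -
    have "norm (q *\<^sub>R \<xi>) \<le> \<rho> * norm \<xi>" using that assms by (auto intro!: mult_right_mono)
    moreover have "norm \<eta> \<le> norm (\<eta> + q *\<^sub>R \<xi>) + norm (q *\<^sub>R \<xi>)"
      using norm_triangle_ineq4[of "\<eta> + q *\<^sub>R \<xi>" "q *\<^sub>R \<xi>"] by simp
    ultimately have "norm (\<eta> + q *\<^sub>R \<xi>) \<ge> norm \<eta> / 2" using True by linarith
    moreover have "max (norm \<eta>) (\<rho> * norm \<xi>) \<le> norm \<eta>" using True norm_ge_zero[of \<eta>] by linarith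
    ultimately show ?thesis using norm_ge_zero[of \<eta>] by linarith
  qed
  then show ?thesis using assms by (intro that[of 0 "\<rho> / 4"]) auto
next
  case False
  let ?r = "\<rho> * norm \<xi>"
  have r: "max (norm \<eta>) ?r / 16 \<le> ?r / 8" using False assms by (auto simp: max_def)
  show ?thesis
  proof (cases "\<forall>q. 0 \<le> q \<longrightarrow> q \<le> \<rho> / 4 \<longrightarrow> norm (\<eta> + q *\<^sub>R \<xi>) \<ge> ?r / 8")
    case True
    with order_trans[OF r] show ?thesis using assms by (intro that[of 0 "\<rho> / 4"]) auto
  next
    case False
    then obtain q1 where q1: "0 \<le> q1" "q1 \<le> \<rho> / 4" "norm (\<eta> + q1 *\<^sub>R \<xi>) < ?r / 8" by auto
    \<comment> \<open>The times q1 and q are at least \<rho>/2 apart, so the displacement between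
      them is at least half of \<rho> |\<xi>|, while the earlier position is closer than an eighth
      of it.\<close>
    have "norm (\<eta> + q *\<^sub>R \<xi>) \<ge> ?r / 8" if "3 * \<rho> / 4 \<le> q" "q \<le> \<rho>" for q
    proof -
      have "\<eta> + q *\<^sub>R \<xi> = (\<eta> + q1 *\<^sub>R \<xi>) + (q - q1) *\<^sub>R \<xi>" by (simp add: algebra_simps)
      then have "norm ((q - q1) *\<^sub>R \<xi>) \<le> norm (\<eta> + q *\<^sub>R \<xi>) + norm (\<eta> + q1 *\<^sub>R \<xi>)"
        by (metis add_diff_cancel_left' norm_triangle_ineq4)
      moreover have "norm ((q - q1) *\<^sub>R \<xi>) \<ge> (\<rho> / 2) * norm \<xi>"
        using that q1 mult_right_mono[of "\<rho> / 2" "q - q1" "norm \<xi>"] by simp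
      moreover have "0 \<le> ?r" using assms by simp
      ultimately show ?thesis using q1(3) by linarith
    qed
    from order_trans[OF r this] show ?thesis using assms by (intro that[of "3 * \<rho> / 4" \<rho>]) auto
  qed
qed

text \<open>Only the good quarter of the interval is kept. The constant is 4 from its length, 16^p
  \<le> 256 from the lower bound for the norm, and 2 because a maximum replaces a sum: 4 * 256 * 2 =
  2048.\<close>

lemma integral_affine_lower:
  fixes \<eta> \<xi> :: "'a::real_normed_vector"
  assumes \<rho>: "\<rho> \<ge> 0" and p: "0 < p" "p < 2" and k: "k \<ge> 0"
    and S: "continuous_on {0..\<rho>} S" "\<And>q. 0 \<le> q \<Longrightarrow> q \<le> \<rho> \<Longrightarrow> S q \<ge> k * (1 + norm (\<eta> + q *\<^sub>R \<xi>) powr p)"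
  shows "integral {0..\<rho>} S \<ge> k / 2048 * \<rho> * (1 + norm \<eta> powr p + (\<rho> * norm \<xi>) powr p)"
proof -
  obtain a b where ab: "0 \<le> a" "a \<le> b" "b \<le> \<rho>" "b - a = \<rho> / 4"
    "\<And>q. a \<le> q \<Longrightarrow> q \<le> b \<Longrightarrow> norm (\<eta> + q *\<^sub>R \<xi>) \<ge> max (norm \<eta>) (\<rho> * norm \<xi>) / 16"
    using affine_norm_lower[OF \<rho>, of \<eta> \<xi>] by metis
  let ?m = "max (norm \<eta>) (\<rho> * norm \<xi>)"
  have Sc: "S q \<ge> k * (1 + (?m / 16) powr p)" if "q \<in> {a..b}" for q
  proof -
    have "(?m / 16) powr p \<le> norm (\<eta> + q *\<^sub>R \<xi>) powr p" using ab that p \<rho> by (intro powr_mono2) (auto simp: max_def)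
    then have "k * (1 + (?m / 16) powr p) \<le> k * (1 + norm (\<eta> + q *\<^sub>R \<xi>) powr p)" using k by (intro mult_left_mono) auto
    then show ?thesis using S(2)[of q] ab that by auto
  qed
  have pos: "S q \<ge> 0" if "q \<in> {0..\<rho>}" for q
  proof -
    have "0 \<le> k * (1 + norm (\<eta> + q *\<^sub>R \<xi>) powr p)" using k by (intro mult_nonneg_nonneg) auto
    then show ?thesis using S(2)[of q] that by auto
  qed
  have i: "S integrable_on {0..\<rho>}" by (rule integrable_continuous_real[OF S(1)])
  have i2: "S integrable_on {a..b}" using ab by (intro integrable_continuous_real continuous_on_subset[OF S(1)]) auto
  have "(b - a) * (k * (1 + (?m / 16) powr p)) = integral {a..b} (\<lambda>_. k * (1 + (?m / 16) powr p))" using ab by simp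
  also have "\<dots> \<le> integral {a..b} S" using i2 Sc by (intro integral_le) auto
  also have "\<dots> \<le> integral {0..\<rho>} S" using ab i i2 pos by (intro integral_subset_le) auto
  finally have 1: "\<rho> / 4 * (k * (1 + (?m / 16) powr p)) \<le> integral {0..\<rho>} S" using ab(4) by simp
  have 2: "(?m / 16) powr p \<ge> (norm \<eta> powr p + (\<rho> * norm \<xi>) powr p) / 512"
  proof -
    have "(?m / 16) powr p = ?m powr p / 16 powr p" using \<rho> by (simp add: powr_divide max_def)
    moreover have "(16::real) powr p \<le> 256" using powr_mono[of p 2 "16::real"] p by simp
    moreover have "?m powr p \<ge> 0" by simp
    ultimately have "(?m / 16) powr p \<ge> ?m powr p / 256"
      using divide_left_mono[of "16 powr p" 256 "?m powr p"] by simp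
    moreover have "norm \<eta> powr p \<le> ?m powr p" "(\<rho> * norm \<xi>) powr p \<le> ?m powr p" using p \<rho> by (auto intro!: powr_mono2)
    moreover have "(A + B) / 512 \<le> x" if "m / 256 \<le> x" "A \<le> m" "B \<le> m" for A B m x :: real
      using that by (simp add: field_simps)
    ultimately show ?thesis by blast
  qed
  have "k / 2048 * \<rho> * (1 + norm \<eta> powr p + (\<rho> * norm \<xi>) powr p) = (\<rho> / 4 * k) * ((1 + norm \<eta> powr p + (\<rho> * norm \<xi>) powr p) / 512)"
    by simp
  also have "\<dots> \<le> (\<rho> / 4 * k) * (1 + (?m / 16) powr p)"
    using 2 \<rho> k by (intro mult_left_mono) auto
  finally show ?thesis using 1 unfolding mult.assoc[of "\<rho> / 4" k] by (rule order_trans)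
qed

text \<open>The equation is solved backwards from infinity, where the damping kills the boundary term.\<close>

lemma duhamel_bound:
  fixes h h' f :: "real \<Rightarrow> complex" and S :: "real \<Rightarrow> real"
  assumes h: "\<And>r. (h has_vector_derivative h' r) (at r)" and bd: "\<And>r. cmod (h r) \<le> M"
    and S: "continuous_on UNIV S" "\<And>r. S r \<ge> k" "k > 0"
    and f: "continuous_on UNIV f" "\<And>r. f r = (\<i> * of_real t + of_real (S r)) * h r - h' r"
    and E: "\<And>r. r \<ge> 0 \<Longrightarrow> integral {0..r} S \<ge> D r"
  shows "ennreal (cmod (h 0)) \<le> (\<integral>\<^sup>+r. ennreal (indicator {0..} r * exp (- D r) * cmod (f r)) \<partial>lborel)"
    (is "_ \<le> ?I")
proof (rule ennreal_le_epsilon)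
  fix e :: real assume e: "e > 0"
  define N where "N r = integral {0..r} S" for r
  have M: "M \<ge> 0" using order_trans[OF norm_ge_zero bd] .
  have Nk: "N r \<ge> k * r" if "r \<ge> 0" for r
  proof -
    have "integral {0..r} (\<lambda>_. k) \<le> integral {0..r} S"
      using S by (intro integral_le integrable_continuous_real continuous_on_subset[OF S(1)]) auto
    then show ?thesis using that by (simp add: N_def mult.commute)
  qed
  \<comment> \<open>The accumulated damping is at least k r and h is bounded, so the boundary term
    at \<open>R\<close> can be made smaller than the given e.\<close>
  have "((\<lambda>r. M * exp (- (k * r))) \<longlongrightarrow> M * 0) at_top"
    using S(3) by (intro tendsto_mult tendsto_const filterlim_compose[OF exp_at_bot])
      (simp add: filterlim_uminus_at_bot filterlim_tendsto_pos_mult_at_top[OF tendsto_const] filterlim_ident)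
  then have "\<forall>\<^sub>F r in at_top. M * exp (- (k * r)) < e" using e by (intro order_tendstoD) auto
  then obtain R where R: "R \<ge> 0" "M * exp (- (k * R)) < e"
    by (metis (mono_tags, lifting) eventually_at_top_linorder linorder_le_cases order_refl)
  \<comment> \<open>Integrating factor: with it the equation for h reads \<phi>' = g, so the
    zeroth-order terms cancel and the fundamental theorem expresses h 0.\<close>
  define \<phi> where "\<phi> r = h r * exp (- (of_real (N r) + \<i> * of_real t * of_real r))" for r
  define g where "g r = - f r * exp (- (of_real (N r) + \<i> * of_real t * of_real r))" for r
  have dN: "(N has_real_derivative S r) (at r within {0..R})" if "r \<in> {0..R}" for r
    unfolding N_def using integral_has_real_derivative[of 0 R S r] that continuous_on_subset[OF S(1)] by auto
  have d\<phi>: "(\<phi> has_vector_derivative g r) (at r within {0..R})" if "r \<in> {0..R}" for r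
  proof -
    have "((\<lambda>r. - (of_real (N r) + \<i> * of_real t * of_real r)) has_vector_derivative - (of_real (S r) + \<i> * of_real t)) (at r within {0..R})"
    proof -
      have "((\<lambda>r. complex_of_real (N r)) has_vector_derivative complex_of_real (S r)) (at r within {0..R})"
        using dN[OF that] by (intro has_vector_derivative_of_real) (simp add: has_real_derivative_iff_has_vector_derivative)
      moreover have "((\<lambda>r. complex_of_real r) has_vector_derivative complex_of_real 1) (at r within {0..R})"
        by (intro has_vector_derivative_of_real DERIV_ident)
      ultimately show ?thesis
        using has_vector_derivative_minus[OF has_vector_derivative_add[OF _ has_vector_derivative_mult_right]] by fastforce
    qed
    from field_vector_diff_chain_within[OF this DERIV_subset[OF DERIV_exp]]
    have "((\<lambda>r. exp (- (of_real (N r) + \<i> * of_real t * of_real r))) has_vector_derivative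
       - (of_real (S r) + \<i> * of_real t) * exp (- (of_real (N r) + \<i> * of_real t * of_real r))) (at r within {0..R})"
      by (simp add: o_def)
    from has_vector_derivative_mult[OF has_vector_derivative_at_within[OF h] this]
    have "(\<phi> has_vector_derivative (h r * (- (of_real (S r) + \<i> * of_real t) * exp (- (of_real (N r) + \<i> * of_real t * of_real r)))
       + h' r * exp (- (of_real (N r) + \<i> * of_real t * of_real r)))) (at r within {0..R})"
      unfolding \<phi>_def .
    moreover have "h r * (- (of_real (S r) + \<i> * of_real t) * exp (- (of_real (N r) + \<i> * of_real t * of_real r)))
       + h' r * exp (- (of_real (N r) + \<i> * of_real t * of_real r)) = g r"
      unfolding g_def f(2) by (simp add: algebra_simps)
    ultimately show ?thesis by simp
  qed
  have cN: "continuous_on {0..R} N"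
    using dN by (intro DERIV_continuous_on) auto
  have cg: "continuous_on {0..R} g"
    unfolding g_def by (intro continuous_intros cN continuous_on_subset[OF f(1)]) auto
  have "integral\<^sup>L lborel (\<lambda>r. indicator {0..R} r *\<^sub>R g r) = \<phi> R - \<phi> 0"
    by (rule integral_FTC_Icc) (use R d\<phi> cg in auto)
  then have "\<phi> 0 = \<phi> R - integral\<^sup>L lborel (\<lambda>r. indicator {0..R} r *\<^sub>R g r)" by simp
  moreover have "\<phi> 0 = h 0" by (simp add: \<phi>_def N_def)
  ultimately have "cmod (h 0) \<le> cmod (\<phi> R) + cmod (integral\<^sup>L lborel (\<lambda>r. indicator {0..R} r *\<^sub>R g r))"
    by (metis norm_triangle_ineq4)
  moreover have "cmod (\<phi> R) \<le> e"
  proof -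
    have "cmod (\<phi> R) = cmod (h R) * exp (- N R)" by (simp add: \<phi>_def norm_mult norm_exp_eq_Re)
    also have "\<dots> \<le> M * exp (- (k * R))" using Nk[OF R(1)] bd M by (intro mult_mono) auto
    finally show ?thesis using R by simp
  qed
  ultimately have "cmod (h 0) \<le> e + cmod (integral\<^sup>L lborel (\<lambda>r. indicator {0..R} r *\<^sub>R g r))" by linarith
  then have "ennreal (cmod (h 0)) \<le> ennreal (e + cmod (integral\<^sup>L lborel (\<lambda>r. indicator {0..R} r *\<^sub>R g r)))" by (rule ennreal_leI)
  also have "\<dots> = ennreal e + ennreal (cmod (integral\<^sup>L lborel (\<lambda>r. indicator {0..R} r *\<^sub>R g r)))" using e by simp
  also have "ennreal (cmod (integral\<^sup>L lborel (\<lambda>r. indicator {0..R} r *\<^sub>R g r))) \<le> (\<integral>\<^sup>+r. ennreal (cmod (indicator {0..R} r *\<^sub>R g r)) \<partial>lborel)"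
    by (rule norm_integral_le_nn)
  also have "\<dots> \<le> ?I"
  proof (intro nn_integral_mono ennreal_leI)
    fix r
    show "cmod (indicator {0..R} r *\<^sub>R g r) \<le> indicator {0..} r * exp (- D r) * cmod (f r)"
    proof (cases "r \<in> {0..R}")
      case True
      then have "exp (- N r) \<le> exp (- D r)" using E[of r] by (simp add: N_def)
      then have "cmod (f r) * exp (- N r) \<le> cmod (f r) * exp (- D r)" by (intro mult_left_mono) auto
      then show ?thesis using True by (simp add: g_def norm_mult norm_exp_eq_Re mult.commute)
    qed auto
  qed
  finally show "ennreal (cmod (h 0)) \<le> ?I + ennreal e" by (simp add: add.commute)
qed

text \<open>The part of \<open>lhs_symbol\<close> that does not involve the time frequency, with p
  standing for 2 \<sigma>.\<close>

definition vw :: "real \<Rightarrow> 'n::finite pt \<Rightarrow> real" where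
  "vw p \<zeta> = 1 + norm (fst (snd \<zeta>)) powr (p / (p + 1)) + norm (snd (snd \<zeta>)) powr p"

lemma vw_ge1: "vw p \<zeta> \<ge> 1" by (simp add: vw_def)

lemma vw_pos [simp]: "vw p \<zeta> > 0" "vw p \<zeta> \<ge> 0" using vw_ge1[of p \<zeta>] by auto

lemma norm_powr_measurable [measurable]:
  "f \<in> borel_measurable M \<Longrightarrow> (\<lambda>x. norm (f x :: 'a::euclidean_space) powr p) \<in> borel_measurable M"
  by measurable

lemma vw_measurable [measurable]: "vw p \<in> borel_measurable borel"
proof -
  have [measurable]: "(\<lambda>\<zeta>::'a pt. fst (snd \<zeta>)) \<in> borel_measurable borel" "(\<lambda>\<zeta>::'a pt. snd (snd \<zeta>)) \<in> borel_measurable borel"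
    by (intro borel_measurable_continuous_onI continuous_intros)+
  show ?thesis unfolding vw_def[abs_def] by measurable
qed

text \<open>The flow of \<xi> . grad_\<eta> at time \<rho>, that is, motion along a
  characteristic.\<close>

definition shear :: "real \<Rightarrow> 'n::finite pt \<Rightarrow> 'n pt" where
  "shear \<rho> \<zeta> = (fst \<zeta>, fst (snd \<zeta>), snd (snd \<zeta>) + \<rho> *\<^sub>R fst (snd \<zeta>))"

lemma shear_measurable [measurable]: "(\<lambda>(\<zeta>, \<rho>). shear \<rho> \<zeta>) \<in> borel_measurable (borel \<Otimes>\<^sub>M borel)"
  unfolding borel_prod shear_def case_prod_beta'
  by (intro borel_measurable_continuous_onI continuous_intros)

lemma shear_measurable1 [measurable]: "shear \<rho> \<in> borel_measurable borel"
  unfolding shear_def[abs_def] by (intro borel_measurable_continuous_onI continuous_intros)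

text \<open>With the first two components fixed the shear is a translation of the third.\<close>

lemma nn_integral_shear:
  fixes f :: "'n::finite pt \<Rightarrow> ennreal"
  assumes f [measurable]: "f \<in> borel_measurable borel"
  shows "(\<integral>\<^sup>+\<zeta>. f (shear \<rho> \<zeta>) \<partial>lborel) = (\<integral>\<^sup>+\<zeta>. f \<zeta> \<partial>lborel)"
proof -
  have it: "integral\<^sup>N lborel f = (\<integral>\<^sup>+x. \<integral>\<^sup>+y. f (x, y) \<partial>lborel \<partial>lborel)" if "f \<in> borel_measurable borel"
    for f :: "'d::euclidean_space \<times> 'e::euclidean_space \<Rightarrow> ennreal"
    using lborel.nn_integral_fst[of f lborel] that by (simp add: lborel_prod)
  have s: "(\<lambda>q. g (t, q)) \<in> borel_measurable borel" if "g \<in> borel_measurable borel" for g :: "'n pt \<Rightarrow> ennreal" and t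
    using that by (rule measurable_compose[rotated]) (intro borel_measurable_continuous_onI continuous_intros)
  have e: "integral\<^sup>N lborel g = (\<integral>\<^sup>+t. \<integral>\<^sup>+x. \<integral>\<^sup>+v. g (t, x, v) \<partial>lborel \<partial>lborel \<partial>lborel)" if "g \<in> borel_measurable borel" for g :: "'n pt \<Rightarrow> ennreal"
    by (subst it[OF that], intro nn_integral_cong, subst it[OF s[OF that]]) simp
  have m: "(\<lambda>v. f (t, x, v)) \<in> borel_measurable borel" for t x
    by (rule measurable_compose[OF _ f]) (intro borel_measurable_continuous_onI continuous_intros)
  show ?thesis
    by (subst e, simp, subst e[OF f]) (simp add: shear_def lborel_nn_integral_shift[OF m])
qed

text \<open>The exponents are balanced so that both factors of the characteristic integral scale alike:
  with a = |xi|^(p/(p+1)) one has rho (rho |xi|)^p = (rho a)^(p+1).\<close>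

lemma char_scaling:
  fixes x :: real
  assumes "0 < p" "0 \<le> \<rho>" "0 \<le> x"
  shows "(\<rho> * x) powr p = (\<rho> * x powr (p / (p + 1))) powr p * x powr (p / (p + 1))"
    and "\<rho> * (\<rho> * x) powr p \<ge> \<rho> * x powr (p / (p + 1)) - 1"
proof -
  let ?a = "x powr (p / (p + 1))"
  have "p / (p + 1) * p + p / (p + 1) = p / (p + 1) * (p + 1)" by (simp only: distrib_left mult_1_right)
  then have e: "p / (p + 1) * p + p / (p + 1) = p" using assms by simp
  have "?a powr p * ?a = x powr (p / (p + 1) * p + p / (p + 1))" by (simp only: powr_powr powr_add)
  then have "?a powr p * ?a = x powr p" by (simp only: e)
  then show 1: "(\<rho> * x) powr p = (\<rho> * ?a) powr p * ?a"
    using assms by (simp add: powr_mult mult.assoc)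
  show "\<rho> * (\<rho> * x) powr p \<ge> \<rho> * ?a - 1"
  proof (cases "\<rho> * ?a \<le> 1")
    case True
    moreover have "0 \<le> \<rho> * (\<rho> * x) powr p" using assms by simp
    ultimately show ?thesis by linarith
  next
    case False
    then have "1 \<le> (\<rho> * ?a) powr p" using assms by (intro ge_one_powr_ge_zero) auto
    then have "\<rho> * ?a * 1 \<le> \<rho> * ?a * (\<rho> * ?a) powr p" using assms by (intro mult_left_mono) auto
    then show ?thesis unfolding 1 by (simp add: mult_ac)
  qed
qed

text \<open>The two hypotheses of Schur's test for one damped kernel: the first bound is integrable
  in \<rho> with \<zeta> fixed, the second after the sheared point has been made the variable. Part
  of the exponential is spent on comparing the weights at the two ends of the
  characteristic.\<close>

lemma kernel_bounds:
  fixes p k s :: real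
  assumes p: "0 < p" "p < 2" and k: "0 < k"
  shows "\<exists>C l. 0 < C \<and> 0 < l \<and> (\<forall>\<zeta> :: 'n::finite pt. \<forall>\<rho>\<ge>0.
    jw s \<zeta> * vw p \<zeta> * exp (- (k * \<rho> * (1 + norm (snd (snd \<zeta>)) powr p + (\<rho> * norm (fst (snd \<zeta>))) powr p)))
      \<le> C * jw s (shear \<rho> \<zeta>) * (vw p \<zeta> * exp (- (l * \<rho> * vw p \<zeta>))) \<and>
    jw s \<zeta> * vw p \<zeta> * exp (- (k * \<rho> * (1 + norm (snd (snd \<zeta>)) powr p + (\<rho> * norm (fst (snd \<zeta>))) powr p)))
      \<le> C * jw s (shear \<rho> \<zeta>) * (vw p (shear \<rho> \<zeta>) * exp (- (l * \<rho> * vw p (shear \<rho> \<zeta>)))))"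
proof -
  \<comment> \<open>The factor 8 accounts for comparing y^p and y'^p up to r. Of the rate l, a
    quarter pays for the ratio of the \<open>jw\<close> weights and a quarter for the ratio of V and
    V'; the rate l / 2 remains and is the one exhibited.\<close>
  define l where "l = k / 8"
  have l: "0 < l" using k by (simp add: l_def)
  obtain C1 where C1: "C1 \<ge> 1" "\<And>x. x \<ge> 0 \<Longrightarrow> (1 + x) ^ nat \<lceil>\<bar>s\<bar>\<rceil> \<le> C1 * exp (l / 4 * x)"
    using power_exp_bound[of "l / 4" "nat \<lceil>\<bar>s\<bar>\<rceil>"] l by auto
  obtain C2 where C2: "C2 \<ge> 1" "\<And>x. x \<ge> 0 \<Longrightarrow> (1 + x) ^ 2 \<le> C2 * exp (l / 4 * x)"
    using power_exp_bound[of "l / 4" 2] l by auto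
  define C where "C = C1 * (8 * C2) * exp k"
  have "jw s \<zeta> * vw p \<zeta> * exp (- (k * \<rho> * (1 + norm (snd (snd \<zeta>)) powr p + (\<rho> * norm (fst (snd \<zeta>))) powr p)))
      \<le> C * jw s (shear \<rho> \<zeta>) * (vw p \<zeta> * exp (- (l / 2 * \<rho> * vw p \<zeta>))) \<and>
    jw s \<zeta> * vw p \<zeta> * exp (- (k * \<rho> * (1 + norm (snd (snd \<zeta>)) powr p + (\<rho> * norm (fst (snd \<zeta>))) powr p)))
      \<le> C * jw s (shear \<rho> \<zeta>) * (vw p (shear \<rho> \<zeta>) * exp (- (l / 2 * \<rho> * vw p (shear \<rho> \<zeta>))))"
    if \<rho>: "\<rho> \<ge> 0" for \<zeta> :: "'n pt" and \<rho>
  proof -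
    define x where "x = norm (fst (snd \<zeta>))"
    define y where "y = norm (snd (snd \<zeta>))"
    define y' where "y' = norm (snd (snd (shear \<rho> \<zeta>)))"
    define a where "a = x powr (p / (p + 1))"
    define r where "r = (\<rho> * x) powr p"
    define V where "V = vw p \<zeta>"
    define V' where "V' = vw p (shear \<rho> \<zeta>)"
    define D where "D = k * \<rho> * (1 + y powr p + r)"
    have V: "V = 1 + a + y powr p" "V' = 1 + a + y' powr p"
      by (simp_all add: V_def V'_def vw_def a_def x_def y_def y'_def) (simp add: shear_def)
    have nn: "x \<ge> 0" "y \<ge> 0" "y' \<ge> 0" "a \<ge> 0" "r \<ge> 0" by (auto simp: x_def y_def y'_def a_def r_def)
    have V1: "V \<ge> 1" "V' \<ge> 1" using nn by (auto simp: V)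
    have yy: "y \<le> y' + \<rho> * x" "y' \<le> y + \<rho> * x"
    proof -
      have "snd (snd (shear \<rho> \<zeta>)) = snd (snd \<zeta>) + \<rho> *\<^sub>R fst (snd \<zeta>)" by (simp add: shear_def)
      moreover have "norm (\<rho> *\<^sub>R fst (snd \<zeta>)) = \<rho> * x" using \<rho> by (simp add: x_def)
      ultimately show "y \<le> y' + \<rho> * x" "y' \<le> y + \<rho> * x"
        unfolding y_def y'_def
        using norm_triangle_ineq4[of "snd (snd \<zeta>) + \<rho> *\<^sub>R fst (snd \<zeta>)" "\<rho> *\<^sub>R fst (snd \<zeta>)"]
          norm_triangle_ineq[of "snd (snd \<zeta>)" "\<rho> *\<^sub>R fst (snd \<zeta>)"] by auto
    qed
    have yp: "y powr p \<le> 4 * (y' powr p + r)" "y' powr p \<le> 4 * (y powr p + r)"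
    proof -
      have "y powr p \<le> (y' + \<rho> * x) powr p" using yy nn p by (intro powr_mono2) auto
      also have "\<dots> \<le> 4 * (y' powr p + r)" unfolding r_def using nn p \<rho> by (intro powr_add_le) auto
      finally show "y powr p \<le> 4 * (y' powr p + r)" .
      have "y' powr p \<le> (y + \<rho> * x) powr p" using yy nn p by (intro powr_mono2) auto
      also have "\<dots> \<le> 4 * (y powr p + r)" unfolding r_def using nn p \<rho> by (intro powr_add_le) auto
      finally show "y' powr p \<le> 4 * (y powr p + r)" .
    qed
    \<comment> \<open>The loss of 1 here becomes the additive -k in the lower bounds for
      \<open>D\<close>, hence the factor exp k in \<open>C\<close>.\<close>
    have ra: "r = (\<rho> * a) powr p * a" "\<rho> * r \<ge> \<rho> * a - 1"
      unfolding r_def a_def using char_scaling[of p \<rho> x] p \<rho> nn by auto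
    have D1: "D \<ge> l * \<rho> * V - k"
    proof -
      have "k * (\<rho> * (1 + y powr p) + \<rho> * r) \<ge> k * (\<rho> * (1 + y powr p) + (\<rho> * a - 1))"
        using k ra by (intro mult_left_mono) auto
      then have "D \<ge> k * (\<rho> * V) - k" by (simp add: D_def V algebra_simps)
      moreover have "l * (\<rho> * V) \<le> k * (\<rho> * V)" using k \<rho> V1 by (intro mult_right_mono) (auto simp: l_def)
      ultimately show ?thesis by (simp add: mult.assoc)
    qed
    have D2: "D \<ge> l * \<rho> * V' - k"
    proof -
      have gen: "(1 + B + q) / 8 \<le> 1 + A + q" if "B \<le> 4 * (A + q)" "0 \<le> A" "0 \<le> q" for A B q :: real
        using that by simp
      have "1 + y powr p + r \<ge> (1 + y' powr p + r) / 8" using yp(2) nn by (intro gen) auto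
      then have "k * \<rho> * ((1 + y' powr p + r) / 8) \<le> D" unfolding D_def using k \<rho> by (intro mult_left_mono) auto
      moreover have "k * \<rho> * ((1 + y' powr p + r) / 8) = l * (\<rho> * (1 + y' powr p) + \<rho> * r)" by (simp add: l_def algebra_simps)
      moreover have "l * (\<rho> * (1 + y' powr p) + \<rho> * r) \<ge> l * (\<rho> * (1 + y' powr p) + (\<rho> * a - 1))"
        using l ra by (intro mult_left_mono) auto
      moreover have "l * (\<rho> * (1 + y' powr p) + (\<rho> * a - 1)) = l * \<rho> * V' - l" by (simp add: V algebra_simps)
      moreover have "l \<le> k" using k by (simp add: l_def)
      ultimately show ?thesis by linarith
    qed
    \<comment> \<open>The shear keeps \<xi> fixed, so the displacement \<rho> |\<xi>| is at most
      \<rho> times the bracket at either end. The brackets are therefore comparable up to 1 +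
      \<rho>, uniformly in \<zeta>.\<close>
    have jr: "jw s \<zeta> \<le> C1 * exp (l / 4 * \<rho>) * jw s (shear \<rho> \<zeta>)"
    proof -
      have d: "norm (\<zeta> - shear \<rho> \<zeta>) = \<rho> * x" "norm (shear \<rho> \<zeta> - \<zeta>) = \<rho> * x"
        using \<rho> by (auto simp: shear_def x_def minus_prod_def)
      have "norm (fst (snd z)) \<le> norm z" for z :: "'n pt"
        by (cases z) (simp, rule order_trans[OF norm_fst_le norm_snd_le])
      then have "norm (fst (snd \<zeta>)) \<le> norm \<zeta>" "norm (fst (snd (shear \<rho> \<zeta>))) \<le> norm (shear \<rho> \<zeta>)"
        by blast+
      then have xj: "x \<le> jb \<zeta>" "x \<le> jb (shear \<rho> \<zeta>)"
        using jb_ge_norm[of \<zeta>] jb_ge_norm[of "shear \<rho> \<zeta>"] by (auto simp: x_def shear_def)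
      have "jb \<zeta> \<le> jb (shear \<rho> \<zeta>) + \<rho> * x" "jb (shear \<rho> \<zeta>) \<le> jb \<zeta> + \<rho> * x"
        using jb_triangle[of \<zeta> "shear \<rho> \<zeta>"] jb_triangle[of "shear \<rho> \<zeta>" \<zeta>] d by auto
      then have "jb \<zeta> \<le> (1 + \<rho>) * jb (shear \<rho> \<zeta>)" "jb (shear \<rho> \<zeta>) \<le> (1 + \<rho>) * jb \<zeta>"
        using mult_left_mono[OF xj(1) \<rho>] mult_left_mono[OF xj(2) \<rho>] by (auto simp: distrib_right)
      then have "jw s \<zeta> \<le> (1 + \<rho>) powr \<bar>s\<bar> * jw s (shear \<rho> \<zeta>)"
        unfolding jw_def using \<rho> by (intro powr_ratio) auto
      also have "\<dots> \<le> (C1 * exp (l / 4 * \<rho>)) * jw s (shear \<rho> \<zeta>)"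
        using order_trans[OF powr_le_power C1(2)] \<rho> by (intro mult_right_mono) auto
      finally show ?thesis .
    qed
    \<comment> \<open>V exceeds V' by at most a multiple of r = (\<rho> a)^p a; the power of \<rho>
      a goes into the exponential and the remaining a is part of V'.\<close>
    have VV: "V \<le> 8 * C2 * exp (l / 4 * (\<rho> * V')) * V'"
    proof -
      have "(\<rho> * a) powr p \<le> (1 + \<rho> * a) powr p" using p \<rho> nn by (intro powr_mono2) auto
      also have "\<dots> \<le> (1 + \<rho> * a) powr 2" using p \<rho> nn by (intro powr_mono) auto
      also have "\<dots> = (1 + \<rho> * a)\<^sup>2" using \<rho> nn by (intro powr_numeral) (auto intro: add_pos_nonneg)
      also have "\<dots> \<le> C2 * exp (l / 4 * (\<rho> * a))" using \<rho> nn by (intro C2) auto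
      also have "\<dots> \<le> C2 * exp (l / 4 * (\<rho> * V'))" using l \<rho> nn C2(1) by (intro mult_left_mono) (auto simp: V intro!: mult_left_mono)
      finally have "(\<rho> * a) powr p * a \<le> C2 * exp (l / 4 * (\<rho> * V')) * V'"
        using nn C2(1) by (intro mult_mono) (auto simp: V)
      then have r: "r \<le> C2 * exp (l / 4 * (\<rho> * V')) * V'" using ra by simp
      have "1 * 1 \<le> C2 * exp (l / 4 * (\<rho> * V'))" using C2(1) l \<rho> V1 by (intro mult_mono) auto
      then have "V' \<le> C2 * exp (l / 4 * (\<rho> * V')) * V'" using V1 by (simp add: mult_right_mono[of 1])
      moreover have "V \<le> 4 * V' + 4 * r" using yp(1) nn by (simp add: V)
      ultimately show ?thesis using r by linarith
    qed
    have C8: "1 \<le> 8 * C2" using C2(1) by simp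
    have E: "exp (l / 4 * \<rho>) * exp (- D) \<le> exp k * exp (- (3 * l / 4 * \<rho> * U))"
      if "D \<ge> l * \<rho> * U - k" "U \<ge> 1" for U
    proof -
      have "l * \<rho> * 1 \<le> l * \<rho> * U" using l \<rho> that by (intro mult_left_mono) auto
      then have "l / 4 * \<rho> + - D \<le> k + - (3 * l / 4 * \<rho> * U)" using that(1) by (simp add: field_simps)
      then show ?thesis unfolding exp_add[symmetric] by (subst exp_le_cancel_iff)
    qed
    have J: "jw s (shear \<rho> \<zeta>) \<ge> 0" by simp
    have "jw s \<zeta> * V * exp (- D) \<le> (C1 * exp (l / 4 * \<rho>) * jw s (shear \<rho> \<zeta>)) * V * exp (- D)"
      using V1 by (intro mult_right_mono jr) auto
    also have "\<dots> = C1 * jw s (shear \<rho> \<zeta>) * V * (exp (l / 4 * \<rho>) * exp (- D))" by simp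
    finally have M: "jw s \<zeta> * V * exp (- D) \<le> C1 * jw s (shear \<rho> \<zeta>) * V * (exp (l / 4 * \<rho>) * exp (- D))" .
    have "C1 * jw s (shear \<rho> \<zeta>) * V * (exp (l / 4 * \<rho>) * exp (- D)) \<le> C1 * jw s (shear \<rho> \<zeta>) * V * (exp k * exp (- (3 * l / 4 * \<rho> * V)))"
      using C1(1) V1 by (intro mult_left_mono E D1) auto
    also have "\<dots> \<le> (8 * C2) * (C1 * jw s (shear \<rho> \<zeta>) * V * (exp k * exp (- (l / 2 * \<rho> * V))))"
    proof -
      have "exp (- (3 * l / 4 * \<rho> * V)) \<le> exp (- (l / 2 * \<rho> * V))" using l \<rho> V1 by (auto intro!: mult_right_mono)
      then have "C1 * jw s (shear \<rho> \<zeta>) * V * (exp k * exp (- (3 * l / 4 * \<rho> * V))) \<le> 1 * (C1 * jw s (shear \<rho> \<zeta>) * V * (exp k * exp (- (l / 2 * \<rho> * V))))"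
        unfolding mult_1 using C1(1) V1 by (intro mult_left_mono) auto
      also have "\<dots> \<le> (8 * C2) * (C1 * jw s (shear \<rho> \<zeta>) * V * (exp k * exp (- (l / 2 * \<rho> * V))))"
        using C8 C1(1) V1 by (intro mult_right_mono) auto
      finally show ?thesis .
    qed
    finally have A1: "jw s \<zeta> * V * exp (- D) \<le> C * jw s (shear \<rho> \<zeta>) * (V * exp (- (l / 2 * \<rho> * V)))"
      using M by (simp add: C_def mult_ac)
    have "C1 * jw s (shear \<rho> \<zeta>) * V * (exp (l / 4 * \<rho>) * exp (- D)) \<le> C1 * jw s (shear \<rho> \<zeta>) * (8 * C2 * exp (l / 4 * (\<rho> * V')) * V') * (exp k * exp (- (3 * l / 4 * \<rho> * V')))"
      using C1(1) V1 C2(1) by (intro mult_mono mult_left_mono VV E D2) auto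
    also have "\<dots> = C * jw s (shear \<rho> \<zeta>) * (V' * (exp (l / 4 * (\<rho> * V')) * exp (- (3 * l / 4 * \<rho> * V'))))"
      by (simp add: C_def)
    also have "exp (l / 4 * (\<rho> * V')) * exp (- (3 * l / 4 * \<rho> * V')) = exp (- (l / 2 * \<rho> * V'))"
      unfolding exp_add[symmetric] by (simp add: field_simps)
    finally have A2: "jw s \<zeta> * V * exp (- D) \<le> C * jw s (shear \<rho> \<zeta>) * (V' * exp (- (l / 2 * \<rho> * V')))"
      by (rule order_trans[OF M])
    show ?thesis using A1 A2 unfolding V_def V'_def D_def r_def x_def y_def by blast
  qed
  moreover have "0 < C" using C1(1) C2(1) by (simp add: C_def)
  ultimately show ?thesis using l by (intro exI[of _ C] exI[of _ "l / 2"]) auto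
qed

text \<open>The value does not depend on V: integration over the characteristic time pays for the
  whole factor V, which is exactly the gain of \<open>vw\<close>.\<close>

lemma nn_integral_exp:
  assumes "0 < l" "0 < (V::real)"
  shows "(\<integral>\<^sup>+\<rho>. ennreal (indicator {0..} \<rho> * (V * exp (- (l * \<rho> * V)))) \<partial>lborel) = ennreal (1 / l)"
proof -
  interpret prob_space "density lborel (exponential_density (l * V))"
    by (rule prob_space_exponential_density) (use assms in simp)
  have "(\<integral>\<^sup>+\<rho>. ennreal (exponential_density (l * V) \<rho>) \<partial>lborel) = 1"
    using emeasure_space_1 by (simp add: emeasure_density)
  moreover have "ennreal (indicator {0..} \<rho> * (V * exp (- (l * \<rho> * V)))) = ennreal (1 / l) * ennreal (exponential_density (l * V) \<rho>)" for \<rho>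
    using assms by (auto simp: exponential_density_def indicator_def ennreal_mult[symmetric] mult_ac)
  ultimately show ?thesis by (simp add: nn_integral_cmult)
qed

section \<open>Bounds for the symbol and the estimate for constant coefficients\<close>

context bump
begin

lemma symF_lower:
  assumes \<sigma>: "0 < \<sigma>" "\<sigma> < 1"
  shows "symF \<sigma> w \<eta> \<ge> norm \<eta> powr (2 * \<sigma>) - 1"
proof (cases "norm \<eta> \<le> 1")
  case True
  have "norm \<eta> powr (2 * \<sigma>) \<le> 1" using True \<sigma> by (intro powr_le1) auto
  moreover have "symF \<sigma> w \<eta> \<ge> 0" unfolding symF_def using w(2,3)[of \<eta>] by simp
  ultimately show ?thesis by simp
next
  case False
  have "norm \<eta> powr (2 * \<sigma>) \<le> norm \<eta> powr 2" using False \<sigma> by (intro powr_mono) auto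
  then have "norm \<eta> powr (2 * \<sigma>) \<le> (norm \<eta>)\<^sup>2" using False by simp
  then have "norm \<eta> powr (2 * \<sigma>) * (1 - w \<eta>) \<le> (norm \<eta>)\<^sup>2 * (1 - w \<eta>)"
    using w(3)[of \<eta>] by (intro mult_right_mono) auto
  then show ?thesis unfolding symF_def by (simp add: algebra_simps)
qed

text \<open>The two symbols differ only inside the ball of radius 2, where each of the two powers is
  at most 4.\<close>

lemma symF_approx:
  assumes \<sigma>: "0 < \<sigma>" "\<sigma> < 1"
  shows "\<bar>symF \<sigma> w \<eta> - norm \<eta> powr (2 * \<sigma>)\<bar> \<le> 8"
proof (cases "norm \<eta> \<le> 2")
  case True
  have "norm \<eta> powr (2 * \<sigma>) \<le> 2 powr (2 * \<sigma>)" using True \<sigma> by (intro powr_mono2) auto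
  also have "\<dots> \<le> 2 powr 2" using \<sigma> by (intro powr_mono) auto
  finally have a: "norm \<eta> powr (2 * \<sigma>) \<le> 4" by simp
  have b: "(norm \<eta>)\<^sup>2 \<le> 4" using power_mono[OF True, of 2] by simp
  have "symF \<sigma> w \<eta> - norm \<eta> powr (2 * \<sigma>) = ((norm \<eta>)\<^sup>2 - norm \<eta> powr (2 * \<sigma>)) * (1 - w \<eta>)"
    unfolding symF_def by (simp add: algebra_simps)
  then have "\<bar>symF \<sigma> w \<eta> - norm \<eta> powr (2 * \<sigma>)\<bar> = \<bar>(norm \<eta>)\<^sup>2 - norm \<eta> powr (2 * \<sigma>)\<bar> * (1 - w \<eta>)"
    using w(3)[of \<eta>] by (simp add: abs_mult)
  also have "\<dots> \<le> 8 * 1"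
  proof (intro mult_mono)
    have "norm \<eta> powr (2 * \<sigma>) \<ge> 0" "(norm \<eta>)\<^sup>2 \<ge> 0" by auto
    then show "\<bar>(norm \<eta>)\<^sup>2 - norm \<eta> powr (2 * \<sigma>)\<bar> \<le> 8" using a b by linarith
  qed (use w(2,3)[of \<eta>] in auto)
  finally show ?thesis by simp
qed (simp add: symF_def w)

text \<open>The symbol vanishes at \<eta> = 0; adding 2 makes the damping rate strictly positive and
  is paid for by the zeroth-order term 2 c G on the right.\<close>

lemma ksym_lower:
  assumes \<sigma>: "0 < \<sigma>" "\<sigma> < 1"
  shows "ksym \<sigma> w \<zeta> + 2 \<ge> 1 + norm (snd (snd \<zeta>)) powr (2 * \<sigma>)"
proof -
  let ?\<eta> = "snd (snd \<zeta>)"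
  have "norm ?\<eta> powr (2 * \<sigma>) \<le> norm ((2 * pi) *\<^sub>R ?\<eta>) powr (2 * \<sigma>)"
    using \<sigma> pi_ge_two mult_right_mono[of 1 "2 * pi" "norm ?\<eta>"] by (intro powr_mono2) auto
  then show ?thesis using symF_lower[OF \<sigma>, of "(2 * pi) *\<^sub>R ?\<eta>"] by (simp add: ksym_def)
qed

lemma ksym_continuous: "continuous_on A (ksym \<sigma> w)"
proof -
  have "continuous_on A (\<lambda>\<zeta>. Re (complex_of_real (ksym \<sigma> w \<zeta>)))"
    by (intro continuous_on_Re continuous_at_imp_continuous_on ballI
        differentiable_imp_continuous_within smtemp_differentiable ksym_smtemp)
  then show ?thesis by simp
qed

text \<open>Along \<rho> to \<open>shear \<rho> \<zeta>\<close> the equation for G is an ordinary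
  one with damping c (\<open>ksym\<close> + 2). Adding 2 c G to both sides creates this positive
  damping, hence the modified source; 2048 comes from \<open>integral_affine_lower\<close>.\<close>

lemma characteristic_bound:
  fixes G f :: "'n pt \<Rightarrow> complex"
  assumes \<sigma>: "0 < \<sigma>" "\<sigma> < 1" and c: "0 < c0" "c0 \<le> c"
    and G: "schw G" and f: "continuous_on UNIV f"
    and eq: "\<And>\<zeta>. f \<zeta> = 2 * pi * \<i> * of_real (fst \<zeta>) * G \<zeta> - frechet_derivative G (at \<zeta>) (0, 0, fst (snd \<zeta>))
      + of_real (c * ksym \<sigma> w \<zeta>) * G \<zeta>"
  shows "ennreal (cmod (G \<zeta>)) \<le> (\<integral>\<^sup>+\<rho>. ennreal (indicator {0..} \<rho> *
      exp (- (c0 / 2048 * \<rho> * (1 + norm (snd (snd \<zeta>)) powr (2 * \<sigma>) + (\<rho> * norm (fst (snd \<zeta>))) powr (2 * \<sigma>)))) *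
      cmod (f (shear \<rho> \<zeta>) + of_real (2 * c) * G (shear \<rho> \<zeta>))) \<partial>lborel)"
proof -
  let ?\<xi> = "fst (snd \<zeta>)" and ?\<eta> = "snd (snd \<zeta>)"
  let ?S = "\<lambda>\<rho>. c * (ksym \<sigma> w (shear \<rho> \<zeta>) + 2)"
  obtain M where M: "\<And>z. cmod (G z) \<le> M" using schwE[OF G, of 0] by (metis mult.right_neutral power_0)
  have sc: "continuous_on A (\<lambda>\<rho>. shear \<rho> \<zeta>)" for A unfolding shear_def by (intro continuous_intros)
  have Sc: "continuous_on A ?S" for A
    by (intro continuous_intros continuous_on_compose2[OF ksym_continuous sc]) auto
  have Sl: "?S \<rho> \<ge> c0 * (1 + norm (?\<eta> + \<rho> *\<^sub>R ?\<xi>) powr (2 * \<sigma>))" for \<rho>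
    using ksym_lower[OF \<sigma>, of "shear \<rho> \<zeta>"] c by (intro mult_mono) (auto simp: shear_def)
  have "ennreal (cmod (G (shear 0 \<zeta>))) \<le> (\<integral>\<^sup>+\<rho>. ennreal (indicator {0..} \<rho> *
      exp (- (c0 / 2048 * \<rho> * (1 + norm ?\<eta> powr (2 * \<sigma>) + (\<rho> * norm ?\<xi>) powr (2 * \<sigma>)))) *
      cmod (f (shear \<rho> \<zeta>) + of_real (2 * c) * G (shear \<rho> \<zeta>))) \<partial>lborel)"
  proof (rule duhamel_bound[where S = ?S and h = "\<lambda>\<rho>. G (shear \<rho> \<zeta>)" and t = "2 * pi * fst \<zeta>" and M = M and k = c0
      and h' = "\<lambda>\<rho>. frechet_derivative G (at (shear \<rho> \<zeta>)) (0, 0, ?\<xi>)"])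
    fix r
    have "((\<lambda>\<rho>. shear \<rho> \<zeta>) has_derivative (\<lambda>q. q *\<^sub>R (0, 0, ?\<xi>))) (at r)"
      unfolding shear_def by (auto intro!: derivative_eq_intros simp: zero_prod_def)
    from has_derivative_compose[OF this differentiableD[OF schw_differentiable[OF G]]]
    show "((\<lambda>\<rho>. G (shear \<rho> \<zeta>)) has_vector_derivative frechet_derivative G (at (shear r \<zeta>)) (0, 0, ?\<xi>)) (at r)"
      using linear_cmul[OF linear_frechet_derivative[OF schw_differentiable[OF G]]]
      by (simp add: has_vector_derivative_def del: scaleR_Pair)
    show "f (shear r \<zeta>) + of_real (2 * c) * G (shear r \<zeta>) =
      (\<i> * complex_of_real (2 * pi * fst \<zeta>) + complex_of_real (?S r)) * G (shear r \<zeta>) - frechet_derivative G (at (shear r \<zeta>)) (0, 0, ?\<xi>)"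
      unfolding eq by (simp add: shear_def algebra_simps)
    show "integral {0..r} ?S \<ge> c0 / 2048 * r * (1 + norm ?\<eta> powr (2 * \<sigma>) + (r * norm ?\<xi>) powr (2 * \<sigma>))" if "r \<ge> 0"
      using that \<sigma> c Sl Sc by (intro integral_affine_lower) auto
    have "c0 * 1 \<le> c0 * (1 + norm (?\<eta> + r *\<^sub>R ?\<xi>) powr (2 * \<sigma>))" using c by (intro mult_left_mono) auto
    then show "?S r \<ge> c0" using Sl[of r] by linarith
  next
    show "continuous_on UNIV (\<lambda>r. f (shear r \<zeta>) + of_real (2 * c) * G (shear r \<zeta>))"
      by (intro continuous_intros continuous_on_compose2[OF f sc] continuous_on_compose2[OF schw_continuous[OF G] sc]) auto
  qed (use M c Sc in auto)
  then show ?thesis by (simp add: shear_def)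
qed

text \<open>Uniformity in c matters: the coefficient is later frozen at many points, and \<epsilon>
  has to be chosen before them.\<close>

theorem constant_coefficient_estimate:
  fixes s :: real
  assumes \<sigma>: "0 < \<sigma>" "\<sigma> < 1" and c0: "0 < c0"
  shows "\<exists>C\<ge>0. \<forall>c G f. c0 \<le> c \<longrightarrow> c \<le> c1 \<longrightarrow> schw G \<longrightarrow> continuous_on UNIV f \<longrightarrow>
    (\<forall>\<zeta>. f \<zeta> = 2 * pi * \<i> * of_real (fst \<zeta>) * G \<zeta> - frechet_derivative G (at \<zeta>) (0, 0, fst (snd \<zeta>))
      + of_real (c * ksym \<sigma> w \<zeta>) * G \<zeta>) \<longrightarrow>
    Nsq (\<lambda>\<zeta>. jw s \<zeta> * vw (2 * \<sigma>) \<zeta>) G \<le> ennreal C * (Nsq (jw s) f + Nsq (jw s) G)"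
proof -
  define p where "p = 2 * \<sigma>"
  have p: "0 < p" "p < 2" using \<sigma> by (auto simp: p_def)
  define k where "k = c0 / 2048"
  have k: "k > 0" using c0 by (simp add: k_def)
  define e where "e \<zeta> \<rho> = exp (- (k * \<rho> * (1 + norm (snd (snd \<zeta>)) powr p + (\<rho> * norm (fst (snd \<zeta>))) powr p)))" for \<zeta> :: "'n pt" and \<rho>
  obtain C l where C: "0 < C" and l: "0 < l"
    and K1: "\<And>\<zeta> :: 'n pt. \<And>\<rho>. \<rho> \<ge> 0 \<Longrightarrow> jw s \<zeta> * vw p \<zeta> * e \<zeta> \<rho> \<le> C * jw s (shear \<rho> \<zeta>) * (vw p \<zeta> * exp (- (l * \<rho> * vw p \<zeta>)))"
    and K2: "\<And>\<zeta> :: 'n pt. \<And>\<rho>. \<rho> \<ge> 0 \<Longrightarrow> jw s \<zeta> * vw p \<zeta> * e \<zeta> \<rho> \<le> C * jw s (shear \<rho> \<zeta>) * (vw p (shear \<rho> \<zeta>) * exp (- (l * \<rho> * vw p (shear \<rho> \<zeta>))))"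
    unfolding e_def using kernel_bounds[OF p k, of s, where 'n='n] by blast
  \<comment> \<open>Dividing by the weight at the sheared point leaves a kernel acting on the
    weighted source \<open>H\<close>, so Schur's test runs in unweighted L^2.\<close>
  define K where "K \<zeta> \<rho> = indicator {0..} \<rho> * (jw s \<zeta> * vw p \<zeta> * e \<zeta> \<rho> / jw s (shear \<rho> \<zeta>))" for \<zeta> :: "'n pt" and \<rho> :: real
  define B where "B V \<rho> = indicator {0..} \<rho> * (V * exp (- (l * \<rho> * V)))" for V \<rho> :: real
  have Kpos: "K \<zeta> \<rho> \<ge> 0" for \<zeta> \<rho> by (simp add: K_def e_def)
  have Bpos: "B (vw p \<zeta>) \<rho> \<ge> 0" for \<zeta> :: "'n pt" and \<rho> by (simp add: B_def)
  have KB1: "K \<zeta> \<rho> \<le> C * B (vw p \<zeta>) \<rho>" for \<zeta> \<rho>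
    using K1[of \<rho> \<zeta>] by (cases "\<rho> \<ge> 0") (auto simp: K_def B_def divide_simps mult_ac)
  have KB2: "K \<zeta> \<rho> \<le> C * B (vw p (shear \<rho> \<zeta>)) \<rho>" for \<zeta> \<rho>
    using K2[of \<rho> \<zeta>] by (cases "\<rho> \<ge> 0") (auto simp: K_def B_def divide_simps mult_ac)
  have [measurable]: "(\<lambda>\<zeta>::'n pt. fst (snd \<zeta>)) \<in> borel_measurable borel" "(\<lambda>\<zeta>::'n pt. snd (snd \<zeta>)) \<in> borel_measurable borel"
    by (intro borel_measurable_continuous_onI continuous_intros)+
  have shm [measurable]: "(\<lambda>x. shear (snd x) (fst x :: 'n pt)) \<in> borel_measurable (borel \<Otimes>\<^sub>M borel)"
    using shear_measurable by (simp add: case_prod_beta')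
  have Km [measurable]: "case_prod K \<in> borel_measurable (borel \<Otimes>\<^sub>M borel)"
    unfolding K_def[abs_def] e_def case_prod_beta' by measurable
  have intB: "(\<integral>\<^sup>+\<rho>. ennreal (B (vw p \<zeta>) \<rho>) \<partial>lborel) = ennreal (1 / l)" for \<zeta> :: "'n pt"
    unfolding B_def by (rule nn_integral_exp[OF l]) simp
  have intK: "(\<integral>\<^sup>+\<rho>. ennreal (K \<zeta> \<rho>) \<partial>lborel) \<le> ennreal (C / l)" for \<zeta>
  proof -
    have "(\<integral>\<^sup>+\<rho>. ennreal (K \<zeta> \<rho>) \<partial>lborel) \<le> (\<integral>\<^sup>+\<rho>. ennreal C * ennreal (B (vw p \<zeta>) \<rho>) \<partial>lborel)"
      using KB1 C by (intro nn_integral_mono) (simp add: ennreal_mult'[symmetric] ennreal_leI)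
    also have "\<dots> = ennreal C * ennreal (1 / l)" by (subst nn_integral_cmult) (auto simp: intB, simp add: B_def)
    finally show ?thesis using C l by (simp add: ennreal_mult[symmetric])
  qed
  have main: "Nsq (\<lambda>\<zeta>. jw s \<zeta> * vw p \<zeta>) G \<le> ennreal ((C / l)\<^sup>2) * Nsq (jw s) (\<lambda>\<zeta>. f \<zeta> + of_real (2 * c) * G \<zeta>)"
    if c: "c0 \<le> c" and G: "schw G" and f: "continuous_on UNIV f"
      and eq: "\<And>\<zeta>. f \<zeta> = 2 * pi * \<i> * of_real (fst \<zeta>) * G \<zeta> - frechet_derivative G (at \<zeta>) (0, 0, fst (snd \<zeta>))
      + of_real (c * ksym \<sigma> w \<zeta>) * G \<zeta>" for c G and f :: "'n pt \<Rightarrow> complex"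
  proof -
    define H where "H \<zeta> = ennreal (jw s \<zeta> * cmod (f \<zeta> + of_real (2 * c) * G \<zeta>))" for \<zeta>
    have [measurable]: "f \<in> borel_measurable borel" "G \<in> borel_measurable borel"
      using borel_measurable_continuous_onI[OF f] schw_measurable[OF G] by auto
    have Hm [measurable]: "H \<in> borel_measurable borel" unfolding H_def by measurable
    have pt: "ennreal (\<bar>jw s \<zeta> * vw p \<zeta>\<bar> * cmod (G \<zeta>)) \<le> (\<integral>\<^sup>+\<rho>. ennreal (K \<zeta> \<rho>) * H (shear \<rho> \<zeta>) \<partial>lborel)" for \<zeta>
    proof -
      have "ennreal (\<bar>jw s \<zeta> * vw p \<zeta>\<bar> * cmod (G \<zeta>)) = ennreal (jw s \<zeta> * vw p \<zeta>) * ennreal (cmod (G \<zeta>))"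
        by (simp add: ennreal_mult')
      also have "\<dots> \<le> ennreal (jw s \<zeta> * vw p \<zeta>) * (\<integral>\<^sup>+\<rho>. ennreal (indicator {0..} \<rho> * e \<zeta> \<rho> *
          cmod (f (shear \<rho> \<zeta>) + of_real (2 * c) * G (shear \<rho> \<zeta>))) \<partial>lborel)"
        using characteristic_bound[OF \<sigma> c0 c G f eq, of \<zeta>] unfolding e_def k_def p_def by (intro mult_left_mono) auto
      also have "\<dots> = (\<integral>\<^sup>+\<rho>. ennreal (jw s \<zeta> * vw p \<zeta>) * ennreal (indicator {0..} \<rho> * e \<zeta> \<rho> *
          cmod (f (shear \<rho> \<zeta>) + of_real (2 * c) * G (shear \<rho> \<zeta>))) \<partial>lborel)"
        unfolding e_def by (rule nn_integral_cmult[symmetric]) measurable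
      also have "\<dots> = (\<integral>\<^sup>+\<rho>. ennreal (K \<zeta> \<rho>) * H (shear \<rho> \<zeta>) \<partial>lborel)"
      proof (intro nn_integral_cong)
        fix \<rho>
        have j: "jw s (shear \<rho> \<zeta>) \<noteq> 0" using jw_pos[of s "shear \<rho> \<zeta>"] by linarith
        show "ennreal (jw s \<zeta> * vw p \<zeta>) * ennreal (indicator {0..} \<rho> * e \<zeta> \<rho> *
          cmod (f (shear \<rho> \<zeta>) + of_real (2 * c) * G (shear \<rho> \<zeta>))) = ennreal (K \<zeta> \<rho>) * H (shear \<rho> \<zeta>)"
          unfolding H_def using j Kpos[of \<zeta> \<rho>]
          by (subst (1 2) ennreal_mult[symmetric]) (auto simp: e_def K_def)
      qed
      finally show ?thesis .
    qed
    \<comment> \<open>Schur's test: Cauchy-Schwarz uses the integral of \<open>K\<close> over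
      \<rho>, and the other factor is then bounded through \<open>KB2\<close>.\<close>
    have "Nsq (\<lambda>\<zeta>. jw s \<zeta> * vw p \<zeta>) G \<le> (\<integral>\<^sup>+\<zeta>. (\<integral>\<^sup>+\<rho>. ennreal (K \<zeta> \<rho>) * H (shear \<rho> \<zeta>) \<partial>lborel)\<^sup>2 \<partial>lborel)"
      unfolding Nsq_def by (intro nn_integral_mono power_mono pt) auto
    also have "\<dots> \<le> (\<integral>\<^sup>+\<zeta>. ennreal (C / l) * (\<integral>\<^sup>+\<rho>. ennreal (K \<zeta> \<rho>) * (H (shear \<rho> \<zeta>))\<^sup>2 \<partial>lborel) \<partial>lborel)"
    proof (intro nn_integral_mono)
      fix \<zeta>
      have "(\<lambda>\<rho>. shear \<rho> \<zeta>) \<in> borel_measurable borel" "(\<lambda>\<rho>. K \<zeta> \<rho>) \<in> borel_measurable borel"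
        using measurable_compose[OF measurable_Pair1'[of \<zeta> borel borel] Km] measurable_compose[OF measurable_Pair1'[of \<zeta> borel borel] shm] by auto
      then have "(\<integral>\<^sup>+\<rho>. ennreal (K \<zeta> \<rho>) * H (shear \<rho> \<zeta>) \<partial>lborel)\<^sup>2 \<le> (\<integral>\<^sup>+\<rho>. ennreal (K \<zeta> \<rho>) \<partial>lborel) * (\<integral>\<^sup>+\<rho>. ennreal (K \<zeta> \<rho>) * (H (shear \<rho> \<zeta>))\<^sup>2 \<partial>lborel)"
        by (intro nn_integral_Cauchy_Schwarz) auto
      also have "\<dots> \<le> ennreal (C / l) * (\<integral>\<^sup>+\<rho>. ennreal (K \<zeta> \<rho>) * (H (shear \<rho> \<zeta>))\<^sup>2 \<partial>lborel)"
        by (intro mult_right_mono intK) auto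
      finally show "(\<integral>\<^sup>+\<rho>. ennreal (K \<zeta> \<rho>) * H (shear \<rho> \<zeta>) \<partial>lborel)\<^sup>2 \<le> ennreal (C / l) * (\<integral>\<^sup>+\<rho>. ennreal (K \<zeta> \<rho>) * (H (shear \<rho> \<zeta>))\<^sup>2 \<partial>lborel)" .
    qed
    also have "\<dots> \<le> (\<integral>\<^sup>+\<zeta>. ennreal (C / l) * (\<integral>\<^sup>+\<rho>. ennreal C * (ennreal (B (vw p (shear \<rho> \<zeta>)) \<rho>) * (H (shear \<rho> \<zeta>))\<^sup>2) \<partial>lborel) \<partial>lborel)"
    proof (intro nn_integral_mono mult_left_mono)
      fix \<zeta> \<rho>
      have "ennreal (K \<zeta> \<rho>) \<le> ennreal C * ennreal (B (vw p (shear \<rho> \<zeta>)) \<rho>)"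
        using KB2[of \<zeta> \<rho>] C by (simp add: ennreal_mult'[symmetric] ennreal_leI)
      from mult_right_mono[OF this, of "(H (shear \<rho> \<zeta>))\<^sup>2"]
      show "ennreal (K \<zeta> \<rho>) * (H (shear \<rho> \<zeta>))\<^sup>2 \<le> ennreal C * (ennreal (B (vw p (shear \<rho> \<zeta>)) \<rho>) * (H (shear \<rho> \<zeta>))\<^sup>2)"
        by (simp add: mult.assoc)
    qed auto
    also have "\<dots> = ennreal (C / l) * (\<integral>\<^sup>+\<zeta>. (\<integral>\<^sup>+\<rho>. ennreal C * (ennreal (B (vw p (shear \<rho> \<zeta>)) \<rho>) * (H (shear \<rho> \<zeta>))\<^sup>2) \<partial>lborel) \<partial>lborel)"
      by (rule nn_integral_cmult, rule lborel.borel_measurable_nn_integral) (simp add: B_def case_prod_beta')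
    also have "(\<integral>\<^sup>+\<zeta>. (\<integral>\<^sup>+\<rho>. ennreal C * (ennreal (B (vw p (shear \<rho> \<zeta>)) \<rho>) * (H (shear \<rho> \<zeta>))\<^sup>2) \<partial>lborel) \<partial>lborel)
       = (\<integral>\<^sup>+\<rho>. (\<integral>\<^sup>+\<zeta>. ennreal C * (ennreal (B (vw p (shear \<rho> \<zeta>)) \<rho>) * (H (shear \<rho> \<zeta>))\<^sup>2) \<partial>lborel) \<partial>lborel)"
      by (rule lborel_pair.Fubini') (simp add: B_def case_prod_beta')
    \<comment> \<open>The integrand depends on \<zeta> only through the sheared point, so for each
      \<rho> the measure-preserving shear can be removed.\<close>
    also have "\<dots> = (\<integral>\<^sup>+\<rho>. (\<integral>\<^sup>+\<zeta>. ennreal C * (ennreal (B (vw p \<zeta>) \<rho>) * (H \<zeta>)\<^sup>2) \<partial>lborel) \<partial>lborel)"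
    proof (rule nn_integral_cong)
      fix \<rho>
      show "(\<integral>\<^sup>+\<zeta>. ennreal C * (ennreal (B (vw p (shear \<rho> \<zeta>)) \<rho>) * (H (shear \<rho> \<zeta>))\<^sup>2) \<partial>lborel) = (\<integral>\<^sup>+\<zeta>. ennreal C * (ennreal (B (vw p \<zeta>) \<rho>) * (H \<zeta>)\<^sup>2) \<partial>lborel)"
        by (rule nn_integral_shear[of "\<lambda>\<zeta>. ennreal C * (ennreal (B (vw p \<zeta>) \<rho>) * (H \<zeta>)\<^sup>2)"]) (simp add: B_def)
    qed
    also have "\<dots> = (\<integral>\<^sup>+\<zeta>. (\<integral>\<^sup>+\<rho>. ennreal C * (ennreal (B (vw p \<zeta>) \<rho>) * (H \<zeta>)\<^sup>2) \<partial>lborel) \<partial>lborel)"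
      by (rule lborel_pair.Fubini'[symmetric]) (simp add: B_def case_prod_beta')
    also have "\<dots> = (\<integral>\<^sup>+\<zeta>. ennreal C * (ennreal (1 / l) * (H \<zeta>)\<^sup>2) \<partial>lborel)"
    proof (intro nn_integral_cong)
      fix \<zeta> :: "'n pt"
      have [measurable]: "(\<lambda>\<rho>. B (vw p \<zeta>) \<rho>) \<in> borel_measurable borel" by (simp add: B_def)
      show "(\<integral>\<^sup>+\<rho>. ennreal C * (ennreal (B (vw p \<zeta>) \<rho>) * (H \<zeta>)\<^sup>2) \<partial>lborel) = ennreal C * (ennreal (1 / l) * (H \<zeta>)\<^sup>2)"
        by (simp add: nn_integral_cmult nn_integral_multc intB)
    qed
    also have "\<dots> = ennreal C * (ennreal (1 / l) * (\<integral>\<^sup>+\<zeta>. (H \<zeta>)\<^sup>2 \<partial>lborel))"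
      by (simp add: nn_integral_cmult)
    also have "(\<integral>\<^sup>+\<zeta>. (H \<zeta>)\<^sup>2 \<partial>lborel) = Nsq (jw s) (\<lambda>\<zeta>. f \<zeta> + of_real (2 * c) * G \<zeta>)"
      unfolding Nsq_def H_def by simp
    also have "ennreal (C / l) * (ennreal C * (ennreal (1 / l) * Nsq (jw s) (\<lambda>\<zeta>. f \<zeta> + of_real (2 * c) * G \<zeta>)))
      = ennreal ((C / l)\<^sup>2) * Nsq (jw s) (\<lambda>\<zeta>. f \<zeta> + of_real (2 * c) * G \<zeta>)"
    proof -
      have "ennreal (C / l) * ennreal C * ennreal (1 / l) = ennreal ((C / l)\<^sup>2)"
        using C l by (simp add: ennreal_mult[symmetric] power2_eq_square)
      then show ?thesis by (simp only: mult.assoc[symmetric])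
    qed
    finally show ?thesis .
  qed
  \<comment> \<open>The numbers 2 and 8 c1^2 are the two-term constants for splitting f + 2 c G with
    c \<le> c1.\<close>
  define D where "D = (C / l)\<^sup>2 * (2 + 8 * c1\<^sup>2)"
  have "Nsq (\<lambda>\<zeta>. jw s \<zeta> * vw p \<zeta>) G \<le> ennreal D * (Nsq (jw s) f + Nsq (jw s) G)"
    if c: "c0 \<le> c" "c \<le> c1" and G: "schw G" and f: "continuous_on UNIV f"
      and eq: "\<And>\<zeta>. f \<zeta> = 2 * pi * \<i> * of_real (fst \<zeta>) * G \<zeta> - frechet_derivative G (at \<zeta>) (0, 0, fst (snd \<zeta>))
      + of_real (c * ksym \<sigma> w \<zeta>) * G \<zeta>" for c G and f :: "'n pt \<Rightarrow> complex"
  proof -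
    have [measurable]: "f \<in> borel_measurable borel" "G \<in> borel_measurable borel"
      using borel_measurable_continuous_onI[OF f] schw_measurable[OF G] by auto
    have "Nsq (jw s) (\<lambda>\<zeta>. f \<zeta> + of_real (2 * c) * G \<zeta>) \<le> ennreal (2 * 1\<^sup>2) * Nsq (jw s) f + ennreal (2 * (2 * c1)\<^sup>2) * Nsq (jw s) G"
    proof (rule Nsq_le2)
      fix \<zeta>
      have "cmod (f \<zeta> + of_real (2 * c) * G \<zeta>) \<le> cmod (f \<zeta>) + 2 * c * cmod (G \<zeta>)"
        using norm_triangle_ineq[of "f \<zeta>" "of_real (2 * c) * G \<zeta>"] c c0 by (simp add: norm_mult)
      also have "\<dots> \<le> cmod (f \<zeta>) + 2 * c1 * cmod (G \<zeta>)" using c by (intro add_left_mono mult_right_mono) auto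
      finally have "jw s \<zeta> * cmod (f \<zeta> + of_real (2 * c) * G \<zeta>) \<le> jw s \<zeta> * (cmod (f \<zeta>) + 2 * c1 * cmod (G \<zeta>))"
        by (intro mult_left_mono) auto
      then show "\<bar>jw s \<zeta>\<bar> * cmod (f \<zeta> + of_real (2 * c) * G \<zeta>) \<le> 1 * (\<bar>jw s \<zeta>\<bar> * cmod (f \<zeta>)) + 2 * c1 * (\<bar>jw s \<zeta>\<bar> * cmod (G \<zeta>))"
        by (simp add: algebra_simps)
    qed (use c c0 in auto)
    also have "\<dots> \<le> ennreal (2 + 8 * c1\<^sup>2) * Nsq (jw s) f + ennreal (2 + 8 * c1\<^sup>2) * Nsq (jw s) G"
      by (intro add_mono mult_right_mono ennreal_leI) (auto simp: power2_eq_square)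
    finally have "ennreal ((C / l)\<^sup>2) * Nsq (jw s) (\<lambda>\<zeta>. f \<zeta> + of_real (2 * c) * G \<zeta>) \<le> ennreal ((C / l)\<^sup>2) * (ennreal (2 + 8 * c1\<^sup>2) * (Nsq (jw s) f + Nsq (jw s) G))"
      by (intro mult_left_mono) (auto simp: distrib_left)
    also have "\<dots> = ennreal D * (Nsq (jw s) f + Nsq (jw s) G)"
      unfolding D_def by (subst ennreal_mult) (auto simp: mult.assoc)
    finally show ?thesis using main[OF c(1) G f eq] order_trans by blast
  qed
  moreover have "D \<ge> 0" by (simp add: D_def)
  ultimately show ?thesis unfolding p_def by blast
qed

end

subsection \<open>Multiplication operators and commutators\<close>

lemma ft_bounded_measurable:
  assumes "integrable lborel g"
  shows "ft g \<in> borel_measurable borel" "\<And>\<zeta>. cmod (ft g \<zeta>) \<le> (\<integral>z. cmod (g z) \<partial>lborel)"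
  using assms by (auto intro!: ft_measurable ft_bound)

text \<open>Multiplication by \<psi> is convolution with \<open>ft \<psi>\<close>, whose decay
  absorbs any polynomial loss in the shift; the second kernel of \<open>conv_bound\<close> is set to
  0.\<close>

lemma mult_weight_bound:
  fixes \<psi> :: "'a::euclidean_space \<Rightarrow> complex"
  assumes \<psi>: "schw \<psi>" and m: "W' \<in> borel_measurable borel"
    and le: "\<And>\<zeta> \<theta>. \<bar>W \<zeta>\<bar> \<le> C * (1 + norm \<theta>) ^ N * \<bar>W' (\<zeta> - \<theta>)\<bar>"
  shows "\<exists>K\<ge>0. \<forall>g. integrable lborel g \<longrightarrow> Nsq W (ft (\<lambda>z. \<psi> z * g z)) \<le> ennreal K * Nsq W' (ft g)"
proof -
  define k1 where "k1 \<theta> = \<bar>C\<bar> * (cmod (ft \<psi> \<theta>) * (1 + norm \<theta>) ^ N)" for \<theta>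
  have k1: "integrable lborel k1" unfolding k1_def[abs_def]
    by (intro integrable_mult_right schw_integrable_weight schw_ft \<psi>)
  have "Nsq W (ft (\<lambda>z. \<psi> z * g z)) \<le> ennreal (2 * (\<integral>\<theta>. k1 \<theta> \<partial>lborel)\<^sup>2) * Nsq W' (ft g)" if g: "integrable lborel g" for g
  proof -
    have "Nsq W (ft (\<lambda>z. \<psi> z * g z)) \<le> ennreal (2 * (\<integral>\<theta>. k1 \<theta> \<partial>lborel)\<^sup>2) * Nsq W' (ft g)
       + ennreal (2 * (\<integral>\<theta>. 0 \<partial>(lborel :: 'a measure))\<^sup>2) * Nsq W' (ft g)"
    proof (rule conv_bound[OF ft_mult[OF \<psi> g] ft_bounded_measurable(1)[OF g] m m k1])
      fix \<zeta> \<theta>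
      have "\<bar>W \<zeta>\<bar> * cmod (ft \<psi> \<theta>) \<le> (\<bar>C\<bar> * (1 + norm \<theta>) ^ N * \<bar>W' (\<zeta> - \<theta>)\<bar>) * cmod (ft \<psi> \<theta>)"
      proof (intro mult_right_mono order_trans[OF le])
        show "C * (1 + norm \<theta>) ^ N * \<bar>W' (\<zeta> - \<theta>)\<bar> \<le> \<bar>C\<bar> * (1 + norm \<theta>) ^ N * \<bar>W' (\<zeta> - \<theta>)\<bar>"
          by (intro mult_right_mono) auto
      qed auto
      then show "\<bar>W \<zeta>\<bar> * cmod (ft \<psi> \<theta>) \<le> k1 \<theta> * \<bar>W' (\<zeta> - \<theta>)\<bar> + 0 * \<bar>W' (\<zeta> - \<theta>)\<bar>"
        by (simp add: k1_def mult_ac)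
    qed (auto simp: k1_def)
    then show ?thesis by simp
  qed
  then show ?thesis by (intro exI[of _ "2 * (\<integral>\<theta>. k1 \<theta> \<partial>lborel)\<^sup>2"]) auto
qed

lemma mult_bound:
  fixes \<psi> :: "'a::euclidean_space \<Rightarrow> complex"
  assumes "schw \<psi>"
  shows "\<exists>K\<ge>0. \<forall>g. integrable lborel g \<longrightarrow> Nsq (jw s) (ft (\<lambda>z. \<psi> z * g z)) \<le> ennreal K * Nsq (jw s) (ft g)"
  by (rule mult_weight_bound[OF assms jw_measurable, where C = 1 and N = "nat \<lceil>\<bar>s\<bar>\<rceil>"]) (simp add: jw_peetre)

text \<open>The leading constant sees only the unweighted L^1 norm of \<open>ft \<psi>\<close>. Its
  8 is 2 * 2^2, from the two-kernel bound and the absolute factor 2 in the sharpened Peetre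
  inequality, so it is the same for all s.\<close>

lemma mult_bound_sharp:
  fixes \<psi> :: "'a::euclidean_space \<Rightarrow> complex"
  assumes \<psi>: "schw \<psi>" and \<epsilon>: "(\<integral>\<theta>. cmod (ft \<psi> \<theta>) \<partial>lborel) \<le> \<epsilon>"
  shows "\<exists>K\<ge>0. \<forall>g. integrable lborel g \<longrightarrow> Nsq (jw s) (ft (\<lambda>z. \<psi> z * g z))
    \<le> ennreal (8 * \<epsilon>\<^sup>2) * Nsq (jw s) (ft g) + ennreal K * Nsq (\<lambda>\<zeta>. jw s \<zeta> / jb \<zeta>) (ft g)"
proof -
  let ?n = "Suc (nat \<lceil>\<bar>s\<bar>\<rceil>)"
  obtain C where C: "C \<ge> 0" "\<And>\<zeta> \<theta> :: 'a. jw s \<zeta> \<le> 2 * jw s (\<zeta> - \<theta>) + C * (1 + norm \<theta>) ^ ?n * (jw s (\<zeta> - \<theta>) / jb (\<zeta> - \<theta>))"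
    using jw_peetre_sharp[of s] by blast
  define k1 where "k1 \<theta> = 2 * cmod (ft \<psi> \<theta>)" for \<theta>
  define k2 where "k2 \<theta> = C * (cmod (ft \<psi> \<theta>) * (1 + norm \<theta>) ^ ?n)" for \<theta>
  have k1: "integrable lborel k1" unfolding k1_def[abs_def]
    by (intro integrable_mult_right integrable_norm schw_integrable schw_ft \<psi>)
  have k2: "integrable lborel k2" unfolding k2_def[abs_def]
    by (intro integrable_mult_right schw_integrable_weight schw_ft \<psi>)
  have i1: "2 * (\<integral>\<theta>. k1 \<theta> \<partial>lborel)\<^sup>2 \<le> 8 * \<epsilon>\<^sup>2"
  proof -
    have "(\<integral>\<theta>. cmod (ft \<psi> \<theta>) \<partial>lborel)\<^sup>2 \<le> \<epsilon>\<^sup>2" using \<epsilon> by (intro power_mono) auto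
    then show ?thesis by (simp add: k1_def power_mult_distrib)
  qed
  have "Nsq (jw s) (ft (\<lambda>z. \<psi> z * g z)) \<le> ennreal (8 * \<epsilon>\<^sup>2) * Nsq (jw s) (ft g)
     + ennreal (2 * (\<integral>\<theta>. k2 \<theta> \<partial>lborel)\<^sup>2) * Nsq (\<lambda>\<zeta>. jw s \<zeta> / jb \<zeta>) (ft g)" if g: "integrable lborel g" for g
  proof -
    have "Nsq (jw s) (ft (\<lambda>z. \<psi> z * g z)) \<le> ennreal (2 * (\<integral>\<theta>. k1 \<theta> \<partial>lborel)\<^sup>2) * Nsq (jw s) (ft g)
       + ennreal (2 * (\<integral>\<theta>. k2 \<theta> \<partial>lborel)\<^sup>2) * Nsq (\<lambda>\<zeta>. jw s \<zeta> / jb \<zeta>) (ft g)"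
    proof (rule conv_bound[OF ft_mult[OF \<psi> g] ft_bounded_measurable(1)[OF g] _ _ k1 k2])
      fix \<zeta> \<theta>
      show "\<bar>jw s \<zeta>\<bar> * cmod (ft \<psi> \<theta>) \<le> k1 \<theta> * \<bar>jw s (\<zeta> - \<theta>)\<bar> + k2 \<theta> * \<bar>jw s (\<zeta> - \<theta>) / jb (\<zeta> - \<theta>)\<bar>"
        using mult_right_mono[OF C(2)[of \<zeta> \<theta>], of "cmod (ft \<psi> \<theta>)"] less_imp_le[OF jb_pos[of "\<zeta> - \<theta>"]]
        by (simp add: k1_def k2_def abs_of_nonneg algebra_simps)
    qed (use C in \<open>auto simp: k1_def k2_def\<close>)
    also have "\<dots> \<le> ennreal (8 * \<epsilon>\<^sup>2) * Nsq (jw s) (ft g)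
     + ennreal (2 * (\<integral>\<theta>. k2 \<theta> \<partial>lborel)\<^sup>2) * Nsq (\<lambda>\<zeta>. jw s \<zeta> / jb \<zeta>) (ft g)"
      by (intro add_right_mono mult_right_mono ennreal_leI i1) auto
    finally show ?thesis .
  qed
  then show ?thesis by (intro exI[of _ "2 * (\<integral>\<theta>. k2 \<theta> \<partial>lborel)\<^sup>2"]) auto
qed

text \<open>The \<eta>-part of \<open>vw\<close>: F and its commutators produce powers of \<eta>
  alone.\<close>

definition bw :: "real \<Rightarrow> 'n::finite pt \<Rightarrow> real" where
  "bw p \<zeta> = 1 + norm (snd (snd \<zeta>)) powr p"

lemma bw_ge1: "bw p \<zeta> \<ge> 1" by (simp add: bw_def)

lemma bw_nonneg [simp]: "bw p \<zeta> \<ge> 0" using bw_ge1[of p \<zeta>] by linarith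

lemma bw_le_vw: "bw p \<zeta> \<le> vw p \<zeta>" by (simp add: bw_def vw_def)

lemma bw_measurable [measurable]: "bw p \<in> borel_measurable borel"
proof -
  have [measurable]: "(\<lambda>\<zeta>::'a pt. snd (snd \<zeta>)) \<in> borel_measurable borel"
    by (intro borel_measurable_continuous_onI continuous_intros)
  show ?thesis unfolding bw_def[abs_def] by measurable
qed

lemma small_factor:
  fixes I \<delta> :: real
  assumes "I \<ge> 0" "\<delta> > 0"
  obtains t where "t > 0" "2 * (I * t)\<^sup>2 \<le> \<delta>"
proof
  let ?t = "sqrt (\<delta> / 2) / (I + 1)"
  show "?t > 0" using assms by simp
  have "I * ?t \<le> sqrt (\<delta> / 2)" using assms by (simp add: field_simps)
  then have "(I * ?t)\<^sup>2 \<le> (sqrt (\<delta> / 2))\<^sup>2" using assms by (intro power_mono) auto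
  then show "2 * (I * ?t)\<^sup>2 \<le> \<delta>" using assms by simp
qed

section \<open>Commutators with the fractional multiplier\<close>

context bump
begin

lemma ksym_bound:
  assumes \<sigma>: "0 < \<sigma>" "\<sigma> < 1"
  shows "\<bar>ksym \<sigma> w \<zeta>\<bar> \<le> ((2 * pi) powr (2 * \<sigma>) + 8) * bw (2 * \<sigma>) \<zeta>"
proof -
  let ?\<eta> = "snd (snd \<zeta>)" and ?c = "(2 * pi) powr (2 * \<sigma>)" and ?y = "norm (snd (snd \<zeta>)) powr (2 * \<sigma>)"
  have e: "norm ((2 * pi) *\<^sub>R ?\<eta>) powr (2 * \<sigma>) = ?c * ?y" by (simp add: powr_mult)
  have "\<bar>ksym \<sigma> w \<zeta> - ?c * ?y\<bar> \<le> 8"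
    using symF_approx[OF \<sigma>, of "(2 * pi) *\<^sub>R ?\<eta>"] unfolding e by (simp add: ksym_def)
  moreover have "?c * ?y \<ge> 0" "?c \<ge> 0" "?y \<ge> 0" by auto
  ultimately have "\<bar>ksym \<sigma> w \<zeta>\<bar> \<le> ?c * ?y + 8" by linarith
  also have "\<dots> \<le> (?c + 8) * (1 + ?y)" using \<open>?c \<ge> 0\<close> \<open>?y \<ge> 0\<close> by (simp add: distrib_left distrib_right)
  finally show ?thesis by (simp add: bw_def)
qed

text \<open>For 2 \<sigma> > 1 the increments of the symbol are unbounded in \<eta>. A small
  multiple of the leading weight is allowed in place of an estimate of order 2 \<sigma> - 1;
  smallness is all that absorption requires.\<close>

lemma ksym_diff:
  assumes \<sigma>: "0 < \<sigma>" "\<sigma> < 1" and \<delta>: "0 < \<delta>"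
  shows "\<exists>C\<ge>0. \<forall>\<zeta> \<theta>. \<bar>ksym \<sigma> w (\<zeta> - \<theta>) - ksym \<sigma> w \<zeta>\<bar> \<le> \<delta> * bw (2 * \<sigma>) (\<zeta> - \<theta>) + C * (1 + norm \<theta>) ^ 2"
proof -
  let ?p = "2 * \<sigma>" and ?c = "(2 * pi) powr (2 * \<sigma>)"
  have c: "?c > 0" by simp
  obtain C where C: "C \<ge> 0" "\<And>x y. x \<ge> 0 \<Longrightarrow> y \<ge> 0 \<Longrightarrow> \<bar>x powr ?p - y powr ?p\<bar> \<le> \<delta> / ?c * y powr ?p + C * (1 + \<bar>x - y\<bar>)\<^sup>2"
    using powr_diff_bound[of ?p "\<delta> / ?c"] \<sigma> \<delta> c by auto
  have "\<bar>ksym \<sigma> w (\<zeta> - \<theta>) - ksym \<sigma> w \<zeta>\<bar> \<le> \<delta> * bw ?p (\<zeta> - \<theta>) + (16 + C * (1 + 2 * pi)\<^sup>2) * (1 + norm \<theta>) ^ 2" for \<zeta> \<theta>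
  proof -
    let ?e = "(2 * pi) *\<^sub>R snd (snd \<zeta>)" and ?e' = "(2 * pi) *\<^sub>R snd (snd (\<zeta> - \<theta>))"
    have "\<bar>norm ?e - norm ?e'\<bar> \<le> norm (?e - ?e')" by (rule norm_triangle_ineq3)
    also have "?e - ?e' = (2 * pi) *\<^sub>R snd (snd \<theta>)" by (simp add: algebra_simps)
    also have "norm \<dots> \<le> 2 * pi * norm \<theta>"
      by (cases \<theta>) (auto intro!: mult_left_mono order_trans[OF norm_snd_le norm_snd_le])
    finally have d: "\<bar>norm ?e - norm ?e'\<bar> \<le> 2 * pi * norm \<theta>" .
    have "(1 + \<bar>norm ?e - norm ?e'\<bar>)\<^sup>2 \<le> ((1 + 2 * pi) * (1 + norm \<theta>))\<^sup>2"
      using d by (intro power_mono) (auto simp: algebra_simps intro: order_trans)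
    then have "C * (1 + \<bar>norm ?e - norm ?e'\<bar>)\<^sup>2 \<le> C * ((1 + 2 * pi)\<^sup>2 * (1 + norm \<theta>)\<^sup>2)"
      using C(1) by (intro mult_left_mono) (auto simp: power_mult_distrib)
    moreover have "norm ?e' powr ?p = ?c * norm (snd (snd (\<zeta> - \<theta>))) powr ?p" by (simp add: powr_mult)
    ultimately have 1: "\<bar>norm ?e powr ?p - norm ?e' powr ?p\<bar> \<le> \<delta> * norm (snd (snd (\<zeta> - \<theta>))) powr ?p + C * ((1 + 2 * pi)\<^sup>2 * (1 + norm \<theta>)\<^sup>2)"
      using C(2)[of "norm ?e" "norm ?e'"] c by simp
    have 2: "\<bar>ksym \<sigma> w \<zeta> - norm ?e powr ?p\<bar> \<le> 8" "\<bar>ksym \<sigma> w (\<zeta> - \<theta>) - norm ?e' powr ?p\<bar> \<le> 8"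
      unfolding ksym_def by (rule symF_approx[OF \<sigma>])+
    \<comment> \<open>16 = 8 + 8 is the cost of replacing the symbol by the pure power at both
      points.\<close>
    have 3: "16 * 1 \<le> 16 * (1 + norm \<theta>)\<^sup>2" by (intro mult_left_mono) (simp_all add: one_le_power)
    have g: "\<bar>k' - k\<bar> \<le> X" if "\<bar>x - y\<bar> \<le> \<delta> * n + Q" "\<bar>k - x\<bar> \<le> 8" "\<bar>k' - y\<bar> \<le> 8" "16 * 1 \<le> R" "X = \<delta> * n + \<delta> + R + Q"
      for k k' x y n Q R X :: real using that \<delta> by simp
    show ?thesis
      by (rule g[OF 1 2 3]) (simp add: bw_def algebra_simps)
  qed
  then show ?thesis using C(1) by (intro exI[of _ "16 + C * (1 + 2 * pi)\<^sup>2"]) auto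
qed

text \<open>Both terms are convolutions with \<open>ft \<psi>\<close>; the symbol is evaluated at
  \<zeta> - \<theta> in one and at \<zeta> in the other.\<close>

lemma commutator_eq:
  assumes \<psi>: "schw \<psi>" and u: "schw u"
  shows "ft (\<lambda>z. \<psi> z * frac_lap_v \<sigma> w u z) \<zeta> - of_real (ksym \<sigma> w \<zeta>) * ft (\<lambda>z. \<psi> z * u z) \<zeta>
    = (\<integral>\<theta>. (ft \<psi> \<theta> * of_real (ksym \<sigma> w (\<zeta> - \<theta>) - ksym \<sigma> w \<zeta>)) * ft u (\<zeta> - \<theta>) \<partial>lborel)"
proof -
  have i: "integrable lborel (\<lambda>\<theta>. ft \<psi> \<theta> * h (\<zeta> - \<theta>))" if h: "schw h" for h
  proof -
    obtain M where M: "\<And>z. cmod (h z) \<le> M" using schwE[OF h, of 0] by (metis mult.right_neutral power_0)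
    have [measurable]: "h \<in> borel_measurable borel" "ft \<psi> \<in> borel_measurable borel"
      using schw_measurable[OF h] schw_measurable[OF schw_ft[OF \<psi>]] by auto
    show ?thesis
    proof (rule Bochner_Integration.integrable_bound)
      show "integrable lborel (\<lambda>\<theta>. of_real M * ft \<psi> \<theta>)"
        by (intro integrable_mult_right schw_integrable schw_ft \<psi>)
      show "AE \<theta> in lborel. norm (ft \<psi> \<theta> * h (\<zeta> - \<theta>)) \<le> norm (of_real M * ft \<psi> \<theta>)"
      proof (intro AE_I2)
        fix \<theta>
        have "cmod (h (\<zeta> - \<theta>)) * cmod (ft \<psi> \<theta>) \<le> \<bar>M\<bar> * cmod (ft \<psi> \<theta>)"
          using M[of "\<zeta> - \<theta>"] by (intro mult_right_mono) auto
        then show "norm (ft \<psi> \<theta> * h (\<zeta> - \<theta>)) \<le> norm (of_real M * ft \<psi> \<theta>)" by (simp add: norm_mult mult.commute)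
      qed
    qed measurable
  qed
  have "ft (\<lambda>z. \<psi> z * frac_lap_v \<sigma> w u z) \<zeta> = (\<integral>\<theta>. ft \<psi> \<theta> * (of_real (ksym \<sigma> w (\<zeta> - \<theta>)) * ft u (\<zeta> - \<theta>)) \<partial>lborel)"
    by (subst ft_mult[OF \<psi> frac_lap_v_integrable[OF u]]) (simp add: ft_frac_lap_v[OF u])
  moreover have "of_real (ksym \<sigma> w \<zeta>) * ft (\<lambda>z. \<psi> z * u z) \<zeta> = (\<integral>\<theta>. of_real (ksym \<sigma> w \<zeta>) * (ft \<psi> \<theta> * ft u (\<zeta> - \<theta>)) \<partial>lborel)"
    by (subst ft_mult[OF \<psi> schw_integrable[OF u]]) simp
  ultimately show ?thesis
    using Bochner_Integration.integral_diff[OF i[OF schw_ksym_ft[OF u, of \<sigma>]] integrable_mult_right[OF i[OF schw_ft[OF u]], of "of_real (ksym \<sigma> w \<zeta>)"]]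
    by (simp add: algebra_simps)
qed

lemma commutator_bound:
  assumes \<sigma>: "0 < \<sigma>" "\<sigma> < 1" and \<psi>: "schw \<psi>" and \<delta>: "0 < \<delta>"
  shows "\<exists>K\<ge>0. \<forall>u. schw u \<longrightarrow>
    Nsq (jw s) (\<lambda>\<zeta>. ft (\<lambda>z. \<psi> z * frac_lap_v \<sigma> w u z) \<zeta> - of_real (ksym \<sigma> w \<zeta>) * ft (\<lambda>z. \<psi> z * u z) \<zeta>)
    \<le> ennreal \<delta> * Nsq (\<lambda>\<zeta>. jw s \<zeta> * bw (2 * \<sigma>) \<zeta>) (ft u) + ennreal K * Nsq (jw s) (ft u)"
proof -
  let ?n = "nat \<lceil>\<bar>s\<bar>\<rceil>"
  define I where "I = (\<integral>\<theta>. cmod (ft \<psi> \<theta>) * (1 + norm \<theta>) ^ ?n \<partial>lborel)"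
  have I: "I \<ge> 0" unfolding I_def by (intro Bochner_Integration.integral_nonneg) auto
  \<comment> \<open>The squared operator norm of the leading kernel is 2 (I t)^2, so t is chosen to
    bring it below \<delta>; the remainder constant then depends on t.\<close>
  obtain t where t: "t > 0" "2 * (I * t)\<^sup>2 \<le> \<delta>" using small_factor[OF I \<delta>] .
  obtain C where C: "C \<ge> 0" "\<And>\<zeta> \<theta>. \<bar>ksym \<sigma> w (\<zeta> - \<theta>) - ksym \<sigma> w \<zeta>\<bar> \<le> t * bw (2 * \<sigma>) (\<zeta> - \<theta>) + C * (1 + norm \<theta>) ^ 2"
    using ksym_diff[OF \<sigma> t(1)] by blast
  define k1 where "k1 \<theta> = t * (cmod (ft \<psi> \<theta>) * (1 + norm \<theta>) ^ ?n)" for \<theta>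
  define k2 where "k2 \<theta> = C * (cmod (ft \<psi> \<theta>) * (1 + norm \<theta>) ^ (?n + 2))" for \<theta>
  have k1: "integrable lborel k1" and k2: "integrable lborel k2" unfolding k1_def[abs_def] k2_def[abs_def]
    by (intro integrable_mult_right schw_integrable_weight schw_ft \<psi>)+
  have i1: "2 * (\<integral>\<theta>. k1 \<theta> \<partial>lborel)\<^sup>2 \<le> \<delta>" using t(2) by (simp add: k1_def I_def mult.commute)
  have "Nsq (jw s) (\<lambda>\<zeta>. ft (\<lambda>z. \<psi> z * frac_lap_v \<sigma> w u z) \<zeta> - of_real (ksym \<sigma> w \<zeta>) * ft (\<lambda>z. \<psi> z * u z) \<zeta>)
    \<le> ennreal \<delta> * Nsq (\<lambda>\<zeta>. jw s \<zeta> * bw (2 * \<sigma>) \<zeta>) (ft u) + ennreal (2 * (\<integral>\<theta>. k2 \<theta> \<partial>lborel)\<^sup>2) * Nsq (jw s) (ft u)"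
    if u: "schw u" for u
  proof -
    have "Nsq (jw s) (\<lambda>\<zeta>. ft (\<lambda>z. \<psi> z * frac_lap_v \<sigma> w u z) \<zeta> - of_real (ksym \<sigma> w \<zeta>) * ft (\<lambda>z. \<psi> z * u z) \<zeta>)
     \<le> ennreal (2 * (\<integral>\<theta>. k1 \<theta> \<partial>lborel)\<^sup>2) * Nsq (\<lambda>\<zeta>. jw s \<zeta> * bw (2 * \<sigma>) \<zeta>) (ft u) + ennreal (2 * (\<integral>\<theta>. k2 \<theta> \<partial>lborel)\<^sup>2) * Nsq (jw s) (ft u)"
    proof (rule conv_bound[OF commutator_eq[OF \<psi> u] schw_measurable[OF schw_ft[OF u]] _ _ k1 k2])
      fix \<zeta> \<theta>
      let ?j = "(1 + norm \<theta>) ^ ?n * jw s (\<zeta> - \<theta>)" and ?d = "\<bar>ksym \<sigma> w (\<zeta> - \<theta>) - ksym \<sigma> w \<zeta>\<bar>" and ?f = "cmod (ft \<psi> \<theta>)"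
      have "jw s \<zeta> * (?f * ?d) \<le> ?j * (?f * (t * bw (2 * \<sigma>) (\<zeta> - \<theta>) + C * (1 + norm \<theta>) ^ 2))"
        by (intro mult_mono jw_peetre C(2) order_refl) auto
      then have "jw s \<zeta> * (?f * ?d) \<le> k1 \<theta> * (jw s (\<zeta> - \<theta>) * bw (2 * \<sigma>) (\<zeta> - \<theta>)) + k2 \<theta> * jw s (\<zeta> - \<theta>)"
        by (simp only: k1_def k2_def power_add distrib_left mult_ac)
      then show "\<bar>jw s \<zeta>\<bar> * cmod (ft \<psi> \<theta> * of_real (ksym \<sigma> w (\<zeta> - \<theta>) - ksym \<sigma> w \<zeta>))
        \<le> k1 \<theta> * \<bar>jw s (\<zeta> - \<theta>) * bw (2 * \<sigma>) (\<zeta> - \<theta>)\<bar> + k2 \<theta> * \<bar>jw s (\<zeta> - \<theta>)\<bar>"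
        by (simp only: norm_mult norm_of_real abs_mult abs_of_nonneg[OF jw_nonneg] abs_of_nonneg[OF bw_nonneg])
    qed (use C t in \<open>auto simp: k1_def k2_def\<close>)
    also have "\<dots> \<le> ennreal \<delta> * Nsq (\<lambda>\<zeta>. jw s \<zeta> * bw (2 * \<sigma>) \<zeta>) (ft u) + ennreal (2 * (\<integral>\<theta>. k2 \<theta> \<partial>lborel)\<^sup>2) * Nsq (jw s) (ft u)"
      by (intro add_right_mono mult_right_mono ennreal_leI i1) auto
    finally show ?thesis .
  qed
  then show ?thesis by (intro exI[of _ "2 * (\<integral>\<theta>. k2 \<theta> \<partial>lborel)\<^sup>2"]) auto
qed

text \<open>At frequencies with bracket at least 1/t the division by the bracket gains a factor t;
  at lower frequencies the symbol is bounded. This disposes of the remainder in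
  \<open>mult_bound_sharp\<close>.\<close>

lemma lower_order_bound:
  assumes \<sigma>: "0 < \<sigma>" "\<sigma> < 1" and \<delta>: "0 < \<delta>"
  shows "\<exists>K\<ge>0. \<forall>G. G \<in> borel_measurable borel \<longrightarrow>
    Nsq (\<lambda>\<zeta>. jw s \<zeta> / jb \<zeta>) (\<lambda>\<zeta>. of_real (ksym \<sigma> w \<zeta>) * G \<zeta>)
    \<le> ennreal \<delta> * Nsq (\<lambda>\<zeta>. jw s \<zeta> * bw (2 * \<sigma>) \<zeta>) G + ennreal K * Nsq (jw s) G"
proof -
  define c where "c = (2 * pi) powr (2 * \<sigma>) + 8"
  have c: "c > 0" unfolding c_def by (simp add: add_nonneg_pos)
  obtain t where t: "t > 0" "2 * (c * t)\<^sup>2 \<le> \<delta>" using small_factor[of c \<delta>] c \<delta> by auto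
  define B where "B = c * (1 + (1 / t) powr (2 * \<sigma>))"
  have B: "B \<ge> 0" using c by (simp add: B_def)
  have p: "\<bar>ksym \<sigma> w \<zeta>\<bar> / jb \<zeta> \<le> c * t * bw (2 * \<sigma>) \<zeta> + B" for \<zeta>
  proof -
    have "\<bar>ksym \<sigma> w \<zeta>\<bar> / jb \<zeta> \<le> c * bw (2 * \<sigma>) \<zeta> / jb \<zeta>"
      using ksym_bound[OF \<sigma>, of \<zeta>] less_imp_le[OF jb_pos] unfolding c_def by (intro divide_right_mono) auto
    also have "\<dots> \<le> c * t * bw (2 * \<sigma>) \<zeta> + B"
    proof (cases "jb \<zeta> \<ge> 1 / t")
      case True
      then have "1 / jb \<zeta> \<le> t" using t(1) by (simp add: field_simps)
      then have "c * bw (2 * \<sigma>) \<zeta> * (1 / jb \<zeta>) \<le> c * bw (2 * \<sigma>) \<zeta> * t" using c by (intro mult_left_mono) auto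
      then show ?thesis using B by (simp add: mult_ac)
    next
      case False
      have "norm (snd (snd \<zeta>)) \<le> norm \<zeta>"
        by (cases \<zeta>) (simp, rule order_trans[OF norm_snd_le norm_snd_le])
      then have "norm (snd (snd \<zeta>)) \<le> 1 / t" using False jb_ge_norm[of \<zeta>] by linarith
      then have "bw (2 * \<sigma>) \<zeta> \<le> 1 + (1 / t) powr (2 * \<sigma>)" unfolding bw_def using \<sigma> by (intro add_left_mono powr_mono2) auto
      then have "c * bw (2 * \<sigma>) \<zeta> \<le> B" unfolding B_def using c by (intro mult_left_mono) auto
      moreover have "c * bw (2 * \<sigma>) \<zeta> / jb \<zeta> \<le> c * bw (2 * \<sigma>) \<zeta> / 1"
        using c jb_ge1 by (intro divide_left_mono) auto
      moreover have "0 \<le> c * t * bw (2 * \<sigma>) \<zeta>" using c t by simp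
      ultimately show ?thesis by linarith
    qed
    finally show ?thesis .
  qed
  have "Nsq (\<lambda>\<zeta>. jw s \<zeta> / jb \<zeta>) (\<lambda>\<zeta>. of_real (ksym \<sigma> w \<zeta>) * G \<zeta>)
    \<le> ennreal \<delta> * Nsq (\<lambda>\<zeta>. jw s \<zeta> * bw (2 * \<sigma>) \<zeta>) G + ennreal (2 * B\<^sup>2) * Nsq (jw s) G" if [measurable]: "G \<in> borel_measurable borel" for G
  proof -
    have "Nsq (\<lambda>\<zeta>. jw s \<zeta> / jb \<zeta>) (\<lambda>\<zeta>. of_real (ksym \<sigma> w \<zeta>) * G \<zeta>)
      \<le> ennreal (2 * (c * t)\<^sup>2) * Nsq (\<lambda>\<zeta>. jw s \<zeta> * bw (2 * \<sigma>) \<zeta>) G + ennreal (2 * B\<^sup>2) * Nsq (jw s) G"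
    proof (rule Nsq_le2)
      fix \<zeta>
      have "jw s \<zeta> * cmod (G \<zeta>) * (\<bar>ksym \<sigma> w \<zeta>\<bar> / jb \<zeta>) \<le> jw s \<zeta> * cmod (G \<zeta>) * (c * t * bw (2 * \<sigma>) \<zeta> + B)"
        by (intro mult_left_mono p) auto
      then show "\<bar>jw s \<zeta> / jb \<zeta>\<bar> * cmod (of_real (ksym \<sigma> w \<zeta>) * G \<zeta>) \<le> c * t * (\<bar>jw s \<zeta> * bw (2 * \<sigma>) \<zeta>\<bar> * cmod (G \<zeta>)) + B * (\<bar>jw s \<zeta>\<bar> * cmod (G \<zeta>))"
        using less_imp_le[OF jb_pos[of \<zeta>]] by (simp add: norm_mult abs_mult abs_of_nonneg algebra_simps)
    qed (use c t B in auto)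
    also have "\<dots> \<le> ennreal \<delta> * Nsq (\<lambda>\<zeta>. jw s \<zeta> * bw (2 * \<sigma>) \<zeta>) G + ennreal (2 * B\<^sup>2) * Nsq (jw s) G"
      by (intro add_right_mono mult_right_mono ennreal_leI t) auto
    finally show ?thesis .
  qed
  then show ?thesis by (intro exI[of _ "2 * B\<^sup>2"]) auto
qed

end

subsection \<open>Freezing a coefficient\<close>

text \<open>For |h| \<le> 1 by the mean value inequality with a decaying weight; for |h| > 1 by the
  triangle inequality, as then 2 \<open>I\<close> \<le> 2 \<open>I\<close> |h|.\<close>

lemma translation_L1_bound:
  fixes \<phi> :: "'a::euclidean_space \<Rightarrow> complex"
  assumes \<phi>: "schw \<phi>"
  shows "\<exists>C\<ge>0. \<forall>h. (\<integral>\<^sup>+y. ennreal (cmod (\<phi> (y - h) - \<phi> y)) \<partial>lborel) \<le> ennreal (C * norm h)"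
proof -
  let ?M = "2 * DIM('a)"
  note [measurable] = schw_measurable[OF \<phi>]
  have "\<forall>b\<in>Basis. \<exists>D. \<forall>z. cmod (dd b \<phi> z) * (1 + norm z) ^ ?M \<le> D"
    using schwE[OF schw_dd[OF \<phi>]] by metis
  then obtain D where D: "\<And>b z. b \<in> Basis \<Longrightarrow> cmod (dd b \<phi> z) * (1 + norm z) ^ ?M \<le> D b" by metis
  define E where "E = (\<Sum>b\<in>(Basis::'a set). \<bar>D b\<bar>)"
  have E: "E \<ge> 0" unfolding E_def by (intro sum_nonneg) auto
  define Q where "Q = (\<integral>z. 1 / (1 + norm z) ^ ?M \<partial>(lborel :: 'a measure))"
  have Q: "Q \<ge> 0" unfolding Q_def by (intro Bochner_Integration.integral_nonneg) auto
  define I where "I = (\<integral>z. cmod (\<phi> z) \<partial>lborel)"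
  have I: "I \<ge> 0" unfolding I_def by (intro Bochner_Integration.integral_nonneg) auto
  have wi: "integrable lborel (\<lambda>z::'a. 1 / (1 + norm z) ^ ?M)" by (intro weight_integrable) simp
  have \<phi>i: "integrable lborel (\<lambda>z. cmod (\<phi> z))" by (intro integrable_norm schw_integrable \<phi>)
  have "(\<integral>\<^sup>+y. ennreal (cmod (\<phi> (y - h) - \<phi> y)) \<partial>lborel) \<le> ennreal ((E * 2 ^ ?M * Q + 2 * I) * norm h)" for h
  proof (cases "norm h \<le> 1")
    case True
    have p: "cmod (\<phi> (y - h) - \<phi> y) \<le> norm h * E * 2 ^ ?M * (1 / (1 + norm y) ^ ?M)" for y
    proof -
      have "cmod (\<phi> (y + - h) - \<phi> y) \<le> norm h * E * 2 ^ ?M * (1 / (1 + norm y) ^ ?M)"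
      proof (rule differentiable_increment[OF schw_differentiable[OF \<phi>]])
        fix r :: real assume r: "0 \<le> r" "r \<le> 1"
        let ?x = "y + r *\<^sub>R - h"
        have p: "(1 + norm ?x) ^ ?M > 0" by (intro zero_less_power) (simp add: add_pos_nonneg)
        have "frechet_derivative \<phi> (at ?x) (- h) = (\<Sum>b\<in>Basis. (- h \<bullet> b) *\<^sub>R dd b \<phi> ?x)"
          using frechet_sum_Basis[OF schw_differentiable[OF \<phi>] linear_id, of ?x "- h"] by (simp add: dd_def)
        also have "cmod \<dots> \<le> (\<Sum>b\<in>(Basis::'a set). norm h * (\<bar>D b\<bar> / (1 + norm ?x) ^ ?M))"
        proof (rule sum_norm_le)
          fix b :: 'a assume b: "b \<in> Basis"
          have "\<bar>h \<bullet> b\<bar> * cmod (dd b \<phi> ?x) \<le> norm h * (\<bar>D b\<bar> / (1 + norm ?x) ^ ?M)"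
            using Basis_le_norm[OF b, of h] D[OF b, of ?x] p by (intro mult_mono) (auto simp: field_simps)
          then show "norm ((- h \<bullet> b) *\<^sub>R dd b \<phi> ?x) \<le> norm h * (\<bar>D b\<bar> / (1 + norm ?x) ^ ?M)" by simp
        qed
        also have "\<dots> = norm h * E * (1 / (1 + norm ?x) ^ ?M)"
          unfolding E_def by (simp add: sum_distrib_left sum_divide_distrib)
        also have "\<dots> \<le> norm h * E * (2 ^ ?M / (1 + norm y) ^ ?M)"
        proof (intro mult_left_mono weight_shift)
          have "r * norm h \<le> 1" using r True by (intro mult_le_one) auto
          then show "norm (r *\<^sub>R - h) \<le> 1" using r by simp
        qed (use E in auto)
        finally show "cmod (frechet_derivative \<phi> (at ?x) (- h)) \<le> norm h * E * 2 ^ ?M * (1 / (1 + norm y) ^ ?M)" by simp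
      qed
      then show ?thesis by simp
    qed
    have "(\<integral>\<^sup>+y. ennreal (cmod (\<phi> (y - h) - \<phi> y)) \<partial>lborel) \<le> (\<integral>\<^sup>+y. ennreal (norm h * E * 2 ^ ?M * (1 / (1 + norm (y::'a)) ^ ?M)) \<partial>lborel)"
      by (intro nn_integral_mono ennreal_leI p)
    also have "\<dots> = ennreal (norm h * E * 2 ^ ?M * Q)"
    proof -
      have "(\<integral>\<^sup>+y. ennreal (norm h * E * 2 ^ ?M * (1 / (1 + norm (y::'a)) ^ ?M)) \<partial>lborel) = ennreal (\<integral>y. norm h * E * 2 ^ ?M * (1 / (1 + norm (y::'a)) ^ ?M) \<partial>lborel)"
        by (rule nn_integral_eq_integral[OF integrable_mult_right[OF wi]]) (use E in auto)
      then show ?thesis unfolding Q_def by (simp only: integral_mult_right_zero)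
    qed
    also have "\<dots> \<le> ennreal ((E * 2 ^ ?M * Q + 2 * I) * norm h)"
      using I by (intro ennreal_leI) (simp add: algebra_simps)
    finally show ?thesis .
  next
    case False
    have "(\<integral>\<^sup>+y. ennreal (cmod (\<phi> (y - h) - \<phi> y)) \<partial>lborel) \<le> (\<integral>\<^sup>+y. ennreal (cmod (\<phi> (y + - h))) + ennreal (cmod (\<phi> y)) \<partial>lborel)"
      by (intro nn_integral_mono) (simp add: norm_triangle_ineq4 flip: ennreal_plus)
    also have "\<dots> = (\<integral>\<^sup>+y. ennreal (cmod (\<phi> (y + - h))) \<partial>lborel) + (\<integral>\<^sup>+y. ennreal (cmod (\<phi> y)) \<partial>lborel)"
      by (rule nn_integral_add) auto
    also have "(\<integral>\<^sup>+y. ennreal (cmod (\<phi> (y + - h))) \<partial>lborel) = (\<integral>\<^sup>+y. ennreal (cmod (\<phi> y)) \<partial>lborel)"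
      by (rule lborel_nn_integral_shift) simp
    also have "(\<integral>\<^sup>+y. ennreal (cmod (\<phi> y)) \<partial>lborel) = ennreal I"
      unfolding I_def by (intro nn_integral_eq_integral \<phi>i) auto
    also have "ennreal I + ennreal I \<le> ennreal ((E * 2 ^ ?M * Q + 2 * I) * norm h)"
    proof -
      have "2 * I * 1 \<le> 2 * I * norm h" using False I by (intro mult_left_mono) auto
      moreover have "0 \<le> E * 2 ^ ?M * Q * norm h" using E Q by simp
      ultimately have "I + I \<le> (E * 2 ^ ?M * Q + 2 * I) * norm h" by (simp add: algebra_simps)
      then show ?thesis using I by (simp add: ennreal_leI flip: ennreal_plus)
    qed
    finally show ?thesis .
  qed
  moreover have "E * 2 ^ ?M * Q + 2 * I \<ge> 0" using E Q I by simp
  ultimately show ?thesis by blast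
qed

lemma ft_affine:
  fixes \<phi> :: "'a::euclidean_space \<Rightarrow> complex"
  assumes [measurable]: "\<phi> \<in> borel_measurable borel" and e: "0 < e"
  shows "ft (\<lambda>z. \<phi> ((1 / e) *\<^sub>R (z - z0))) \<zeta> = of_real (e ^ DIM('a)) * (cis (- 2 * pi * (z0 \<bullet> \<zeta>)) * ft \<phi> (e *\<^sub>R \<zeta>))"
proof -
  have "ft (\<lambda>z. \<phi> ((1 / e) *\<^sub>R (z - z0))) \<zeta> = e ^ DIM('a) *\<^sub>R (\<integral>x. cis (- 2 * pi * ((z0 + e *\<^sub>R x) \<bullet> \<zeta>)) * \<phi> ((1 / e) *\<^sub>R ((z0 + e *\<^sub>R x) - z0)) \<partial>lborel)"
    unfolding ft_def using e by (subst lborel_integral_affine[of _ e z0]) auto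
  also have "(\<integral>x. cis (- 2 * pi * ((z0 + e *\<^sub>R x) \<bullet> \<zeta>)) * \<phi> ((1 / e) *\<^sub>R ((z0 + e *\<^sub>R x) - z0)) \<partial>lborel) =
     (\<integral>x. cis (- 2 * pi * (z0 \<bullet> \<zeta>)) * (cis (- 2 * pi * (x \<bullet> (e *\<^sub>R \<zeta>))) * \<phi> x) \<partial>lborel)"
  proof (intro Bochner_Integration.integral_cong refl)
    fix x
    have "cis (- 2 * pi * ((z0 + e *\<^sub>R x) \<bullet> \<zeta>)) = cis (- 2 * pi * (z0 \<bullet> \<zeta>)) * cis (- 2 * pi * (x \<bullet> (e *\<^sub>R \<zeta>)))"
      by (simp add: cis_mult inner_add_left algebra_simps)
    moreover have "(1 / e) *\<^sub>R ((z0 + e *\<^sub>R x) - z0) = x" using e by simp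
    ultimately show "cis (- 2 * pi * ((z0 + e *\<^sub>R x) \<bullet> \<zeta>)) * \<phi> ((1 / e) *\<^sub>R ((z0 + e *\<^sub>R x) - z0)) = cis (- 2 * pi * (z0 \<bullet> \<zeta>)) * (cis (- 2 * pi * (x \<bullet> (e *\<^sub>R \<zeta>))) * \<phi> x)"
      by (simp only: mult.assoc)
  qed
  finally show ?thesis by (simp add: ft_def scaleR_conv_of_real)
qed

text \<open>Wiener's argument: the transform of the localised oscillation is a superposition of differences
  of two translates of the transform of the rescaled bump, and these are small in mean.\<close>

lemma freeze_Wiener:
  fixes b \<phi> :: "'a::euclidean_space \<Rightarrow> complex"
  assumes b: "schw b" and \<phi>: "schw \<phi>"
  shows "\<exists>C\<ge>0. \<forall>e z0. 0 < e \<longrightarrow> schw (\<lambda>z. \<phi> ((1 / e) *\<^sub>R (z - z0))) \<longrightarrow>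
    (\<integral>\<^sup>+\<zeta>. ennreal (cmod (ft (\<lambda>z. (b z - b z0) * \<phi> ((1 / e) *\<^sub>R (z - z0))) \<zeta>)) \<partial>lborel) \<le> ennreal (C * e)"
proof -
  have F: "schw (ft \<phi>)" and Fb: "schw (ft b)" using schw_ft \<phi> b by auto
  note [measurable] = schw_measurable[OF F] schw_measurable[OF Fb] schw_measurable[OF \<phi>]
  obtain T where T: "T \<ge> 0" "\<And>h. (\<integral>\<^sup>+y. ennreal (cmod (ft \<phi> (y - h) - ft \<phi> y)) \<partial>lborel) \<le> ennreal (T * norm h)"
    using translation_L1_bound[OF F] by blast
  define I where "I = (\<integral>\<theta>. cmod (ft b \<theta>) * (1 + norm \<theta>) ^ 1 \<partial>lborel)"
  have I: "I \<ge> 0" unfolding I_def by (intro Bochner_Integration.integral_nonneg) auto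
  have "(\<integral>\<^sup>+\<zeta>. ennreal (cmod (ft (\<lambda>z. (b z - b z0) * \<phi> ((1 / e) *\<^sub>R (z - z0))) \<zeta>)) \<partial>lborel) \<le> ennreal (I * T * e)"
    if e: "0 < e" and \<phi>e: "schw (\<lambda>z. \<phi> ((1 / e) *\<^sub>R (z - z0)))" for e and z0 :: 'a
  proof -
    let ?d = "e ^ DIM('a)"
    let ?g = "\<lambda>\<zeta> \<theta>. cmod (ft b \<theta>) * (?d * cmod (ft \<phi> (e *\<^sub>R \<zeta> - e *\<^sub>R \<theta>) - ft \<phi> (e *\<^sub>R \<zeta>)))"
    let ?\<phi>e = "\<lambda>z. \<phi> ((1 / e) *\<^sub>R (z - z0))"
    have b0: "b z0 = (\<integral>\<theta>. ft b \<theta> * cis (2 * pi * (z0 \<bullet> \<theta>)) \<partial>lborel)"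
      using schw_inversion[OF b, of z0] by (simp add: ft_def inner_commute mult.commute)
    have fe: "ft ?\<phi>e \<zeta> = of_real ?d * (cis (- 2 * pi * (z0 \<bullet> \<zeta>)) * ft \<phi> (e *\<^sub>R \<zeta>))" for \<zeta>
      by (rule ft_affine[OF _ e]) simp
    obtain M where M: "\<And>z. cmod (ft ?\<phi>e z) \<le> M" using ft_bound[of ?\<phi>e] by blast
    \<comment> \<open>Inversion writes b z0 as an integral over \<theta>, and the convolution
      theorem does the same for the product with b, so the two can be subtracted under one
      integral.\<close>
    have key: "ft (\<lambda>z. (b z - b z0) * ?\<phi>e z) \<zeta> = (\<integral>\<theta>. ft b \<theta> * (ft ?\<phi>e (\<zeta> - \<theta>) - cis (2 * pi * (z0 \<bullet> \<theta>)) * ft ?\<phi>e \<zeta>) \<partial>lborel)" for \<zeta>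
    proof -
      have i1: "integrable lborel (\<lambda>\<theta>. ft b \<theta> * ft ?\<phi>e (\<zeta> - \<theta>))"
      proof (rule Bochner_Integration.integrable_bound)
        show "integrable lborel (\<lambda>\<theta>. of_real M * ft b \<theta>)" by (intro integrable_mult_right schw_integrable Fb)
        show "AE \<theta> in lborel. norm (ft b \<theta> * ft ?\<phi>e (\<zeta> - \<theta>)) \<le> norm (of_real M * ft b \<theta>)"
        proof (intro AE_I2)
          fix \<theta>
          have "cmod (ft ?\<phi>e (\<zeta> - \<theta>)) * cmod (ft b \<theta>) \<le> \<bar>M\<bar> * cmod (ft b \<theta>)"
            using M[of "\<zeta> - \<theta>"] by (intro mult_right_mono) auto
          then show "norm (ft b \<theta> * ft ?\<phi>e (\<zeta> - \<theta>)) \<le> norm (of_real M * ft b \<theta>)" by (simp only: norm_mult norm_of_real mult.commute)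
        qed
        have "ft ?\<phi>e \<in> borel_measurable borel" by (rule schw_measurable[OF schw_ft[OF \<phi>e]])
        then show "(\<lambda>\<theta>. ft b \<theta> * ft ?\<phi>e (\<zeta> - \<theta>)) \<in> borel_measurable lborel" by simp
      qed
      have i2: "integrable lborel (\<lambda>\<theta>. ft b \<theta> * cis (2 * pi * (z0 \<bullet> \<theta>)))"
        using ft_integrand_integrable[OF schw_integrable[OF Fb], of "2*pi" z0] by (simp add: inner_commute mult.commute)
      have "(\<lambda>z. (b z - b z0) * ?\<phi>e z) = (\<lambda>z. b z * ?\<phi>e z - b z0 * ?\<phi>e z)" by (simp add: algebra_simps)
      then have "ft (\<lambda>z. (b z - b z0) * ?\<phi>e z) \<zeta> = ft (\<lambda>z. b z * ?\<phi>e z) \<zeta> - b z0 * ft ?\<phi>e \<zeta>"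
        using ft_diff[OF schw_integrable[OF schw_mult[OF b \<phi>e]] schw_integrable[OF schw_cmult[OF \<phi>e]], of "b z0" \<zeta>]
        by (simp only: ft_cmult)
      also have "\<dots> = (\<integral>\<theta>. ft b \<theta> * ft ?\<phi>e (\<zeta> - \<theta>) \<partial>lborel) - (\<integral>\<theta>. (ft b \<theta> * cis (2 * pi * (z0 \<bullet> \<theta>))) * ft ?\<phi>e \<zeta> \<partial>lborel)"
        by (simp only: ft_mult[OF b schw_integrable[OF \<phi>e]] integral_mult_left_zero flip: b0)
      also have "\<dots> = (\<integral>\<theta>. ft b \<theta> * ft ?\<phi>e (\<zeta> - \<theta>) - (ft b \<theta> * cis (2 * pi * (z0 \<bullet> \<theta>))) * ft ?\<phi>e \<zeta> \<partial>lborel)"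
        by (rule Bochner_Integration.integral_diff[symmetric, OF i1 integrable_mult_left[OF i2]])
      finally show ?thesis by (simp only: right_diff_distrib mult.assoc)
    qed
    \<comment> \<open>The phases produced by centring at z0 combine into a common unimodular factor,
      so the bound is uniform in z0.\<close>
    have norm_eq: "cmod (ft b \<theta> * (ft ?\<phi>e (\<zeta> - \<theta>) - cis (2 * pi * (z0 \<bullet> \<theta>)) * ft ?\<phi>e \<zeta>)) = ?g \<zeta> \<theta>" for \<zeta> \<theta>
    proof -
      have "cis (2 * pi * (z0 \<bullet> \<theta>)) * cis (- 2 * pi * (z0 \<bullet> \<zeta>)) = cis (- 2 * pi * (z0 \<bullet> (\<zeta> - \<theta>)))"
        by (simp add: cis_mult inner_diff_right algebra_simps)
      then have "cis (2 * pi * (z0 \<bullet> \<theta>)) * ft ?\<phi>e \<zeta> = of_real ?d * (cis (- 2 * pi * (z0 \<bullet> (\<zeta> - \<theta>))) * ft \<phi> (e *\<^sub>R \<zeta>))"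
        unfolding fe
      proof -
        assume *: "cis (2 * pi * (z0 \<bullet> \<theta>)) * cis (- 2 * pi * (z0 \<bullet> \<zeta>)) = cis (- 2 * pi * (z0 \<bullet> (\<zeta> - \<theta>)))"
        have "cis (2 * pi * (z0 \<bullet> \<theta>)) * (of_real ?d * (cis (- 2 * pi * (z0 \<bullet> \<zeta>)) * ft \<phi> (e *\<^sub>R \<zeta>))) =
          of_real ?d * ((cis (2 * pi * (z0 \<bullet> \<theta>)) * cis (- 2 * pi * (z0 \<bullet> \<zeta>))) * ft \<phi> (e *\<^sub>R \<zeta>))"
          by (simp only: mult_ac)
        then show "cis (2 * pi * (z0 \<bullet> \<theta>)) * (of_real ?d * (cis (- 2 * pi * (z0 \<bullet> \<zeta>)) * ft \<phi> (e *\<^sub>R \<zeta>))) =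
          of_real ?d * (cis (- 2 * pi * (z0 \<bullet> (\<zeta> - \<theta>))) * ft \<phi> (e *\<^sub>R \<zeta>))" by (simp only: *)
      qed
      then have "ft ?\<phi>e (\<zeta> - \<theta>) - cis (2 * pi * (z0 \<bullet> \<theta>)) * ft ?\<phi>e \<zeta> =
        of_real ?d * cis (- 2 * pi * (z0 \<bullet> (\<zeta> - \<theta>))) * (ft \<phi> (e *\<^sub>R \<zeta> - e *\<^sub>R \<theta>) - ft \<phi> (e *\<^sub>R \<zeta>))"
        unfolding fe by (simp only: scaleR_diff_right right_diff_distrib mult.assoc)
      then show ?thesis using e by (simp only: norm_mult norm_cis norm_of_real) (simp add: abs_of_pos)
    qed
    have "(\<integral>\<^sup>+\<zeta>. ennreal (cmod (ft (\<lambda>z. (b z - b z0) * ?\<phi>e z) \<zeta>)) \<partial>lborel) \<le> (\<integral>\<^sup>+\<zeta>. (\<integral>\<^sup>+\<theta>. ennreal (?g \<zeta> \<theta>) \<partial>lborel) \<partial>lborel)"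
    proof (intro nn_integral_mono)
      fix \<zeta>
      show "ennreal (cmod (ft (\<lambda>z. (b z - b z0) * ?\<phi>e z) \<zeta>)) \<le> (\<integral>\<^sup>+\<theta>. ennreal (?g \<zeta> \<theta>) \<partial>lborel)"
        unfolding key norm_eq[symmetric] by (rule norm_integral_le_nn)
    qed
    also have "\<dots> = (\<integral>\<^sup>+\<theta>. (\<integral>\<^sup>+\<zeta>. ennreal (?g \<zeta> \<theta>) \<partial>lborel) \<partial>lborel)"
      by (rule lborel_pair.Fubini') simp
    also have "\<dots> \<le> (\<integral>\<^sup>+\<theta>. ennreal (T * e * (cmod (ft b \<theta>) * (1 + norm \<theta>) ^ 1)) \<partial>lborel)"
    proof (intro nn_integral_mono)
      fix \<theta>
      have "(\<integral>\<^sup>+\<zeta>. ennreal (?g \<zeta> \<theta>) \<partial>lborel) = ennreal (cmod (ft b \<theta>)) * (ennreal ?d * (\<integral>\<^sup>+\<zeta>. ennreal (cmod (ft \<phi> (e *\<^sub>R \<zeta> - e *\<^sub>R \<theta>) - ft \<phi> (e *\<^sub>R \<zeta>))) \<partial>lborel))"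
        using e by (simp add: ennreal_mult' nn_integral_cmult)
      \<comment> \<open>The power of e from rescaling the bump is exactly the Jacobian of y = e
        \<zeta>, so only the translation by e \<theta> remains and supplies the factor e.\<close>
      also have "ennreal ?d * (\<integral>\<^sup>+\<zeta>. ennreal (cmod (ft \<phi> (e *\<^sub>R \<zeta> - e *\<^sub>R \<theta>) - ft \<phi> (e *\<^sub>R \<zeta>))) \<partial>lborel) = (\<integral>\<^sup>+y. ennreal (cmod (ft \<phi> (y - e *\<^sub>R \<theta>) - ft \<phi> y)) \<partial>lborel)"
        using e by (subst lborel_nn_integral_affine[of "\<lambda>y. ennreal (cmod (ft \<phi> (y - e *\<^sub>R \<theta>) - ft \<phi> y))" e 0]) auto
      also have "ennreal (cmod (ft b \<theta>)) * \<dots> \<le> ennreal (cmod (ft b \<theta>)) * ennreal (T * norm (e *\<^sub>R \<theta>))"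
        by (intro mult_left_mono T) auto
      also have "\<dots> = ennreal (cmod (ft b \<theta>) * (T * (e * norm \<theta>)))" using e T(1) by (simp add: ennreal_mult)
      also have "\<dots> \<le> ennreal (T * e * (cmod (ft b \<theta>) * (1 + norm \<theta>) ^ 1))"
      proof (intro ennreal_leI)
        have "T * e * cmod (ft b \<theta>) * norm \<theta> \<le> T * e * cmod (ft b \<theta>) * (1 + norm \<theta>)" using T(1) e by (intro mult_left_mono) auto
        then show "cmod (ft b \<theta>) * (T * (e * norm \<theta>)) \<le> T * e * (cmod (ft b \<theta>) * (1 + norm \<theta>) ^ 1)" by (simp add: mult_ac)
      qed
      finally show "(\<integral>\<^sup>+\<zeta>. ennreal (?g \<zeta> \<theta>) \<partial>lborel) \<le> ennreal (T * e * (cmod (ft b \<theta>) * (1 + norm \<theta>) ^ 1))" .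
    qed
    also have "\<dots> = ennreal (T * e * I)"
    proof -
      have "integrable lborel (\<lambda>\<theta>. T * e * (cmod (ft b \<theta>) * (1 + norm \<theta>) ^ 1))"
        by (intro integrable_mult_right schw_integrable_weight Fb)
      then show ?thesis unfolding I_def using T(1) e by (subst nn_integral_eq_integral) auto
    qed
    finally show ?thesis by (simp add: mult_ac)
  qed
  moreover have "I * T \<ge> 0" using I T(1) by simp
  ultimately show ?thesis by blast
qed

section \<open>Bump functions and a finite partition of unity\<close>

context bump
begin

text \<open>The complement of the given cutoff serves as a bump function in all variables; a unit vector
  carries it over to the time variable.\<close>

definition bump3 :: "'n pt \<Rightarrow> complex" where
  "bump3 z = bp (fst z *\<^sub>R axis undefined 1) * (bp (fst (snd z)) * bp (snd (snd z)))"

lemma bump3_smth: "smth bump3"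
proof -
  have l: "bounded_linear (\<lambda>z::'n pt. fst z *\<^sub>R axis undefined 1 :: real ^ 'n)"
    "bounded_linear (\<lambda>z::'n pt. fst (snd z))" "bounded_linear (\<lambda>z::'n pt. snd (snd z))"
    by (intro bounded_linear_scaleR_const bounded_linear_fst bounded_linear_compose[OF bounded_linear_fst bounded_linear_snd]
        bounded_linear_compose[OF bounded_linear_snd bounded_linear_snd])+
  have b: "smth bp" by (rule schw_smth[OF bp_schw])
  show ?thesis unfolding bump3_def[abs_def]
    using smth_mult[OF smth_affine[OF b l(1), of 0] smth_mult[OF smth_affine[OF b l(2), of 0] smth_affine[OF b l(3), of 0]]] by simp
qed

lemma bp_1: "norm \<eta> \<le> 1 \<Longrightarrow> bp \<eta> = 1" and bp_0: "bp \<eta> \<noteq> 0 \<Longrightarrow> norm \<eta> < 2"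
  using w(4,5) by (auto simp: bp_def not_le[symmetric])

lemma bump3_1: "norm z \<le> 1 \<Longrightarrow> bump3 z = 1"
proof -
  assume z: "norm z \<le> 1"
  obtain t x v where e: "z = (t, x, v)" by (cases z)
  have "norm t \<le> norm z" "norm x \<le> norm z" "norm v \<le> norm z"
    unfolding e by (rule norm_fst_le) (rule order_trans[OF norm_fst_le norm_snd_le], rule order_trans[OF norm_snd_le norm_snd_le])
  then show ?thesis using z by (simp add: bump3_def e bp_1)
qed

text \<open>Each of the three factors confines its variable to the ball of radius 2, and the three
  radii add up to 6.\<close>

lemma bump3_supp: "bump3 z \<noteq> 0 \<Longrightarrow> norm z \<le> 6"
proof -
  assume z: "bump3 z \<noteq> 0"
  obtain t x v where e: "z = (t, x, v)" by (cases z)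
  have "norm (t *\<^sub>R axis undefined 1 :: real ^ 'n) < 2" "norm x < 2" "norm v < 2"
    using z bp_0[of "t *\<^sub>R axis undefined 1"] bp_0[of x] bp_0[of v] by (auto simp: bump3_def e)
  moreover have "norm z \<le> norm t + (norm x + norm v)"
    unfolding e using norm_Pair_le[of t "(x, v)"] norm_Pair_le[of x v] by linarith
  ultimately show ?thesis by simp
qed

lemma bump3_affine:
  assumes "0 < e"
  shows "smth (\<lambda>z. bump3 ((1 / e) *\<^sub>R (z - z0)))" "schw (\<lambda>z. bump3 ((1 / e) *\<^sub>R (z - z0)))"
    "norm (z - z0) \<le> e \<Longrightarrow> bump3 ((1 / e) *\<^sub>R (z - z0)) = 1"
    "bump3 ((1 / e) *\<^sub>R (z - z0)) \<noteq> 0 \<Longrightarrow> norm (z - z0) \<le> 6 * e"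
proof -
  have l: "bounded_linear (\<lambda>z::'n pt. (1 / e) *\<^sub>R z)" by (rule bounded_linear_scaleR_right)
  have "(\<lambda>z. bump3 ((- 1 / e) *\<^sub>R z0 + (1 / e) *\<^sub>R z)) = (\<lambda>z. bump3 ((1 / e) *\<^sub>R (z - z0)))" by (simp add: algebra_simps)
  then show s: "smth (\<lambda>z. bump3 ((1 / e) *\<^sub>R (z - z0)))" using smth_affine[OF bump3_smth l, of "(- 1 / e) *\<^sub>R z0"] by simp
  show supp: "norm (z - z0) \<le> 6 * e" if "bump3 ((1 / e) *\<^sub>R (z - z0)) \<noteq> 0" for z
    using bump3_supp[OF that] assms unfolding norm_scaleR by (simp add: field_simps)
  show "norm (z - z0) \<le> e \<Longrightarrow> bump3 ((1 / e) *\<^sub>R (z - z0)) = 1"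
    using assms by (intro bump3_1, unfold norm_scaleR) (simp add: field_simps)
  show "schw (\<lambda>z. bump3 ((1 / e) *\<^sub>R (z - z0)))"
  proof (rule smth_schw[OF s, of "norm z0 + 6 * e"])
    fix z assume "bump3 ((1 / e) *\<^sub>R (z - z0)) \<noteq> 0"
    then show "norm z \<le> norm z0 + 6 * e" using supp[of z] norm_triangle_ineq2[of z z0] by linarith
  qed
qed

lemma smth_diff1: "smth f \<Longrightarrow> smth (\<lambda>z. 1 - f z)"
  using smth_add[OF smtemp_smth[OF smtemp_const] smth_mult[OF smtemp_smth[OF smtemp_const]], of f 1 "-1"] by simp

text \<open>Centres are added one at a time: to a partial sum S the function \<open>bump3\<close> (1
  - S) is added. The new sum is 1 wherever S was 1 or the bump is 1, so no division by a sum of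
  bumps occurs. The 6 is the ratio of support radius to plateau radius.\<close>

lemma partition_of_unity:
  assumes "0 < e" "finite Z"
  shows "\<exists>\<kappa> :: 'n pt \<Rightarrow> 'n pt \<Rightarrow> complex. (\<forall>j\<in>Z. smth (\<kappa> j) \<and> (\<forall>z. \<kappa> j z \<noteq> 0 \<longrightarrow> norm (z - j) \<le> 6 * e))
    \<and> (\<forall>z. (\<exists>j\<in>Z. norm (z - j) \<le> e) \<longrightarrow> (\<Sum>j\<in>Z. \<kappa> j z) = 1)"
  using assms(2)
proof (induction Z rule: finite_induct)
  case (insert j Z)
  then obtain \<kappa> where \<kappa>: "\<And>i. i \<in> Z \<Longrightarrow> smth (\<kappa> i)" "\<And>i z. i \<in> Z \<Longrightarrow> \<kappa> i z \<noteq> 0 \<Longrightarrow> norm (z - i) \<le> 6 * e"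
    "\<And>z. (\<exists>i\<in>Z. norm (z - i) \<le> e) \<Longrightarrow> (\<Sum>i\<in>Z. \<kappa> i z) = 1" by blast
  define S where "S z = (\<Sum>i\<in>Z. \<kappa> i z)" for z
  have S: "smth S" unfolding S_def using insert(1) \<kappa>(1)
  proof (induction Z rule: finite_induct)
    case empty
    then show ?case using smtemp_smth[OF smtemp_const[of 0]] by simp
  qed (auto intro!: smth_add)
  define f where "f z = bump3 ((1 / e) *\<^sub>R (z - j)) * (1 - S z)" for z
  have f: "smth f" "\<And>z. f z \<noteq> 0 \<Longrightarrow> norm (z - j) \<le> 6 * e"
    unfolding f_def using bump3_affine[OF assms(1), where ?z0.0=j] by (auto intro!: smth_mult smth_diff1 S)
  have "(\<Sum>i\<in>insert j Z. (\<kappa>(j := f)) i z) = f z + S z" for z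
    unfolding S_def using insert by (simp add: sum.insert) (intro sum.cong, auto)
  moreover have "f z + S z = 1" if "\<exists>i\<in>insert j Z. norm (z - i) \<le> e" for z
  proof (cases "\<exists>i\<in>Z. norm (z - i) \<le> e")
    case True
    then show ?thesis using \<kappa>(3) by (simp add: f_def S_def)
  next
    case False
    then show ?thesis using that bump3_affine(3)[OF assms(1)] by (simp add: f_def)
  qed
  ultimately show ?case using f \<kappa> by (intro exI[of _ "\<kappa>(j := f)"]) auto
qed auto

end

subsection \<open>The localised estimate\<close>

text \<open>Finiteness is essential: for infinite X the second hypothesis says nothing.\<close>

lemma ennreal_absorb:
  fixes X Y :: ennreal
  assumes "X < \<infinity>" "X \<le> ennreal (1/2) * X + Y"
  shows "X \<le> 2 * Y"
proof (cases Y)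
  case (real y)
  obtain x where x: "X = ennreal x" "x \<ge> 0" using assms(1) by (cases X) auto
  have "ennreal (1/2 * x) = ennreal (1/2) * ennreal x" by (rule ennreal_mult') simp
  moreover have "ennreal (1/2 * x + y) = ennreal (1/2 * x) + ennreal y" using x real by (intro ennreal_plus) auto
  ultimately have "ennreal x \<le> ennreal (1/2 * x + y)" using assms(2) unfolding x(1) real by simp
  then have "x \<le> 2 * y" using x real by (subst (asm) ennreal_le_iff) auto
  then have "ennreal x \<le> ennreal (2 * y)" by (rule ennreal_leI)
  then show ?thesis using x real by (simp add: ennreal_mult)
qed (simp add: ennreal_mult_top)

lemma ennreal_bound_mult:
  assumes "X \<le> ennreal k * Z" "Z \<le> ennreal z" "0 \<le> k"
  shows "X \<le> ennreal (k * z)"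
proof -
  have "X \<le> ennreal k * ennreal z" using assms(1) mult_left_mono[OF assms(2), of "ennreal k"] by (meson order_trans zero_le)
  then show ?thesis using assms by (simp add: ennreal_mult')
qed

lemma ennreal_bound_add:
  assumes "X \<le> A + B" "A \<le> ennreal a" "B \<le> ennreal b" "0 \<le> a" "0 \<le> b"
  shows "X \<le> ennreal (a + b)"
  using order_trans[OF assms(1) add_mono[OF assms(2,3)]] assms(4,5) by simp

text \<open>The bookkeeping of the localised estimate, kept apart from the analysis. Y is the gained
  norm of the localised function and G its plain norm, N is the source, X1 to X5 are its pieces, D
  is the commutator, U and P are the norms on the right, and B is the term left for the patching.
  The \<open>+ 1\<close> keeps the constant positive, so an infinite right-hand norm makes the claim
  trivial.\<close>

lemma absorb_arith:
  fixes Y N G X1 X2 X3 X4 X5 D P U B :: ennreal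
  assumes Y: "Y < \<infinity>"
    and e: "Y \<le> ennreal C1 * (N + G)" "N \<le> 2 * X5 + 16 * (X1 + (X2 + (X3 + X4)))"
      "X5 \<le> ennreal e1 * Y + ennreal k5 * G" "X1 \<le> ennreal k1 * P" "X2 \<le> ennreal k2 * U"
      "X3 \<le> ennreal k3 * D" "X4 \<le> ennreal k4 * D" "D \<le> ennreal d * B + ennreal k * U" "G \<le> ennreal k6 * U"
    and nn: "0 \<le> C1" "0 \<le> e1" "0 \<le> k1" "0 \<le> k2" "0 \<le> k3" "0 \<le> k4" "0 \<le> k5" "0 \<le> k6" "0 \<le> d" "0 \<le> k" "0 < \<delta>"
    and small: "2 * C1 * e1 \<le> 1 / 2" "32 * C1 * (k3 + k4) * d \<le> \<delta>"
  shows "Y \<le> ennreal \<delta> * B + ennreal (2 * C1 * (2 * k5 * k6 + 16 * k1 + 16 * k2 + 16 * (k3 + k4) * k + k6) + 1) * (U + P)"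
    (is "_ \<le> _ + ennreal ?K * _")
proof -
  have K: "?K > 0" using nn by (intro add_nonneg_pos mult_nonneg_nonneg) auto
  show ?thesis
  proof (cases "B = \<infinity> \<or> U = \<infinity> \<or> P = \<infinity>")
    case True
    then show ?thesis using K nn(11) by (auto simp: ennreal_mult_top)
  next
    case False
    then obtain b u q where r: "B = ennreal b" "0 \<le> b" "U = ennreal u" "0 \<le> u" "P = ennreal q" "0 \<le> q"
      by (cases B; cases U; cases P) auto
    obtain y where y: "Y = ennreal y" "0 \<le> y" using Y by (cases Y) auto
    have D: "D \<le> ennreal (d * b + k * u)"
      using e(8) nn r by (simp add: ennreal_mult)
    have G: "G \<le> ennreal (k6 * u)" using e(9) nn r by (simp add: ennreal_mult)
    have X1: "X1 \<le> ennreal (k1 * q)" and X2: "X2 \<le> ennreal (k2 * u)" using e(4,5) nn r by (auto simp: ennreal_mult)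
    have X3: "X3 \<le> ennreal (k3 * (d * b + k * u))" and X4: "X4 \<le> ennreal (k4 * (d * b + k * u))"
      using ennreal_bound_mult[OF e(6) D] ennreal_bound_mult[OF e(7) D] nn by auto
    have X5: "X5 \<le> ennreal (e1 * y + k5 * (k6 * u))"
    proof (rule ennreal_bound_add[OF e(3)])
      show "ennreal e1 * Y \<le> ennreal (e1 * y)" using nn y by (simp add: ennreal_mult)
      show "ennreal k5 * G \<le> ennreal (k5 * (k6 * u))" by (rule ennreal_bound_mult[OF order_refl G nn(7)])
    qed (use nn r y in auto)
    have X34: "X3 + X4 \<le> ennreal (k3 * (d * b + k * u) + k4 * (d * b + k * u))"
      by (rule ennreal_bound_add[OF order_refl X3 X4]) (use nn r in auto)
    have X24: "X2 + (X3 + X4) \<le> ennreal (k2 * u + (k3 * (d * b + k * u) + k4 * (d * b + k * u)))"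
      by (rule ennreal_bound_add[OF order_refl X2 X34]) (use nn r in auto)
    have X14: "X1 + (X2 + (X3 + X4)) \<le> ennreal (k1 * q + (k2 * u + (k3 * (d * b + k * u) + k4 * (d * b + k * u))))"
      by (rule ennreal_bound_add[OF order_refl X1 X24]) (use nn r in auto)
    let ?n = "2 * (e1 * y + k5 * (k6 * u)) + 16 * (k1 * q + (k2 * u + (k3 * (d * b + k * u) + k4 * (d * b + k * u))))"
    have N: "N \<le> ennreal ?n"
    proof (rule ennreal_bound_add[OF e(2)])
      have "(2::ennreal) * X5 \<le> ennreal 2 * X5" by simp
      from ennreal_bound_mult[OF this X5] show "2 * X5 \<le> ennreal (2 * (e1 * y + k5 * (k6 * u)))" by simp
      have "(16::ennreal) * (X1 + (X2 + (X3 + X4))) \<le> ennreal 16 * (X1 + (X2 + (X3 + X4)))" by simp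
      from ennreal_bound_mult[OF this X14] show "16 * (X1 + (X2 + (X3 + X4))) \<le> ennreal (16 * (k1 * q + (k2 * u + (k3 * (d * b + k * u) + k4 * (d * b + k * u)))))"
        by simp
    qed (use nn r y in auto)
    have NG: "N + G \<le> ennreal (?n + k6 * u)"
      by (rule ennreal_bound_add[OF order_refl N G]) (use nn r y in auto)
    have "ennreal y \<le> ennreal (C1 * (?n + k6 * u))" using ennreal_bound_mult[OF e(1) NG nn(1)] y by simp
    then have "y \<le> C1 * (?n + k6 * u)" using nn r y by (subst (asm) ennreal_le_iff) auto
    \<comment> \<open>Collected by unknowns: the y-term has coefficient at most 1/2 and moves to the
      left, which doubles the other coefficients and explains the 32 in the smallness
      condition.\<close>
    also have "\<dots> = 2 * C1 * e1 * y + C1 * ((2 * k5 * k6 + 16 * k2 + 16 * (k3 + k4) * k + k6) * u + 16 * k1 * q) + 16 * C1 * (k3 + k4) * d * b"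
      by (simp add: algebra_simps)
    also have "2 * C1 * e1 * y \<le> 1 / 2 * y" using small y by (intro mult_right_mono) auto
    finally have "y \<le> 32 * C1 * (k3 + k4) * d * b + 2 * C1 * ((2 * k5 * k6 + 16 * k2 + 16 * (k3 + k4) * k + k6) * u + 16 * k1 * q)" by simp
    also have "32 * C1 * (k3 + k4) * d * b \<le> \<delta> * b" using small r by (intro mult_right_mono) auto
    also have "2 * C1 * ((2 * k5 * k6 + 16 * k2 + 16 * (k3 + k4) * k + k6) * u + 16 * k1 * q) \<le> ?K * (u + q)"
    proof -
      let ?s = "2 * k5 * k6 + 16 * k2 + 16 * (k3 + k4) * k + k6"
      have "?s * u + 16 * k1 * q \<le> (?s + 16 * k1) * (u + q)" using nn r by (simp add: algebra_simps)
      then have "2 * C1 * (?s * u + 16 * k1 * q) \<le> 2 * C1 * ((?s + 16 * k1) * (u + q))" using nn by (intro mult_left_mono) auto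
      also have "\<dots> \<le> ?K * (u + q)" using r by (simp add: algebra_simps)
      finally show ?thesis .
    qed
    finally have "ennreal y \<le> ennreal (\<delta> * b + ?K * (u + q))" by (intro ennreal_leI) auto
    moreover have "ennreal (\<delta> * b + K * (u + q)) = ennreal \<delta> * ennreal b + ennreal K * (ennreal u + ennreal q)" if "K > 0" for K
      using that r nn(11) by (simp add: ennreal_mult)
    ultimately show ?thesis using K unfolding y(1) r(1,3,5) by simp
  qed
qed

lemma ennreal_nested_sum:
  fixes A B C E F :: ennreal
  shows "2 * A + 2 * (2 * B + 2 * (2 * C + 2 * (2 * E + 2 * F))) \<le> 2 * A + 16 * (B + (C + (E + F)))"
proof -
  have "2 * A + 2 * (2 * B + 2 * (2 * C + 2 * (2 * E + 2 * F))) = 2 * A + (4 * B + (8 * C + (16 * E + 16 * F)))"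
    by (simp add: distrib_left mult.assoc[symmetric])
  also have "\<dots> \<le> 2 * A + (16 * B + (16 * C + (16 * E + 16 * F)))"
    by (intro add_mono mult_right_mono order_refl) auto
  finally show ?thesis by (simp only: distrib_left)
qed

section \<open>Integrability and finiteness of the pieces\<close>

lemma schw_mult_integrable:
  assumes \<psi>: "schw \<psi>" and g: "integrable lborel g"
  shows "integrable lborel (\<lambda>z. \<psi> z * g z)"
proof -
  obtain M where M: "\<And>z. cmod (\<psi> z) \<le> M" using schwE[OF \<psi>, of 0] by (metis mult.right_neutral power_0)
  note [measurable] = schw_measurable[OF \<psi>]
  have [measurable]: "g \<in> borel_measurable borel" using g by auto
  show ?thesis
  proof (rule Bochner_Integration.integrable_bound)
    show "integrable lborel (\<lambda>z. of_real M * g z)" using g by (intro integrable_mult_right)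
    show "AE z in lborel. norm (\<psi> z * g z) \<le> norm (of_real M * g z)"
    proof (intro AE_I2)
      fix z
      have "cmod (\<psi> z) * cmod (g z) \<le> \<bar>M\<bar> * cmod (g z)" using M[of z] by (intro mult_right_mono) auto
      then show "norm (\<psi> z * g z) \<le> norm (of_real M * g z)" by (simp add: norm_mult)
    qed
  qed measurable
qed

lemma Nsq_mono: "(\<And>\<zeta>. \<bar>W \<zeta>\<bar> \<le> \<bar>W' \<zeta>\<bar>) \<Longrightarrow> Nsq W g \<le> Nsq W' g"
  unfolding Nsq_def by (intro nn_integral_mono power_mono ennreal_leI mult_right_mono) auto

text \<open>Both weights grow at most polynomially and \<open>ft u\<close> decays rapidly; this
  licenses the two absorptions below.\<close>

lemma Nsq_weights_finite:
  assumes "schw u" "0 < p"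
  shows "Nsq (\<lambda>\<zeta>. jw s \<zeta> * vw p \<zeta>) (ft u) < \<infinity>"
proof (rule Nsq_finite)
  fix \<zeta> :: "'a pt"
  let ?n = "nat \<lceil>\<bar>s\<bar>\<rceil>" and ?m = "nat \<lceil>\<bar>p\<bar>\<rceil>"
  have j: "jw s \<zeta> \<le> (1 + norm \<zeta>) ^ ?n"
    using jw_peetre[of s \<zeta> \<zeta>] by (simp add: jw_def jb_def)
  have b: "r powr q \<le> (1 + norm \<zeta>) ^ ?m" if "0 \<le> r" "r \<le> norm \<zeta>" "0 < q" "q \<le> p" for r q
  proof -
    have "r powr q \<le> (1 + norm \<zeta>) powr q" using that by (intro powr_mono2) auto
    also have "\<dots> \<le> (1 + norm \<zeta>) powr \<bar>p\<bar>" using that by (intro powr_mono) auto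
    also have "\<dots> \<le> (1 + norm \<zeta>) ^ ?m" by (intro powr_le_power) simp
    finally show ?thesis .
  qed
  have "norm (fst (snd \<zeta>)) \<le> norm \<zeta>" "norm (snd (snd \<zeta>)) \<le> norm \<zeta>"
    by (cases \<zeta>, simp, rule order_trans[OF norm_fst_le norm_snd_le], cases \<zeta>, simp, rule order_trans[OF norm_snd_le norm_snd_le])
  then have "norm (fst (snd \<zeta>)) powr (p / (p + 1)) \<le> (1 + norm \<zeta>) ^ ?m" "norm (snd (snd \<zeta>)) powr p \<le> (1 + norm \<zeta>) ^ ?m"
    using assms(2) by - (rule b; auto simp: divide_simps)+
  moreover have "1 \<le> (1 + norm \<zeta>) ^ ?m" by (intro one_le_power) simp
  ultimately have "vw p \<zeta> \<le> 3 * (1 + norm \<zeta>) ^ ?m" unfolding vw_def by linarith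
  then have "jw s \<zeta> * vw p \<zeta> \<le> (1 + norm \<zeta>) ^ ?n * (3 * (1 + norm \<zeta>) ^ ?m)" by (intro mult_mono j) auto
  then show "\<bar>jw s \<zeta> * vw p \<zeta>\<bar> \<le> 3 * (1 + norm \<zeta>) ^ (?n + ?m)" by (simp add: power_add)
qed (use assms schw_rapid schw_ft schw_measurable in auto)

context bump
begin

lemma opP_integrable:
  assumes a: "continuous_on UNIV a" "\<And>z. \<bar>a z\<bar> \<le> A" and u: "schw u"
  shows "integrable lborel (opP \<sigma> w a u)"
proof -
  have [measurable]: "a \<in> borel_measurable borel" using a by (intro borel_measurable_continuous_onI)
  have L: "integrable lborel (frac_lap_v \<sigma> w u)" by (rule frac_lap_v_integrable[OF u])
  then have [measurable]: "frac_lap_v \<sigma> w u \<in> borel_measurable borel" by auto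
  have "integrable lborel (\<lambda>z. complex_of_real (a z) * frac_lap_v \<sigma> w u z)"
  proof (rule Bochner_Integration.integrable_bound)
    show "integrable lborel (\<lambda>z. of_real A * frac_lap_v \<sigma> w u z)" by (intro integrable_mult_right L)
    show "AE z in lborel. norm (complex_of_real (a z) * frac_lap_v \<sigma> w u z) \<le> norm (of_real A * frac_lap_v \<sigma> w u z)"
    proof (intro AE_I2)
      fix z
      have "\<bar>a z\<bar> * cmod (frac_lap_v \<sigma> w u z) \<le> \<bar>A\<bar> * cmod (frac_lap_v \<sigma> w u z)" using a(2)[of z] by (intro mult_right_mono) auto
      then show "norm (complex_of_real (a z) * frac_lap_v \<sigma> w u z) \<le> norm (of_real A * frac_lap_v \<sigma> w u z)" by (simp add: norm_mult)
    qed
  qed measurable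
  then show ?thesis
    unfolding opP_eq[abs_def] by (rule Bochner_Integration.integrable_add[OF schw_integrable[OF schw_transport[OF u]]])
qed

text \<open>On the support of \<phi> the coefficient is c + \<beta>. The oscillation \<beta> is made
  to act on F(D) of the localised function, not on \<phi> times F(D) u, because only the former is
  controlled by the left side; the exchange costs a second commutator, itself multiplied by \<beta>.
  The identity \<open>eq\<close> binds only where \<phi> is nonzero, so \<beta> can be a Schwartz
  function.\<close>

lemma local_decomposition:
  fixes \<sigma> :: real and a :: "'n pt \<Rightarrow> real"
  assumes a: "continuous_on UNIV a" "\<And>z. \<bar>a z\<bar> \<le> A" and \<phi>: "schw \<phi>" and \<beta>: "schw \<beta>" and u: "schw u"
    and eq: "\<And>z. (complex_of_real (a z) - of_real c) * \<phi> z = \<beta> z * \<phi> z"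
  defines "D \<equiv> \<lambda>\<zeta>. ft (\<lambda>z. \<phi> z * frac_lap_v \<sigma> w u z) \<zeta> - of_real (ksym \<sigma> w \<zeta>) * ft (\<lambda>z. \<phi> z * u z) \<zeta>"
  shows "ft (transport (\<lambda>z. \<phi> z * u z)) \<zeta> + of_real (c * ksym \<sigma> w \<zeta>) * ft (\<lambda>z. \<phi> z * u z) \<zeta> =
     (- 1) * ft (\<lambda>z. \<beta> z * frac_lap_v \<sigma> w (\<lambda>z. \<phi> z * u z) z) \<zeta> +
     (ft (\<lambda>z. \<phi> z * opP \<sigma> w a u z) \<zeta> + (ft (\<lambda>z. transport \<phi> z * u z) \<zeta> +
      ((- of_real c) * D \<zeta> + (- 1) * ft (\<lambda>z. \<beta> z * (\<phi> z * frac_lap_v \<sigma> w u z - frac_lap_v \<sigma> w (\<lambda>z. \<phi> z * u z) z)) \<zeta>)))"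
    and "ft (\<lambda>z. \<phi> z * frac_lap_v \<sigma> w u z - frac_lap_v \<sigma> w (\<lambda>z. \<phi> z * u z) z) = D"
    and "integrable lborel (\<lambda>z. \<phi> z * frac_lap_v \<sigma> w u z - frac_lap_v \<sigma> w (\<lambda>z. \<phi> z * u z) z)"
proof -
  let ?v = "\<lambda>z. \<phi> z * u z" and ?L = "frac_lap_v \<sigma> w u"
  have v: "schw ?v" by (intro schw_mult \<phi> u)
  let ?Lv = "frac_lap_v \<sigma> w ?v"
  have i1: "integrable lborel (\<lambda>z. \<phi> z * opP \<sigma> w a u z)" by (intro schw_mult_integrable \<phi> opP_integrable[OF a u])
  have i2: "integrable lborel (\<lambda>z. transport \<phi> z * u z)" by (intro schw_integrable schw_mult schw_transport \<phi> u)
  have i3: "integrable lborel (\<lambda>z. \<phi> z * ?L z)" by (intro schw_mult_integrable \<phi> frac_lap_v_integrable u)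
  have i4: "integrable lborel ?Lv" by (intro frac_lap_v_integrable v)
  show i5: "integrable lborel (\<lambda>z. \<phi> z * ?L z - ?Lv z)" by (intro Bochner_Integration.integrable_diff i3 i4)
  have i6: "integrable lborel (\<lambda>z. \<beta> z * (\<phi> z * ?L z - ?Lv z))" by (intro schw_mult_integrable \<beta> i5)
  have i7: "integrable lborel (\<lambda>z. \<beta> z * ?Lv z)" by (intro schw_mult_integrable \<beta> i4)
  show "ft (\<lambda>z. \<phi> z * ?L z - ?Lv z) = D"
    unfolding D_def by (rule ext) (simp add: ft_diff[OF i3 i4] ft_frac_lap_v[OF v])
  have "transport ?v z = (- 1) * (\<beta> z * ?Lv z) + (\<phi> z * opP \<sigma> w a u z + (transport \<phi> z * u z +
      ((- of_real c) * (\<phi> z * ?L z) + (- 1) * (\<beta> z * (\<phi> z * ?L z - ?Lv z)))))" for z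
  proof -
    have "transport ?v z = \<phi> z * transport u z + transport \<phi> z * u z"
      by (rule transport_mult) (use \<phi> u schw_differentiable in auto)
    moreover have "of_real (a z) * (\<phi> z * ?L z) = of_real c * (\<phi> z * ?L z) + \<beta> z * (\<phi> z * ?L z)"
      using arg_cong[OF eq[of z], of "\<lambda>x. x * ?L z"] by (simp add: algebra_simps)
    ultimately show ?thesis unfolding opP_eq by (simp add: algebra_simps)
  qed
  then have "ft (transport ?v) \<zeta> = ft (\<lambda>z. (- 1) * (\<beta> z * ?Lv z) + (\<phi> z * opP \<sigma> w a u z + (transport \<phi> z * u z +
      ((- of_real c) * (\<phi> z * ?L z) + (- 1) * (\<beta> z * (\<phi> z * ?L z - ?Lv z)))))) \<zeta>" by presburger
  also have "\<dots> = (- 1) * ft (\<lambda>z. \<beta> z * ?Lv z) \<zeta> + (ft (\<lambda>z. \<phi> z * opP \<sigma> w a u z) \<zeta> + (ft (\<lambda>z. transport \<phi> z * u z) \<zeta> +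
      ((- of_real c) * ft (\<lambda>z. \<phi> z * ?L z) \<zeta> + (- 1) * ft (\<lambda>z. \<beta> z * (\<phi> z * ?L z - ?Lv z)) \<zeta>)))"
    by (subst ft_add, intro integrable_mult_right i7,
        intro Bochner_Integration.integrable_add integrable_mult_right i1 i2 i3 i6,
        subst ft_add, rule i1,
        intro Bochner_Integration.integrable_add integrable_mult_right i2 i3 i6,
        subst ft_add, rule i2,
        intro Bochner_Integration.integrable_add integrable_mult_right i3 i6,
        subst ft_add, intro integrable_mult_right i3, intro integrable_mult_right i6)
       (simp only: ft_cmult)
  finally show "ft (transport ?v) \<zeta> + of_real (c * ksym \<sigma> w \<zeta>) * ft ?v \<zeta> =
     (- 1) * ft (\<lambda>z. \<beta> z * ?Lv z) \<zeta> +
     (ft (\<lambda>z. \<phi> z * opP \<sigma> w a u z) \<zeta> + (ft (\<lambda>z. transport \<phi> z * u z) \<zeta> +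
      ((- of_real c) * D \<zeta> + (- 1) * ft (\<lambda>z. \<beta> z * (\<phi> z * ?L z - ?Lv z)) \<zeta>)))"
    by (simp add: D_def algebra_simps)
qed

text \<open>The threshold \<epsilon> precedes \<phi>, \<beta>, c and \<delta>: it may depend on s
  and the bounds of the coefficient but not on the ball, whose size it determines. The first term on
  the right lives on u, not on the localised function, and can be absorbed only after
  summation.\<close>

theorem local_estimate:
  fixes s :: real and a :: "'n pt \<Rightarrow> real"
  assumes \<sigma>: "0 < \<sigma>" "\<sigma> < 1" and a: "continuous_on UNIV a" "\<And>z. \<bar>a z\<bar> \<le> A" and a0: "0 < a0"
  shows "\<exists>\<epsilon>>0. \<forall>\<phi> \<beta> c \<delta>. schw \<phi> \<longrightarrow> schw \<beta> \<longrightarrow> (\<integral>\<theta>. cmod (ft \<beta> \<theta>) \<partial>lborel) \<le> \<epsilon> \<longrightarrow> a0 \<le> c \<longrightarrow> c \<le> A \<longrightarrow>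
    (\<forall>z. (complex_of_real (a z) - of_real c) * \<phi> z = \<beta> z * \<phi> z) \<longrightarrow> 0 < \<delta> \<longrightarrow>
    (\<exists>K\<ge>0. \<forall>u. schw u \<longrightarrow> Nsq (\<lambda>\<zeta>. jw s \<zeta> * vw (2 * \<sigma>) \<zeta>) (ft (\<lambda>z. \<phi> z * u z)) \<le>
      ennreal \<delta> * Nsq (\<lambda>\<zeta>. jw s \<zeta> * bw (2 * \<sigma>) \<zeta>) (ft u) + ennreal K * (Nsq (jw s) (ft u) + Nsq (jw s) (ft (opP \<sigma> w a u))))"
proof -
  define p where "p = 2 * \<sigma>"
  obtain C1 where C1: "C1 \<ge> 0" "\<And>c (G :: 'n pt \<Rightarrow> complex) f. a0 \<le> c \<Longrightarrow> c \<le> A \<Longrightarrow> schw G \<Longrightarrow> continuous_on UNIV f \<Longrightarrow>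
    (\<And>\<zeta>. f \<zeta> = 2 * pi * \<i> * of_real (fst \<zeta>) * G \<zeta> - frechet_derivative G (at \<zeta>) (0, 0, fst (snd \<zeta>))
      + of_real (c * ksym \<sigma> w \<zeta>) * G \<zeta>) \<Longrightarrow>
    Nsq (\<lambda>\<zeta>. jw s \<zeta> * vw (2 * \<sigma>) \<zeta>) G \<le> ennreal C1 * (Nsq (jw s) f + Nsq (jw s) G)"
    using constant_coefficient_estimate[OF \<sigma> a0, of A s] by blast
  define cF where "cF = (2 * pi) powr (2 * \<sigma>) + 8"
  have cF: "cF > 0" by (simp add: cF_def add_nonneg_pos)
  \<comment> \<open>With this choice the leading part of the oscillation contributes at most 32/144
    < 1/4 after multiplication by 2 C1; the \<open>+ 1\<close> guards against C1 = 0.\<close>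
  define \<epsilon> where "\<epsilon> = 1 / (12 * cF * (C1 + 1))"
  have \<epsilon>: "\<epsilon> > 0" using cF C1(1) by (simp add: \<epsilon>_def)
  have \<epsilon>s: "2 * C1 * (8 * \<epsilon>\<^sup>2 * (2 * cF\<^sup>2)) \<le> 1 / 4"
  proof -
    have "\<epsilon> * cF = 1 / (12 * (C1 + 1))" using cF by (simp add: \<epsilon>_def)
    moreover have "2 * C1 * (8 * \<epsilon>\<^sup>2 * (2 * cF\<^sup>2)) = 32 * C1 * (\<epsilon> * cF)\<^sup>2"
      by (simp add: power_mult_distrib)
    ultimately have "2 * C1 * (8 * \<epsilon>\<^sup>2 * (2 * cF\<^sup>2)) = 32 * C1 * (1 / (12 * (C1 + 1)))\<^sup>2"
      by (simp only:)
    also have "\<dots> = (32 / 144) * (C1 / (C1 + 1)\<^sup>2)" by (simp only: power_divide power_mult_distrib) simp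
    also have "\<dots> \<le> (32 / 144) * 1"
    proof (intro mult_left_mono)
      have "C1 \<le> (C1 + 1)\<^sup>2" using C1(1) by (simp add: power2_eq_square algebra_simps)
      then show "C1 / (C1 + 1)\<^sup>2 \<le> 1" using C1(1) by (simp add: divide_le_eq_1)
    qed auto
    finally show ?thesis by simp
  qed
  have "\<exists>K\<ge>0. \<forall>u. schw u \<longrightarrow> Nsq (\<lambda>\<zeta>. jw s \<zeta> * vw (2 * \<sigma>) \<zeta>) (ft (\<lambda>z. \<phi> z * u z)) \<le>
      ennreal \<delta> * Nsq (\<lambda>\<zeta>. jw s \<zeta> * bw (2 * \<sigma>) \<zeta>) (ft u) + ennreal K * (Nsq (jw s) (ft u) + Nsq (jw s) (ft (opP \<sigma> w a u)))"
    if \<phi>: "schw \<phi>" and \<beta>: "schw \<beta>" and \<beta>\<epsilon>: "(\<integral>\<theta>. cmod (ft \<beta> \<theta>) \<partial>lborel) \<le> \<epsilon>" and c: "a0 \<le> c" "c \<le> A"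
      and eq: "\<And>z. (complex_of_real (a z) - of_real c) * \<phi> z = \<beta> z * \<phi> z" and \<delta>: "0 < \<delta>" for \<phi> \<beta> :: "'n pt \<Rightarrow> complex" and c \<delta>
  proof -
    obtain k1 where k1: "k1 \<ge> 0" "\<And>g. integrable lborel g \<Longrightarrow> Nsq (jw s) (ft (\<lambda>z. \<phi> z * g z)) \<le> ennreal k1 * Nsq (jw s) (ft g)"
      using mult_bound[OF \<phi>, of s] by blast
    obtain k2 where k2: "k2 \<ge> 0" "\<And>g. integrable lborel g \<Longrightarrow> Nsq (jw s) (ft (\<lambda>z. transport \<phi> z * g z)) \<le> ennreal k2 * Nsq (jw s) (ft g)"
      using mult_bound[OF schw_transport[OF \<phi>], of s] by blast
    obtain k4 where k4: "k4 \<ge> 0" "\<And>g. integrable lborel g \<Longrightarrow> Nsq (jw s) (ft (\<lambda>z. \<beta> z * g z)) \<le> ennreal k4 * Nsq (jw s) (ft g)"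
      using mult_bound[OF \<beta>, of s] by blast
    define k3 where "k3 = c\<^sup>2"
    obtain k5 where k5: "k5 \<ge> 0" "\<And>g. integrable lborel g \<Longrightarrow> Nsq (jw s) (ft (\<lambda>z. \<beta> z * g z))
        \<le> ennreal (8 * \<epsilon>\<^sup>2) * Nsq (jw s) (ft g) + ennreal k5 * Nsq (\<lambda>\<zeta>. jw s \<zeta> / jb \<zeta>) (ft g)"
      using mult_bound_sharp[OF \<beta> \<beta>\<epsilon>, of s] by blast
    \<comment> \<open>The lower-order part of the oscillation contributes the other quarter: 2 C1 k5
      \<delta>5 \<le> 1/4, so the two together stay below 1/2.\<close>
    define \<delta>5 where "\<delta>5 = 1 / (8 * (C1 * k5 + 1))"
    have \<delta>5: "\<delta>5 > 0" using C1(1) k5(1) by (simp add: \<delta>5_def add_nonneg_pos)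
    obtain k7 where k7: "k7 \<ge> 0" "\<And>G. G \<in> borel_measurable borel \<Longrightarrow>
      Nsq (\<lambda>\<zeta>. jw s \<zeta> / jb \<zeta>) (\<lambda>\<zeta>. of_real (ksym \<sigma> w \<zeta>) * G \<zeta>)
      \<le> ennreal \<delta>5 * Nsq (\<lambda>\<zeta>. jw s \<zeta> * bw (2 * \<sigma>) \<zeta>) G + ennreal k7 * Nsq (jw s) G"
      using lower_order_bound[OF \<sigma> \<delta>5, of s] by blast
    \<comment> \<open>Commutators occur twice, with the constants k3 and k4, and must leave at most
      \<delta> in front of the norm of u.\<close>
    define d where "d = \<delta> / (32 * C1 * (k3 + k4) + 1)"
    have d: "d > 0" "32 * C1 * (k3 + k4) * d \<le> \<delta>"
    proof -
      have q: "32 * C1 * (k3 + k4) \<ge> 0" using C1(1) k4(1) by (simp add: k3_def)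
      then show "d > 0" using \<delta> by (simp add: d_def add_nonneg_pos)
      show "32 * C1 * (k3 + k4) * d \<le> \<delta>" using q \<delta> unfolding d_def by (simp add: divide_le_eq add_nonneg_pos)
    qed
    obtain k where k: "k \<ge> 0" "\<And>u. schw u \<Longrightarrow>
      Nsq (jw s) (\<lambda>\<zeta>. ft (\<lambda>z. \<phi> z * frac_lap_v \<sigma> w u z) \<zeta> - of_real (ksym \<sigma> w \<zeta>) * ft (\<lambda>z. \<phi> z * u z) \<zeta>)
      \<le> ennreal d * Nsq (\<lambda>\<zeta>. jw s \<zeta> * bw (2 * \<sigma>) \<zeta>) (ft u) + ennreal k * Nsq (jw s) (ft u)"
      using commutator_bound[OF \<sigma> \<phi> d(1), of s] by blast
    define e1 where "e1 = 8 * \<epsilon>\<^sup>2 * (2 * cF\<^sup>2) + k5 * \<delta>5"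
    have e1: "2 * C1 * e1 \<le> 1 / 2" "e1 \<ge> 0"
    proof -
      have "q * (1 / (8 * (q + 1))) \<le> 1 / 8" if "q \<ge> 0" for q :: real
        using that by (simp add: divide_le_eq)
      from this[of "C1 * k5"] have "C1 * k5 * \<delta>5 \<le> 1 / 8" using C1(1) k5(1) by (simp add: \<delta>5_def)
      then show "2 * C1 * e1 \<le> 1 / 2" using \<epsilon>s unfolding e1_def by (simp add: distrib_left)
      show "e1 \<ge> 0" using k5(1) \<delta>5 by (simp add: e1_def)
    qed
    have "Nsq (\<lambda>\<zeta>. jw s \<zeta> * vw (2 * \<sigma>) \<zeta>) (ft (\<lambda>z. \<phi> z * u z)) \<le>
      ennreal \<delta> * Nsq (\<lambda>\<zeta>. jw s \<zeta> * bw (2 * \<sigma>) \<zeta>) (ft u) +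
      ennreal (2 * C1 * (2 * (k5 * k7) * k1 + 16 * k1 + 16 * k2 + 16 * (k3 + k4) * k + k1) + 1) * (Nsq (jw s) (ft u) + Nsq (jw s) (ft (opP \<sigma> w a u)))"
      if u: "schw u" for u
    proof -
      let ?v = "\<lambda>z. \<phi> z * u z" and ?L = "frac_lap_v \<sigma> w u"
      let ?Lv = "frac_lap_v \<sigma> w ?v" and ?P = "opP \<sigma> w a u"
      define D where "D = (\<lambda>\<zeta>. ft (\<lambda>z. \<phi> z * ?L z) \<zeta> - of_real (ksym \<sigma> w \<zeta>) * ft ?v \<zeta>)"
      have v: "schw ?v" by (intro schw_mult \<phi> u)
      note dec = local_decomposition[OF a \<phi> \<beta> u eq, where \<sigma>=\<sigma>, folded D_def]
      let ?f = "\<lambda>\<zeta>. ft (transport ?v) \<zeta> + of_real (c * ksym \<sigma> w \<zeta>) * ft ?v \<zeta>"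
      let ?Y = "Nsq (\<lambda>\<zeta>. jw s \<zeta> * vw (2 * \<sigma>) \<zeta>) (ft ?v)"
      have fs: "schw ?f"
        using schw_add[OF schw_ft[OF schw_transport[OF v]] schw_cmult[OF schw_ksym_ft[OF v], of "of_real c"]] by (simp add: mult.assoc)
      have P: "integrable lborel ?P" by (rule opP_integrable[OF a u])
      have Dm: "D \<in> borel_measurable borel"
        unfolding dec(2)[symmetric] by (intro ft_bounded_measurable dec(3))
      have m: "ft (\<lambda>z. \<beta> z * ?Lv z) \<in> borel_measurable borel" "ft (\<lambda>z. \<phi> z * ?P z) \<in> borel_measurable borel"
        "ft (\<lambda>z. transport \<phi> z * u z) \<in> borel_measurable borel" "ft (\<lambda>z. \<beta> z * (\<phi> z * ?L z - ?Lv z)) \<in> borel_measurable borel"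
        by (intro ft_bounded_measurable schw_mult_integrable \<beta> \<phi> P frac_lap_v_integrable v schw_transport schw_integrable u dec(3))+
      note [measurable] = Dm m
      show ?thesis
      proof (rule absorb_arith[where ?X5.0 = "Nsq (jw s) (ft (\<lambda>z. \<beta> z * ?Lv z))" and ?X1.0 = "Nsq (jw s) (ft (\<lambda>z. \<phi> z * ?P z))"
          and ?X2.0 = "Nsq (jw s) (ft (\<lambda>z. transport \<phi> z * u z))" and ?X3.0 = "ennreal k3 * Nsq (jw s) D"
          and ?X4.0 = "Nsq (jw s) (ft (\<lambda>z. \<beta> z * (\<phi> z * ?L z - ?Lv z)))" and D = "Nsq (jw s) D" and N = "Nsq (jw s) ?f"
          and G = "Nsq (jw s) (ft ?v)" and ?e1.0 = e1 and d = d])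
        show "?Y < \<infinity>" by (rule Nsq_weights_finite[OF v]) (use \<sigma> in simp)
        show "?Y \<le> ennreal C1 * (Nsq (jw s) ?f + Nsq (jw s) (ft ?v))"
        proof (rule C1(2)[OF c schw_ft[OF v]])
          show "continuous_on UNIV ?f" by (rule schw_continuous[OF fs])
          show "\<And>\<zeta>. ?f \<zeta> = 2 * pi * \<i> * of_real (fst \<zeta>) * ft ?v \<zeta> - frechet_derivative (ft ?v) (at \<zeta>) (0, 0, fst (snd \<zeta>))
            + of_real (c * ksym \<sigma> w \<zeta>) * ft ?v \<zeta>" by (simp add: ft_transport[OF v])
        qed
        let ?A = "\<lambda>\<zeta>. (- 1) * ft (\<lambda>z. \<beta> z * ?Lv z) \<zeta>"
        let ?B = "ft (\<lambda>z. \<phi> z * ?P z)" and ?C = "ft (\<lambda>z. transport \<phi> z * u z)" and ?E = "\<lambda>\<zeta>. (- of_real c) * D \<zeta>"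
        let ?F = "\<lambda>\<zeta>. (- 1) * ft (\<lambda>z. \<beta> z * (\<phi> z * ?L z - ?Lv z)) \<zeta>"
        have n: "Nsq (jw s) ?A = Nsq (jw s) (ft (\<lambda>z. \<beta> z * ?Lv z))" "Nsq (jw s) ?F = Nsq (jw s) (ft (\<lambda>z. \<beta> z * (\<phi> z * ?L z - ?Lv z)))"
          "Nsq (jw s) ?E = ennreal k3 * Nsq (jw s) D"
          by (subst Nsq_cmult; simp add: k3_def)+
        have "Nsq (jw s) ?f = Nsq (jw s) (\<lambda>\<zeta>. ?A \<zeta> + (?B \<zeta> + (?C \<zeta> + (?E \<zeta> + ?F \<zeta>))))" by (simp only: dec(1) D_def)
        also have "\<dots> \<le> 2 * Nsq (jw s) ?A + 2 * Nsq (jw s) (\<lambda>\<zeta>. ?B \<zeta> + (?C \<zeta> + (?E \<zeta> + ?F \<zeta>)))" by (rule Nsq_add) auto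
        also have "\<dots> \<le> 2 * Nsq (jw s) ?A + 2 * (2 * Nsq (jw s) ?B + 2 * Nsq (jw s) (\<lambda>\<zeta>. ?C \<zeta> + (?E \<zeta> + ?F \<zeta>)))"
          by (intro add_left_mono mult_left_mono Nsq_add) auto
        also have "\<dots> \<le> 2 * Nsq (jw s) ?A + 2 * (2 * Nsq (jw s) ?B + 2 * (2 * Nsq (jw s) ?C + 2 * Nsq (jw s) (\<lambda>\<zeta>. ?E \<zeta> + ?F \<zeta>)))"
          by (intro add_left_mono mult_left_mono Nsq_add) auto
        also have "\<dots> \<le> 2 * Nsq (jw s) ?A + 2 * (2 * Nsq (jw s) ?B + 2 * (2 * Nsq (jw s) ?C + 2 * (2 * Nsq (jw s) ?E + 2 * Nsq (jw s) ?F)))"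
          by (intro add_left_mono mult_left_mono Nsq_add) auto
        finally have "Nsq (jw s) ?f \<le> 2 * Nsq (jw s) ?A + 2 * (2 * Nsq (jw s) ?B + 2 * (2 * Nsq (jw s) ?C + 2 * (2 * Nsq (jw s) ?E + 2 * Nsq (jw s) ?F)))" .
        also note ennreal_nested_sum
        finally show "Nsq (jw s) ?f \<le> 2 * Nsq (jw s) (ft (\<lambda>z. \<beta> z * ?Lv z)) + 16 * (Nsq (jw s) (ft (\<lambda>z. \<phi> z * ?P z)) + (Nsq (jw s) (ft (\<lambda>z. transport \<phi> z * u z)) +
          (ennreal k3 * Nsq (jw s) D + Nsq (jw s) (ft (\<lambda>z. \<beta> z * (\<phi> z * ?L z - ?Lv z))))))"
          unfolding n .
        \<comment> \<open>The one piece of full order. Its smallness has two sources: \<epsilon> in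
          the leading part, \<delta>5 in the part where one power of the bracket has been
          gained.\<close>
        show "Nsq (jw s) (ft (\<lambda>z. \<beta> z * ?Lv z)) \<le> ennreal e1 * ?Y + ennreal (k5 * k7) * Nsq (jw s) (ft ?v)"
        proof -
          let ?W = "Nsq (\<lambda>\<zeta>. jw s \<zeta> * bw (2 * \<sigma>) \<zeta>) (ft ?v)"
          have Gm: "ft ?v \<in> borel_measurable borel" by (rule schw_measurable[OF schw_ft[OF v]])
          have W: "?W \<le> ?Y"
          proof (rule Nsq_mono)
            fix \<zeta> :: "'n pt"
            show "\<bar>jw s \<zeta> * bw (2 * \<sigma>) \<zeta>\<bar> \<le> \<bar>jw s \<zeta> * vw (2 * \<sigma>) \<zeta>\<bar>"
              by (simp add: abs_mult bw_le_vw mult_left_mono)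
          qed
          have L: "ft ?Lv = (\<lambda>\<zeta>. of_real (ksym \<sigma> w \<zeta>) * ft ?v \<zeta>)" by (rule ext) (rule ft_frac_lap_v[OF v])
          have 1: "Nsq (jw s) (ft ?Lv) \<le> ennreal (2 * cF\<^sup>2) * ?W"
            unfolding L
          proof (rule Nsq_le)
            fix \<zeta>
            have "jw s \<zeta> * cmod (ft ?v \<zeta>) * \<bar>ksym \<sigma> w \<zeta>\<bar> \<le> jw s \<zeta> * cmod (ft ?v \<zeta>) * (cF * bw (2 * \<sigma>) \<zeta>)"
              unfolding cF_def by (intro mult_left_mono ksym_bound[OF \<sigma>]) auto
            then show "\<bar>jw s \<zeta>\<bar> * cmod (of_real (ksym \<sigma> w \<zeta>) * ft ?v \<zeta>) \<le> cF * (\<bar>jw s \<zeta> * bw (2 * \<sigma>) \<zeta>\<bar> * cmod (ft ?v \<zeta>))"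
              by (simp add: norm_mult abs_mult mult_ac)
          qed (use Gm cF in auto)
          have "Nsq (jw s) (ft (\<lambda>z. \<beta> z * ?Lv z)) \<le> ennreal (8 * \<epsilon>\<^sup>2) * Nsq (jw s) (ft ?Lv) + ennreal k5 * Nsq (\<lambda>\<zeta>. jw s \<zeta> / jb \<zeta>) (ft ?Lv)"
            by (rule k5(2)[OF frac_lap_v_integrable[OF v]])
          also have "\<dots> \<le> ennreal (8 * \<epsilon>\<^sup>2) * (ennreal (2 * cF\<^sup>2) * ?Y) + ennreal k5 * (ennreal \<delta>5 * ?Y + ennreal k7 * Nsq (jw s) (ft ?v))"
          proof (intro add_mono mult_left_mono)
            show "Nsq (jw s) (ft ?Lv) \<le> ennreal (2 * cF\<^sup>2) * ?Y" using 1 mult_left_mono[OF W, of "ennreal (2 * cF\<^sup>2)"] by (meson order_trans zero_le)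
            show "Nsq (\<lambda>\<zeta>. jw s \<zeta> / jb \<zeta>) (ft ?Lv) \<le> ennreal \<delta>5 * ?Y + ennreal k7 * Nsq (jw s) (ft ?v)"
              unfolding L by (rule order_trans[OF k7(2)[OF Gm]], intro add_right_mono mult_left_mono W) auto
          qed auto
          also have "\<dots> = ennreal e1 * ?Y + ennreal (k5 * k7) * Nsq (jw s) (ft ?v)"
          proof -
            have "ennreal e1 = ennreal (8 * \<epsilon>\<^sup>2) * ennreal (2 * cF\<^sup>2) + ennreal k5 * ennreal \<delta>5"
              unfolding e1_def using k5(1) \<delta>5 by (simp only: ennreal_plus[symmetric] ennreal_mult[symmetric] zero_le_mult_iff zero_le_power2 zero_le_numeral less_imp_le simp_thms)
                 (auto simp: ennreal_mult)?
            moreover have "ennreal (k5 * k7) = ennreal k5 * ennreal k7" using k5(1) k7(1) by (rule ennreal_mult)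
            ultimately show ?thesis by (simp only: distrib_left distrib_right mult.assoc add.assoc)
          qed
          finally show ?thesis .
        qed
        show "Nsq (jw s) (ft (\<lambda>z. \<phi> z * ?P z)) \<le> ennreal k1 * Nsq (jw s) (ft ?P)" by (rule k1(2)[OF P])
        show "Nsq (jw s) (ft (\<lambda>z. transport \<phi> z * u z)) \<le> ennreal k2 * Nsq (jw s) (ft u)"
          by (rule k2(2)[OF schw_integrable[OF u]])
        show "Nsq (jw s) (ft (\<lambda>z. \<beta> z * (\<phi> z * ?L z - ?Lv z))) \<le> ennreal k4 * Nsq (jw s) D"
          using k4(2)[OF dec(3)] by (simp only: dec(2) D_def)
        show "Nsq (jw s) D \<le> ennreal d * Nsq (\<lambda>\<zeta>. jw s \<zeta> * bw (2 * \<sigma>) \<zeta>) (ft u) + ennreal k * Nsq (jw s) (ft u)"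
          unfolding D_def by (rule k(2)[OF u])
        show "Nsq (jw s) (ft ?v) \<le> ennreal k1 * Nsq (jw s) (ft u)" by (rule k1(2)[OF schw_integrable[OF u]])
      qed (use C1(1) k1(1) k2(1) k4(1) k(1) e1 d \<delta> k5(1) k7(1) in \<open>auto simp: k3_def\<close>)
    qed
    moreover have "2 * C1 * (2 * (k5 * k7) * k1 + 16 * k1 + 16 * k2 + 16 * (k3 + k4) * k + k1) + 1 \<ge> 0"
      using C1(1) k1(1) k2(1) k4(1) k5(1) k7(1) k(1) by (simp add: k3_def)
    ultimately show ?thesis by blast
  qed
  then show ?thesis using \<epsilon> by blast
qed

end

subsection \<open>Patching the local estimates\<close>

text \<open>The factor doubles with every summand. This is crude but harmless, because \<delta> is
  chosen after the number of pieces.\<close>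

lemma Nsq_sum:
  assumes "finite I" "W \<in> borel_measurable borel" "\<And>i. i \<in> I \<Longrightarrow> g i \<in> borel_measurable borel"
  shows "Nsq W (\<lambda>\<zeta>. \<Sum>i\<in>I. g i \<zeta>) \<le> ennreal (2 ^ card I) * (\<Sum>i\<in>I. Nsq W (g i))"
  using assms(1,3)
proof (induction I rule: finite_induct)
  case empty
  then show ?case by (simp add: Nsq_def)
next
  case (insert i I)
  have "Nsq W (\<lambda>\<zeta>. \<Sum>i\<in>insert i I. g i \<zeta>) = Nsq W (\<lambda>\<zeta>. g i \<zeta> + (\<Sum>i\<in>I. g i \<zeta>))"
    using insert by simp
  also have "\<dots> \<le> 2 * Nsq W (g i) + 2 * Nsq W (\<lambda>\<zeta>. \<Sum>i\<in>I. g i \<zeta>)"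
    using insert assms(2) by (intro Nsq_add borel_measurable_sum) auto
  also have "\<dots> \<le> 2 * (ennreal (2 ^ card I) * Nsq W (g i)) + 2 * (ennreal (2 ^ card I) * (\<Sum>i\<in>I. Nsq W (g i)))"
  proof (intro add_mono mult_left_mono)
    have "1 * Nsq W (g i) \<le> ennreal (2 ^ card I) * Nsq W (g i)" by (intro mult_right_mono) (simp_all add: one_le_power)
    then show "Nsq W (g i) \<le> ennreal (2 ^ card I) * Nsq W (g i)" by simp
  qed (use insert in auto)
  also have "\<dots> = ennreal (2 ^ card (insert i I)) * (\<Sum>i\<in>insert i I. Nsq W (g i))"
    using insert by (simp add: distrib_left ennreal_mult mult.assoc)
  finally show ?case .
qed

context bump
begin

lemma main_estimate:
  fixes s :: real and a :: "'n pt \<Rightarrow> real"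
  assumes \<sigma>: "0 < \<sigma>" "\<sigma> < 1" and a: "smth (\<lambda>z. complex_of_real (a z))" "\<And>z. \<bar>a z\<bar> \<le> A" and a0: "0 < a0" "\<And>z. a0 \<le> a z"
    and K: "compact K"
  shows "\<exists>C\<ge>0. \<forall>u. schw u \<longrightarrow> (\<forall>z. u z \<noteq> 0 \<longrightarrow> z \<in> K) \<longrightarrow>
    Nsq (\<lambda>\<zeta>. jw s \<zeta> * vw (2 * \<sigma>) \<zeta>) (ft u) \<le> ennreal C * (Nsq (jw s) (ft u) + Nsq (jw s) (ft (opP \<sigma> w a u)))"
proof -
  have ac: "continuous_on UNIV a"
  proof -
    have "continuous_on UNIV (\<lambda>z. Re (complex_of_real (a z)))"
      by (intro continuous_on_Re continuous_at_imp_continuous_on ballI differentiable_imp_continuous_within smth_differentiable a)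
    then show ?thesis by simp
  qed
  obtain \<epsilon> where \<epsilon>: "\<epsilon> > 0" and loc: "\<And>\<phi> \<beta> c \<delta>. schw \<phi> \<Longrightarrow> schw \<beta> \<Longrightarrow> (\<integral>\<theta>. cmod (ft \<beta> \<theta>) \<partial>lborel) \<le> \<epsilon> \<Longrightarrow> a0 \<le> c \<Longrightarrow> c \<le> A \<Longrightarrow>
    (\<And>z. (complex_of_real (a z) - of_real c) * \<phi> z = \<beta> z * \<phi> z) \<Longrightarrow> 0 < \<delta> \<Longrightarrow>
    (\<exists>K\<ge>0. \<forall>u. schw u \<longrightarrow> Nsq (\<lambda>\<zeta>. jw s \<zeta> * vw (2 * \<sigma>) \<zeta>) (ft (\<lambda>z. \<phi> z * u z)) \<le>
      ennreal \<delta> * Nsq (\<lambda>\<zeta>. jw s \<zeta> * bw (2 * \<sigma>) \<zeta>) (ft u) + ennreal K * (Nsq (jw s) (ft u) + Nsq (jw s) (ft (opP \<sigma> w a u))))"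
    using local_estimate[OF \<sigma> ac a(2) a0(1), of s] by blast
  obtain R0 where R0: "\<And>z. z \<in> K \<Longrightarrow> norm z \<le> R0" using compact_imp_bounded[OF K] unfolding bounded_iff by blast
  define R where "R = \<bar>R0\<bar> + 1"
  have R: "R > 0" by (simp add: R_def)
  \<comment> \<open>The coefficient cut off to a Schwartz function, as Wiener's argument requires.
    It agrees with a on the ball of radius \<open>R\<close>, which contains every point at distance
    at most 1 from K.\<close>
  define b where "b z = complex_of_real (a z) * bump3 ((1 / R) *\<^sub>R (z - 0))" for z
  have b: "schw b"
  proof (rule smth_schw)
    show "smth b" unfolding b_def by (intro smth_mult a bump3_affine R)
    show "norm z \<le> 6 * R" if "b z \<noteq> 0" for z using bump3_affine(4)[OF R, of z 0] that by (auto simp: b_def)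
  qed
  have ba: "b z = of_real (a z)" if "norm z \<le> R" for z using bump3_affine(3)[OF R, of z 0] that by (simp add: b_def)
  have b3: "schw bump3" by (rule smth_schw[OF bump3_smth bump3_supp])
  obtain T where T: "T \<ge> 0" "\<And>e z0. 0 < e \<Longrightarrow> schw (\<lambda>z. bump3 ((1 / e) *\<^sub>R (z - z0))) \<Longrightarrow>
    (\<integral>\<^sup>+\<zeta>. ennreal (cmod (ft (\<lambda>z. (b z - b z0) * bump3 ((1 / e) *\<^sub>R (z - z0))) \<zeta>)) \<partial>lborel) \<le> ennreal (T * e)"
    using freeze_Wiener[OF b b3] by blast
  \<comment> \<open>The bound 1 keeps the localising balls inside the region where b equals a; the
    second term makes the oscillation smaller than \<epsilon>.\<close>
  define e where "e = min 1 (\<epsilon> / (T + 1))"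
  have e: "0 < e" "e \<le> 1" "T * e \<le> \<epsilon>"
  proof -
    show "0 < e" "e \<le> 1" using \<epsilon> T(1) by (auto simp: e_def)
    have "T * e \<le> T * (\<epsilon> / (T + 1))" using T(1) by (intro mult_left_mono) (auto simp: e_def)
    also have "\<dots> \<le> \<epsilon>" using T(1) \<epsilon> by (simp add: divide_le_eq)
    finally show "T * e \<le> \<epsilon>" .
  qed
  \<comment> \<open>Covering with radius e/6 because the partition functions reach six times
    further, that is, up to e.\<close>
  have e6: "e / 6 > 0" using e by simp
  obtain Z where Z: "Z \<subseteq> K" "finite Z" "K \<subseteq> (\<Union>z\<in>Z. ball z (e / 6))"
    by (rule compactE_image[OF K, of K "\<lambda>z. ball z (e / 6)"]) (use e6 in auto)
  obtain \<kappa> where \<kappa>: "\<And>j. j \<in> Z \<Longrightarrow> smth (\<kappa> j)" "\<And>j z. j \<in> Z \<Longrightarrow> \<kappa> j z \<noteq> 0 \<Longrightarrow> norm (z - j) \<le> 6 * (e / 6)"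
    "\<And>z. (\<exists>j\<in>Z. norm (z - j) \<le> e / 6) \<Longrightarrow> (\<Sum>j\<in>Z. \<kappa> j z) = 1"
    using partition_of_unity[OF e6 Z(2)] by blast
  have \<kappa>s: "schw (\<kappa> j)" if "j \<in> Z" for j
  proof (rule smth_schw[OF \<kappa>(1)[OF that]])
    fix z assume "\<kappa> j z \<noteq> 0"
    then show "norm z \<le> norm j + e" using \<kappa>(2)[OF that, of z] norm_triangle_ineq2[of z j] by simp
  qed
  \<comment> \<open>The bump at scale e equals 1 on the support of \<open>\<kappa> j\<close>, so
    there \<beta> is exactly the difference between the coefficient and its frozen value.\<close>
  define \<beta> where "\<beta> j z = (b z - b j) * bump3 ((1 / e) *\<^sub>R (z - j))" for j z
  have \<beta>s: "schw (\<beta> j)" for j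
  proof -
    have "schw (\<lambda>z. b z * bump3 ((1 / e) *\<^sub>R (z - j)) + (- b j) * bump3 ((1 / e) *\<^sub>R (z - j)))"
      by (intro schw_add schw_mult schw_cmult b bump3_affine e)
    then show ?thesis unfolding \<beta>_def by (simp add: algebra_simps)
  qed
  have \<beta>\<epsilon>: "(\<integral>\<theta>. cmod (ft (\<beta> j) \<theta>) \<partial>lborel) \<le> \<epsilon>" for j
  proof -
    have "integrable lborel (\<lambda>\<theta>. cmod (ft (\<beta> j) \<theta>))" by (intro integrable_norm schw_integrable schw_ft \<beta>s)
    then have "ennreal (\<integral>\<theta>. cmod (ft (\<beta> j) \<theta>) \<partial>lborel) = (\<integral>\<^sup>+\<theta>. ennreal (cmod (ft (\<beta> j) \<theta>)) \<partial>lborel)"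
      by (intro nn_integral_eq_integral[symmetric]) auto
    also have "\<dots> \<le> ennreal (T * e)" unfolding \<beta>_def by (rule T(2)[OF e(1) bump3_affine(2)[OF e(1)]])
    finally show ?thesis using T(1) e by (subst (asm) ennreal_le_iff) auto
  qed
  have eq: "(complex_of_real (a z) - of_real (a j)) * \<kappa> j z = \<beta> j z * \<kappa> j z" if j: "j \<in> Z" for j z
  proof (cases "\<kappa> j z = 0")
    case False
    then have d: "norm (z - j) \<le> e" using \<kappa>(2)[OF j] by simp
    have nj: "norm j \<le> R0" using R0 Z j by blast
    moreover have "norm z \<le> norm j + e" using norm_triangle_ineq2[of z j] d by linarith
    ultimately have "norm z \<le> R" "norm j \<le> R" using e by (auto simp: R_def)
    then show ?thesis using bump3_affine(3)[OF e(1) d] by (simp add: \<beta>_def ba)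
  qed simp
  define n where "n = card Z"
  \<comment> \<open>Summing n local estimates costs n and the 2^n of \<open>Nsq_sum\<close>; this
    \<delta> leaves at most 1/2 of the global norm.\<close>
  define \<delta> where "\<delta> = 1 / (2 * 2 ^ n * (real n + 1))"
  have \<delta>: "\<delta> > 0" by (simp add: \<delta>_def)
  have \<delta>n: "2 ^ n * (real n * \<delta>) \<le> 1 / 2"
  proof -
    have "2 ^ n * (real n * \<delta>) = 1 / 2 * (real n / (real n + 1))" by (simp add: \<delta>_def)
    also have "\<dots> \<le> 1 / 2 * 1" by (intro mult_left_mono) auto
    finally show ?thesis by simp
  qed
  have "\<forall>j\<in>Z. \<exists>K\<ge>0. \<forall>u. schw u \<longrightarrow> Nsq (\<lambda>\<zeta>. jw s \<zeta> * vw (2 * \<sigma>) \<zeta>) (ft (\<lambda>z. \<kappa> j z * u z)) \<le>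
      ennreal \<delta> * Nsq (\<lambda>\<zeta>. jw s \<zeta> * bw (2 * \<sigma>) \<zeta>) (ft u) + ennreal K * (Nsq (jw s) (ft u) + Nsq (jw s) (ft (opP \<sigma> w a u)))"
  proof
    fix j assume j: "j \<in> Z"
    have "a j \<le> A" using a(2)[of j] by linarith
    then show "\<exists>K\<ge>0. \<forall>u. schw u \<longrightarrow> Nsq (\<lambda>\<zeta>. jw s \<zeta> * vw (2 * \<sigma>) \<zeta>) (ft (\<lambda>z. \<kappa> j z * u z)) \<le>
      ennreal \<delta> * Nsq (\<lambda>\<zeta>. jw s \<zeta> * bw (2 * \<sigma>) \<zeta>) (ft u) + ennreal K * (Nsq (jw s) (ft u) + Nsq (jw s) (ft (opP \<sigma> w a u)))"
      by (intro loc[OF \<kappa>s[OF j] \<beta>s[of j] \<beta>\<epsilon> a0(2)[of j] _ eq[OF j] \<delta>])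
  qed
  from bchoice[OF this] obtain k where k0: "\<forall>j\<in>Z. 0 \<le> k j \<and> (\<forall>u. schw u \<longrightarrow> Nsq (\<lambda>\<zeta>. jw s \<zeta> * vw (2 * \<sigma>) \<zeta>) (ft (\<lambda>z. \<kappa> j z * u z)) \<le>
      ennreal \<delta> * Nsq (\<lambda>\<zeta>. jw s \<zeta> * bw (2 * \<sigma>) \<zeta>) (ft u) + ennreal (k j) * (Nsq (jw s) (ft u) + Nsq (jw s) (ft (opP \<sigma> w a u))))" ..
  then have k: "\<And>j. j \<in> Z \<Longrightarrow> k j \<ge> 0" "\<And>j u. j \<in> Z \<Longrightarrow> schw u \<Longrightarrow> Nsq (\<lambda>\<zeta>. jw s \<zeta> * vw (2 * \<sigma>) \<zeta>) (ft (\<lambda>z. \<kappa> j z * u z)) \<le>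
      ennreal \<delta> * Nsq (\<lambda>\<zeta>. jw s \<zeta> * bw (2 * \<sigma>) \<zeta>) (ft u) + ennreal (k j) * (Nsq (jw s) (ft u) + Nsq (jw s) (ft (opP \<sigma> w a u)))"
    by blast+
  define S where "S = (\<Sum>j\<in>Z. k j)"
  have S: "S \<ge> 0" unfolding S_def by (intro sum_nonneg k)
  have "Nsq (\<lambda>\<zeta>. jw s \<zeta> * vw (2 * \<sigma>) \<zeta>) (ft u) \<le> ennreal (2 * (2 ^ n * S)) * (Nsq (jw s) (ft u) + Nsq (jw s) (ft (opP \<sigma> w a u)))"
    if u: "schw u" and supp: "\<And>z. u z \<noteq> 0 \<Longrightarrow> z \<in> K" for u
  proof -
    let ?W = "\<lambda>\<zeta> :: 'n pt. jw s \<zeta> * vw (2 * \<sigma>) \<zeta>" and ?B = "\<lambda>\<zeta> :: 'n pt. jw s \<zeta> * bw (2 * \<sigma>) \<zeta>"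
    let ?Q = "Nsq (jw s) (ft u) + Nsq (jw s) (ft (opP \<sigma> w a u))"
    have us: "u = (\<lambda>z. \<Sum>j\<in>Z. \<kappa> j z * u z)"
    proof
      fix z
      show "u z = (\<Sum>j\<in>Z. \<kappa> j z * u z)"
      proof (cases "u z = 0")
        case False
        then obtain j where "j \<in> Z" "z \<in> ball j (e / 6)" using supp Z(3) by blast
        then have "(\<Sum>j\<in>Z. \<kappa> j z) = 1" by (intro \<kappa>(3) bexI[of _ j]) (auto simp: dist_norm norm_minus_commute)
        then show ?thesis by (simp flip: sum_distrib_right)
      qed simp
    qed
    have ku: "schw (\<lambda>z. \<kappa> j z * u z)" if "j \<in> Z" for j by (intro schw_mult \<kappa>s that u)
    have "ft u = ft (\<lambda>z. \<Sum>j\<in>Z. \<kappa> j z * u z)" using us by simp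
    also have "\<dots> = (\<lambda>\<zeta>. \<Sum>j\<in>Z. ft (\<lambda>z. \<kappa> j z * u z) \<zeta>)"
      by (intro ext ft_sum Z schw_integrable ku)
    finally have "Nsq ?W (ft u) = Nsq ?W (\<lambda>\<zeta>. \<Sum>j\<in>Z. ft (\<lambda>z. \<kappa> j z * u z) \<zeta>)" by (rule arg_cong)
    also have "\<dots> \<le> ennreal (2 ^ card Z) * (\<Sum>j\<in>Z. Nsq ?W (ft (\<lambda>z. \<kappa> j z * u z)))"
      using ku by (intro Nsq_sum Z schw_measurable schw_ft) auto
    also have "\<dots> \<le> ennreal (2 ^ card Z) * (\<Sum>j\<in>Z. ennreal \<delta> * Nsq ?B (ft u) + ennreal (k j) * ?Q)"
      by (intro mult_left_mono sum_mono k u) auto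
    also have "(\<Sum>j\<in>Z. ennreal \<delta> * Nsq ?B (ft u) + ennreal (k j) * ?Q) = ennreal (real n * \<delta>) * Nsq ?B (ft u) + ennreal S * ?Q"
    proof -
      have "(\<Sum>j\<in>Z. ennreal (k j)) = ennreal S" unfolding S_def using k(1) by (rule sum_ennreal)
      moreover have "(\<Sum>j\<in>Z. ennreal \<delta> * Nsq ?B (ft u)) = ennreal (real n * \<delta>) * Nsq ?B (ft u)"
        using \<delta> by (simp add: n_def ennreal_mult ennreal_of_nat_eq_real_of_nat mult.assoc)
      ultimately show ?thesis by (simp only: sum.distrib flip: sum_distrib_right)
    qed
    also have "ennreal (2 ^ card Z) * (ennreal (real n * \<delta>) * Nsq ?B (ft u) + ennreal S * ?Q) =
      ennreal (2 ^ n * (real n * \<delta>)) * Nsq ?B (ft u) + ennreal (2 ^ n * S) * ?Q"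
    proof -
      have "ennreal (2 ^ n * (real n * \<delta>)) = ennreal (2 ^ n) * ennreal (real n * \<delta>)" "ennreal (2 ^ n * S) = ennreal (2 ^ n) * ennreal S"
        by (intro ennreal_mult; use S \<delta> in simp)+
      then show ?thesis by (simp only: n_def distrib_left mult.assoc)
    qed
    \<comment> \<open>The commutator weight \<open>bw\<close> is dominated by \<open>vw\<close>, so
      the error is of the same kind as the left side and can be absorbed.\<close>
    also have "\<dots> \<le> ennreal (1 / 2) * Nsq ?W (ft u) + ennreal (2 ^ n * S) * ?Q"
    proof (intro add_right_mono mult_mono ennreal_leI \<delta>n Nsq_mono)
      fix \<zeta> :: "'n pt"
      show "\<bar>?B \<zeta>\<bar> \<le> \<bar>?W \<zeta>\<bar>" by (simp add: abs_mult bw_le_vw mult_left_mono)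
    qed auto
    finally have "Nsq ?W (ft u) \<le> 2 * (ennreal (2 ^ n * S) * ?Q)"
      by (rule ennreal_absorb[OF Nsq_weights_finite[OF u mult_pos_pos[OF zero_less_numeral \<sigma>(1)]]])
    also have "\<dots> = ennreal (2 * (2 ^ n * S)) * ?Q" using S by (subst ennreal_mult) (auto simp: mult.assoc)
    finally show ?thesis .
  qed
  moreover have "2 * (2 ^ n * S) \<ge> 0" using S by simp
  ultimately show ?thesis by blast
qed

end

subsection \<open>The time derivative\<close>

text \<open>Kept apart from \<open>vw\<close> because a negative power of it is needed as a damping
  factor in the interpolation.\<close>

definition xw :: "'n::finite pt \<Rightarrow> real" where "xw \<zeta> = 1 + norm (fst (snd \<zeta>))"

lemma xw_ge1: "xw \<zeta> \<ge> 1" by (simp add: xw_def)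

lemma pt_components_measurable [measurable]:
  "(\<lambda>\<zeta>::'n::finite pt. fst \<zeta>) \<in> borel_measurable borel"
  "(\<lambda>\<zeta>::'n::finite pt. fst (snd \<zeta>)) \<in> borel_measurable borel"
  by (intro borel_measurable_continuous_onI continuous_intros)+

lemma xw_measurable [measurable]: "(\<lambda>\<zeta>::'n::finite pt. xw \<zeta> powr q) \<in> borel_measurable borel"
  unfolding xw_def by measurable

text \<open>If |\<tau>| exceeds m, replacing |\<tau>| by m in the negative power \<alpha> - 1 only
  increases it. With m = 1 + |\<xi>| a full time derivative is needed only with the factor
  m^(\<alpha> - 1), which reduces the |\<xi>| from v . grad_x to the power \<alpha> already
  gained.\<close>

lemma tau_interpolation:
  fixes \<tau> m \<alpha> :: real
  assumes "0 < \<alpha>" "\<alpha> < 1" "1 \<le> m"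
  shows "\<bar>\<tau>\<bar> powr \<alpha> \<le> \<bar>\<tau>\<bar> * m powr (\<alpha> - 1) + m powr \<alpha>"
proof (cases "\<bar>\<tau>\<bar> \<le> m")
  case True
  then have "\<bar>\<tau>\<bar> powr \<alpha> \<le> m powr \<alpha>" using assms by (intro powr_mono2) auto
  moreover have "0 \<le> \<bar>\<tau>\<bar> * m powr (\<alpha> - 1)" by simp
  ultimately show ?thesis by linarith
next
  case False
  then have "\<bar>\<tau>\<bar> powr \<alpha> = \<bar>\<tau>\<bar> powr 1 * \<bar>\<tau>\<bar> powr (\<alpha> - 1)" using assms by (subst powr_add[symmetric]) simp
  also have "\<dots> = \<bar>\<tau>\<bar> * \<bar>\<tau>\<bar> powr (\<alpha> - 1)" using False assms by simp
  also have "\<dots> \<le> \<bar>\<tau>\<bar> * m powr (\<alpha> - 1)" using False assms by (intro mult_left_mono powr_mono2') auto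
  finally show ?thesis using powr_ge_zero[of m \<alpha>] by linarith
qed

lemma xw_powr_le_vw:
  assumes "0 < p" shows "xw \<zeta> powr (p / (p + 1)) \<le> 4 * vw p \<zeta>"
proof -
  have "xw \<zeta> powr (p / (p + 1)) \<le> 4 * (1 powr (p / (p + 1)) + norm (fst (snd \<zeta>)) powr (p / (p + 1)))"
    unfolding xw_def using assms by (intro powr_add_le) (auto simp: divide_simps)
  also have "\<dots> \<le> 4 * vw p \<zeta>" by (simp add: vw_def)
  finally show ?thesis .
qed

text \<open>Makes multiplication by the cut-off velocity components bounded for the weight
  \<open>jw s\<close> times \<open>xw\<close> to the power \<alpha>.\<close>

lemma xw_peetre:
  assumes "0 < \<alpha>" "\<alpha> < 1"
  shows "jw s \<zeta> * xw \<zeta> powr \<alpha> \<le> (1 + norm \<theta>) ^ (nat \<lceil>\<bar>s\<bar>\<rceil> + 1) * (jw s (\<zeta> - \<theta>) * xw (\<zeta> - \<theta>) powr \<alpha>)"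
proof -
  have "norm (fst (snd \<theta>)) \<le> norm \<theta>" by (cases \<theta>) (simp, rule order_trans[OF norm_fst_le norm_snd_le])
  moreover have "norm (fst (snd \<zeta>)) \<le> norm (fst (snd (\<zeta> - \<theta>))) + norm (fst (snd \<theta>))"
    using norm_triangle_ineq[of "fst (snd (\<zeta> - \<theta>))" "fst (snd \<theta>)"] by simp
  moreover have "1 + c \<le> (1 + n) * (1 + d)" if "e \<le> n" "c \<le> d + e" "0 \<le> d" "0 \<le> n" for c d e n :: real
    using mult_nonneg_nonneg[OF that(3,4)] that
    unfolding distrib_left distrib_right mult_1 mult_1_right mult.commute[of n d] by linarith
  ultimately have "xw \<zeta> \<le> (1 + norm \<theta>) * xw (\<zeta> - \<theta>)" unfolding xw_def by (meson norm_ge_zero)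
  then have "xw \<zeta> powr \<alpha> \<le> ((1 + norm \<theta>) * xw (\<zeta> - \<theta>)) powr \<alpha>" using assms xw_ge1[of \<zeta>] by (intro powr_mono2) auto
  also have "\<dots> = (1 + norm \<theta>) powr \<alpha> * xw (\<zeta> - \<theta>) powr \<alpha>" using xw_ge1[of "\<zeta> - \<theta>"] by (simp add: powr_mult)
  also have "\<dots> \<le> (1 + norm \<theta>) powr 1 * xw (\<zeta> - \<theta>) powr \<alpha>" using assms by (intro mult_right_mono powr_mono) auto
  also have "(1 + norm \<theta>) powr 1 = 1 + norm \<theta>" by simp
  finally have "jw s \<zeta> * xw \<zeta> powr \<alpha> \<le> ((1 + norm \<theta>) ^ nat \<lceil>\<bar>s\<bar>\<rceil> * jw s (\<zeta> - \<theta>)) * ((1 + norm \<theta>) * xw (\<zeta> - \<theta>) powr \<alpha>)"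
    by (intro mult_mono jw_peetre) auto
  then show ?thesis by (simp add: mult_ac)
qed

text \<open>Since q is 1 where u is nonzero, the unbounded factor v_b may be replaced by v_b q,
  which is Schwartz when q is.\<close>

lemma ft_dt:
  fixes u :: "'n::finite pt \<Rightarrow> complex"
  assumes u: "schw u" and q: "\<And>z. u z \<noteq> 0 \<Longrightarrow> q z = 1"
  shows "2 * pi * \<i> * of_real (fst \<zeta>) * ft u \<zeta> = ft (transport u) \<zeta>
    - (\<Sum>b\<in>Basis. 2 * pi * \<i> * of_real (fst (snd \<zeta>) \<bullet> b) * ft (\<lambda>z. of_real (z \<bullet> (0, 0, b)) * q z * u z) \<zeta>)"
proof -
  have "(\<lambda>z. of_real (z \<bullet> (0, 0, b)) * q z * u z) = (\<lambda>z. of_real (z \<bullet> (0, 0, b)) * u z)" for b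
  proof
    fix z show "of_real (z \<bullet> (0, 0, b)) * q z * u z = of_real (z \<bullet> (0, 0, b)) * u z"
      using q[of z] by (cases "u z = 0") auto
  qed
  moreover have "frechet_derivative (ft u) (at \<zeta>) (0, 0, fst (snd \<zeta>)) =
    (\<Sum>b\<in>Basis. - (2 * pi * \<i> * of_real (fst (snd \<zeta>) \<bullet> b) * ft (\<lambda>z. of_real (z \<bullet> (0, 0, b)) * u z) \<zeta>))"
  proof -
    have "frechet_derivative (ft u) (at \<zeta>) (0, 0, b) = (- 2 * pi * \<i>) * ft (\<lambda>z. of_real (z \<bullet> (0, 0, b)) * u z) \<zeta>" for b
      using fun_cong[OF dd_ft[OF u, of "(0, 0, b)"], of \<zeta>] unfolding mult.assoc[of "- 2 * pi * \<i>"] ft_cmult dd_def .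
    then show ?thesis
      by (subst frechet_sum_Basis[OF schw_differentiable[OF schw_ft[OF u]] linear_inj_pt(2)])
         (simp add: scaleR_conv_of_real mult_ac)
  qed
  ultimately show ?thesis unfolding ft_transport[OF u] by (simp add: sum_negf)
qed

lemma ennreal_le_scale:
  fixes X Q :: ennreal
  assumes "X \<le> ennreal k * Z" "Z \<le> ennreal l * Q" "0 \<le> k" "0 \<le> l"
  shows "X \<le> ennreal (k * l) * Q"
proof -
  have "X \<le> ennreal k * (ennreal l * Q)" using assms(1) mult_left_mono[OF assms(2), of "ennreal k"] by (meson order_trans zero_le)
  then show ?thesis using assms by (simp add: ennreal_mult mult.assoc)
qed

context bump
begin

text \<open>The equation is solved for the transport part after writing u = q u. The multiplier is
  nonlocal, so F(D) u does not vanish off the support of u; inserting q turns its coefficient into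
  the Schwartz function a q, to which \<open>mult_bound\<close> applies.\<close>

lemma transport_estimate:
  fixes s :: real and a :: "'n pt \<Rightarrow> real"
  assumes \<sigma>: "0 < \<sigma>" "\<sigma> < 1" and a: "smth (\<lambda>z. complex_of_real (a z))" "\<And>z. \<bar>a z\<bar> \<le> A"
    and q: "schw q" "schw (\<lambda>z. complex_of_real (a z) * q z)"
  shows "\<exists>C\<ge>0. \<forall>u. schw u \<longrightarrow> (\<forall>z. u z \<noteq> 0 \<longrightarrow> q z = 1) \<longrightarrow>
    Nsq (jw s) (ft (transport u)) \<le> ennreal C * (Nsq (\<lambda>\<zeta>. jw s \<zeta> * vw (2 * \<sigma>) \<zeta>) (ft u) + (Nsq (jw s) (ft u) + Nsq (jw s) (ft (opP \<sigma> w a u))))"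
proof -
  have ac: "continuous_on UNIV a"
  proof -
    have "continuous_on UNIV (\<lambda>z. Re (complex_of_real (a z)))"
      by (intro continuous_on_Re continuous_at_imp_continuous_on ballI differentiable_imp_continuous_within smth_differentiable a)
    then show ?thesis by simp
  qed
  obtain k1 where k1: "k1 \<ge> 0" "\<And>g. integrable lborel g \<Longrightarrow> Nsq (jw s) (ft (\<lambda>z. q z * g z)) \<le> ennreal k1 * Nsq (jw s) (ft g)"
    using mult_bound[OF q(1), of s] by blast
  obtain k2 where k2: "k2 \<ge> 0" "\<And>g. integrable lborel g \<Longrightarrow> Nsq (jw s) (ft (\<lambda>z. transport q z * g z)) \<le> ennreal k2 * Nsq (jw s) (ft g)"
    using mult_bound[OF schw_transport[OF q(1)], of s] by blast
  obtain k3 where k3: "k3 \<ge> 0" "\<And>g. integrable lborel g \<Longrightarrow> Nsq (jw s) (ft (\<lambda>z. complex_of_real (a z) * q z * g z)) \<le> ennreal k3 * Nsq (jw s) (ft g)"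
    using mult_bound[OF q(2), of s] by blast
  define cF where "cF = (2 * pi) powr (2 * \<sigma>) + 8"
  have cF: "cF \<ge> 0" by (simp add: cF_def)
  define M where "M = k1 + k2 + k3 * (2 * cF\<^sup>2)"
  have M: "k1 \<le> M" "k2 \<le> M" "k3 * (2 * cF\<^sup>2) \<le> M" "M \<ge> 0" using k1 k2 k3 by (auto simp: M_def)
  have "Nsq (jw s) (ft (transport u)) \<le> ennreal (4 * M) * (Nsq (\<lambda>\<zeta>. jw s \<zeta> * vw (2 * \<sigma>) \<zeta>) (ft u) + (Nsq (jw s) (ft u) + Nsq (jw s) (ft (opP \<sigma> w a u))))"
    if u: "schw u" and qu: "\<And>z. u z \<noteq> 0 \<Longrightarrow> q z = 1" for u
  proof -
    let ?L = "frac_lap_v \<sigma> w u" and ?P = "opP \<sigma> w a u"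
    let ?X = "Nsq (\<lambda>\<zeta>. jw s \<zeta> * vw (2 * \<sigma>) \<zeta>) (ft u)"
    have L: "integrable lborel ?L" by (rule frac_lap_v_integrable[OF u])
    have P: "integrable lborel ?P" by (rule opP_integrable[OF ac a(2) u])
    have i: "integrable lborel (\<lambda>z. q z * ?P z)" "integrable lborel (\<lambda>z. transport q z * u z)"
      "integrable lborel (\<lambda>z. complex_of_real (a z) * q z * ?L z)"
      by (intro schw_mult_integrable q P L schw_transport schw_integrable[OF u])+
    have "u = (\<lambda>z. q z * u z)" using qu by fastforce
    then have "transport u z = transport (\<lambda>z. q z * u z) z" for z by simp
    also have "transport (\<lambda>z. q z * u z) z = q z * transport u z + transport q z * u z" for z
      by (rule transport_mult) (use q u schw_differentiable in auto)
    also have "q z * transport u z + transport q z * u z = q z * ?P z + (transport q z * u z + (- 1) * (complex_of_real (a z) * q z * ?L z))" for z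
      unfolding opP_eq by (simp add: algebra_simps)
    finally have tr: "transport u = (\<lambda>z. q z * ?P z + (transport q z * u z + (- 1) * (complex_of_real (a z) * q z * ?L z)))" by blast
    have i4: "integrable lborel (\<lambda>z. (- 1) * (complex_of_real (a z) * q z * ?L z))" by (intro integrable_mult_right i)
    have e: "ft (transport u) = (\<lambda>\<zeta>. ft (\<lambda>z. q z * ?P z) \<zeta> + (ft (\<lambda>z. transport q z * u z) \<zeta> + (- 1) * ft (\<lambda>z. complex_of_real (a z) * q z * ?L z) \<zeta>))"
    proof
      fix \<zeta>
      have "ft (transport u) \<zeta> = ft (\<lambda>z. q z * ?P z + (transport q z * u z + (- 1) * (complex_of_real (a z) * q z * ?L z))) \<zeta>"
        using tr by (rule arg_cong[where f = "\<lambda>f. ft f \<zeta>"])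
      then show "ft (transport u) \<zeta> = ft (\<lambda>z. q z * ?P z) \<zeta> + (ft (\<lambda>z. transport q z * u z) \<zeta> + (- 1) * ft (\<lambda>z. complex_of_real (a z) * q z * ?L z) \<zeta>)"
        by (simp only: ft_add[OF i(1) Bochner_Integration.integrable_add[OF i(2) i4]] ft_add[OF i(2) i4] ft_cmult)
    qed
    have m [measurable]: "ft (\<lambda>z. q z * ?P z) \<in> borel_measurable borel" "ft (\<lambda>z. transport q z * u z) \<in> borel_measurable borel"
      "ft (\<lambda>z. complex_of_real (a z) * q z * ?L z) \<in> borel_measurable borel"
      by (intro ft_bounded_measurable i)+
    let ?A = "ft (\<lambda>z. q z * ?P z)" and ?B = "ft (\<lambda>z. transport q z * u z)" and ?C = "ft (\<lambda>z. complex_of_real (a z) * q z * ?L z)"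
    have "Nsq (jw s) (ft (transport u)) \<le> 2 * Nsq (jw s) ?A + 2 * Nsq (jw s) (\<lambda>\<zeta>. ?B \<zeta> + (- 1) * ?C \<zeta>)"
      unfolding e by (rule Nsq_add) auto
    also have "\<dots> \<le> 2 * Nsq (jw s) ?A + 2 * (2 * Nsq (jw s) ?B + 2 * Nsq (jw s) (\<lambda>\<zeta>. (- 1) * ?C \<zeta>))"
      by (intro add_left_mono mult_left_mono Nsq_add) auto
    also have "Nsq (jw s) (\<lambda>\<zeta>. (- 1) * ?C \<zeta>) = Nsq (jw s) ?C" by (subst Nsq_cmult) auto
    also have "2 * Nsq (jw s) ?A + 2 * (2 * Nsq (jw s) ?B + 2 * Nsq (jw s) ?C) \<le> 4 * (Nsq (jw s) ?C + (Nsq (jw s) ?B + Nsq (jw s) ?A))"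
    proof -
      have "2 * Nsq (jw s) ?A \<le> 4 * Nsq (jw s) ?A" by (intro mult_right_mono) auto
      then have "2 * Nsq (jw s) ?A + (4 * Nsq (jw s) ?B + 4 * Nsq (jw s) ?C) \<le> 4 * Nsq (jw s) ?A + (4 * Nsq (jw s) ?B + 4 * Nsq (jw s) ?C)"
        by (intro add_right_mono)
      then show ?thesis by (simp add: distrib_left add_ac mult.assoc[symmetric])
    qed
    also have "\<dots> \<le> 4 * (ennreal M * ?X + (ennreal M * Nsq (jw s) (ft u) + ennreal M * Nsq (jw s) (ft ?P)))"
    proof (intro mult_left_mono add_mono)
      show "Nsq (jw s) ?A \<le> ennreal M * Nsq (jw s) (ft ?P)"
        using k1(2)[OF P] mult_right_mono[OF ennreal_leI[OF M(1)], of "Nsq (jw s) (ft ?P)"] by (meson order_trans zero_le)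
      show "Nsq (jw s) ?B \<le> ennreal M * Nsq (jw s) (ft u)"
        using k2(2)[OF schw_integrable[OF u]] mult_right_mono[OF ennreal_leI[OF M(2)], of "Nsq (jw s) (ft u)"] by (meson order_trans zero_le)
      have "Nsq (jw s) (ft ?L) \<le> ennreal (2 * cF\<^sup>2) * ?X"
      proof (rule Nsq_le)
        fix \<zeta>
        have "\<bar>ksym \<sigma> w \<zeta>\<bar> \<le> cF * bw (2 * \<sigma>) \<zeta>" unfolding cF_def by (rule ksym_bound[OF \<sigma>])
        also have "\<dots> \<le> cF * vw (2 * \<sigma>) \<zeta>" by (intro mult_left_mono bw_le_vw cF)
        finally have "jw s \<zeta> * cmod (ft u \<zeta>) * \<bar>ksym \<sigma> w \<zeta>\<bar> \<le> jw s \<zeta> * cmod (ft u \<zeta>) * (cF * vw (2 * \<sigma>) \<zeta>)"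
          by (intro mult_left_mono) auto
        then show "\<bar>jw s \<zeta>\<bar> * cmod (ft ?L \<zeta>) \<le> cF * (\<bar>jw s \<zeta> * vw (2 * \<sigma>) \<zeta>\<bar> * cmod (ft u \<zeta>))"
          by (simp add: ft_frac_lap_v[OF u] norm_mult abs_mult mult_ac)
      qed (use cF schw_measurable[OF schw_ft[OF u]] in auto)
      from ennreal_le_scale[OF k3(2)[OF L] this k3(1)] have "Nsq (jw s) ?C \<le> ennreal (k3 * (2 * cF\<^sup>2)) * ?X" using cF by simp
      then show "Nsq (jw s) ?C \<le> ennreal M * ?X"
        using mult_right_mono[OF ennreal_leI[OF M(3)], of ?X] by (meson order_trans zero_le)
    qed auto
    also have "\<dots> = ennreal (4 * M) * (?X + (Nsq (jw s) (ft u) + Nsq (jw s) (ft ?P)))"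
      using M(4) by (simp add: ennreal_mult distrib_left mult.assoc)
    finally show ?thesis .
  qed
  then show ?thesis using M(4) by (intro exI[of _ "4 * M"]) auto
qed

lemma tau_estimate:
  fixes s :: real and a :: "'n pt \<Rightarrow> real"
  assumes \<sigma>: "0 < \<sigma>" "\<sigma> < 1" and a: "smth (\<lambda>z. complex_of_real (a z))" "\<And>z. \<bar>a z\<bar> \<le> A"
    and q: "schw q" "schw (\<lambda>z. complex_of_real (a z) * q z)"
  shows "\<exists>C\<ge>0. \<forall>u. schw u \<longrightarrow> (\<forall>z. u z \<noteq> 0 \<longrightarrow> q z = 1) \<longrightarrow>
    Nsq (\<lambda>\<zeta>. jw s \<zeta> * \<bar>fst \<zeta>\<bar> powr (2 * \<sigma> / (2 * \<sigma> + 1))) (ft u)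
      \<le> ennreal C * (Nsq (\<lambda>\<zeta>. jw s \<zeta> * vw (2 * \<sigma>) \<zeta>) (ft u) + (Nsq (jw s) (ft u) + Nsq (jw s) (ft (opP \<sigma> w a u))))"
proof -
  define \<alpha> where "\<alpha> = 2 * \<sigma> / (2 * \<sigma> + 1)"
  have \<alpha>: "0 < \<alpha>" "\<alpha> < 1" using \<sigma> by (auto simp: \<alpha>_def)
  obtain C1 where C1: "C1 \<ge> 0" "\<And>u. schw u \<Longrightarrow> (\<And>z. u z \<noteq> 0 \<Longrightarrow> q z = 1) \<Longrightarrow>
    Nsq (jw s) (ft (transport u)) \<le> ennreal C1 * (Nsq (\<lambda>\<zeta>. jw s \<zeta> * vw (2 * \<sigma>) \<zeta>) (ft u) + (Nsq (jw s) (ft u) + Nsq (jw s) (ft (opP \<sigma> w a u))))"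
    using transport_estimate[OF \<sigma> a q, of s] by blast
  let ?W = "\<lambda>\<zeta> :: 'n pt. jw s \<zeta> * xw \<zeta> powr \<alpha>"
  \<comment> \<open>Each velocity component, cut off by q, is a bounded multiplier for the weighted
    norm in which v . grad_x u is measured.\<close>
  have "\<forall>b\<in>(Basis :: (real ^ 'n) set). \<exists>K\<ge>0. \<forall>g. integrable lborel g \<longrightarrow> Nsq ?W (ft (\<lambda>z. (of_real (z \<bullet> (0, 0, b)) * q z) * g z)) \<le> ennreal K * Nsq ?W (ft g)"
  proof
    fix b :: "real ^ 'n"
    show "\<exists>K\<ge>0. \<forall>g. integrable lborel g \<longrightarrow> Nsq ?W (ft (\<lambda>z. (of_real (z \<bullet> (0, 0, b)) * q z) * g z)) \<le> ennreal K * Nsq ?W (ft g)"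
    proof (rule mult_weight_bound[where C = 1 and N = "nat \<lceil>\<bar>s\<bar>\<rceil> + 1"])
      show "schw (\<lambda>z. of_real (z \<bullet> (0, 0, b)) * q z)" by (rule schw_mult_inner1[OF q(1)])
      show "\<bar>?W \<zeta>\<bar> \<le> 1 * (1 + norm \<theta>) ^ (nat \<lceil>\<bar>s\<bar>\<rceil> + 1) * \<bar>?W (\<zeta> - \<theta>)\<bar>" for \<zeta> \<theta>
        using xw_peetre[OF \<alpha>, of s \<zeta> \<theta>] by (simp add: abs_mult)
    qed simp
  qed
  from bchoice[OF this] obtain k where k0: "\<forall>b\<in>Basis. 0 \<le> k b \<and> (\<forall>g. integrable lborel g \<longrightarrow>
      Nsq ?W (ft (\<lambda>z. (of_real (z \<bullet> (0, 0, b)) * q z) * g z)) \<le> ennreal (k b) * Nsq ?W (ft g))" ..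
  then have k: "\<And>b. b \<in> Basis \<Longrightarrow> k b \<ge> 0" "\<And>b g. b \<in> Basis \<Longrightarrow> integrable lborel g \<Longrightarrow>
      Nsq ?W (ft (\<lambda>z. (of_real (z \<bullet> (0, 0, b)) * q z) * g z)) \<le> ennreal (k b) * Nsq ?W (ft g)" by blast+
  define S where "S = (\<Sum>b\<in>(Basis :: (real ^ 'n) set). k b)"
  have S: "S \<ge> 0" unfolding S_def by (intro sum_nonneg k)
  let ?N = "2 ^ CARD('n) :: real"
  define C where "C = 2 * (2 * C1 + 2 * (?N * (S * 32))) + 64"
  have C: "C \<ge> 0" using C1(1) S by (simp add: C_def)
  have "Nsq (\<lambda>\<zeta>. jw s \<zeta> * \<bar>fst \<zeta>\<bar> powr \<alpha>) (ft u)
      \<le> ennreal C * (Nsq (\<lambda>\<zeta>. jw s \<zeta> * vw (2 * \<sigma>) \<zeta>) (ft u) + (Nsq (jw s) (ft u) + Nsq (jw s) (ft (opP \<sigma> w a u))))"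
    if u: "schw u" and qu: "\<And>z. u z \<noteq> 0 \<Longrightarrow> q z = 1" for u
  proof -
    let ?X = "Nsq (\<lambda>\<zeta>. jw s \<zeta> * vw (2 * \<sigma>) \<zeta>) (ft u)"
    let ?Q = "?X + (Nsq (jw s) (ft u) + Nsq (jw s) (ft (opP \<sigma> w a u)))"
    let ?h = "\<lambda>b z. of_real (z \<bullet> (0, 0, b)) * q z * u z"
    have um [measurable]: "ft u \<in> borel_measurable borel" by (rule schw_measurable[OF schw_ft[OF u]])
    have hm [measurable]: "ft (?h b) \<in> borel_measurable borel" for b
      by (intro schw_measurable schw_ft schw_mult schw_mult_inner1 q u)
    have tm [measurable]: "ft (transport u) \<in> borel_measurable borel" by (intro schw_measurable schw_ft schw_transport u)
    have W: "Nsq ?W (ft u) \<le> ennreal 32 * ?Q"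
    proof -
      have "Nsq ?W (ft u) \<le> ennreal (2 * 4\<^sup>2) * ?X"
      proof (rule Nsq_le)
        fix \<zeta> :: "'n pt"
        have "jw s \<zeta> * cmod (ft u \<zeta>) * xw \<zeta> powr \<alpha> \<le> jw s \<zeta> * cmod (ft u \<zeta>) * (4 * vw (2 * \<sigma>) \<zeta>)"
          unfolding \<alpha>_def using \<sigma> by (intro mult_left_mono xw_powr_le_vw) auto
        then show "\<bar>?W \<zeta>\<bar> * cmod (ft u \<zeta>) \<le> 4 * (\<bar>jw s \<zeta> * vw (2 * \<sigma>) \<zeta>\<bar> * cmod (ft u \<zeta>))"
          by (simp add: abs_mult mult_ac)
      qed auto
      also have "\<dots> \<le> ennreal (2 * 4\<^sup>2) * ?Q" by (intro mult_left_mono) auto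
      finally show ?thesis by simp
    qed
    \<comment> \<open>A sum of absolute values dominates all velocity components at once; it is
      viewed as complex so that \<open>Nsq_sum\<close> applies.\<close>
    define R where "R \<zeta> = (\<Sum>b\<in>(Basis :: (real ^ 'n) set). of_real (cmod (ft (?h b) \<zeta>)) :: complex)" for \<zeta>
    have Rm [measurable]: "R \<in> borel_measurable borel" unfolding R_def by measurable
    have NR: "Nsq ?W R \<le> ennreal (?N * (S * 32)) * ?Q"
    proof -
      have "Nsq ?W R \<le> ennreal (2 ^ card (Basis :: (real ^ 'n) set)) * (\<Sum>b\<in>(Basis :: (real ^ 'n) set). Nsq ?W (\<lambda>\<zeta>. of_real (cmod (ft (?h b) \<zeta>))))"
        unfolding R_def by (intro Nsq_sum) auto
      also have "(\<Sum>b\<in>(Basis :: (real ^ 'n) set). Nsq ?W (\<lambda>\<zeta>. of_real (cmod (ft (?h b) \<zeta>)))) = (\<Sum>b\<in>Basis. Nsq ?W (ft (?h b)))"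
        by (simp add: Nsq_def)
      also have "\<dots> \<le> (\<Sum>b\<in>Basis. ennreal (k b) * Nsq ?W (ft u))"
        by (intro sum_mono k schw_integrable u)
      also have "\<dots> = ennreal S * Nsq ?W (ft u)"
        unfolding S_def by (simp only: sum_ennreal[OF k(1), symmetric] sum_distrib_right)
      also have "\<dots> \<le> ennreal S * (ennreal 32 * ?Q)" by (intro mult_left_mono W) auto
      finally have "Nsq ?W R \<le> ennreal ?N * (ennreal S * (ennreal 32 * ?Q))" by (simp add: mult_left_mono)
      also have "\<dots> = ennreal (?N * (S * 32)) * ?Q"
      proof -
        have "ennreal (?N * (S * 32)) = ennreal ?N * (ennreal S * ennreal 32)" using S by (simp only: ennreal_mult mult_nonneg_nonneg zero_le_numeral zero_le_power)
        then show ?thesis by (simp only: mult.assoc)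
      qed
      finally show ?thesis .
    qed
    let ?T = "\<lambda>\<zeta> :: 'n pt. jw s \<zeta> * (\<bar>fst \<zeta>\<bar> * xw \<zeta> powr (\<alpha> - 1))"
    have NT: "Nsq ?T (ft u) \<le> ennreal (2 * 1\<^sup>2) * Nsq (jw s) (ft (transport u)) + ennreal (2 * 1\<^sup>2) * Nsq ?W R"
    proof (rule Nsq_le2)
      fix \<zeta> :: "'n pt"
      let ?x = "norm (fst (snd \<zeta>))"
      have R: "cmod (R \<zeta>) = (\<Sum>b\<in>Basis. cmod (ft (?h b) \<zeta>))"
        unfolding R_def of_real_sum[symmetric] norm_of_real by (simp add: sum_nonneg)
      have "2 * pi * (\<bar>fst \<zeta>\<bar> * cmod (ft u \<zeta>)) = cmod (2 * pi * \<i> * of_real (fst \<zeta>) * ft u \<zeta>)"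
        by (simp add: norm_mult)
      also have "\<dots> \<le> cmod (ft (transport u) \<zeta>) + cmod (\<Sum>b\<in>Basis. 2 * pi * \<i> * of_real (fst (snd \<zeta>) \<bullet> b) * ft (?h b) \<zeta>)"
        by (subst ft_dt[OF u, of q], rule qu, assumption, rule norm_triangle_ineq4)
      also have "cmod (\<Sum>b\<in>Basis. 2 * pi * \<i> * of_real (fst (snd \<zeta>) \<bullet> b) * ft (?h b) \<zeta>) \<le> (\<Sum>b\<in>Basis. 2 * pi * ?x * cmod (ft (?h b) \<zeta>))"
      proof (rule sum_norm_le)
        fix b :: "real ^ 'n" assume b: "b \<in> Basis"
        have "2 * pi * \<bar>fst (snd \<zeta>) \<bullet> b\<bar> * cmod (ft (?h b) \<zeta>) \<le> 2 * pi * ?x * cmod (ft (?h b) \<zeta>)"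
          by (intro mult_right_mono mult_left_mono Basis_le_norm b) auto
        then show "norm (2 * pi * \<i> * of_real (fst (snd \<zeta>) \<bullet> b) * ft (?h b) \<zeta>) \<le> 2 * pi * ?x * cmod (ft (?h b) \<zeta>)"
          by (simp add: norm_mult)
      qed
      also have "(\<Sum>b\<in>Basis. 2 * pi * ?x * cmod (ft (?h b) \<zeta>)) = 2 * pi * (?x * cmod (R \<zeta>))"
        unfolding R by (simp add: sum_distrib_left mult.assoc)
      finally have "2 * pi * (\<bar>fst \<zeta>\<bar> * cmod (ft u \<zeta>)) \<le> cmod (ft (transport u) \<zeta>) + 2 * pi * (?x * cmod (R \<zeta>))" by simp
      moreover have "1 * cmod (ft (transport u) \<zeta>) \<le> 2 * pi * cmod (ft (transport u) \<zeta>)" using pi_ge_two by (intro mult_right_mono) auto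
      ultimately have "2 * pi * (\<bar>fst \<zeta>\<bar> * cmod (ft u \<zeta>)) \<le> 2 * pi * (cmod (ft (transport u) \<zeta>) + ?x * cmod (R \<zeta>))"
        unfolding distrib_left by linarith
      then have t: "\<bar>fst \<zeta>\<bar> * cmod (ft u \<zeta>) \<le> cmod (ft (transport u) \<zeta>) + ?x * cmod (R \<zeta>)" by simp
      \<comment> \<open>The damping factor is at most 1, so it is simply dropped on the transport
        term; on the other term it combines with |\<xi>| \<le> \<open>xw \<zeta>\<close> to the
        power \<alpha>.\<close>
      have x1: "xw \<zeta> powr (\<alpha> - 1) \<le> 1" using \<alpha> xw_ge1[of \<zeta>] powr_mono[of "\<alpha> - 1" 0 "xw \<zeta>"] by simp
      have x2: "xw \<zeta> powr (\<alpha> - 1) * ?x \<le> xw \<zeta> powr \<alpha>"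
      proof -
        have "xw \<zeta> powr (\<alpha> - 1) * ?x \<le> xw \<zeta> powr (\<alpha> - 1) * xw \<zeta> powr 1"
          using xw_ge1[of \<zeta>] by (intro mult_left_mono) (auto simp: xw_def)
        then show ?thesis by (simp only: powr_add[symmetric]) simp
      qed
      have "xw \<zeta> powr (\<alpha> - 1) * (\<bar>fst \<zeta>\<bar> * cmod (ft u \<zeta>)) \<le> xw \<zeta> powr (\<alpha> - 1) * (cmod (ft (transport u) \<zeta>) + ?x * cmod (R \<zeta>))"
        by (intro mult_left_mono t) auto
      also have "\<dots> = xw \<zeta> powr (\<alpha> - 1) * cmod (ft (transport u) \<zeta>) + xw \<zeta> powr (\<alpha> - 1) * ?x * cmod (R \<zeta>)"
        by (simp add: distrib_left mult.assoc)
      also have "\<dots> \<le> 1 * cmod (ft (transport u) \<zeta>) + xw \<zeta> powr \<alpha> * cmod (R \<zeta>)"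
        by (intro add_mono mult_right_mono x1 x2) auto
      finally have "jw s \<zeta> * (xw \<zeta> powr (\<alpha> - 1) * (\<bar>fst \<zeta>\<bar> * cmod (ft u \<zeta>))) \<le> jw s \<zeta> * (1 * cmod (ft (transport u) \<zeta>) + xw \<zeta> powr \<alpha> * cmod (R \<zeta>))"
        by (intro mult_left_mono) auto
      then show "\<bar>?T \<zeta>\<bar> * cmod (ft u \<zeta>) \<le> 1 * (\<bar>jw s \<zeta>\<bar> * cmod (ft (transport u) \<zeta>)) + 1 * (\<bar>?W \<zeta>\<bar> * cmod (R \<zeta>))"
        by (simp add: abs_mult distrib_left mult_ac)
    qed auto
    have "Nsq (\<lambda>\<zeta>. jw s \<zeta> * \<bar>fst \<zeta>\<bar> powr \<alpha>) (ft u) \<le> ennreal (2 * 1\<^sup>2) * Nsq ?T (ft u) + ennreal (2 * 1\<^sup>2) * Nsq ?W (ft u)"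
    proof (rule Nsq_le2)
      fix \<zeta> :: "'n pt"
      have "jw s \<zeta> * cmod (ft u \<zeta>) * \<bar>fst \<zeta>\<bar> powr \<alpha> \<le> jw s \<zeta> * cmod (ft u \<zeta>) * (\<bar>fst \<zeta>\<bar> * xw \<zeta> powr (\<alpha> - 1) + xw \<zeta> powr \<alpha>)"
        by (intro mult_left_mono tau_interpolation \<alpha> xw_ge1) auto
      then show "\<bar>jw s \<zeta> * \<bar>fst \<zeta>\<bar> powr \<alpha>\<bar> * cmod (ft u \<zeta>) \<le> 1 * (\<bar>?T \<zeta>\<bar> * cmod (ft u \<zeta>)) + 1 * (\<bar>?W \<zeta>\<bar> * cmod (ft u \<zeta>))"
        by (simp add: abs_mult distrib_left mult_ac)
    qed auto
    also have "\<dots> \<le> ennreal 2 * (ennreal 2 * (ennreal C1 * ?Q) + ennreal 2 * (ennreal (?N * (S * 32)) * ?Q)) + ennreal 2 * (ennreal 32 * ?Q)"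
    proof (intro add_mono mult_mono W order_refl)
      show "Nsq ?T (ft u) \<le> ennreal 2 * (ennreal C1 * ?Q) + ennreal 2 * (ennreal (?N * (S * 32)) * ?Q)"
        by (rule order_trans[OF NT], intro add_mono mult_mono NR C1(2) u qu) auto
    qed auto
    also have "\<dots> = ennreal C * ?Q"
    proof -
      have p: "0 \<le> ?N * (S * 32)" using S by simp
      have "ennreal C = ennreal 2 * (ennreal 2 * ennreal C1 + ennreal 2 * ennreal (?N * (S * 32))) + ennreal 2 * ennreal 32"
        unfolding C_def using C1(1) p by (simp only: ennreal_mult[symmetric] ennreal_plus[symmetric] mult_nonneg_nonneg add_nonneg_nonneg zero_le_numeral) simp
      moreover have "e * (e * (x * Q) + e * (y * Q)) + e * (z * Q) = (e * (e * x + e * y) + e * z) * Q" for e x y z Q :: ennreal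
        by (simp only: distrib_left distrib_right mult.assoc)
      ultimately show ?thesis by (simp only:)
    qed
    finally show ?thesis .
  qed
  then show ?thesis using C unfolding \<alpha>_def by blast
qed

end

section \<open>From squared norms to the stated inequality\<close>

lemma esqrt_mono_scaled:
  assumes "A \<le> ennreal c * (B + D)" "0 \<le> c"
  shows "esqrt A \<le> ennreal (sqrt c + 1) * (esqrt B + esqrt D)"
proof (cases "B = top \<or> D = top")
  case True
  \<comment> \<open>The added 1 keeps the factor nonzero, since 0 times infinity would be 0.\<close>
  have "ennreal (sqrt c + 1) \<noteq> 0" using assms(2) by (simp add: add_nonneg_pos)
  then show ?thesis using True by (auto simp: esqrt_def ennreal_mult_top)
next
  case False
  then obtain b d where r: "B = ennreal b" "0 \<le> b" "D = ennreal d" "0 \<le> d" by (cases B; cases D) auto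
  have A: "A \<le> ennreal (c * (b + d))" using assms r by (simp add: ennreal_mult)
  then obtain x where x: "A = ennreal x" "0 \<le> x" by (cases A) (auto simp: top_unique)
  have "x \<le> c * (b + d)" using A x r assms(2) by (subst (asm) x) (simp add: ennreal_le_iff)
  then have "sqrt x \<le> sqrt (c * (b + d))" by (rule real_sqrt_le_mono)
  also have "\<dots> = sqrt c * sqrt (b + d)" by (rule real_sqrt_mult)
  also have "\<dots> \<le> (sqrt c + 1) * (sqrt b + sqrt d)" using assms(2) r by (intro mult_mono sqrt_add_le_add_sqrt) auto
  finally have "ennreal (sqrt x) \<le> ennreal ((sqrt c + 1) * (sqrt b + sqrt d))" by (rule ennreal_leI)
  then show ?thesis using x r assms(2) by (simp add: esqrt_def ennreal_mult)
qed

theorem theorem1: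
  fixes \<sigma> s :: real
    and a :: "'n::finite pt \<Rightarrow> real"
    and w :: "real ^ 'n \<Rightarrow> real"
    and a0 :: real
    and K :: "'n pt set"
  assumes "0 < \<sigma>" and "\<sigma> < 1"
    and "smooth_bdd a" and "0 < a0" and "\<forall>z. a z \<ge> a0"
    and "smooth w" and "\<forall>\<eta>. 0 \<le> w \<eta> \<and> w \<eta> \<le> 1"
    and "\<forall>\<eta>. norm \<eta> \<ge> 2 \<longrightarrow> w \<eta> = 1"
    and "\<forall>\<eta>. norm \<eta> \<le> 1 \<longrightarrow> w \<eta> = 0"
    and "compact K"
  shows "\<exists>C>0. \<forall>u :: 'n pt \<Rightarrow> complex. smooth u \<and> tsupp u \<subseteq> K \<longrightarrow>
           hs_norm_mult s (lhs_symbol \<sigma>) u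
             \<le> ennreal C * (hs_norm s (opP \<sigma> w a u) + hs_norm s u)"
proof -
  interpret bump w by unfold_locales (use assms in auto)
  have "bounded (range a)" using assms(3) unfolding smooth_bdd_def by (metis empty_set empty_subsetI iter_dd.simps(1))
  then obtain A where A: "\<And>z. \<bar>a z\<bar> \<le> A" unfolding bounded_iff by auto
  have a: "smth (\<lambda>z. complex_of_real (a z))"
    using assms(3) unfolding smooth_bdd_def by (intro smooth_smth smooth_of_real) simp
  obtain R0 where R0: "\<And>z. z \<in> K \<Longrightarrow> norm z \<le> R0" using compact_imp_bounded[OF assms(10)] unfolding bounded_iff by blast
  define R where "R = \<bar>R0\<bar> + 1"
  have R: "R > 0" by (simp add: R_def)
  \<comment> \<open>A cutoff equal to 1 on K and depending on K alone, so that the constants are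
    uniform in u.\<close>
  define q where "q z = bump3 ((1 / R) *\<^sub>R (z - 0))" for z
  have q: "schw q" unfolding q_def by (rule bump3_affine(2)[OF R])
  have aq: "schw (\<lambda>z. complex_of_real (a z) * q z)"
  proof (rule smth_schw)
    show "smth (\<lambda>z. complex_of_real (a z) * q z)" unfolding q_def by (intro smth_mult a bump3_affine R)
    show "norm z \<le> 6 * R" if "complex_of_real (a z) * q z \<noteq> 0" for z
      using bump3_affine(4)[OF R, of z 0] that by (auto simp: q_def)
  qed
  let ?V = "\<lambda>\<zeta> :: 'n pt. jw s \<zeta> * vw (2 * \<sigma>) \<zeta>"
  obtain C1 where C1: "C1 \<ge> 0" "\<And>u. schw u \<Longrightarrow> (\<And>z. u z \<noteq> 0 \<Longrightarrow> z \<in> K) \<Longrightarrow>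
    Nsq ?V (ft u) \<le> ennreal C1 * (Nsq (jw s) (ft u) + Nsq (jw s) (ft (opP \<sigma> w a u)))"
    using main_estimate[OF assms(1,2) a A assms(4) _ assms(10), of s] assms(5) by blast
  let ?T = "\<lambda>\<zeta> :: 'n pt. jw s \<zeta> * \<bar>fst \<zeta>\<bar> powr (2 * \<sigma> / (2 * \<sigma> + 1))"
  obtain C2 where C2: "C2 \<ge> 0" "\<And>u. schw u \<Longrightarrow> (\<And>z. u z \<noteq> 0 \<Longrightarrow> q z = 1) \<Longrightarrow>
    Nsq ?T (ft u) \<le> ennreal C2 * (Nsq ?V (ft u) + (Nsq (jw s) (ft u) + Nsq (jw s) (ft (opP \<sigma> w a u))))"
    using tau_estimate[OF assms(1,2) a A q aq, of s] by blast
  define C where "C = 2 * (C2 * (C1 + 1)) + 2 * C1"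
  have C: "C \<ge> 0" using C1(1) C2(1) by (simp add: C_def)
  have "hs_norm_mult s (lhs_symbol \<sigma>) u \<le> ennreal (sqrt C + 1) * (hs_norm s (opP \<sigma> w a u) + hs_norm s u)"
    if sm: "smooth u" and supp: "tsupp u \<subseteq> K" for u :: "'n pt \<Rightarrow> complex"
  proof -
    have uK: "z \<in> K" if "u z \<noteq> 0" for z
      using supp that closure_subset[of "{x. u x \<noteq> 0}"] unfolding tsupp_def by blast
    have u: "schw u" by (rule smth_schw[OF smooth_smth[OF sm]]) (rule R0[OF uK])
    have uq: "q z = 1" if "u z \<noteq> 0" for z
      using bump3_affine(3)[OF R, of z 0] R0[OF uK[OF that]] by (simp add: q_def R_def)
    let ?Q = "Nsq (jw s) (ft u) + Nsq (jw s) (ft (opP \<sigma> w a u))"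
    have m [measurable]: "ft u \<in> borel_measurable borel" by (rule schw_measurable[OF schw_ft[OF u]])
    have N1: "Nsq ?V (ft u) \<le> ennreal C1 * ?Q" by (rule C1(2)[OF u uK])
    have "Nsq ?T (ft u) \<le> ennreal C2 * (Nsq ?V (ft u) + ?Q)" by (rule C2(2)[OF u uq])
    also have "\<dots> \<le> ennreal C2 * (ennreal C1 * ?Q + ?Q)" by (intro mult_left_mono add_right_mono N1) auto
    also have "\<dots> = ennreal (C2 * (C1 + 1)) * ?Q"
      using C1(1) C2(1) by (simp add: ennreal_mult distrib_right mult.assoc)
    finally have N2: "Nsq ?T (ft u) \<le> ennreal (C2 * (C1 + 1)) * ?Q" .
    have "Nsq (jw s) (\<lambda>\<zeta>. complex_of_real (lhs_symbol \<sigma> \<zeta>) * ft u \<zeta>) \<le> ennreal (2 * 1\<^sup>2) * Nsq ?T (ft u) + ennreal (2 * 1\<^sup>2) * Nsq ?V (ft u)"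
    proof (rule Nsq_le2)
      fix \<zeta> :: "'n pt"
      \<comment> \<open>The symbol is exactly the time part plus \<open>vw\<close>, so the two
        estimates together cover it.\<close>
      have l: "lhs_symbol \<sigma> \<zeta> = \<bar>fst \<zeta>\<bar> powr (2 * \<sigma> / (2 * \<sigma> + 1)) + vw (2 * \<sigma>) \<zeta>"
        by (cases \<zeta>) (simp add: lhs_symbol_def vw_def)
      have "\<bar>lhs_symbol \<sigma> \<zeta>\<bar> = lhs_symbol \<sigma> \<zeta>" unfolding l by (simp add: add_nonneg_nonneg)
      then show "\<bar>jw s \<zeta>\<bar> * cmod (complex_of_real (lhs_symbol \<sigma> \<zeta>) * ft u \<zeta>) \<le> 1 * (\<bar>?T \<zeta>\<bar> * cmod (ft u \<zeta>)) + 1 * (\<bar>?V \<zeta>\<bar> * cmod (ft u \<zeta>))"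
        by (simp only: norm_mult norm_of_real) (simp add: l abs_mult distrib_left distrib_right mult_ac)
    qed auto
    also have "\<dots> \<le> ennreal 2 * (ennreal (C2 * (C1 + 1)) * ?Q) + ennreal 2 * (ennreal C1 * ?Q)"
      by (intro add_mono mult_mono N1 N2) auto
    also have "\<dots> = ennreal C * ?Q"
    proof -
      have "ennreal C = ennreal 2 * ennreal (C2 * (C1 + 1)) + ennreal 2 * ennreal C1"
        unfolding C_def using C1(1) C2(1) by (simp only: ennreal_mult[symmetric] ennreal_plus[symmetric] mult_nonneg_nonneg add_nonneg_nonneg zero_le_numeral zero_le_one)
      moreover have "e * (x * Q) + e * (y * Q) = (e * x + e * y) * Q" for e x y Q :: ennreal
        by (simp only: distrib_right mult.assoc)
      ultimately show ?thesis by (simp only:)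
    qed
    finally have "Nsq (jw s) (\<lambda>\<zeta>. complex_of_real (lhs_symbol \<sigma> \<zeta>) * ft u \<zeta>) \<le> ennreal C * (Nsq (jw s) (ft (opP \<sigma> w a u)) + Nsq (jw s) (ft u))"
      by (simp add: add.commute)
    from esqrt_mono_scaled[OF this C] show ?thesis
      by (simp add: hs_norm_mult_def hs_norm_def hs_norm_hat_eq fourier_eq_ft)
  qed
  moreover have "sqrt C + 1 > 0" using C by (simp add: add_nonneg_pos)
  ultimately show ?thesis by blast
qed

end
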